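(* Let $m\geq 1$ and set $k_{crit}^C(W,H):=\frac W2(2m+1)-\frac H2$. Let $H_{CE}(\mathsf{GC}_{(g),1})$ be the Chevalley–Eilenberg cohomology, bigraded by weight and imbalance, of the dg Lie algebra $\mathsf{GC}_{(g),1}$ defined in the context. Then for all integers $W\ge 0$, $g\geq 3W$, $H\in\mathbb{Z}$ and all integers $k\neq k_{crit}^C(W,H)$ one has $$\mathrm{gr}^{(W,H)}H_{CE}^k(\mathsf{GC}_{(g),1})=0.$$
   Context: All vector spaces are over $\mathbb{Q}$; gradings are cohomological (differentials have degree $+1$); $V[k]$ denotes $V$ with degrees shifted down by $k$; Koszul signs are used throughout. Fix $m\ge 1$, $g\ge 0$. Decorations: let $W_g=\#^g(S^m\times S^{m+1})$ and $W_{g,1}=W_g\setminus D^{2m+1}$. Its reduced cohomology is $\bar H^\bullet=\bar H^\bullet(W_{g,1})=V_g\oplus V_g^*$, where $V_g=H^m(W_{g,1})$ has basis $\alpha_1,\dots,\alpha_g$ of degree $m$ and $V_g^*=H^{m+1}(W_{g,1})$ has dual basis $\beta_1,\dots,\beta_g$ of degree $m+1$. Put $\Delta=(-1)^m\sum_{i=1}^g(\alpha_i\otimes\beta_i-\beta_i\otimes\alpha_i)$. $S(\cdot)$ is the graded symmetric algebra. Graphs: $\mathit{gra}_{n,k}$ is the set of directed graphs with vertex set $\{1,\dots,n\}$ and an ordered list of $k$ edges, each an ordered pair $(i,j)$ of vertices. The group $S_n\times(S_2\wr S_k)$ acts by renumbering vertices, reordering edges and flipping edges. Let $$\bigoplus_{n\ge1,k\ge0}\Big(\mathbb{Q}\,\mathit{gra}_{n,k}[-2mk]\otimes\mathbb{Q}[2m+1]^{\otimes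 n}\otimes \mathrm{sgn}_{S_2}^{\otimes k}\otimes S(\bar H^\bullet)^{\otimes n}\Big)_{S_n\times(S_2\wr S_k)}$$ (coinvariants; $S_n$ also permutes the factors $\mathbb{Q}[2m+1]$ and $S(\bar H^\bullet)$ with Koszul signs, and flipping an edge gives $-1$). Its elements are linear combinations of (not necessarily connected) graphs whose vertices are decorated by products of elements of $\bar H^\bullet$. The valence of a vertex is its number of incident half-edges plus its number of decorations; $\mathsf{fG}_{(g),1}$ is the subspace spanned by graphs all of whose vertices have valence $\ge 3$. Differential $d=d_c+d_{cut}$ on $\mathsf{fG}_{(g),1}$: $d_c\Gamma=\sum_{e=(i,j)}(-1)^j\,\Gamma/e$, where $\Gamma/e$ contracts $e$ (zero if $i=j$; otherwise remove $e$ and the vertex $j$, replace $j$ by $i$ in all edges, renumber vertices preserving order, and multiply the $j$-th decoration factor into the $i$-th one); $d_{cut}\Gamma=(-1)^{|V\Gamma|}\sum_{e=(i,j)}\mathrm{cut}(\Gamma,e)$, where $\mathrm{cut}(\Gamma,e)$ removes $e$ and multiplies the two factors of $\Delta$ from the left into the $i$-th and $j$-th decoration factors. Gradings: a graph with $e$ edges, $v$ vertices, $a$ decorations in $H^m$ and $b$ decorations in $H^{m+1}$ has degree $2me-(2m+1)v+ma+(m+1)b$ in $\mathsf{fG}_{(g),1}$, weight $W=2(e-v)+a+b$ and imbalance $H=a-b$. The differential preserves $(W,H)$; $\mathrm{gr}^{(W,H)}$ denotes the corresponding summand. Disjoint union makes $\mathsf{fG}_{(g),1}$ a non-unital dg commutative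 algebra, free as a graded commutative algebra on connected graphs: $\mathsf{fG}_{(g),1}\cong S^+(\mathsf{G}_{(g),1}[-1])$, with $\mathsf{G}_{(g),1}[-1]$ the span of connected graphs. The differential makes $\mathsf{G}_{(g),1}$ a dg Lie coalgebra, and $\mathsf{GC}_{(g),1}:=\mathsf{G}_{(g),1}^*=\prod_{W,H}(\mathrm{gr}^{(W,H)}\mathsf{G}_{(g),1})^*$ is the dual dg Lie algebra, with finite-dimensional bigraded pieces; its graded dual is $\mathsf{G}_{(g),1}$. The Chevalley–Eilenberg complex is the cobar construction of the graded dual Lie coalgebra, i.e. the dg commutative algebra $C_{CE}(\mathsf{GC}_{(g),1})=S(\mathsf{G}_{(g),1}[-1])=\mathsf{fG}_{(g),1}\oplus\mathbb{Q}$ (the unit $\mathbb{Q}$ in degree, weight and imbalance $0$), with the differential $d=d_c+d_{cut}$, the cohomological degree $2me-(2m+1)v+ma+(m+1)b$ and the bigrading by weight $W=2(e-v)+a+b$ and imbalance $H=a-b$; $H_{CE}$ is its cohomology. *)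

theory Defs
  imports
    Complex_Main
    "HOL-Library.Poly_Mapping"
    "HOL-Combinatorics.Permutations"
    "HOL-Algebra.Coset"
    "HOL-Algebra.Elementary_Groups"
begin

subsection \<open>Rational vector spaces on a basis\<close>

definition scl :: "rat \<Rightarrow> ('a \<Rightarrow>\<^sub>0 rat) \<Rightarrow> 'a \<Rightarrow>\<^sub>0 rat" where
  "scl c x = Poly_Mapping.map ((*) c) x"

lemma lookup_scl: "Poly_Mapping.lookup (scl c x) b = c * Poly_Mapping.lookup x b"
  by (simp add: scl_def Poly_Mapping.map.rep_eq when_def)

interpretation rat_free: vector_space "scl :: rat \<Rightarrow> ('a \<Rightarrow>\<^sub>0 rat) \<Rightarrow> 'a \<Rightarrow>\<^sub>0 rat"
  by unfold_locales (auto intro!: poly_mapping_eqI simp: lookup_scl lookup_add algebra_simps)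

definition lin_ext :: "('a \<Rightarrow> 'b \<Rightarrow>\<^sub>0 rat) \<Rightarrow> ('a \<Rightarrow>\<^sub>0 rat) \<Rightarrow> 'b \<Rightarrow>\<^sub>0 rat" where
  "lin_ext f x = (\<Sum>b\<in>Poly_Mapping.keys x. scl (Poly_Mapping.lookup x b) (f b))"

definition additive_group :: "'v::ab_group_add set \<Rightarrow> 'v monoid" where
  "additive_group V = \<lparr>carrier = V, mult = (+), one = 0\<rparr>"


subsection \<open>Decorated graphs\<close>

text \<open>
  Basis of the reduced cohomology: \<open>Alpha p\<close> in degree \<open>m\<close> and \<open>Beta p\<close> in degree
  \<open>m + 1\<close>, for \<open>p < g\<close>.
\<close>

datatype letter = Alpha nat | Beta nat

fun index :: "letter \<Rightarrow> nat" where
  "index (Alpha p) = p"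
| "index (Beta p) = p"

fun ldeg :: "nat \<Rightarrow> letter \<Rightarrow> nat" where
  "ldeg m (Alpha p) = m"
| "ldeg m (Beta p) = m + 1"

definition wdeg :: "nat \<Rightarrow> letter list \<Rightarrow> nat" where
  "wdeg m w = sum_list (map (ldeg m) w)"

text \<open>
  \<open>DGraph es ds\<close> has the ordered edge list \<open>es\<close> and the vertices \<open>0, \<dots>, length ds - 1\<close>;
  so the vertex called \<open>v\<close> here is the vertex number \<open>v + 1\<close> in a numbering starting with \<open>1\<close>.
  It stands for the tensor
  \<open>graph \<otimes> s \<otimes> \<dots> \<otimes> s \<otimes> ds!0 \<otimes> \<dots> \<otimes> ds!(n-1)\<close>
  with \<open>s\<close> a generator of the line \<open>\<rat>[2m+1]\<close>, where the word \<open>ds!v\<close> stands for the product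
  of its letters, in this order, in the graded symmetric algebra.
\<close>

datatype dgraph = DGraph (edges: "(nat \<times> nat) list") (decs: "letter list list")

abbreviation nverts :: "dgraph \<Rightarrow> nat" where "nverts \<Gamma> \<equiv> length (decs \<Gamma>)"
abbreviation nedges :: "dgraph \<Rightarrow> nat" where "nedges \<Gamma> \<equiv> length (edges \<Gamma>)"

definition dgraphs :: "nat \<Rightarrow> dgraph set" where
  "dgraphs g = {\<Gamma>. (\<forall>(i, j) \<in> set (edges \<Gamma>). i < nverts \<Gamma> \<and> j < nverts \<Gamma>) \<and>
                    (\<forall>w \<in> set (decs \<Gamma>). \<forall>x \<in> set w. index x < g)}"

definition valence :: "dgraph \<Rightarrow> nat \<Rightarrow> nat" where
  "valence \<Gamma> v = length (filter (\<lambda>e. fst e = v) (edges \<Gamma>))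
     + length (filter (\<lambda>e. snd e = v) (edges \<Gamma>)) + length (decs \<Gamma> ! v)"

fun is_Alpha :: "letter \<Rightarrow> bool" where
  "is_Alpha (Alpha p) = True"
| "is_Alpha (Beta p) = False"

definition num_alpha :: "dgraph \<Rightarrow> nat" where
  "num_alpha \<Gamma> = length (filter is_Alpha (concat (decs \<Gamma>)))"

definition num_beta :: "dgraph \<Rightarrow> nat" where
  "num_beta \<Gamma> = length (filter (\<lambda>x. \<not> is_Alpha x) (concat (decs \<Gamma>)))"

definition degr :: "nat \<Rightarrow> dgraph \<Rightarrow> int" where
  "degr m \<Gamma> = 2 * int m * int (nedges \<Gamma>) - (2 * int m + 1) * int (nverts \<Gamma>)
     + int m * int (num_alpha \<Gamma>) + (int m + 1) * int (num_beta \<Gamma>)"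

definition weight :: "dgraph \<Rightarrow> int" where
  "weight \<Gamma> = 2 * (int (nedges \<Gamma>) - int (nverts \<Gamma>)) + int (num_alpha \<Gamma>) + int (num_beta \<Gamma>)"

definition imbalance :: "dgraph \<Rightarrow> int" where
  "imbalance \<Gamma> = int (num_alpha \<Gamma>) - int (num_beta \<Gamma>)"


subsection \<open>Coinvariants\<close>

text \<open>
  The permutation \<open>\<sigma>\<close> moves the \<open>i\<close>-th vertex to position \<open>\<sigma> i\<close>, \<open>\<pi>\<close> reorders the edges, and
  the edges at the positions in \<open>F\<close> are flipped; these triples are the elements of
  \<open>S\<^sub>n \<times> (S\<^sub>2 \<wr> S\<^sub>k)\<close>.
\<close>

definition act :: "(nat \<Rightarrow> nat) \<Rightarrow> (nat \<Rightarrow> nat) \<Rightarrow> nat set \<Rightarrow> dgraph \<Rightarrow> dgraph" where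
  "act \<sigma> \<pi> F \<Gamma> = DGraph
     (map (map_prod \<sigma> \<sigma>) (permute_list \<pi>
        (map (\<lambda>l. if l \<in> F then prod.swap (edges \<Gamma> ! l) else edges \<Gamma> ! l) [0..<nedges \<Gamma>])))
     (permute_list (inv_into UNIV \<sigma>) (decs \<Gamma>))"

definition koszul :: "(nat \<Rightarrow> nat) \<Rightarrow> nat list \<Rightarrow> int" where
  "koszul \<sigma> ns = (-1) ^ (\<Sum>(i, j) \<in> {(i, j). i < j \<and> j < length ns \<and> \<sigma> j < \<sigma> i}. ns ! i * ns ! j)"

text \<open>
  The factor \<open>sign \<sigma>\<close> comes from permuting the odd lines \<open>\<rat>[2m+1]\<close>. Edges have even degree
  \<open>2m\<close>, so reordering them produces no sign.
\<close>

definition act_sign :: "nat \<Rightarrow> (nat \<Rightarrow> nat) \<Rightarrow> nat set \<Rightarrow> dgraph \<Rightarrow> int" where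
  "act_sign m \<sigma> F \<Gamma> = sign \<sigma> * koszul \<sigma> (map (wdeg m) (decs \<Gamma>)) * (-1) ^ card F"

definition group_relations :: "nat \<Rightarrow> nat \<Rightarrow> (dgraph \<Rightarrow>\<^sub>0 rat) set" where
  "group_relations m g =
     {Poly_Mapping.single \<Gamma> 1 - Poly_Mapping.single (act \<sigma> \<pi> F \<Gamma>) (of_int (act_sign m \<sigma> F \<Gamma>)) |
        \<Gamma> \<sigma> \<pi> F. \<Gamma> \<in> dgraphs g \<and> \<sigma> permutes {..<nverts \<Gamma>} \<and> \<pi> permutes {..<nedges \<Gamma>} \<and>
                 F \<subseteq> {..<nedges \<Gamma>}}"

text \<open>
  The relations \<open>x y = (-1)\<^bsup>|x| |y|\<^esup> y x\<close> of the graded symmetric algebra (as a quotient of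
  the tensor algebra), imposed at each vertex.
\<close>

definition symmetric_relations :: "nat \<Rightarrow> nat \<Rightarrow> (dgraph \<Rightarrow>\<^sub>0 rat) set" where
  "symmetric_relations m g =
     {Poly_Mapping.single (DGraph es (as @ (us @ [x, y] @ vs) # bs)) 1
      - Poly_Mapping.single (DGraph es (as @ (us @ [y, x] @ vs) # bs)) ((-1) ^ (ldeg m x * ldeg m y)) |
        es as us x y vs bs. DGraph es (as @ (us @ [x, y] @ vs) # bs) \<in> dgraphs g}"

definition relations :: "nat \<Rightarrow> nat \<Rightarrow> (dgraph \<Rightarrow>\<^sub>0 rat) set" where
  "relations m g = rat_free.span (group_relations m g \<union> symmetric_relations m g)"

definition graph_span :: "dgraph set \<Rightarrow> (dgraph \<Rightarrow>\<^sub>0 rat) set" where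
  "graph_span B = rat_free.span ((\<lambda>\<Gamma>. Poly_Mapping.single \<Gamma> 1) ` B)"

text \<open>
  The space of coinvariants. The summand with no vertices is a copy of \<open>\<rat>\<close> spanned by the empty
  graph, the unit for disjoint union.
\<close>

definition coinvariants :: "nat \<Rightarrow> nat \<Rightarrow> (dgraph \<Rightarrow>\<^sub>0 rat) set monoid" where
  "coinvariants m g = additive_group (graph_span (dgraphs g)) Mod relations m g"

definition cls :: "nat \<Rightarrow> nat \<Rightarrow> (dgraph \<Rightarrow>\<^sub>0 rat) \<Rightarrow> (dgraph \<Rightarrow>\<^sub>0 rat) set" where
  "cls m g x = relations m g #>\<^bsub>additive_group (graph_span (dgraphs g))\<^esub> x"


subsection \<open>The differential\<close>

text \<open>
  \<open>contract_edge m \<Gamma> l\<close> contracts the edge \<open>(i, j)\<close> at position \<open>l\<close>: the \<open>j\<close>-th decoration factor is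
  moved, with its Koszul sign, to the place directly behind the \<open>i\<close>-th one. The exponent \<open>Suc j\<close>
  is the number of the vertex \<open>j\<close> when counting from \<open>1\<close>.
\<close>

definition contract_vertex :: "nat \<Rightarrow> nat \<Rightarrow> nat \<Rightarrow> nat" where
  "contract_vertex i j v = (let w = (if v = j then i else v) in if j < w then w - 1 else w)"

definition drop_nth :: "nat \<Rightarrow> 'a list \<Rightarrow> 'a list" where
  "drop_nth l xs = take l xs @ drop (Suc l) xs"

definition contract_edge :: "nat \<Rightarrow> dgraph \<Rightarrow> nat \<Rightarrow> dgraph \<Rightarrow>\<^sub>0 rat" where
  "contract_edge m \<Gamma> l = (let (i, j) = edges \<Gamma> ! l; ds = decs \<Gamma> in
     if i = j then 0
     else Poly_Mapping.single
       (DGraph (map (map_prod (contract_vertex i j) (contract_vertex i j)) (drop_nth l (edges \<Gamma>)))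
               (drop_nth j (ds[i := ds ! i @ ds ! j])))
       ((-1) ^ (wdeg m (ds ! j) * (\<Sum>v | i < v \<and> v < j \<or> j < v \<and> v \<le> i. wdeg m (ds ! v)))))"

definition d_c :: "nat \<Rightarrow> dgraph \<Rightarrow> dgraph \<Rightarrow>\<^sub>0 rat" where
  "d_c m \<Gamma> = (\<Sum>l<nedges \<Gamma>. scl ((-1) ^ Suc (snd (edges \<Gamma> ! l))) (contract_edge m \<Gamma> l))"

text \<open>\<open>left_mult m x v \<Gamma>\<close> moves \<open>x\<close> from the left of all decoration factors into the \<open>v\<close>-th one.\<close>

definition left_mult :: "nat \<Rightarrow> letter \<Rightarrow> nat \<Rightarrow> dgraph \<Rightarrow> dgraph \<Rightarrow>\<^sub>0 rat" where
  "left_mult m x v \<Gamma> = Poly_Mapping.single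
     (DGraph (edges \<Gamma>) ((decs \<Gamma>)[v := x # decs \<Gamma> ! v]))
     ((-1) ^ (ldeg m x * (\<Sum>u<v. wdeg m (decs \<Gamma> ! u))))"

definition left_mult2 :: "nat \<Rightarrow> letter \<Rightarrow> nat \<Rightarrow> letter \<Rightarrow> nat \<Rightarrow> dgraph \<Rightarrow> dgraph \<Rightarrow>\<^sub>0 rat" where
  "left_mult2 m x i y j \<Gamma> = lin_ext (left_mult m x i) (left_mult m y j \<Gamma>)"

definition cut_edge :: "nat \<Rightarrow> nat \<Rightarrow> dgraph \<Rightarrow> nat \<Rightarrow> dgraph \<Rightarrow>\<^sub>0 rat" where
  "cut_edge m g \<Gamma> l = (let (i, j) = edges \<Gamma> ! l; \<Gamma>' = DGraph (drop_nth l (edges \<Gamma>)) (decs \<Gamma>) in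
     scl ((-1) ^ m) (\<Sum>p<g. left_mult2 m (Alpha p) i (Beta p) j \<Gamma>'
                             - left_mult2 m (Beta p) i (Alpha p) j \<Gamma>'))"

definition d_cut :: "nat \<Rightarrow> nat \<Rightarrow> dgraph \<Rightarrow> dgraph \<Rightarrow>\<^sub>0 rat" where
  "d_cut m g \<Gamma> = scl ((-1) ^ nverts \<Gamma>) (\<Sum>l<nedges \<Gamma>. cut_edge m g \<Gamma> l)"

definition differential :: "nat \<Rightarrow> nat \<Rightarrow> (dgraph \<Rightarrow>\<^sub>0 rat) \<Rightarrow> dgraph \<Rightarrow>\<^sub>0 rat" where
  "differential m g = lin_ext (\<lambda>\<Gamma>. d_c m \<Gamma> + d_cut m g \<Gamma>)"

text \<open>
  The induced map on classes; \<open>differential\<close> maps \<open>relations m g\<close> into itself, so the union is over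
  one and the same class.
\<close>

definition differential_cls :: "nat \<Rightarrow> nat \<Rightarrow> (dgraph \<Rightarrow>\<^sub>0 rat) set \<Rightarrow> (dgraph \<Rightarrow>\<^sub>0 rat) set" where
  "differential_cls m g X = (\<Union>x\<in>X. cls m g (differential m g x))"


subsection \<open>The Chevalley--Eilenberg complex\<close>

definition fG_graphs :: "nat \<Rightarrow> dgraph set" where
  "fG_graphs g = {\<Gamma> \<in> dgraphs g. nverts \<Gamma> \<ge> 1 \<and> (\<forall>v<nverts \<Gamma>. valence \<Gamma> v \<ge> 3)}"

text \<open>
  The Chevalley--Eilenberg complex of the dual dg Lie algebra of the dg Lie coalgebra of connected
  graphs is the space of all graphs plus the unit, which is the class of the empty graph.
\<close>

definition CE_graphs :: "nat \<Rightarrow> dgraph set" where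
  "CE_graphs g = insert (DGraph [] []) (fG_graphs g)"

definition CE_cochains :: "nat \<Rightarrow> nat \<Rightarrow> int \<Rightarrow> int \<Rightarrow> int \<Rightarrow> (dgraph \<Rightarrow>\<^sub>0 rat) set monoid" where
  "CE_cochains m g W H k = (coinvariants m g)
     \<lparr>carrier := cls m g ` graph_span
        {\<Gamma> \<in> CE_graphs g. weight \<Gamma> = W \<and> imbalance \<Gamma> = H \<and> degr m \<Gamma> = k}\<rparr>"

definition CE_cocycles :: "nat \<Rightarrow> nat \<Rightarrow> int \<Rightarrow> int \<Rightarrow> int \<Rightarrow> (dgraph \<Rightarrow>\<^sub>0 rat) set set" where
  "CE_cocycles m g W H k =
     kernel (CE_cochains m g W H k) (CE_cochains m g W H (k + 1)) (differential_cls m g)"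

definition CE_coboundaries :: "nat \<Rightarrow> nat \<Rightarrow> int \<Rightarrow> int \<Rightarrow> int \<Rightarrow> (dgraph \<Rightarrow>\<^sub>0 rat) set set" where
  "CE_coboundaries m g W H k = differential_cls m g ` carrier (CE_cochains m g W H (k - 1))"

definition CE_cohomology :: "nat \<Rightarrow> nat \<Rightarrow> int \<Rightarrow> int \<Rightarrow> int \<Rightarrow> (dgraph \<Rightarrow>\<^sub>0 rat) set set monoid" where
  "CE_cohomology m g W H k =
     (CE_cochains m g W H k)\<lparr>carrier := CE_cocycles m g W H k\<rparr> Mod CE_coboundaries m g W H k"

definition k_crit :: "nat \<Rightarrow> int \<Rightarrow> int \<Rightarrow> rat" where
  "k_crit m W H = of_int W / 2 * (2 * of_nat m + 1) - of_int H / 2"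

end

theory Submission
  imports Defs
begin

text \<open>
  In weight \<open>W\<close> and imbalance \<open>H\<close> a graph with \<open>e\<close> edges has degree \<open>k_crit m W H - e\<close>, so the theorem says
  that the complex is exact at the graphs with at least one edge. Moreover \<open>W\<close> is the sum of
  \<open>valence - 2\<close> over the vertices. Valences being at least 3, there are at most \<open>W\<close> vertices, and if
  there is an edge, the numbers \<open>a\<close> and \<open>b\<close> of decorations \<open>\<alpha>\<^sub>p\<close> and \<open>\<beta>\<^sub>p\<close> satisfy
  \<open>a + b \<le> 3 W - 2 < g\<close> (lemma \<open>decorations_bound\<close>).

  Contraction lowers the number of vertices by one and cutting preserves it. An induction on the number
  of vertices (lemma \<open>exact_filtered\<close>) therefore reduces the claim to \<open>d_cut\<close> alone: for fixed
  numbers \<open>n\<close> of vertices, \<open>e \<ge> 1\<close> of edges, and \<open>a\<close>, \<open>b\<close> of decorations with \<open>a + b < g\<close>, every cycle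
  of \<open>d_cut\<close> is a boundary (lemma \<open>d_cut_exact\<close>).

  A graph with numbered vertices is a monomial in even variables, one for each ordered pair of vertices,
  and in variables \<open>\<alpha>\<^sub>p\<^sub>i\<close>, \<open>\<beta>\<^sub>p\<^sub>i\<close> for the decorations of the vertex \<open>i\<close>. Taking coinvariants amounts to
  restricting to elements that are skew under the flip of an edge and alternating under renumbering
  of the vertices, and there cutting is, up to a factor, the differential operator
  \<open>D = (\<Sum>i j p. \<alpha>\<^sub>p\<^sub>i \<beta>\<^sub>p\<^sub>j \<partial>/\<partial>(Edge i j))\<close>. For the positive definite form in which multiplication
  by a variable is adjoint to the derivation with respect to it, let \<open>D\<^sup>*\<close> be the adjoint of \<open>D\<close>, which joins
  pairs \<open>\<alpha>\<^sub>p\<close>, \<open>\<beta>\<^sub>p\<close> to edges. Computing the Laplacian gives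
  \<open>|D x|\<^sup>2 + |D\<^sup>* x|\<^sup>2 \<ge> (g - a - b) e |x|\<^sup>2\<close> (lemma \<open>laplacian_bound\<close>): removing an inserted pair
  \<open>\<alpha>\<^sub>p\<close>, \<open>\<beta>\<^sub>p\<close> again is possible for each of the \<open>g\<close> values of \<open>p\<close>, which produces the term \<open>g e |x|\<^sup>2\<close>, and the
  remaining terms of indefinite sign are bounded by Cauchy--Schwarz. Subtracting from a cycle its
  orthogonal projection to the boundaries leaves an element killed by \<open>D\<close> and by \<open>D\<^sup>*\<close>, and
  for \<open>a + b < g\<close> and \<open>e \<ge> 1\<close> such an element vanishes.

  The passage from graphs to monomials has to match all signs. Here a list of letters, each labelled by
  a vertex, is turned into a graph with the sign of sorting the letters by their vertex. In terms of such
  lists the Koszul signs of the relations and of the differential are absorbed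
  (lemmas \<open>koszul_sortsign\<close> and \<open>contract_flat\<close>).
\<close>


section \<open>Linear maps on free rational vector spaces\<close>

abbreviation bas :: "'a \<Rightarrow> 'a \<Rightarrow>\<^sub>0 rat" where
  "bas b \<equiv> Poly_Mapping.single b 1"

abbreviation lkp :: "('a \<Rightarrow>\<^sub>0 rat) \<Rightarrow> 'a \<Rightarrow> rat" where
  "lkp \<equiv> Poly_Mapping.lookup"

abbreviation keys :: "('a \<Rightarrow>\<^sub>0 rat) \<Rightarrow> 'a set" where
  "keys \<equiv> Poly_Mapping.keys"

lemma scl_simps [simp]:
  "scl c 0 = 0" "scl 0 x = 0" "scl 1 x = x" "scl a (scl b x) = scl (a * b) x"
  "scl c (Poly_Mapping.single k d) = Poly_Mapping.single k (c * d)"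
  by (auto intro!: poly_mapping_eqI simp: lookup_scl lookup_single when_def)

lemma scl_add: "scl c (x + y) = scl c x + scl c y"
  and scl_diff: "scl c (x - y) = scl c x - scl c y"
  and scl_minus: "scl c (- x) = - scl c x"
  and scl_minus_left: "scl (- c) x = - scl c x"
  and scl_left_distrib: "scl (c + d) x = scl c x + scl d x"
  by (auto intro!: poly_mapping_eqI simp: lookup_scl lookup_add lookup_minus algebra_simps)

lemma scl_sum: "scl c (sum f A) = (\<Sum>a\<in>A. scl c (f a))"
  by (induction A rule: infinite_finite_induct) (auto simp: scl_add)

lemma keys_scl_subset: "keys (scl c x) \<subseteq> keys x"
  by (auto simp: in_keys_iff lookup_scl)

lemma lin_ext_superset:
  assumes "finite A" "keys x \<subseteq> A"
  shows "lin_ext f x = (\<Sum>b\<in>A. scl (lkp x b) (f b))"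
  unfolding lin_ext_def using assms
  by (intro sum.mono_neutral_left) (auto simp: in_keys_iff)

lemma lin_ext_add: "lin_ext f (x + y) = lin_ext f x + lin_ext f y"
proof -
  let ?A = "keys x \<union> keys y"
  have "keys (x + y) \<subseteq> ?A" by (auto simp: in_keys_iff lookup_add)
  then show ?thesis
    by (simp add: lin_ext_superset[of ?A] lookup_add scl_left_distrib sum.distrib)
qed

lemma lin_ext_scl: "lin_ext f (scl c x) = scl c (lin_ext f x)"
  using keys_scl_subset[of c x]
  by (simp add: lin_ext_superset[of "keys x"] lookup_scl scl_sum)

lemma lin_ext_zero [simp]: "lin_ext f 0 = 0"
  by (simp add: lin_ext_def)

lemma lin_ext_minus: "lin_ext f (- x) = - lin_ext f x"
  using lin_ext_scl[of f "-1" x] by (simp add: scl_minus_left)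

lemma lin_ext_diff: "lin_ext f (x - y) = lin_ext f x - lin_ext f y"
  using lin_ext_add[of f x "- y"] by (simp add: lin_ext_minus)

lemma lin_ext_sum: "lin_ext f (sum h A) = (\<Sum>a\<in>A. lin_ext f (h a))"
  by (induction A rule: infinite_finite_induct) (auto simp: lin_ext_add)

lemma lin_ext_single [simp]: "lin_ext f (Poly_Mapping.single b c) = scl c (f b)"
  by (cases "c = 0") (simp_all add: lin_ext_def lookup_single)

lemma lin_ext_lin_ext: "lin_ext f (lin_ext h x) = lin_ext (\<lambda>b. lin_ext f (h b)) x"
  by (simp add: lin_ext_def[of h x] lin_ext_def[of "\<lambda>b. lin_ext f (h b)"] lin_ext_sum lin_ext_scl)

lemma lin_ext_bas [simp]: "lin_ext bas x = x"
proof (rule poly_mapping_eqI)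
  fix a
  have "lkp (\<Sum>b\<in>keys x. Poly_Mapping.single b (lkp x b)) a
      = (\<Sum>b\<in>keys x. lkp (Poly_Mapping.single b (lkp x b)) a)"
    by (induction "keys x" rule: infinite_finite_induct) (auto simp: lookup_sum)
  also have "\<dots> = lkp x a"
    by (auto simp: lookup_single when_def in_keys_iff)
  finally show "lkp (lin_ext bas x) a = lkp x a"
    by (simp add: lin_ext_def)
qed

lemma lin_ext_cong: "(\<And>b. b \<in> keys x \<Longrightarrow> f b = h b) \<Longrightarrow> lin_ext f x = lin_ext h x"
  by (simp add: lin_ext_def)

lemma lin_ext_plus_fun: "lin_ext (\<lambda>b. f b + h b) x = lin_ext f x + lin_ext h x"
  and lin_ext_diff_fun: "lin_ext (\<lambda>b. f b - h b) x = lin_ext f x - lin_ext h x"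
  and lin_ext_scl_fun: "lin_ext (\<lambda>b. scl c (f b)) x = scl c (lin_ext f x)"
  by (simp_all add: lin_ext_def scl_add scl_diff sum.distrib sum_subtractf scl_sum mult.commute)

lemma lin_ext_zero_fun [simp]: "lin_ext (\<lambda>b. 0) x = 0"
  by (simp add: lin_ext_def)

lemma lin_ext_sum_fun: "lin_ext (\<lambda>b. \<Sum>a\<in>A. f a b) x = (\<Sum>a\<in>A. lin_ext (f a) x)"
  by (induction A rule: infinite_finite_induct) (auto simp: lin_ext_plus_fun)

lemma span_bas: "rat_free.span ((\<lambda>b. bas b) ` B) = {x. keys x \<subseteq> B}"
proof (intro Set.set_eqI iffI)
  fix x assume "x \<in> rat_free.span ((\<lambda>b. bas b) ` B)"
  then show "x \<in> {x. keys x \<subseteq> B}"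
  proof (induction rule: rat_free.span_induct_alt)
    case base then show ?case by simp
  next
    case (step c b y)
    have "keys (scl c b + y) \<subseteq> keys b \<union> keys y"
      by (auto simp: in_keys_iff lookup_add lookup_scl)
    with step show ?case by (auto split: if_splits)
  qed
next
  fix x :: "'a \<Rightarrow>\<^sub>0 rat" assume x: "x \<in> {x. keys x \<subseteq> B}"
  have "lin_ext bas x \<in> rat_free.span ((\<lambda>b. bas b) ` B)"
    unfolding lin_ext_def
    by (rule rat_free.span_sum, rule rat_free.span_scale, rule rat_free.span_base) (use x in auto)
  then show "x \<in> rat_free.span ((\<lambda>b. bas b) ` B)" by simp
qed

lemma keys_add_subset: "keys x \<subseteq> B \<Longrightarrow> keys y \<subseteq> B \<Longrightarrow> keys (x + y) \<subseteq> B"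
  using Poly_Mapping.keys_add[of x y] by blast

lemma keys_scl: "keys x \<subseteq> B \<Longrightarrow> keys (scl c x) \<subseteq> B"
  using keys_scl_subset[of c x] by blast

lemma keys_minus_subset: "keys x \<subseteq> B \<Longrightarrow> keys (- x) \<subseteq> B"
  using keys_scl[of x B "-1"] by (simp add: scl_minus_left)

lemma keys_diff_subset: "keys x \<subseteq> B \<Longrightarrow> keys y \<subseteq> B \<Longrightarrow> keys (x - y) \<subseteq> B"
  using keys_add_subset[of x B "- y"] keys_minus_subset[of y B] by simp

lemma keys_sum_subset: "(\<And>a. a \<in> A \<Longrightarrow> keys (f a) \<subseteq> B) \<Longrightarrow> keys (sum f A) \<subseteq> B"
  by (induction A rule: infinite_finite_induct) (simp_all add: keys_add_subset)

lemma keys_lin_ext: "(\<And>b. b \<in> keys x \<Longrightarrow> keys (f b) \<subseteq> B) \<Longrightarrow> keys (lin_ext f x) \<subseteq> B"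
  unfolding lin_ext_def by (intro keys_sum_subset keys_scl)


subsection \<open>Congruence modulo a subspace\<close>

definition cong_mod :: "('a \<Rightarrow>\<^sub>0 rat) \<Rightarrow> ('a \<Rightarrow>\<^sub>0 rat) set \<Rightarrow> ('a \<Rightarrow>\<^sub>0 rat) \<Rightarrow> bool"
    ("(_/ \<approx>[_] _)" [51, 0, 51] 50) where
  "x \<approx>[R] y \<longleftrightarrow> x - y \<in> R"

lemma cong_mod_zero: "x \<approx>[R] 0 \<longleftrightarrow> x \<in> R"
  by (simp add: cong_mod_def)

text \<open>All subspaces that occur are spans, so the rules are stated for spans.\<close>

lemma cm_refl [simp]: "x \<approx>[rat_free.span S] x"
  by (simp add: cong_mod_def rat_free.span_zero)

lemma cm_sym: "x \<approx>[rat_free.span S] y \<Longrightarrow> y \<approx>[rat_free.span S] x"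
  unfolding cong_mod_def using rat_free.span_neg by fastforce

lemma cm_trans [trans]:
  "x \<approx>[rat_free.span S] y \<Longrightarrow> y \<approx>[rat_free.span S] z \<Longrightarrow> x \<approx>[rat_free.span S] z"
  unfolding cong_mod_def using rat_free.span_add by fastforce

lemma cm_add:
  "x \<approx>[rat_free.span S] y \<Longrightarrow> x' \<approx>[rat_free.span S] y' \<Longrightarrow> x + x' \<approx>[rat_free.span S] y + y'"
  unfolding cong_mod_def using rat_free.span_add[of "x - y" S "x' - y'"] by (simp add: algebra_simps)

lemma cm_scl: "x \<approx>[rat_free.span S] y \<Longrightarrow> scl c x \<approx>[rat_free.span S] scl c y"
  unfolding cong_mod_def using rat_free.span_scale[of "x - y" S c] by (simp add: scl_diff)

lemma cm_minus: "x \<approx>[rat_free.span S] y \<Longrightarrow> - x \<approx>[rat_free.span S] - y"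
  using cm_scl[of x S y "-1"] by (simp add: scl_minus_left)

lemma cm_diff:
  "x \<approx>[rat_free.span S] y \<Longrightarrow> x' \<approx>[rat_free.span S] y' \<Longrightarrow> x - x' \<approx>[rat_free.span S] y - y'"
  using cm_add[OF _ cm_minus, of x S y x' y'] by simp

lemma cm_sum:
  "(\<And>a. a \<in> A \<Longrightarrow> f a \<approx>[rat_free.span S] h a) \<Longrightarrow> sum f A \<approx>[rat_free.span S] sum h A"
  by (induction A rule: infinite_finite_induct) (auto intro: cm_add)

lemma cm_lin_ext:
  "(\<And>b. b \<in> keys x \<Longrightarrow> f b \<approx>[rat_free.span S] h b) \<Longrightarrow>
     lin_ext f x \<approx>[rat_free.span S] lin_ext h x"
  unfolding lin_ext_def by (intro cm_sum cm_scl)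

lemma lin_ext_span:
  assumes "\<And>r. r \<in> S \<Longrightarrow> lin_ext f r \<in> rat_free.span S'" and "x \<in> rat_free.span S"
  shows "lin_ext f x \<in> rat_free.span S'"
  using assms(2)
proof (induction rule: rat_free.span_induct_alt)
  case base then show ?case by (simp add: rat_free.span_zero)
next
  case (step c b y)
  then show ?case
    by (simp add: lin_ext_add lin_ext_scl rat_free.span_add rat_free.span_scale assms(1))
qed

lemma cm_lin_ext_span:
  assumes "\<And>r. r \<in> S \<Longrightarrow> lin_ext f r \<in> rat_free.span S'" and "x \<approx>[rat_free.span S] y"
  shows "lin_ext f x \<approx>[rat_free.span S'] lin_ext f y"
proof -
  have "x - y \<in> rat_free.span S" using assms(2) by (simp add: cong_mod_def)
  from lin_ext_span[OF assms(1) this] show ?thesis by (simp add: cong_mod_def lin_ext_diff)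
qed

lemma cm_neg_self:
  assumes "x \<approx>[rat_free.span S] - x" shows "x \<approx>[rat_free.span S] 0"
proof -
  have "scl (1/2) (x - - x) \<in> rat_free.span S"
    using assms rat_free.span_scale unfolding cong_mod_def by blast
  moreover have "scl (1/2) (x - - x) = x"
    by (auto intro!: poly_mapping_eqI simp: lookup_scl lookup_minus lookup_add)
  ultimately show ?thesis by (simp add: cong_mod_zero)
qed


section \<open>Words in supercommuting letters\<close>

text \<open>
  The free supercommutative algebra on letters \<open>a\<close> of degree \<open>par a\<close> is the quotient of the span of
  words by \<open>srel par\<close>. Multiplication by a letter and the derivation \<open>\<partial>/\<partial>a\<close> both lift to words. There
  derivations commute with each other and with multiplications by the canonical rules exactly, and only the
  commutation of two multiplications needs \<open>srel\<close>; so no normal form of monomials is ever needed.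
\<close>

definition swap_sign :: "('t \<Rightarrow> nat) \<Rightarrow> 't \<Rightarrow> 't \<Rightarrow> rat" where
  "swap_sign par a b = (-1) ^ (par a * par b)"

lemma swap_sign_sym: "swap_sign par a b = swap_sign par b a"
  by (simp add: swap_sign_def mult.commute)

lemma swap_sign_sq [simp]: "swap_sign par a b * swap_sign par a b = 1" "swap_sign par a b * (swap_sign par a b * z) = z"
  by (simp_all add: swap_sign_def flip: power_add mult_2 mult.assoc)

definition srel_gen :: "('t \<Rightarrow> nat) \<Rightarrow> ('t list \<Rightarrow>\<^sub>0 rat) set" where
  "srel_gen par = {bas (u @ [a, b] @ v) - scl (swap_sign par a b) (bas (u @ [b, a] @ v)) | u a b v. True}"

abbreviation srel :: "('t \<Rightarrow> nat) \<Rightarrow> ('t list \<Rightarrow>\<^sub>0 rat) set" where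
  "srel par \<equiv> rat_free.span (srel_gen par)"

definition mul :: "'t \<Rightarrow> ('t list \<Rightarrow>\<^sub>0 rat) \<Rightarrow> 't list \<Rightarrow>\<^sub>0 rat" where
  "mul a = lin_ext (\<lambda>w. bas (a # w))"

fun dword :: "('t \<Rightarrow> nat) \<Rightarrow> 't \<Rightarrow> 't list \<Rightarrow> 't list \<Rightarrow>\<^sub>0 rat" where
  "dword par a [] = 0"
| "dword par a (b # w) = (if a = b then bas w else 0) + scl (swap_sign par a b) (mul b (dword par a w))"

definition der :: "('t \<Rightarrow> nat) \<Rightarrow> 't \<Rightarrow> ('t list \<Rightarrow>\<^sub>0 rat) \<Rightarrow> 't list \<Rightarrow>\<^sub>0 rat" where
  "der par a = lin_ext (dword par a)"

lemma mul_linear: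
  "mul a (x + y) = mul a x + mul a y" "mul a (x - y) = mul a x - mul a y" "mul a 0 = 0"
  "mul a (scl c x) = scl c (mul a x)" "mul a (sum h A) = (\<Sum>i\<in>A. mul a (h i))"
  "mul a (- x) = - mul a x"
  by (simp_all add: mul_def lin_ext_add lin_ext_diff lin_ext_scl lin_ext_sum lin_ext_minus)

lemma der_linear:
  "der par a (x + y) = der par a x + der par a y" "der par a (x - y) = der par a x - der par a y"
  "der par a 0 = 0" "der par a (scl c x) = scl c (der par a x)"
  "der par a (sum h A) = (\<Sum>i\<in>A. der par a (h i))" "der par a (- x) = - der par a x"
  by (simp_all add: der_def lin_ext_add lin_ext_diff lin_ext_scl lin_ext_sum lin_ext_minus)

lemma mul_single [simp]: "mul a (Poly_Mapping.single w c) = Poly_Mapping.single (a # w) c"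
  by (simp add: mul_def)

lemma der_bas [simp]: "der par a (bas w) = dword par a w"
  by (simp add: der_def)

lemma der_mul:
  "der par a (mul b x) = (if a = b then x else 0) + scl (swap_sign par a b) (mul b (der par a x))"
  by (simp add: der_def mul_def lin_ext_lin_ext lin_ext_plus_fun lin_ext_scl_fun)

lemma word_swap: "bas (u @ [a, b] @ v) \<approx>[srel par] scl (swap_sign par a b) (bas (u @ [b, a] @ v))"
  unfolding cong_mod_def srel_gen_def by (rule rat_free.span_base) blast

lemma mul_swap: "mul a (mul b x) \<approx>[srel par] scl (swap_sign par a b) (mul b (mul a x))"
proof -
  have "lin_ext (\<lambda>w. bas (a # b # w)) x \<approx>[srel par] lin_ext (\<lambda>w. scl (swap_sign par a b) (bas (b # a # w))) x"
    using word_swap[of "[]"] by (intro cm_lin_ext) simp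
  then show ?thesis by (simp add: mul_def lin_ext_lin_ext lin_ext_scl_fun del: scl_simps(5))
qed

lemma mul_cong:
  assumes "x \<approx>[srel par] y" shows "mul a x \<approx>[srel par] mul a y"
  unfolding mul_def
proof (rule cm_lin_ext_span[OF _ assms])
  fix r assume "r \<in> srel_gen par"
  then obtain u c b v where r: "r = bas (u @ [c, b] @ v) - scl (swap_sign par c b) (bas (u @ [b, c] @ v))"
    unfolding srel_gen_def by blast
  show "lin_ext (\<lambda>w. bas (a # w)) r \<in> srel par"
    using word_swap[of "a # u" c b v par] by (simp add: r lin_ext_diff cong_mod_def)
qed

lemma der_cong:
  assumes "x \<approx>[srel par] y" shows "der par a x \<approx>[srel par] der par a y"
  unfolding der_def
proof (rule cm_lin_ext_span[OF _ assms])
  fix r assume "r \<in> srel_gen par"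
  then obtain u c b v where r: "r = bas (u @ [c, b] @ v) - scl (swap_sign par c b) (bas (u @ [b, c] @ v))"
    unfolding srel_gen_def by blast
  let ?s = "swap_sign par"
  have base: "dword par a (c # b # v) \<approx>[srel par] scl (?s c b) (dword par a (b # c # v))"
  proof -
    let ?d = "dword par a v"
    have "mul c (mul b ?d) \<approx>[srel par] scl (?s c b) (mul b (mul c ?d))"
      by (rule mul_swap)
    from cm_scl[OF this, of "?s a c * ?s a b"]
    have "scl (?s a c * ?s a b) (mul c (mul b ?d) - scl (?s c b) (mul b (mul c ?d))) \<in> srel par"
      by (simp add: cong_mod_def scl_diff)
    moreover have "dword par a (c # b # v) - scl (?s c b) (dword par a (b # c # v))
      = scl (?s a c * ?s a b) (mul c (mul b ?d) - scl (?s c b) (mul b (mul c ?d)))"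
      by (auto simp: mul_linear scl_add scl_diff mult_ac swap_sign_sym)
    ultimately show ?thesis by (simp add: cong_mod_def)
  qed
  have "dword par a (u @ [c, b] @ v) \<approx>[srel par] scl (?s c b) (dword par a (u @ [b, c] @ v))"
  proof (induction u)
    case Nil then show ?case using base by simp
  next
    case (Cons e u)
    have "scl (?s a e) (mul e (dword par a (u @ [c, b] @ v)))
        \<approx>[srel par] scl (?s a e) (mul e (scl (?s c b) (dword par a (u @ [b, c] @ v))))"
      by (intro cm_scl mul_cong Cons.IH)
    moreover have "(if a = e then bas (u @ [c, b] @ v) else 0)
        \<approx>[srel par] scl (?s c b) (if a = e then bas (u @ [b, c] @ v) else 0)"
      using word_swap[of u c b v par] by auto
    ultimately have "(if a = e then bas (u @ [c, b] @ v) else 0) + scl (?s a e) (mul e (dword par a (u @ [c, b] @ v)))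
       \<approx>[srel par] scl (?s c b) (if a = e then bas (u @ [b, c] @ v) else 0)
         + scl (?s a e) (mul e (scl (?s c b) (dword par a (u @ [b, c] @ v))))"
      by (rule cm_add[rotated])
    then show ?case by (cases "a = e") (simp_all add: scl_add mul_linear mult_ac del: scl_simps(5))
  qed
  then show "lin_ext (dword par a) r \<in> srel par"
    by (simp add: r lin_ext_diff cong_mod_def)
qed

lemma der_swap: "der par a (der par b x) = scl (swap_sign par a b) (der par b (der par a x))"
proof -
  let ?s = "swap_sign par"
  have "der par a (dword par b w) = scl (?s a b) (der par b (dword par a w))" for w
  proof (induction w)
    case Nil then show ?case by (simp add: der_linear)
  next
    case (Cons c w)
    define Y where "Y = der par b (dword par a w)"
    have ab: "der par a (dword par b (c # w)) = (if b = c then dword par a w else 0)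
        + scl (?s b c) ((if a = c then dword par b w else 0) + scl (?s a c) (mul c (scl (?s a b) Y)))"
      unfolding Y_def Cons.IH[symmetric] by (simp add: der_linear der_mul)
    have ba: "der par b (dword par a (c # w)) = (if a = c then dword par b w else 0)
        + scl (?s a c) ((if b = c then dword par a w else 0) + scl (?s b c) (mul c Y))"
      unfolding Y_def by (simp add: der_linear der_mul)
    have "?s a b * ?s a b = 1" by simp
    then show ?case
      unfolding ab ba by (auto simp: scl_add mul_linear mult_ac swap_sign_sym[of par b a] intro: swap_sign_sym)
  qed
  then show ?thesis
    by (simp add: der_def lin_ext_lin_ext lin_ext_scl_fun)
qed

lemma word_move:
  "bas (u @ v @ w) \<approx>[srel par]
     scl ((-1) ^ (sum_list (map par u) * sum_list (map par v))) (bas (v @ u @ w))"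
proof -
  have one: "bas (a # v @ w) \<approx>[srel par]
     scl ((-1) ^ (par a * sum_list (map par v))) (bas (v @ a # w))" for a w
  proof (induction v)
    case Nil then show ?case by simp
  next
    case (Cons b v)
    have "bas (a # b # v @ w) \<approx>[srel par] scl (swap_sign par a b) (mul b (bas (a # v @ w)))"
      using word_swap[of "[]" a b "v @ w"] by simp
    also have "\<dots> \<approx>[srel par]
        scl (swap_sign par a b) (mul b (scl ((-1) ^ (par a * sum_list (map par v))) (bas (v @ a # w))))"
      by (intro cm_scl mul_cong Cons.IH)
    finally show ?case by (simp add: swap_sign_def power_add distrib_left mult_ac)
  qed
  show ?thesis
  proof (induction u)
    case Nil then show ?case by simp
  next
    case (Cons a u)
    have "mul a (bas (u @ v @ w)) \<approx>[srel par]
        mul a (scl ((-1) ^ (sum_list (map par u) * sum_list (map par v))) (bas (v @ u @ w)))"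
      by (rule mul_cong[OF Cons.IH])
    also have "\<dots> = scl ((-1) ^ (sum_list (map par u) * sum_list (map par v))) (bas (a # v @ u @ w))"
      by simp
    also have "\<dots> \<approx>[srel par] scl ((-1) ^ (sum_list (map par u) * sum_list (map par v)))
        (scl ((-1) ^ (par a * sum_list (map par v))) (bas (v @ a # u @ w)))"
      by (intro cm_scl one)
    finally show ?case by (simp add: power_add distrib_left mult_ac)
  qed
qed

lemma word_prefix:
  assumes "bas v \<approx>[srel par] scl c (bas v')"
  shows "bas (u @ v) \<approx>[srel par] scl c (bas (u @ v'))"
proof (induction u)
  case Nil then show ?case using assms by simp
next
  case (Cons a u)
  from mul_cong[OF this, of a] show ?case by simp
qed

text \<open>
  The summand for \<open>a\<close> brings each occurrence of \<open>a\<close> to the front, which changes nothing modulo \<open>srel\<close>;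
  so the sum counts the letters in \<open>A\<close>.
\<close>

lemma euler_word:
  assumes "finite A"
  shows "(\<Sum>a\<in>A. mul a (dword par a w)) \<approx>[srel par] scl (of_nat (length (filter (\<lambda>b. b \<in> A) w))) (bas w)"
proof (induction w)
  case Nil then show ?case by (simp add: mul_linear)
next
  case (Cons b w)
  have "(\<Sum>a\<in>A. mul a (dword par a (b # w)))
     = (\<Sum>a\<in>A. if a = b then bas (b # w) else 0) + (\<Sum>a\<in>A. scl (swap_sign par a b) (mul a (mul b (dword par a w))))"
    by (auto simp: mul_linear sum.distrib intro!: sum.cong)
  also have "(\<Sum>a\<in>A. if a = b then bas (b # w) else 0) = (if b \<in> A then bas (b # w) else 0)"
    using assms by auto
  also have "(if b \<in> A then bas (b # w) else 0) + (\<Sum>a\<in>A. scl (swap_sign par a b) (mul a (mul b (dword par a w))))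
    \<approx>[srel par] (if b \<in> A then bas (b # w) else 0)
        + (\<Sum>a\<in>A. scl (swap_sign par a b) (scl (swap_sign par a b) (mul b (mul a (dword par a w)))))"
    by (intro cm_add cm_refl cm_sum cm_scl mul_swap)
  also have "\<dots> = (if b \<in> A then bas (b # w) else 0) + mul b (\<Sum>a\<in>A. mul a (dword par a w))"
    by (simp add: mul_linear)
  also have "\<dots> \<approx>[srel par] (if b \<in> A then bas (b # w) else 0)
      + mul b (scl (of_nat (length (filter (\<lambda>b. b \<in> A) w))) (bas w))"
    by (intro cm_add cm_refl mul_cong Cons.IH)
  also have "\<dots> = scl (of_nat (length (filter (\<lambda>b. b \<in> A) (b # w)))) (bas (b # w))"
    by (simp add: single_add[symmetric] add.commute)
  finally show ?case .
qed

lemma euler: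
  assumes "finite A" and "\<And>w. w \<in> keys x \<Longrightarrow> length (filter (\<lambda>b. b \<in> A) w) = c"
  shows "(\<Sum>a\<in>A. mul a (der par a x)) \<approx>[srel par] scl (of_nat c) x"
proof -
  have "(\<Sum>a\<in>A. mul a (der par a x)) = lin_ext (\<lambda>w. \<Sum>a\<in>A. mul a (dword par a w)) x"
    by (simp add: lin_ext_sum_fun mul_def der_def lin_ext_lin_ext)
  also have "\<dots> \<approx>[srel par] lin_ext (\<lambda>w. scl (of_nat c) (bas w)) x"
    using euler_word[OF assms(1)] assms(2) by (intro cm_lin_ext) fastforce
  also have "\<dots> = scl (of_nat c) x"
    using lin_ext_scl_fun[of "of_nat c" bas x] by simp
  finally show ?thesis .
qed

lemma keys_mul: "keys x \<subseteq> B \<Longrightarrow> keys (mul a x) \<subseteq> (#) a ` B"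
  unfolding mul_def by (rule keys_lin_ext) auto

lemma keys_dword: "keys (dword par a w) \<subseteq> {v. mset w = add_mset a (mset v)}"
proof (induction w)
  case Nil then show ?case by simp
next
  case (Cons b w)
  have "keys (mul b (dword par a w)) \<subseteq> {v. mset (b # w) = add_mset a (mset v)}"
    using keys_mul[OF Cons.IH, of b] by auto
  then have "keys ((if a = b then bas w else 0) + scl (swap_sign par a b) (mul b (dword par a w)))
      \<subseteq> {v. mset (b # w) = add_mset a (mset v)}"
    by (intro keys_add_subset keys_scl) auto
  then show ?case by simp
qed

lemma keys_der:
  assumes "w \<in> keys (der par a x)" obtains v where "v \<in> keys x" "mset v = add_mset a (mset w)"
proof -
  have "keys (der par a x) \<subseteq> {w. \<exists>v\<in>keys x. mset v = add_mset a (mset w)}"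
    unfolding der_def using keys_dword by (intro keys_lin_ext) fast
  with assms that show ?thesis by blast
qed


section \<open>The inner product on words\<close>

text \<open>
  The form is determined by the empty word having norm 1 and \<open>mul a\<close> being adjoint to \<open>\<partial>/\<partial>a\<close>.
  By Euler's formula \<open>N \<langle>x, y\<rangle> = (\<Sum>a. \<langle>\<partial>x/\<partial>a, \<partial>y/\<partial>a\<rangle>)\<close> on words of length \<open>N\<close>, so symmetry,
  positivity and definiteness modulo \<open>srel\<close> follow by induction on \<open>N\<close>.
\<close>

fun wform :: "('t \<Rightarrow> nat) \<Rightarrow> 't list \<Rightarrow> ('t list \<Rightarrow>\<^sub>0 rat) \<Rightarrow> rat" where
  "wform par [] y = lkp y []"
| "wform par (a # u) y = wform par u (der par a y)"

definition form :: "('t \<Rightarrow> nat) \<Rightarrow> ('t list \<Rightarrow>\<^sub>0 rat) \<Rightarrow> ('t list \<Rightarrow>\<^sub>0 rat) \<Rightarrow> rat" where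
  "form par x y = (\<Sum>u\<in>keys x. lkp x u * wform par u y)"

lemma wform_linear:
  "wform par u (x + y) = wform par u x + wform par u y" "wform par u (scl c x) = c * wform par u x"
  by (induction u arbitrary: x y) (simp_all add: lookup_add lookup_scl der_linear)

lemma form_superset:
  assumes "finite A" "keys x \<subseteq> A" shows "form par x y = (\<Sum>u\<in>A. lkp x u * wform par u y)"
  unfolding form_def using assms by (intro sum.mono_neutral_left) (auto simp: in_keys_iff)

lemma form_add_right: "form par x (y + z) = form par x y + form par x z"
  and form_scl_right: "form par x (scl c y) = c * form par x y"
  by (simp_all add: form_def wform_linear algebra_simps sum.distrib sum_distrib_left)

lemma form_add_left: "form par (x + y) z = form par x z + form par y z"
proof -
  let ?A = "keys x \<union> keys y"
  have "keys (x + y) \<subseteq> ?A" by (auto simp: in_keys_iff lookup_add)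
  then show ?thesis by (simp add: form_superset[of ?A] lookup_add algebra_simps sum.distrib)
qed

lemma form_scl_left: "form par (scl c x) z = c * form par x z"
  using keys_scl_subset[of c x]
  by (simp add: form_superset[of "keys x"] lookup_scl sum_distrib_left mult.assoc)

lemma form_zero [simp]: "form par 0 x = 0" "form par x 0 = 0"
  using form_scl_left[of par 0 0] form_scl_right[of par x 0 0] by simp_all

lemma form_minus_left: "form par (- x) y = - form par x y"
  and form_minus_right: "form par y (- x) = - form par y x"
  using form_scl_left[of par "-1" x y] form_scl_right[of par y "-1" x] by (simp_all add: scl_minus_left)

lemma form_diff_left: "form par (x - y) z = form par x z - form par y z"
  and form_diff_right: "form par z (x - y) = form par z x - form par z y"
  using form_add_left[of par x "- y" z] form_add_right[of par z x "- y"]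
  by (simp_all add: form_minus_left form_minus_right)

lemma form_sum_left: "form par (sum h A) z = (\<Sum>a\<in>A. form par (h a) z)"
  and form_sum_right: "form par z (sum h A) = (\<Sum>a\<in>A. form par z (h a))"
  by (induction A rule: infinite_finite_induct) (auto simp: form_add_left form_add_right)

lemmas form_bilinear = form_add_left form_add_right form_scl_left form_scl_right form_minus_left
  form_minus_right form_diff_left form_diff_right form_sum_left form_sum_right

lemma form_bas: "form par (bas u) y = wform par u y"
  by (simp add: form_def lookup_single)

lemma form_mul: "form par (mul a x) y = form par x (der par a y)"
proof -
  have "form par (mul a (lin_ext bas x)) y = form par (lin_ext bas x) (der par a y)"
    unfolding lin_ext_def mul_linear form_bilinear
    by (simp add: form_scl_left form_bas mul_linear form_sum_left del: scl_simps(5))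
  then show ?thesis by simp
qed

lemma lookup_srel_Nil: "x \<approx>[srel par] y \<Longrightarrow> lkp x [] = lkp y []"
proof -
  assume "x \<approx>[srel par] y"
  then have "x - y \<in> srel par" by (simp add: cong_mod_def)
  then have "lkp (x - y) [] = 0"
  proof (induction rule: rat_free.span_induct_alt)
    case base then show ?case by simp
  next
    case (step c b z)
    then show ?case
      by (auto simp: srel_gen_def lookup_add lookup_scl lookup_minus lookup_single)
  qed
  then show ?thesis by (simp add: lookup_minus)
qed

lemma form_cong_right:
  assumes "x \<approx>[srel par] y" shows "form par z x = form par z y"
proof -
  have "wform par u x = wform par u y" for u
    using assms by (induction u arbitrary: x y) (auto simp: lookup_srel_Nil der_cong)
  then show ?thesis by (simp add: form_def)
qed

lemma wform_srel: "r \<in> srel_gen par \<Longrightarrow> form par r y = 0"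
proof -
  assume "r \<in> srel_gen par"
  then obtain u a b v where r: "r = bas (u @ [a, b] @ v) - scl (swap_sign par a b) (bas (u @ [b, a] @ v))"
    unfolding srel_gen_def by blast
  have "wform par (u @ [a, b] @ v) y = swap_sign par a b * wform par (u @ [b, a] @ v) y" for y
  proof (induction u arbitrary: y)
    case Nil
    show ?case
      using der_swap[of par b a y] by (simp add: wform_linear swap_sign_sym[of par b a])
  qed simp
  then show ?thesis
    unfolding r form_diff_left form_scl_left form_bas by simp
qed

lemma form_cong_left:
  assumes "x \<approx>[srel par] y" shows "form par x z = form par y z"
proof -
  have "x - y \<in> srel par" using assms by (simp add: cong_mod_def)
  then have "form par (x - y) z = 0"
    by (induction rule: rat_free.span_induct_alt) (auto simp: form_bilinear wform_srel)
  then show ?thesis by (simp add: form_diff_left)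
qed

lemma form_euler:
  assumes "finite A" and "\<And>w. w \<in> keys x \<Longrightarrow> length (filter (\<lambda>b. b \<in> A) w) = c"
  shows "of_nat c * form par x y = (\<Sum>a\<in>A. form par (der par a x) (der par a y))"
proof -
  have "of_nat c * form par x y = form par (scl (of_nat c) x) y" by (simp add: form_scl_left)
  also have "\<dots> = form par (\<Sum>a\<in>A. mul a (der par a x)) y"
    by (rule form_cong_left[symmetric], rule euler[OF assms])
  finally show ?thesis by (simp add: form_sum_left form_mul)
qed

lemma homogeneous_der:
  assumes "keys x \<subseteq> {w. set w \<subseteq> A \<and> length w = Suc N}"
  shows "keys (der par a x) \<subseteq> {w. set w \<subseteq> A \<and> length w = N}"
proof
  fix w assume "w \<in> keys (der par a x)"
  then obtain v where v: "v \<in> keys x" "mset v = add_mset a (mset w)" by (rule keys_der)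
  have "set v = insert a (set w)" "length v = Suc (length w)"
    using v(2) by (metis set_mset_mset set_mset_add_mset_insert, metis size_mset size_add_mset)
  with v(1) assms show "w \<in> {w. set w \<subseteq> A \<and> length w = N}" by auto
qed

lemma homogeneous_count:
  "keys x \<subseteq> {w. set w \<subseteq> A \<and> length w = N} \<Longrightarrow> w \<in> keys x \<Longrightarrow> length (filter (\<lambda>b. b \<in> A) w) = N"
  by (auto simp: subset_iff filter_id_conv)

lemma homogeneous_0:
  assumes "keys x \<subseteq> {w. set w \<subseteq> A \<and> length w = 0}"
  shows "\<exists>c. x = Poly_Mapping.single [] c"
proof
  show "x = Poly_Mapping.single [] (lkp x [])"
    using assms by (intro poly_mapping_eqI) (auto simp: lookup_single when_def in_keys_iff subset_iff)
qed

lemma form_single_Nil: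
  "form par (Poly_Mapping.single [] c) (Poly_Mapping.single [] d) = c * d"
  by (simp add: form_def)

lemma form_sym:
  assumes "finite A" "keys x \<subseteq> {w. set w \<subseteq> A \<and> length w = N}" "keys y \<subseteq> {w. set w \<subseteq> A \<and> length w = N}"
  shows "form par x y = form par y x"
  using assms(2,3)
proof (induction N arbitrary: x y)
  case 0
  from homogeneous_0[OF 0(1)] homogeneous_0[OF 0(2)]
  obtain c d where "x = Poly_Mapping.single [] c" "y = Poly_Mapping.single [] d" by blast
  then show ?case by (simp add: form_single_Nil)
next
  case (Suc N)
  have "of_nat (Suc N) * form par x y = (\<Sum>a\<in>A. form par (der par a x) (der par a y))"
    using homogeneous_count Suc.prems by (intro form_euler assms(1)) blast
  also have "\<dots> = (\<Sum>a\<in>A. form par (der par a y) (der par a x))"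
    by (intro sum.cong Suc.IH homogeneous_der Suc.prems refl)
  also have "\<dots> = of_nat (Suc N) * form par y x"
    using homogeneous_count Suc.prems by (intro form_euler[symmetric] assms(1)) blast
  finally show ?case by (simp del: of_nat_Suc)
qed

lemma form_nonneg:
  assumes "finite A" "keys x \<subseteq> {w. set w \<subseteq> A \<and> length w = N}"
  shows "form par x x \<ge> 0"
  using assms(2)
proof (induction N arbitrary: x)
  case 0
  from homogeneous_0[OF 0] obtain c where "x = Poly_Mapping.single [] c" by blast
  then show ?case by (simp add: form_single_Nil)
next
  case (Suc N)
  have "of_nat (Suc N) * form par x x = (\<Sum>a\<in>A. form par (der par a x) (der par a x))"
    using homogeneous_count Suc.prems by (intro form_euler assms(1)) blast
  also have "\<dots> \<ge> 0"
    by (intro sum_nonneg Suc.IH homogeneous_der Suc.prems)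
  finally show ?case by (simp add: zero_le_mult_iff)
qed

text \<open>
  If \<open>x\<close> has norm 0, so have all its derivatives by Euler's formula. They vanish by induction, and Euler's
  formula recovers \<open>x\<close> from them.
\<close>

lemma form_definite:
  assumes "finite A" "keys x \<subseteq> {w. set w \<subseteq> A \<and> length w = N}" "form par x x = 0"
  shows "x \<in> srel par"
  using assms(2,3)
proof (induction N arbitrary: x)
  case 0
  from homogeneous_0[OF 0(1)] obtain c where x: "x = Poly_Mapping.single [] c" by blast
  then have "c = 0" using 0 by (simp add: form_single_Nil)
  with x show ?case by (simp add: rat_free.span_zero)
next
  case (Suc N)
  note hom = homogeneous_der[OF Suc.prems(1)]
  have "(\<Sum>a\<in>A. form par (der par a x) (der par a x)) = of_nat (Suc N) * form par x x"
    using homogeneous_count Suc.prems by (intro form_euler[symmetric] assms(1)) blast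
  then have "\<forall>a\<in>A. form par (der par a x) (der par a x) = 0"
    using form_nonneg[OF assms(1) hom] Suc.prems(2) by (subst sum_nonneg_eq_0_iff[symmetric]) (auto simp: assms(1))
  then have "\<And>a. a \<in> A \<Longrightarrow> der par a x \<approx>[srel par] 0"
    using Suc.IH[OF hom] by (simp add: cong_mod_zero)
  then have "(\<Sum>a\<in>A. mul a (der par a x)) \<approx>[srel par] (\<Sum>a\<in>A. mul a 0)"
    by (intro cm_sum mul_cong)
  moreover have "(\<Sum>a\<in>A. mul a (der par a x)) \<approx>[srel par] scl (of_nat (Suc N)) x"
    using homogeneous_count Suc.prems by (intro euler assms(1)) blast
  ultimately have "scl (of_nat (Suc N)) x \<approx>[srel par] 0"
    using cm_sym cm_trans by (fastforce simp: mul_linear)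
  from cm_scl[OF this, of "1 / of_nat (Suc N)"] show ?case
    by (simp add: cong_mod_zero del: of_nat_Suc)
qed

lemma form_cauchy:
  assumes "finite A" "keys x \<subseteq> {w. set w \<subseteq> A \<and> length w = N}" "keys y \<subseteq> {w. set w \<subseteq> A \<and> length w = N}"
  shows "2 * form par x y \<le> form par x x + form par y y" "- 2 * form par x y \<le> form par x x + form par y y"
proof -
  have "form par (x - y) (x - y) \<ge> 0" "form par (x + y) (x + y) \<ge> 0"
    by (rule form_nonneg[OF assms(1)], rule keys_diff_subset[OF assms(2,3)],
        rule form_nonneg[OF assms(1)], rule keys_add_subset[OF assms(2,3)])
  then show "2 * form par x y \<le> form par x x + form par y y" "- 2 * form par x y \<le> form par x x + form par y y"
    using form_sym[OF assms] by (simp_all add: form_bilinear)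
qed

text \<open>
  Gram--Schmidt without normalisation; a spanning vector that becomes isotropic is congruent to 0
  by definiteness and can be dropped.
\<close>

lemma orthogonal_projection:
  assumes A: "finite A" and S: "finite S" and hS: "\<And>s. s \<in> S \<Longrightarrow> keys (u s) \<subseteq> {w. set w \<subseteq> A \<and> length w = N}"
    and hx: "keys x \<subseteq> {w. set w \<subseteq> A \<and> length w = N}"
  shows "\<exists>c. \<forall>t\<in>S. form par (x - (\<Sum>s\<in>S. scl (c s) (u s))) (u t) = 0"
  using S hS hx
proof (induction S arbitrary: x rule: finite_induct)
  case empty then show ?case by simp
next
  case (insert r S)
  let ?H = "{w. set w \<subseteq> A \<and> length w = N}"
  have hS: "keys (u s) \<subseteq> ?H" if "s \<in> S" for s
    using insert.prems(1) that by simp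
  have hr0: "keys (u r) \<subseteq> ?H"
    by (rule insert.prems(1)) simp
  have "\<exists>c. \<forall>t\<in>S. form par (x - (\<Sum>s\<in>S. scl (c s) (u s))) (u t) = 0"
    by (rule insert.IH[OF _ insert.prems(2)]) (rule hS)
  then obtain c where c: "\<forall>t\<in>S. form par (x - (\<Sum>s\<in>S. scl (c s) (u s))) (u t) = 0" ..
  have "\<exists>d. \<forall>t\<in>S. form par (u r - (\<Sum>s\<in>S. scl (d s) (u s))) (u t) = 0"
    by (rule insert.IH[OF _ hr0]) (rule hS)
  then obtain d where d: "\<forall>t\<in>S. form par (u r - (\<Sum>s\<in>S. scl (d s) (u s))) (u t) = 0" ..
  let ?x = "x - (\<Sum>s\<in>S. scl (c s) (u s))" and ?r = "u r - (\<Sum>s\<in>S. scl (d s) (u s))"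
  have hr: "keys ?r \<subseteq> ?H" and hx': "keys ?x \<subseteq> ?H"
    by (intro keys_diff_subset keys_sum_subset keys_scl hr0 hS; assumption)
      (intro keys_diff_subset keys_sum_subset keys_scl insert.prems(2) hS; assumption)
  define q where "q = form par ?x ?r / form par ?r ?r"
  define y where "y = ?x - scl q ?r"
  have form_y: "form par y z = form par ?x z - q * form par ?r z" for z
    unfolding y_def by (subst form_diff_left, subst form_scl_left, rule refl)
  have y_S: "form par y (u t) = 0" if "t \<in> S" for t
    by (simp only: form_y bspec[OF c that] bspec[OF d that] mult_zero_right diff_self)
  have "form par y ?r = 0"
  proof (cases "form par ?r ?r = 0")
    case True
    then have "?r \<approx>[srel par] 0" using form_definite[OF A hr] by (simp add: cong_mod_zero)
    then show ?thesis using form_cong_right by fastforce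
  next
    case False
    have "r \<noteq> 0 \<Longrightarrow> s - s / r * r = 0" for r s :: rat by simp
    from this[OF False] show ?thesis unfolding form_y q_def .
  qed
  moreover have "form par y (\<Sum>s\<in>S. scl (d s) (u s)) = 0"
    using y_S by (simp add: form_sum_right form_scl_right)
  ultimately have y_r: "form par y (u r) = 0"
    by (simp add: form_diff_right)
  define e where "e s = (if s = r then q else c s - q * d s)" for s
  have "(\<Sum>s\<in>insert r S. scl (e s) (u s)) = scl q (u r) + (\<Sum>s\<in>S. scl (c s) (u s) - scl (q * d s) (u s))"
    using insert.hyps by (auto simp: e_def scl_left_distrib scl_minus_left diff_conv_add_uminus
        simp del: add_uminus_conv_diff intro!: sum.cong)
  then have "x - (\<Sum>s\<in>insert r S. scl (e s) (u s)) = y"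
    by (simp add: y_def scl_diff scl_sum sum_subtractf)
  then show ?case using y_S y_r by (intro exI[of _ e]) auto
qed


section \<open>The Laplacian of the cutting operator\<close>

datatype tok = Edge nat nat | Decor letter nat

fun tpar :: "nat \<Rightarrow> tok \<Rightarrow> nat" where
  "tpar m (Edge i j) = 0"
| "tpar m (Decor x v) = ldeg m x"

abbreviation tA :: "nat \<Rightarrow> nat \<Rightarrow> tok" where "tA p i \<equiv> Decor (Alpha p) i"
abbreviation tB :: "nat \<Rightarrow> nat \<Rightarrow> tok" where "tB p i \<equiv> Decor (Beta p) i"

definition edge_toks :: "nat \<Rightarrow> tok set" where "edge_toks n = (\<lambda>(i, j). Edge i j) ` ({..<n} \<times> {..<n})"
definition alpha_toks :: "nat \<Rightarrow> nat \<Rightarrow> tok set" where "alpha_toks g n = (\<lambda>(p, i). tA p i) ` ({..<g} \<times> {..<n})"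
definition beta_toks :: "nat \<Rightarrow> nat \<Rightarrow> tok set" where "beta_toks g n = (\<lambda>(p, i). tB p i) ` ({..<g} \<times> {..<n})"
definition toks :: "nat \<Rightarrow> nat \<Rightarrow> tok set" where "toks g n = edge_toks n \<union> alpha_toks g n \<union> beta_toks g n"

lemma tok_mem [simp]:
  "Edge i j \<in> edge_toks n \<longleftrightarrow> i < n \<and> j < n" "Decor x v \<notin> edge_toks n"
  "tA p i \<in> alpha_toks g n \<longleftrightarrow> p < g \<and> i < n" "Edge i j \<notin> alpha_toks g n" "tB p i \<notin> alpha_toks g n"
  "tB p i \<in> beta_toks g n \<longleftrightarrow> p < g \<and> i < n" "Edge i j \<notin> beta_toks g n" "tA p i \<notin> beta_toks g n"
  "Edge i j \<in> toks g n \<longleftrightarrow> i < n \<and> j < n"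
  "Decor x v \<in> toks g n \<longleftrightarrow> index x < g \<and> v < n"
  by (cases x; auto simp: edge_toks_def alpha_toks_def beta_toks_def toks_def)+

lemma finite_toks [simp]: "finite (edge_toks n)" "finite (alpha_toks g n)" "finite (beta_toks g n)" "finite (toks g n)"
  by (auto simp: edge_toks_def alpha_toks_def beta_toks_def toks_def)

lemma sum_toks:
  "sum f (edge_toks n) = (\<Sum>i<n. \<Sum>j<n. f (Edge i j))"
  "sum f (alpha_toks g n) = (\<Sum>p<g. \<Sum>i<n. f (tA p i))"
  "sum f (beta_toks g n) = (\<Sum>p<g. \<Sum>i<n. f (tB p i))"
  unfolding edge_toks_def alpha_toks_def beta_toks_def
  by (subst sum.reindex, force simp: inj_on_def, simp add: sum.cartesian_product case_prod_unfold)+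

lemma swap_sign_tok [simp]:
  "swap_sign (tpar m) (Edge i j) t = 1" "swap_sign (tpar m) t (Edge i j) = 1"
  "swap_sign (tpar m) (tA p i) (tB q j) = 1" "swap_sign (tpar m) (tB q j) (tA p i) = 1"
  "swap_sign (tpar m) (tA p i) (tA q j) = (-1) ^ m" "swap_sign (tpar m) (tB p i) (tB q j) = - ((-1) ^ m)"
  by (simp_all add: swap_sign_def minus_one_power_iff)

abbreviation dE :: "nat \<Rightarrow> nat \<Rightarrow> nat \<Rightarrow> (tok list \<Rightarrow>\<^sub>0 rat) \<Rightarrow> tok list \<Rightarrow>\<^sub>0 rat" where
  "dE m i j \<equiv> der (tpar m) (Edge i j)"
abbreviation dA :: "nat \<Rightarrow> nat \<Rightarrow> nat \<Rightarrow> (tok list \<Rightarrow>\<^sub>0 rat) \<Rightarrow> tok list \<Rightarrow>\<^sub>0 rat" where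
  "dA m p i \<equiv> der (tpar m) (tA p i)"
abbreviation dB :: "nat \<Rightarrow> nat \<Rightarrow> nat \<Rightarrow> (tok list \<Rightarrow>\<^sub>0 rat) \<Rightarrow> tok list \<Rightarrow>\<^sub>0 rat" where
  "dB m p i \<equiv> der (tpar m) (tB p i)"

text \<open>
  The cutting operator is \<open>cut_op\<close> up to a nonzero factor on elements that are skew, that is, on
  combinations in which \<open>Edge i j\<close> and \<open>Edge j i\<close> enter as negatives of each other. On such elements
  its adjoint is \<open>join_op\<close>, which joins contracted pairs \<open>\<alpha>\<^sub>p, \<beta>\<^sub>p\<close> of decorations to edges.
\<close>

definition half_cut :: "nat \<Rightarrow> nat \<Rightarrow> nat \<Rightarrow> nat \<Rightarrow> (tok list \<Rightarrow>\<^sub>0 rat) \<Rightarrow> tok list \<Rightarrow>\<^sub>0 rat" where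
  "half_cut m n p i x = (\<Sum>j<n. mul (tB p j) (dE m i j x))"

definition cut_op :: "nat \<Rightarrow> nat \<Rightarrow> nat \<Rightarrow> (tok list \<Rightarrow>\<^sub>0 rat) \<Rightarrow> tok list \<Rightarrow>\<^sub>0 rat" where
  "cut_op m g n x = (\<Sum>i<n. \<Sum>p<g. mul (tA p i) (half_cut m n p i x))"

definition contract_pairs :: "nat \<Rightarrow> nat \<Rightarrow> nat \<Rightarrow> nat \<Rightarrow> (tok list \<Rightarrow>\<^sub>0 rat) \<Rightarrow> tok list \<Rightarrow>\<^sub>0 rat" where
  "contract_pairs m g i j x = (\<Sum>p<g. dB m p j (dA m p i x))"

definition join_op :: "nat \<Rightarrow> nat \<Rightarrow> nat \<Rightarrow> (tok list \<Rightarrow>\<^sub>0 rat) \<Rightarrow> tok list \<Rightarrow>\<^sub>0 rat" where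
  "join_op m g n x = scl (1/2) (\<Sum>i<n. \<Sum>j<n. mul (Edge i j) (contract_pairs m g i j x - contract_pairs m g j i x))"

definition skew :: "nat \<Rightarrow> nat \<Rightarrow> (tok list \<Rightarrow>\<^sub>0 rat) \<Rightarrow> bool" where
  "skew m n x \<longleftrightarrow> (\<forall>i<n. \<forall>j<n. dE m j i x \<approx>[srel (tpar m)] - dE m i j x)"

lemma dE_commute [simp]:
  "dA m p k (dE m i j x) = dE m i j (dA m p k x)" "dB m p k (dE m i j x) = dE m i j (dB m p k x)"
  using der_swap[of "tpar m" "tA p k" "Edge i j" x] der_swap[of "tpar m" "tB p k" "Edge i j" x] by simp_all

lemma dE_dE: "dE m i j (dE m k l x) = dE m k l (dE m i j x)"
  using der_swap[of "tpar m" "Edge i j" "Edge k l" x] by simp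

lemma half_cut_linear: "half_cut m n p i (x + y) = half_cut m n p i x + half_cut m n p i y"
    "half_cut m n p i (scl c x) = scl c (half_cut m n p i x)"
    "half_cut m n p i (sum h A) = (\<Sum>a\<in>A. half_cut m n p i (h a))"
    "half_cut m n p i (x - y) = half_cut m n p i x - half_cut m n p i y"
    "half_cut m n p i 0 = 0"
proof -
  show add: "half_cut m n p i (x + y) = half_cut m n p i x + half_cut m n p i y" for x y
    by (simp add: half_cut_def der_linear mul_linear sum.distrib)
  show scl: "half_cut m n p i (scl c x) = scl c (half_cut m n p i x)" for c x
    by (simp add: half_cut_def der_linear mul_linear scl_sum)
  show zero: "half_cut m n p i 0 = 0" by (simp add: half_cut_def der_linear mul_linear)
  show "half_cut m n p i (sum h A) = (\<Sum>a\<in>A. half_cut m n p i (h a))"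
    by (induction A rule: infinite_finite_induct) (simp_all add: add zero)
  show "half_cut m n p i (x - y) = half_cut m n p i x - half_cut m n p i y"
    by (simp add: half_cut_def der_linear mul_linear sum_subtractf)
qed

lemma cut_op_linear: "cut_op m g n (x + y) = cut_op m g n x + cut_op m g n y"
    "cut_op m g n (scl c x) = scl c (cut_op m g n x)"
    "cut_op m g n (sum h A) = (\<Sum>a\<in>A. cut_op m g n (h a))"
    "cut_op m g n (x - y) = cut_op m g n x - cut_op m g n y"
    "cut_op m g n 0 = 0"
proof -
  show add: "cut_op m g n (x + y) = cut_op m g n x + cut_op m g n y" for x y
    by (simp add: cut_op_def half_cut_linear mul_linear sum.distrib)
  show scl: "cut_op m g n (scl c x) = scl c (cut_op m g n x)" for c x
    by (simp add: cut_op_def half_cut_linear mul_linear scl_sum)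
  show zero: "cut_op m g n 0 = 0" by (simp add: cut_op_def half_cut_linear mul_linear)
  show "cut_op m g n (sum h A) = (\<Sum>a\<in>A. cut_op m g n (h a))"
    by (induction A rule: infinite_finite_induct) (simp_all add: add zero)
  show "cut_op m g n (x - y) = cut_op m g n x - cut_op m g n y"
    by (simp add: cut_op_def half_cut_linear mul_linear sum_subtractf)
qed

lemma contract_pairs_linear: "contract_pairs m g i j (x - y) = contract_pairs m g i j x - contract_pairs m g i j y"
    "contract_pairs m g i j (- x) = - contract_pairs m g i j x"
  by (simp_all add: contract_pairs_def der_linear sum_subtractf sum_negf)

lemma contract_pairs_cong: "x \<approx>[srel (tpar m)] y \<Longrightarrow> contract_pairs m g i j x \<approx>[srel (tpar m)] contract_pairs m g i j y"
  unfolding contract_pairs_def by (intro cm_sum der_cong)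

lemma contract_pairs_dE: "contract_pairs m g k l (dE m i j x) = dE m i j (contract_pairs m g k l x)"
  by (simp add: contract_pairs_def der_linear)

lemma dA_half_cut: "dA m p i (half_cut m n q k x) = half_cut m n q k (dA m p i x)"
  by (simp add: half_cut_def der_linear der_mul)

lemma dA_cut_op:
  assumes "i < n" "p < g"
  shows "dA m p i (cut_op m g n x) = half_cut m n p i x + scl ((-1) ^ m) (cut_op m g n (dA m p i x))"
proof -
  have "dA m p i (cut_op m g n x)
     = (\<Sum>k<n. \<Sum>q<g. if i = k then (if p = q then half_cut m n q k x else 0) else 0)
       + (\<Sum>k<n. \<Sum>q<g. scl ((-1) ^ m) (mul (tA q k) (half_cut m n q k (dA m p i x))))"
    by (auto simp: cut_op_def der_linear der_mul dA_half_cut sum.distrib intro!: arg_cong2[of _ _ _ _ "(+)"] sum.cong)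
  also have "(\<Sum>k<n. \<Sum>q<g. if i = k then (if p = q then half_cut m n q k x else 0) else 0)
     = (\<Sum>k<n. if i = k then (\<Sum>q<g. if p = q then half_cut m n q k x else 0) else 0)"
    by (intro sum.cong) auto
  also have "\<dots> = half_cut m n p i x" using assms by simp
  finally show ?thesis by (simp add: cut_op_def scl_sum)
qed

lemma dB_half_cut:
  assumes "j < n"
  shows "dB m p j (half_cut m n q k x)
    = (if p = q then dE m k j x else 0) - scl ((-1) ^ m) (half_cut m n q k (dB m p j x))"
proof -
  have "dB m p j (half_cut m n q k x)
     = (\<Sum>l<n. (if j = l then (if p = q then dE m k l x else 0) else 0)
         - scl ((-1) ^ m) (mul (tB q l) (dE m k l (dB m p j x))))"
    unfolding half_cut_def der_linear by (intro sum.cong refl) (auto simp: der_mul scl_minus_left)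
  then show ?thesis using assms by (simp add: half_cut_def scl_sum sum_subtractf)
qed

lemma dB_cut_op:
  assumes "j < n" "p < g"
  shows "dB m p j (cut_op m g n x) = (\<Sum>k<n. mul (tA p k) (dE m k j x)) - scl ((-1) ^ m) (cut_op m g n (dB m p j x))"
proof -
  have "dB m p j (cut_op m g n x)
     = (\<Sum>k<n. \<Sum>q<g. (if p = q then mul (tA q k) (dE m k j x) else 0)
          - scl ((-1) ^ m) (mul (tA q k) (half_cut m n q k (dB m p j x))))"
    using assms by (auto simp: cut_op_def der_linear der_mul dB_half_cut mul_linear intro!: sum.cong)
  also have "\<dots> = (\<Sum>k<n. \<Sum>q<g. if p = q then mul (tA q k) (dE m k j x) else 0)
      - scl ((-1) ^ m) (cut_op m g n (dB m p j x))"
    by (simp add: cut_op_def scl_sum sum_subtractf)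
  finally show ?thesis using assms by simp
qed

text \<open>
  Both derivations hit the inserted pair, or only one does, or none. Only the first term
  accumulates when summed over \<open>p\<close>.
\<close>

lemma dB_dA_cut_op:
  assumes "i < n" "j < n" "p < g"
  shows "dB m p j (dA m p i (cut_op m g n x))
    = dE m i j x - scl ((-1) ^ m) (half_cut m n p i (dB m p j x))
      + scl ((-1) ^ m) (\<Sum>k<n. mul (tA p k) (dE m k j (dA m p i x)))
      - cut_op m g n (dB m p j (dA m p i x))"
  using assms by (simp add: dA_cut_op dB_cut_op dB_half_cut der_linear scl_diff flip: power_add mult_2)


subsection \<open>The estimate\<close>

text \<open>
  The home of the \<open>k\<close>-fold derivatives of words of length \<open>N\<close>. For \<open>k > N\<close> it is empty, whereas the length
  \<open>N - k\<close> would allow the empty word.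
\<close>

definition hwords :: "'t set \<Rightarrow> nat \<Rightarrow> nat \<Rightarrow> 't list set" where
  "hwords A N k = {w. set w \<subseteq> A \<and> length w + k = N}"

lemma hwords_empty: "N < k \<Longrightarrow> hwords A N k = {}"
  by (auto simp: hwords_def)

lemma hwords_alt: "k \<le> N \<Longrightarrow> hwords A N k = {w. set w \<subseteq> A \<and> length w = N - k}"
  by (auto simp: hwords_def)

lemma hw_der: "keys x \<subseteq> hwords A N k \<Longrightarrow> keys (der par a x) \<subseteq> hwords A N (Suc k)"
proof
  fix w assume "keys x \<subseteq> hwords A N k" "w \<in> keys (der par a x)"
  then obtain v where "v \<in> hwords A N k" "mset v = add_mset a (mset w)" by (meson keys_der subsetD)
  moreover from this have "set v = insert a (set w)" "length v = Suc (length w)"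
    by (metis set_mset_mset set_mset_add_mset_insert, metis size_mset size_add_mset)
  ultimately show "w \<in> hwords A N (Suc k)" by (simp add: hwords_def)
qed

lemma hw_mul:
  assumes "a \<in> A" "keys x \<subseteq> hwords A N (Suc k)" shows "keys (mul a x) \<subseteq> hwords A N k"
proof -
  have "(#) a ` hwords A N (Suc k) \<subseteq> hwords A N k" using assms(1) by (auto simp: hwords_def)
  with keys_mul[OF assms(2), of a] show ?thesis by (rule subset_trans)
qed

lemma hw_sym:
  assumes "finite A" "keys x \<subseteq> hwords A N k" "keys y \<subseteq> hwords A N k"
  shows "form par x y = form par y x"
proof (cases "k \<le> N")
  case True show ?thesis using assms unfolding hwords_alt[OF True] by (rule form_sym)
next
  case False then have "x = 0" "y = 0" using assms(2,3) by (auto simp: hwords_empty)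
  then show ?thesis by simp
qed

lemma hw_nonneg:
  assumes "finite A" "keys x \<subseteq> hwords A N k" shows "form par x x \<ge> 0"
proof (cases "k \<le> N")
  case True show ?thesis using assms unfolding hwords_alt[OF True] by (rule form_nonneg)
next
  case False then have "x = 0" using assms(2) by (auto simp: hwords_empty)
  then show ?thesis by simp
qed

lemma hw_cauchy:
  assumes "finite A" "keys x \<subseteq> hwords A N k" "keys y \<subseteq> hwords A N k" "c = 1 \<or> c = -1"
  shows "- (form par x x + form par y y) / 2 \<le> c * form par x y"
proof (cases "k \<le> N")
  case True
  have "2 * form par x y \<le> form par x x + form par y y" "- 2 * form par x y \<le> form par x x + form par y y"
    using assms(1-3) unfolding hwords_alt[OF True] by (rule form_cauchy)+
  then show ?thesis using assms(4) by auto
next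
  case False then have "x = 0" "y = 0" using assms(2,3) by (auto simp: hwords_empty)
  then show ?thesis by simp
qed

lemma hw_adj:
  assumes "finite A" "a \<in> A" "keys y \<subseteq> hwords A N k" "keys z \<subseteq> hwords A N (Suc k)"
  shows "form par y (mul a z) = form par (der par a y) z"
  using hw_sym[OF assms(1) assms(3) hw_mul[OF assms(2,4)]]
    hw_sym[OF assms(1) hw_der[OF assms(3)] assms(4)] by (simp add: form_mul)

lemma hw_contract_pairs: "keys x \<subseteq> hwords A N k \<Longrightarrow> keys (contract_pairs m g i j x) \<subseteq> hwords A N (Suc (Suc k))"
  unfolding contract_pairs_def by (intro keys_sum_subset hw_der)

lemma count_der:
  assumes "w \<in> keys (der par t x)" "\<And>w. w \<in> keys x \<Longrightarrow> length (filter P w) = c" "\<not> P t"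
  shows "length (filter P w) = c"
proof -
  obtain v where v: "v \<in> keys x" "mset v = add_mset t (mset w)" using assms(1) by (rule keys_der)
  have "mset (filter P v) = mset (filter P w)" using v(2) assms(3) by simp
  then have "length (filter P v) = length (filter P w)" by (metis size_mset)
  then show ?thesis using assms(2) v(1) by simp
qed

lemma sum4_neg_half:
  fixes F G :: "_ \<Rightarrow> _ \<Rightarrow> _ \<Rightarrow> _ \<Rightarrow> rat"
  shows "(\<Sum>i\<in>A. \<Sum>p\<in>B. \<Sum>j\<in>C. \<Sum>l\<in>D. - (F i p j l + G i p j l) / 2)
    = - ((\<Sum>i\<in>A. \<Sum>p\<in>B. \<Sum>j\<in>C. \<Sum>l\<in>D. F i p j l) + (\<Sum>i\<in>A. \<Sum>p\<in>B. \<Sum>j\<in>C. \<Sum>l\<in>D. G i p j l)) / 2"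
  by (simp only: sum_divide_distrib[symmetric] sum_negf sum.distrib)

text \<open>
  Commuting \<open>\<partial>/\<partial>\<beta>\<^sub>p\<^sub>j \<partial>/\<partial>\<alpha>\<^sub>p\<^sub>i\<close> past \<open>cut_op\<close> gives \<open>g e |x|\<^sup>2\<close> from the full contractions, summed over \<open>p\<close>.
  A partial contraction with \<open>\<beta>\<close> pairs the family of the \<open>\<partial>/\<partial>\<beta>\<^sub>p\<^sub>l \<partial>x/\<partial>(Edge i j)\<close> with the same family after
  exchanging \<open>j\<close> and \<open>l\<close>, up to a sign. The squared norm of this family is \<open>b e |x|\<^sup>2\<close>, so by
  Cauchy--Schwarz the contribution is at least \<open>- b e |x|\<^sup>2\<close>; those with \<open>\<alpha>\<close> likewise contribute at least
  \<open>- a e |x|\<^sup>2\<close>. The uncontracted part is \<open>- Z\<close>, and \<open>|join_op x|\<^sup>2\<close> is \<open>Z\<close> plus a sum of squares.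
\<close>

lemma laplacian_bound:
  fixes x :: "tok list \<Rightarrow>\<^sub>0 rat"
  assumes hx: "\<And>w. w \<in> keys x \<Longrightarrow> set w \<subseteq> toks g n \<and> length w = N \<and>
      length (filter (\<lambda>t. t \<in> edge_toks n) w) = e \<and> length (filter (\<lambda>t. t \<in> alpha_toks g n) w) = a
      \<and> length (filter (\<lambda>t. t \<in> beta_toks g n) w) = b"
    and sk: "skew m n x"
  shows "(of_nat g - of_nat a - of_nat b) * of_nat e * form (tpar m) x x
     \<le> form (tpar m) (cut_op m g n x) (cut_op m g n x) + form (tpar m) (join_op m g n x) (join_op m g n x)"
proof -
  let ?f = "form (tpar m)" and ?T = "toks g n" and ?s = "(-1) ^ m :: rat"
  have fin: "finite ?T" by simp
  have s: "?s = 1 \<or> ?s = -1" "- ?s = 1 \<or> - ?s = -1" by (auto simp: minus_one_power_iff)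
  have hx0: "keys x \<subseteq> hwords ?T N 0" using hx by (auto simp: hwords_def)
  define y where "y i j = dE m i j x" for i j
  have hy: "keys (y i j) \<subseteq> hwords ?T N (Suc 0)" for i j
    using hw_der[OF hx0] by (simp add: y_def)
  have hyd: "keys (der (tpar m) t (y i j)) \<subseteq> hwords ?T N (Suc (Suc 0))" for i j t
    by (rule hw_der[OF hy])
  define u where "u k l i j = dE m k l (contract_pairs m g i j x)" for k l i j
  have hu: "keys (u k l i j) \<subseteq> hwords ?T N (Suc (Suc (Suc 0)))" for k l i j
    unfolding u_def by (rule hw_der[OF hw_contract_pairs[OF hx0]])
  define Z where "Z = (\<Sum>i<n. \<Sum>j<n. \<Sum>k<n. \<Sum>l<n. ?f (u k l i j) (u i j k l))"

  have norm_y: "(\<Sum>i<n. \<Sum>j<n. ?f (y i j) (y i j)) = of_nat e * ?f x x"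
    unfolding y_def using form_euler[of "edge_toks n" x e "tpar m" x] hx by (simp add: sum_toks)
  have norm_B: "(\<Sum>p<g. \<Sum>l<n. ?f (dB m p l (y i j)) (dB m p l (y i j))) = of_nat b * ?f (y i j) (y i j)" for i j
    using form_euler[of "beta_toks g n" "y i j" b "tpar m" "y i j"]
      count_der[of _ "tpar m" "Edge i j" x "\<lambda>t. t \<in> beta_toks g n" b] hx by (simp add: sum_toks y_def)
  have norm_A: "(\<Sum>p<g. \<Sum>l<n. ?f (dA m p l (y i j)) (dA m p l (y i j))) = of_nat a * ?f (y i j) (y i j)" for i j
    using form_euler[of "alpha_toks g n" "y i j" a "tpar m" "y i j"]
      count_der[of _ "tpar m" "Edge i j" x "\<lambda>t. t \<in> alpha_toks g n" a] hx by (simp add: sum_toks y_def)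

  \<comment> \<open>the exchanges of an edge end with a decoration \<open>\<beta>\<close>\<close>
  define TB where "TB = (\<Sum>i<n. \<Sum>p<g. \<Sum>j<n. ?f (y i j) (half_cut m n p i (dB m p j x)))"
  have "?f (y i j) (half_cut m n p i (dB m p j x)) = (\<Sum>l<n. ?f (dB m p l (y i j)) (dB m p j (y i l)))"
    if "p < g" for i j p
  proof -
    have "?f (y i j) (mul (tB p l) (dE m i l (dB m p j x))) = ?f (dB m p l (y i j)) (dB m p j (y i l))"
      if "l < n" for l
    proof -
      have "?f (y i j) (mul (tB p l) (dB m p j (y i l))) = ?f (dB m p l (y i j)) (dB m p j (y i l))"
        using that \<open>p < g\<close> by (intro hw_adj[OF fin _ hy hyd]) simp
      then show ?thesis by (simp add: y_def)
    qed
    then show ?thesis by (simp add: half_cut_def form_sum_right)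
  qed
  then have TB: "- ?s * TB = (\<Sum>i<n. \<Sum>p<g. \<Sum>j<n. \<Sum>l<n. - ?s * ?f (dB m p l (y i j)) (dB m p j (y i l)))"
    by (simp add: TB_def sum_distrib_left)
  define TBn where "TBn = (\<Sum>i<n. \<Sum>p<g. \<Sum>j<n. \<Sum>l<n. ?f (dB m p l (y i j)) (dB m p l (y i j)))"
  have "TBn = (\<Sum>i<n. \<Sum>p<g. \<Sum>j<n. \<Sum>l<n. ?f (dB m p j (y i l)) (dB m p j (y i l)))"
    unfolding TBn_def by (intro sum.cong refl sum.swap)
  then have "- TBn = (\<Sum>i<n. \<Sum>p<g. \<Sum>j<n. \<Sum>l<n.
      - (?f (dB m p l (y i j)) (dB m p l (y i j)) + ?f (dB m p j (y i l)) (dB m p j (y i l))) / 2)"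
    unfolding sum4_neg_half TBn_def[symmetric] by simp
  also have "\<dots> \<le> - ?s * TB"
    unfolding TB by (intro sum_mono hw_cauchy[OF fin hyd hyd s(2)])
  finally have TB_ge: "- TBn \<le> - ?s * TB" .
  have "TBn = (\<Sum>i<n. \<Sum>j<n. \<Sum>p<g. \<Sum>l<n. ?f (dB m p l (y i j)) (dB m p l (y i j)))"
    unfolding TBn_def by (intro sum.cong refl sum.swap)
  then have TBn: "TBn = of_nat b * (of_nat e * ?f x x)"
    by (simp add: norm_B norm_y flip: sum_distrib_left)

  \<comment> \<open>the exchanges of an edge end with a decoration \<open>\<alpha>\<close>\<close>
  define TA where "TA = (\<Sum>i<n. \<Sum>p<g. \<Sum>j<n. ?f (y i j) (\<Sum>k<n. mul (tA p k) (dE m k j (dA m p i x))))"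
  have "?f (y i j) (\<Sum>k<n. mul (tA p k) (dE m k j (dA m p i x))) = (\<Sum>k<n. ?f (dA m p k (y i j)) (dA m p i (y k j)))"
    if "p < g" for i j p
  proof -
    have "?f (y i j) (mul (tA p k) (dE m k j (dA m p i x))) = ?f (dA m p k (y i j)) (dA m p i (y k j))"
      if "k < n" for k
    proof -
      have "?f (y i j) (mul (tA p k) (dA m p i (y k j))) = ?f (dA m p k (y i j)) (dA m p i (y k j))"
        using that \<open>p < g\<close> by (intro hw_adj[OF fin _ hy hyd]) simp
      then show ?thesis by (simp add: y_def)
    qed
    then show ?thesis by (simp add: form_sum_right)
  qed
  then have TA: "?s * TA = (\<Sum>i<n. \<Sum>p<g. \<Sum>j<n. \<Sum>k<n. ?s * ?f (dA m p k (y i j)) (dA m p i (y k j)))"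
    by (simp add: TA_def sum_distrib_left)
  define TAn where "TAn = (\<Sum>i<n. \<Sum>p<g. \<Sum>j<n. \<Sum>k<n. ?f (dA m p k (y i j)) (dA m p k (y i j)))"
  have "TAn = (\<Sum>p<g. \<Sum>i<n. \<Sum>k<n. \<Sum>j<n. ?f (dA m p k (y i j)) (dA m p k (y i j)))"
    unfolding TAn_def by (subst sum.swap) (intro sum.cong refl sum.swap)
  also have "\<dots> = (\<Sum>p<g. \<Sum>i<n. \<Sum>k<n. \<Sum>j<n. ?f (dA m p i (y k j)) (dA m p i (y k j)))"
    by (intro sum.cong refl sum.swap)
  also have "\<dots> = (\<Sum>i<n. \<Sum>p<g. \<Sum>j<n. \<Sum>k<n. ?f (dA m p i (y k j)) (dA m p i (y k j)))"
    by (subst sum.swap) (intro sum.cong refl sum.swap)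
  finally have "- TAn = (\<Sum>i<n. \<Sum>p<g. \<Sum>j<n. \<Sum>k<n.
      - (?f (dA m p k (y i j)) (dA m p k (y i j)) + ?f (dA m p i (y k j)) (dA m p i (y k j))) / 2)"
    unfolding sum4_neg_half TAn_def[symmetric] by simp
  also have "\<dots> \<le> ?s * TA"
    unfolding TA by (intro sum_mono hw_cauchy[OF fin hyd hyd s(1)])
  finally have TA_ge: "- TAn \<le> ?s * TA" .
  have "TAn = (\<Sum>i<n. \<Sum>j<n. \<Sum>p<g. \<Sum>k<n. ?f (dA m p k (y i j)) (dA m p k (y i j)))"
    unfolding TAn_def by (intro sum.cong refl sum.swap)
  then have TAn: "TAn = of_nat a * (of_nat e * ?f x x)"
    by (simp add: norm_A norm_y flip: sum_distrib_left)

  \<comment> \<open>the uncontracted part\<close>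
  have D_right: "?f (y i j) (cut_op m g n (contract_pairs m g i j x)) = (\<Sum>k<n. \<Sum>l<n. ?f (u i j k l) (u k l i j))" for i j
  proof -
    have eq: "?f (y i j) (mul (tA q k) (mul (tB q l) (u k l i j))) = ?f (dB m q l (dA m q k (y i j))) (u k l i j)"
      if "k < n" "l < n" "q < g" for k l q
    proof -
      have "keys (mul (tB q l) (u k l i j)) \<subseteq> hwords ?T N (Suc (Suc 0))"
        using that by (intro hw_mul hu) simp
      then have "?f (y i j) (mul (tA q k) (mul (tB q l) (u k l i j))) = ?f (dA m q k (y i j)) (mul (tB q l) (u k l i j))"
        using that by (intro hw_adj[OF fin _ hy]) simp_all
      also have "\<dots> = ?f (dB m q l (dA m q k (y i j))) (u k l i j)"
        using that by (intro hw_adj[OF fin _ hyd hu]) simp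
      finally show ?thesis .
    qed
    have "?f (y i j) (cut_op m g n (contract_pairs m g i j x))
       = (\<Sum>k<n. \<Sum>q<g. \<Sum>l<n. ?f (dB m q l (dA m q k (y i j))) (u k l i j))"
      by (simp add: cut_op_def half_cut_def form_sum_right mul_linear u_def[symmetric] eq)
    also have "\<dots> = (\<Sum>k<n. \<Sum>l<n. \<Sum>q<g. ?f (dB m q l (dA m q k (y i j))) (u k l i j))"
      by (intro sum.cong refl sum.swap)
    also have "\<dots> = (\<Sum>k<n. \<Sum>l<n. ?f (contract_pairs m g k l (y i j)) (u k l i j))"
      by (simp add: contract_pairs_def form_sum_left)
    finally show ?thesis by (simp add: y_def contract_pairs_dE u_def)
  qed
  have TD: "(\<Sum>i<n. \<Sum>p<g. \<Sum>j<n. ?f (y i j) (cut_op m g n (dB m p j (dA m p i x)))) = Z"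
  proof -
    have "(\<Sum>i<n. \<Sum>p<g. \<Sum>j<n. ?f (y i j) (cut_op m g n (dB m p j (dA m p i x))))
       = (\<Sum>i<n. \<Sum>j<n. \<Sum>p<g. ?f (y i j) (cut_op m g n (dB m p j (dA m p i x))))"
      by (intro sum.cong refl sum.swap)
    also have "\<dots> = (\<Sum>i<n. \<Sum>j<n. ?f (y i j) (cut_op m g n (contract_pairs m g i j x)))"
      by (simp add: contract_pairs_def cut_op_linear form_sum_right)
    also have "\<dots> = Z"
      unfolding D_right Z_def using hw_sym[OF fin hu hu] by simp
    finally show ?thesis .
  qed

  have norm_D: "?f (cut_op m g n x) (cut_op m g n x) = of_nat g * (of_nat e * ?f x x) - ?s * TB + ?s * TA - Z"
  proof -
    have "?f (cut_op m g n x) (cut_op m g n x)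
       = (\<Sum>i<n. \<Sum>p<g. \<Sum>j<n. ?f (y i j) (dB m p j (dA m p i (cut_op m g n x))))"
      by (subst (1) cut_op_def) (simp add: half_cut_def form_sum_left form_mul y_def)
    also have "\<dots> = (\<Sum>i<n. \<Sum>p<g. \<Sum>j<n. ?f (y i j) (y i j)
        - ?s * ?f (y i j) (half_cut m n p i (dB m p j x))
        + ?s * ?f (y i j) (\<Sum>k<n. mul (tA p k) (dE m k j (dA m p i x)))
        - ?f (y i j) (cut_op m g n (dB m p j (dA m p i x))))"
      by (intro sum.cong refl)
        (simp add: dB_dA_cut_op form_add_right form_diff_right form_scl_right y_def)
    also have "\<dots> = (\<Sum>i<n. \<Sum>p<g. \<Sum>j<n. ?f (y i j) (y i j)) - ?s * TB + ?s * TA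
        - (\<Sum>i<n. \<Sum>p<g. \<Sum>j<n. ?f (y i j) (cut_op m g n (dB m p j (dA m p i x))))"
      by (simp add: sum.distrib sum_subtractf sum_distrib_left TB_def TA_def)
    also have "(\<Sum>i<n. \<Sum>p<g. \<Sum>j<n. ?f (y i j) (y i j)) = of_nat g * (\<Sum>i<n. \<Sum>j<n. ?f (y i j) (y i j))"
      by (simp add: sum_distrib_left)
    finally show ?thesis by (simp add: norm_y TD)
  qed

  \<comment> \<open>the norm of the adjoint: as \<open>x\<close> is skew, the four products into which the pairings of the
    antisymmetrised contractions \<open>A i j\<close> expand all contribute \<open>Z\<close>\<close>
  define A where "A i j = contract_pairs m g i j x - contract_pairs m g j i x" for i j
  have hA: "keys (A i j) \<subseteq> hwords ?T N (Suc (Suc 0))" for i j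
    unfolding A_def by (intro keys_diff_subset hw_contract_pairs hx0)
  have dE_A: "dE m k l (A i j) = u k l i j - u k l j i" for k l i j
    by (simp add: A_def u_def der_linear)
  have hdA: "keys (dE m k l (A i j)) \<subseteq> hwords ?T N (Suc (Suc (Suc 0)))" for k l i j
    by (rule hw_der[OF hA])
  have u_skew: "u l k i j \<approx>[srel (tpar m)] - u k l i j" if "k < n" "l < n" for k l i j
    using contract_pairs_cong[of "dE m l k x" m "- dE m k l x" g i j] sk that
    by (simp add: skew_def u_def contract_pairs_dE contract_pairs_linear)
  have dE_H: "dE m i j (join_op m g n x) = scl (1/2) (A i j) + scl (1/2) (\<Sum>k<n. \<Sum>l<n. mul (Edge k l) (dE m i j (A k l)))"
    if "i < n" "j < n" for i j
  proof -
    have "dE m i j (\<Sum>k<n. \<Sum>l<n. mul (Edge k l) (A k l))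
      = (\<Sum>k<n. \<Sum>l<n. if i = k then (if j = l then A k l else 0) else 0)
         + (\<Sum>k<n. \<Sum>l<n. mul (Edge k l) (dE m i j (A k l)))"
      by (auto simp: der_linear der_mul sum.distrib intro!: arg_cong2[of _ _ _ _ "(+)"] sum.cong)
    also have "(\<Sum>k<n. \<Sum>l<n. if i = k then (if j = l then A k l else 0) else 0)
      = (\<Sum>k<n. if i = k then (\<Sum>l<n. if j = l then A k l else 0) else 0)"
      by (intro sum.cong) auto
    finally show ?thesis
      using that by (simp add: join_op_def A_def[symmetric] der_linear(4) scl_add)
  qed
  have "?f (join_op m g n x) (join_op m g n x) = 1/2 * (\<Sum>i<n. \<Sum>j<n. ?f (A i j) (dE m i j (join_op m g n x)))"
    by (subst (1) join_op_def) (simp add: form_scl_left form_sum_left form_mul A_def)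
  also have "(\<Sum>i<n. \<Sum>j<n. ?f (A i j) (dE m i j (join_op m g n x)))
      = (\<Sum>i<n. \<Sum>j<n. 1/2 * ?f (A i j) (A i j)
         + 1/2 * (\<Sum>k<n. \<Sum>l<n. ?f (dE m k l (A i j)) (dE m i j (A k l))))"
  proof (intro sum.cong refl)
    fix i j assume ij: "i \<in> {..<n}" "j \<in> {..<n}"
    have "?f (A i j) (mul (Edge k l) (dE m i j (A k l))) = ?f (dE m k l (A i j)) (dE m i j (A k l))"
      if "k < n" "l < n" for k l
      using that by (intro hw_adj[OF fin _ hA hdA]) simp
    then show "?f (A i j) (dE m i j (join_op m g n x)) = 1/2 * ?f (A i j) (A i j)
         + 1/2 * (\<Sum>k<n. \<Sum>l<n. ?f (dE m k l (A i j)) (dE m i j (A k l)))"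
      using ij by (simp add: dE_H form_add_right form_scl_right form_sum_right)
  qed
  also have "1/2 * \<dots> = 1/4 * (\<Sum>i<n. \<Sum>j<n. ?f (A i j) (A i j))
      + 1/4 * (\<Sum>i<n. \<Sum>j<n. \<Sum>k<n. \<Sum>l<n. ?f (dE m k l (A i j)) (dE m i j (A k l)))"
    by (simp add: sum.distrib flip: sum_distrib_left sum_divide_distrib)
  also have "(\<Sum>i<n. \<Sum>j<n. \<Sum>k<n. \<Sum>l<n. ?f (dE m k l (A i j)) (dE m i j (A k l))) = 4 * Z"
  proof -
    have neg: "?f (u l k i j) z = - ?f (u k l i j) z" "?f z (u l k i j) = - ?f z (u k l i j)"
      if "k < n" "l < n" for k l i j z
      using form_cong_left[OF u_skew[OF that]] form_cong_right[OF u_skew[OF that]]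
      by (simp_all add: form_bilinear)
    have Z2: "(\<Sum>i<n. \<Sum>j<n. \<Sum>k<n. \<Sum>l<n. ?f (u k l j i) (u i j k l)) = - Z"
    proof -
      have "(\<Sum>i<n. \<Sum>j<n. \<Sum>k<n. \<Sum>l<n. ?f (u k l j i) (u i j k l))
         = (\<Sum>i<n. \<Sum>j<n. \<Sum>k<n. \<Sum>l<n. ?f (u k l i j) (u j i k l))"
        by (rule sum.swap)
      also have "\<dots> = (\<Sum>i<n. \<Sum>j<n. \<Sum>k<n. \<Sum>l<n. - ?f (u k l i j) (u i j k l))"
        by (intro sum.cong refl neg(2)) auto
      finally show ?thesis by (simp add: Z_def sum_negf)
    qed
    have Z3: "(\<Sum>i<n. \<Sum>j<n. \<Sum>k<n. \<Sum>l<n. ?f (u k l i j) (u i j l k)) = - Z"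
    proof -
      have "(\<Sum>i<n. \<Sum>j<n. \<Sum>k<n. \<Sum>l<n. ?f (u k l i j) (u i j l k))
         = (\<Sum>i<n. \<Sum>j<n. \<Sum>k<n. \<Sum>l<n. ?f (u l k i j) (u i j k l))"
        by (intro sum.cong refl sum.swap)
      also have "\<dots> = (\<Sum>i<n. \<Sum>j<n. \<Sum>k<n. \<Sum>l<n. - ?f (u k l i j) (u i j k l))"
        by (intro sum.cong refl neg(1)) auto
      finally show ?thesis by (simp add: Z_def sum_negf)
    qed
    have Z4: "(\<Sum>i<n. \<Sum>j<n. \<Sum>k<n. \<Sum>l<n. ?f (u k l j i) (u i j l k)) = Z"
    proof -
      have "(\<Sum>i<n. \<Sum>j<n. \<Sum>k<n. \<Sum>l<n. ?f (u k l j i) (u i j l k))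
         = (\<Sum>i<n. \<Sum>j<n. \<Sum>k<n. \<Sum>l<n. ?f (u k l i j) (u j i l k))"
        by (rule sum.swap)
      also have "\<dots> = (\<Sum>i<n. \<Sum>j<n. \<Sum>k<n. \<Sum>l<n. - ?f (u k l i j) (u i j l k))"
        by (intro sum.cong refl neg(2)) auto
      finally show ?thesis by (simp add: Z3 sum_negf)
    qed
    have "(\<Sum>i<n. \<Sum>j<n. \<Sum>k<n. \<Sum>l<n. ?f (dE m k l (A i j)) (dE m i j (A k l)))
      = Z - (\<Sum>i<n. \<Sum>j<n. \<Sum>k<n. \<Sum>l<n. ?f (u k l j i) (u i j k l))
        - (\<Sum>i<n. \<Sum>j<n. \<Sum>k<n. \<Sum>l<n. ?f (u k l i j) (u i j l k))
        + (\<Sum>i<n. \<Sum>j<n. \<Sum>k<n. \<Sum>l<n. ?f (u k l j i) (u i j l k))"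
      by (simp add: dE_A form_diff_left form_diff_right sum_subtractf sum.distrib Z_def algebra_simps)
    then show ?thesis by (simp add: Z2 Z3 Z4)
  qed
  finally have norm_H: "?f (join_op m g n x) (join_op m g n x) = 1/4 * (\<Sum>i<n. \<Sum>j<n. ?f (A i j) (A i j)) + Z"
    by simp
  have "(\<Sum>i<n. \<Sum>j<n. ?f (A i j) (A i j)) \<ge> 0"
    by (intro sum_nonneg hw_nonneg[OF fin hA])
  then show ?thesis
    using norm_D norm_H TB_ge TA_ge TBn TAn by (simp add: algebra_simps)
qed

lemma sum4_exchange:
  fixes F :: "nat \<Rightarrow> nat \<Rightarrow> nat \<Rightarrow> nat \<Rightarrow> 'v::comm_monoid_add"
  shows "(\<Sum>i\<in>A. \<Sum>j\<in>A. \<Sum>k\<in>A. \<Sum>l\<in>A. F k l i j) = (\<Sum>i\<in>A. \<Sum>j\<in>A. \<Sum>k\<in>A. \<Sum>l\<in>A. F i j k l)"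
proof -
  have P: "(\<Sum>i\<in>A. \<Sum>j\<in>A. h i j) = (\<Sum>z\<in>A \<times> A. h (fst z) (snd z))" for h :: "nat \<Rightarrow> nat \<Rightarrow> 'v"
    by (simp add: sum.cartesian_product case_prod_unfold)
  show ?thesis by (simp only: P) (rule sum.swap)
qed

text \<open>
  Two edges can be removed in either order, but the pairs inserted for them have the odd degree
  \<open>2 m + 1\<close> and anticommute; so the terms for the two orders cancel.
\<close>

lemma cut_op_cut_op: "cut_op m g n (cut_op m g n x) \<approx>[srel (tpar m)] 0"
proof -
  let ?R = "srel (tpar m)"
  define M where "M i j z = (\<Sum>p<g. mul (tA p i) (mul (tB p j) z))" for i j z
  have D: "cut_op m g n z = (\<Sum>i<n. \<Sum>j<n. M i j (dE m i j z))" for z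
    unfolding cut_op_def half_cut_def M_def mul_linear by (intro sum.cong refl sum.swap)
  have dE_M: "dE m k l (M i j z) = M i j (dE m k l z)" for i j k l z
    by (simp add: M_def der_linear der_mul)
  have M_linear: "M i j (sum h A) = (\<Sum>a\<in>A. M i j (h a))" for i j h and A :: "nat set"
    unfolding M_def mul_linear by (rule sum.swap)
  have M_M: "M i j (M k l z) \<approx>[?R] - M k l (M i j z)" for i j k l z
  proof -
    have one: "mul (tA p i) (mul (tB p j) (mul (tA q k) (mul (tB q l) z)))
      \<approx>[?R] - mul (tA q k) (mul (tB q l) (mul (tA p i) (mul (tB p j) z)))" for p q
    proof -
      have "lin_ext (\<lambda>w. bas ([tA p i, tB p j] @ [tA q k, tB q l] @ w)) z
        \<approx>[?R] lin_ext (\<lambda>w. scl (-1) (bas ([tA q k, tB q l] @ [tA p i, tB p j] @ w))) z"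
      proof (intro cm_lin_ext)
        fix w
        show "bas ([tA p i, tB p j] @ [tA q k, tB q l] @ w)
          \<approx>[?R] scl (-1) (bas ([tA q k, tB q l] @ [tA p i, tB p j] @ w))"
          using word_move[of "[tA p i, tB p j]" "[tA q k, tB q l]" w "tpar m"]
          by (simp add: minus_one_power_iff)
      qed
      then show ?thesis unfolding lin_ext_scl_fun
        by (simp add: mul_def lin_ext_lin_ext scl_minus_left)
    qed
    have "M i j (M k l z) = (\<Sum>p<g. \<Sum>q<g. mul (tA p i) (mul (tB p j) (mul (tA q k) (mul (tB q l) z))))"
      by (simp add: M_def mul_linear)
    also have "\<dots> \<approx>[?R] (\<Sum>p<g. \<Sum>q<g. - mul (tA q k) (mul (tB q l) (mul (tA p i) (mul (tB p j) z))))"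
      by (intro cm_sum one)
    also have "\<dots> = - (\<Sum>q<g. \<Sum>p<g. mul (tA q k) (mul (tB q l) (mul (tA p i) (mul (tB p j) z))))"
      by (subst sum.swap) (simp add: sum_negf)
    also have "\<dots> = - M k l (M i j z)"
      by (simp add: M_def mul_linear)
    finally show ?thesis .
  qed
  let ?F = "\<lambda>i j k l. M i j (M k l (dE m i j (dE m k l x)))"
  have FF: "?F i j k l \<approx>[?R] - ?F k l i j" for i j k l
    unfolding dE_dE[of m i j k l x] by (rule M_M)
  have DD: "cut_op m g n (cut_op m g n x) = (\<Sum>i<n. \<Sum>j<n. \<Sum>k<n. \<Sum>l<n. ?F i j k l)"
    unfolding D der_linear M_linear dE_M ..
  have neg: "(\<Sum>i<n. \<Sum>j<n. \<Sum>k<n. \<Sum>l<n. - ?F k l i j) = - cut_op m g n (cut_op m g n x)"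
    unfolding DD sum_negf by (rule arg_cong[where f = uminus], rule sum4_exchange)
  have "cut_op m g n (cut_op m g n x) \<approx>[?R] - cut_op m g n (cut_op m g n x)"
    unfolding neg[symmetric] unfolding DD by (rule cm_sum, rule cm_sum, rule cm_sum, rule cm_sum, rule FF)
  then show ?thesis by (rule cm_neg_self)
qed


section \<open>Permutations and contraction of vertex numbers\<close>

abbreviation swp :: "nat \<Rightarrow> nat \<Rightarrow> nat" where
  "swp k \<equiv> Transposition.transpose k (Suc k)"

text \<open>
  A transposition of distant elements is conjugate to a nearer one by an adjacent transposition.
\<close>

lemma permutes_adjacent_induct [consumes 1, case_names id swap]:
  assumes "\<sigma> permutes {..<n}" "P id"
    and step: "\<And>k \<tau>. Suc k < n \<Longrightarrow> \<tau> permutes {..<n} \<Longrightarrow> P \<tau> \<Longrightarrow> P (swp k \<circ> \<tau>)"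
  shows "P \<sigma>"
proof -
  have trans: "P (Transposition.transpose a b \<circ> \<tau>)" if "a < b" "b < n" "\<tau> permutes {..<n}" "P \<tau>" for a b \<tau>
    using that
  proof (induction "b - Suc a" arbitrary: b \<tau>)
    case 0
    then have "b = Suc a" by simp
    then show ?case unfolding \<open>b = Suc a\<close> using 0 by (intro step) auto
  next
    case (Suc d)
    then obtain c where c: "b = Suc c" "a < c" by (cases b) auto
    have perm: "Transposition.transpose c b permutes {..<n}" "Transposition.transpose a c permutes {..<n}"
      using c Suc.prems by (auto intro: permutes_swap_id)
    have "P (swp c \<circ> \<tau>)"
      using step[of c \<tau>] c Suc.prems by simp
    then have "P (Transposition.transpose a c \<circ> (swp c \<circ> \<tau>))"
      using Suc.hyps(2) c Suc.prems perm by (intro Suc.hyps(1) permutes_compose) auto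
    then have "P (swp c \<circ> (Transposition.transpose a c \<circ> (swp c \<circ> \<tau>)))"
      using c Suc.prems perm by (intro step permutes_compose) auto
    moreover have "swp c \<circ> (Transposition.transpose a c \<circ> (swp c \<circ> \<tau>)) = Transposition.transpose a b \<circ> \<tau>"
      using c by (auto simp: fun_eq_iff Transposition.transpose_def)
    ultimately show ?case by simp
  qed
  show ?thesis
    using assms(1) finite_lessThan
  proof (induction rule: permutes_induct)
    case id then show ?case by (rule assms(2))
  next
    case (swap a b p)
    show ?case
    proof (cases "a < b")
      case True
      show ?thesis by (rule trans) (use True swap in auto)
    next
      case False
      show ?thesis by (subst transpose_commute, rule trans) (use False swap in auto)
    qed
  qed
qed

text \<open>
  If one of the two exchanged vertices is the removed one, the numbering of the remaining vertices does not
  notice the exchange; otherwise they are exchanged, shifted by one if the removed vertex precedes them.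
\<close>

lemma contract_vertex_adjacent:
  assumes "a \<noteq> b"
  shows "contract_vertex (swp k a) (swp k b) (swp k w)
    = (if b = k \<or> b = Suc k then id else if b < k then swp (k - 1) else swp k) (contract_vertex a b w)"
proof -
  consider "b = k" | "b = Suc k" | "b < k" | "b > Suc k" by linarith
  then show ?thesis
  proof cases
    case 1
    consider "a = Suc k" | "a < k" | "a > Suc k" using assms 1 by linarith
    then show ?thesis using 1 by cases (auto simp: contract_vertex_def Let_def Transposition.transpose_def)
  next
    case 2
    consider "a = k" | "a < k" | "a > Suc k" using assms 2 by linarith
    then show ?thesis using 2 by cases (auto simp: contract_vertex_def Let_def Transposition.transpose_def)
  next
    case 3
    consider "a = k" | "a = Suc k" | "a < k" | "a > Suc k" by linarith
    then show ?thesis using 3 assms by cases (auto simp: contract_vertex_def Let_def Transposition.transpose_def)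
  next
    case 4
    consider "a = k" | "a = Suc k" | "a < k" | "a > Suc k" by linarith
    then show ?thesis using 4 assms by cases (auto simp: contract_vertex_def Let_def Transposition.transpose_def)
  qed
qed

text \<open>
  Contracting the vertex \<open>j\<close> into \<open>i\<close> commutes with renumbering up to a renumbering of the remaining
  vertices. The sign compares the generators of \<open>\<rat>[2m+1]\<close> that belong to the removed vertices.
\<close>

lemma contract_vertex_permute:
  assumes "\<sigma> permutes {..<n}" "i < n" "j < n" "i \<noteq> j"
  shows "\<exists>\<sigma>'. \<sigma>' permutes {..<n - 1} \<and> (\<forall>v<n. contract_vertex (\<sigma> i) (\<sigma> j) (\<sigma> v) = \<sigma>' (contract_vertex i j v))
           \<and> sign \<sigma>' * (-1) ^ \<sigma> j = sign \<sigma> * ((-1) ^ j :: int)"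
  using assms(1)
proof (induction rule: permutes_adjacent_induct)
  case id
  show ?case by (intro exI[of _ id] conjI permutes_id) simp_all
next
  case (swap k \<tau>)
  then obtain \<tau>' where t: "\<tau>' permutes {..<n - 1}"
    "\<And>v. v < n \<Longrightarrow> contract_vertex (\<tau> i) (\<tau> j) (\<tau> v) = \<tau>' (contract_vertex i j v)"
    "sign \<tau>' * (-1) ^ \<tau> j = sign \<tau> * ((-1) ^ j :: int)" by blast
  define a b where "a = \<tau> i" and "b = \<tau> j"
  have ab: "a < n" "b < n" "a \<noteq> b"
    using assms permutes_in_image[OF swap.hyps(2)] permutes_inj[OF swap.hyps(2)]
    by (auto simp: a_def b_def inj_def)
  define \<rho> where "\<rho> = (if b = k \<or> b = Suc k then id else if b < k then swp (k - 1) else swp k)"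
  have rho: "\<rho> permutes {..<n - 1}"
    using swap.hyps(1) ab unfolding \<rho>_def by (auto intro!: permutes_swap_id simp: permutes_id)
  have cv: "contract_vertex (swp k a) (swp k b) (swp k w) = \<rho> (contract_vertex a b w)" for w
    unfolding \<rho>_def using ab(3) by (rule contract_vertex_adjacent)
  have sg: "sign \<rho> * (-1) ^ swp k b = - ((-1) ^ b :: int)"
    by (cases "b = k"; cases "b = Suc k") (auto simp: \<rho>_def sign_swap_id transpose_apply_other)
  have perm: "permutation \<rho>" "permutation \<tau>'" "permutation (swp k)" "permutation \<tau>"
    by (rule permutes_imp_permutation[OF _ rho], simp, rule permutes_imp_permutation[OF _ t(1)], simp,
        rule permutation_swap_id, rule permutes_imp_permutation[OF _ swap.hyps(2)], simp)
  have "sign (\<rho> \<circ> \<tau>') * (-1) ^ swp k b = sign \<tau>' * (sign \<rho> * (-1) ^ swp k b :: int)"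
    using perm by (simp add: sign_compose)
  also have "\<dots> = sign (swp k) * (sign \<tau>' * (-1) ^ b)"
    unfolding sg by (simp add: sign_swap_id)
  also have "\<dots> = sign (swp k \<circ> \<tau>) * (-1) ^ j"
    using perm t(3) by (simp add: sign_compose b_def)
  finally have "sign (\<rho> \<circ> \<tau>') * (-1) ^ swp k b = sign (swp k \<circ> \<tau>) * ((-1) ^ j :: int)" .
  moreover have "\<rho> \<circ> \<tau>' permutes {..<n - 1}"
    by (rule permutes_compose[OF t(1) rho])
  moreover have "contract_vertex ((swp k \<circ> \<tau>) i) ((swp k \<circ> \<tau>) j) ((swp k \<circ> \<tau>) v) = (\<rho> \<circ> \<tau>') (contract_vertex i j v)"
    if "v < n" for v
    using t(2)[OF that] cv by (simp add: a_def b_def)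
  moreover have "swp k b = (swp k \<circ> \<tau>) j" by (simp add: b_def)
  ultimately show ?case by (intro exI[of _ "\<rho> \<circ> \<tau>'"] conjI allI impI) metis+
qed

lemma permutes_to_front:
  assumes "i < n" "j < n" "i \<noteq> j"
  shows "\<exists>\<sigma>. \<sigma> permutes {..<n} \<and> \<sigma> i = 0 \<and> \<sigma> j = (1::nat)"
proof -
  define \<tau> where "\<tau> = Transposition.transpose 0 i"
  have "\<tau> permutes {..<n}" unfolding \<tau>_def using assms by (intro permutes_swap_id) auto
  moreover have "\<tau> j < n" "\<tau> j \<noteq> 0" "\<tau> i = 0"
    using assms by (auto simp: \<tau>_def Transposition.transpose_def)
  moreover from this have "Transposition.transpose 1 (\<tau> j) permutes {..<n}"
    using assms by (intro permutes_swap_id) auto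
  ultimately show ?thesis
    by (intro exI[of _ "Transposition.transpose 1 (\<tau> j) \<circ> \<tau>"]) (auto intro: permutes_compose simp: Transposition.transpose_def)
qed

text \<open>
  The two ways of contracting the edge between the vertices 0 and 1 agree as maps, so the claim follows by
  moving the edge to these vertices.
\<close>

lemma contract_vertex_flip:
  assumes "i < n" "j < n" "i \<noteq> j"
  shows "\<exists>\<sigma>. \<sigma> permutes {..<n - 1} \<and> (\<forall>v<n. contract_vertex j i v = \<sigma> (contract_vertex i j v))
           \<and> sign \<sigma> * (-1) ^ i = - ((-1) ^ j :: int)"
proof -
  obtain \<sigma> where s: "\<sigma> permutes {..<n}" "\<sigma> i = 0" "\<sigma> j = 1" using permutes_to_front[OF assms] by blast
  obtain \<sigma>1 where s1: "\<sigma>1 permutes {..<n - 1}"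
    "\<And>v. v < n \<Longrightarrow> contract_vertex 0 1 (\<sigma> v) = \<sigma>1 (contract_vertex i j v)"
    "- sign \<sigma>1 = sign \<sigma> * ((-1) ^ j :: int)"
    using contract_vertex_permute[OF s(1) assms] s(2,3) by auto
  obtain \<sigma>2 where s2: "\<sigma>2 permutes {..<n - 1}"
    "\<And>v. v < n \<Longrightarrow> contract_vertex 1 0 (\<sigma> v) = \<sigma>2 (contract_vertex j i v)"
    "sign \<sigma>2 = sign \<sigma> * ((-1) ^ i :: int)"
    using contract_vertex_permute[OF s(1) assms(2,1)] assms(3) s(2,3) by auto
  have same: "contract_vertex 0 1 = contract_vertex 1 0"
    by (auto simp: fun_eq_iff contract_vertex_def Let_def)
  define \<rho> where "\<rho> = inv_into UNIV \<sigma>2 \<circ> \<sigma>1"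
  have "contract_vertex j i v = \<rho> (contract_vertex i j v)" if "v < n" for v
    using s1(2)[OF that] s2(2)[OF that, folded same] permutes_inverses(2)[OF s2(1)] by (simp add: \<rho>_def)
  moreover have "\<rho> permutes {..<n - 1}"
    unfolding \<rho>_def by (intro permutes_compose permutes_inv s1 s2)
  moreover have "sign \<rho> = sign \<sigma>2 * sign \<sigma>1"
    unfolding \<rho>_def using s1(1) s2(1) permutes_imp_permutation[of "{..<n-1}"] permutes_inv[OF s2(1)]
    by (simp add: sign_compose sign_inverse)
  moreover have "sign \<sigma>2 * sign \<sigma>1 * (-1) ^ i = - ((-1) ^ j :: int)"
  proof -
    have sq: "(-1) ^ i * (-1) ^ i = (1 :: int)" by (simp flip: power_add mult_2)
    have "sign \<sigma>1 = - (sign \<sigma> * ((-1) ^ j :: int))" using s1(3) by simp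
    then have "sign \<sigma>2 * sign \<sigma>1 * (-1) ^ i
        = - ((sign \<sigma> * sign \<sigma>) * ((-1) ^ i * (-1) ^ i) * ((-1) ^ j :: int))"
      unfolding s2(3) by (simp only: mult_ac mult_minus_left mult_minus_right)
    then show ?thesis by (simp only: sq sign_idempotent mult_1)
  qed
  ultimately show ?thesis by (intro exI[of _ \<rho>] conjI allI impI) simp_all
qed


section \<open>Graphs with located decorations\<close>

text \<open>
  A word in located letters \<open>(x, v)\<close> determines decorations of \<open>n\<close> vertices once its letters are
  sorted by their vertex. With the sign of this sorting, the Koszul signs in the relations and in the
  differential disappear: everything is expressed by renaming the locations.
\<close>

fun lpar :: "nat \<Rightarrow> letter \<times> nat \<Rightarrow> nat" where
  "lpar m (x, v) = ldeg m x"

definition bins :: "nat \<Rightarrow> (letter \<times> nat) list \<Rightarrow> letter list list" where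
  "bins n lw = map (\<lambda>v. map fst (filter (\<lambda>z. snd z = v) lw)) [0..<n]"

definition below :: "nat \<Rightarrow> nat \<Rightarrow> (letter \<times> nat) list \<Rightarrow> nat" where
  "below m v lw = sum_list (map (lpar m) (filter (\<lambda>z. snd z < v) lw))"

fun sortsign :: "nat \<Rightarrow> (letter \<times> nat) list \<Rightarrow> rat" where
  "sortsign m [] = 1"
| "sortsign m (z # lw) = (-1) ^ (lpar m z * below m (snd z) lw) * sortsign m lw"

definition located :: "nat \<Rightarrow> nat \<Rightarrow> (nat \<times> nat) list \<Rightarrow> (letter \<times> nat) list \<Rightarrow> dgraph \<Rightarrow>\<^sub>0 rat" where
  "located m n es lw = Poly_Mapping.single (DGraph es (bins n lw)) (sortsign m lw)"

fun flat :: "nat \<Rightarrow> letter list list \<Rightarrow> (letter \<times> nat) list" where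
  "flat k [] = []"
| "flat k (w # ds) = map (\<lambda>x. (x, k)) w @ flat (Suc k) ds"

definition wf_edges :: "nat \<Rightarrow> (nat \<times> nat) list \<Rightarrow> bool" where
  "wf_edges n es \<longleftrightarrow> (\<forall>(i, j) \<in> set es. i < n \<and> j < n)"

definition wf_locs :: "nat \<Rightarrow> nat \<Rightarrow> (letter \<times> nat) list \<Rightarrow> bool" where
  "wf_locs g n lw \<longleftrightarrow> (\<forall>(x, v) \<in> set lw. index x < g \<and> v < n)"

abbreviation rels :: "nat \<Rightarrow> nat \<Rightarrow> (dgraph \<Rightarrow>\<^sub>0 rat) set" where
  "rels m g \<equiv> group_relations m g \<union> symmetric_relations m g"

abbreviation RR :: "nat \<Rightarrow> nat \<Rightarrow> (dgraph \<Rightarrow>\<^sub>0 rat) set" where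
  "RR m g \<equiv> rat_free.span (rels m g)"

lemma length_bins [simp]: "length (bins n lw) = n"
  by (simp add: bins_def)

lemma bins_nth: "v < n \<Longrightarrow> bins n lw ! v = map fst (filter (\<lambda>z. snd z = v) lw)"
  by (simp add: bins_def)

lemma sortsign_sq [simp]: "sortsign m lw * sortsign m lw = 1"
  by (induction lw) (simp_all add: algebra_simps flip: power_add mult_2)

lemma sortsign_nz [simp]: "sortsign m lw \<noteq> 0"
  by (metis sortsign_sq mult_zero_left zero_neq_one)

lemma dgraphs_bins: "wf_edges n es \<Longrightarrow> wf_locs g n lw \<Longrightarrow> DGraph es (bins n lw) \<in> dgraphs g"
  by (fastforce simp: dgraphs_def wf_edges_def wf_locs_def bins_def)

lemma flat_append: "flat k (as @ bs) = flat k as @ flat (k + length as) bs"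
  by (induction as arbitrary: k) auto

lemma flat_labels: "z \<in> set (flat k ds) \<Longrightarrow> k \<le> snd z \<and> snd z < k + length ds"
  by (induction ds arbitrary: k) fastforce+

lemma bins_flat [simp]: "bins (length ds) (flat 0 ds) = ds"
proof -
  have "map (\<lambda>v. map fst (filter (\<lambda>z. snd z = v) (flat k ds))) [k..<k + length ds] = ds" for k
  proof (induction ds arbitrary: k)
    case Nil then show ?case by simp
  next
    case (Cons w ds)
    let ?h = "\<lambda>v. map fst (filter (\<lambda>z. snd z = v) (flat k (w # ds)))"
    have "filter (\<lambda>z. snd z = k) (flat (Suc k) ds) = []"
      by (auto simp: filter_empty_conv dest: flat_labels)
    then have "?h k = w"
      by (simp add: o_def filter_map)
    moreover have "map ?h [Suc k..<Suc k + length ds]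
       = map (\<lambda>v. map fst (filter (\<lambda>z. snd z = v) (flat (Suc k) ds))) [Suc k..<Suc k + length ds]"
      by (intro map_cong refl) (auto simp: filter_empty_conv)
    moreover have "[k..<k + length (w # ds)] = k # [Suc k..<Suc k + length ds]"
      by (simp add: upt_conv_Cons del: upt_Suc)
    ultimately show ?case using Cons.IH[of "Suc k"] by (simp only: list.map)
  qed
  from this[of 0] show ?thesis by (simp add: bins_def)
qed

lemma below_flat: "v \<le> k \<Longrightarrow> below m v (flat k ds) = 0"
  by (auto simp: below_def filter_empty_conv dest!: flat_labels intro!: arg_cong[of _ "[]" "\<lambda>l. sum_list (map (lpar m) l)", simplified])

lemma sortsign_flat [simp]: "sortsign m (flat k ds) = 1"
proof (induction ds arbitrary: k)
  case Nil then show ?case by simp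
next
  case (Cons w ds)
  have "below m k (map (\<lambda>x. (x, k)) w @ flat (Suc k) ds) = 0" for w
    using below_flat[of k "Suc k" m ds] by (simp add: below_def)
  then have "sortsign m (map (\<lambda>x. (x, k)) w @ flat (Suc k) ds) = sortsign m (flat (Suc k) ds)"
    by (induction w) simp_all
  with Cons.IH show ?case by simp
qed

lemma located_flat: "located m (length ds) es (flat 0 ds) = bas (DGraph es ds)"
  by (simp add: located_def)

lemma wf_locs_flat: "(\<forall>w \<in> set ds. \<forall>x \<in> set w. index x < g) \<Longrightarrow> wf_locs g (k + length ds) (flat k ds)"
  by (induction ds arbitrary: k) (fastforce simp: wf_locs_def)+

lemma dgraphs_located:
  assumes "\<Gamma> \<in> dgraphs g"
  shows "bas \<Gamma> = located m (nverts \<Gamma>) (edges \<Gamma>) (flat 0 (decs \<Gamma>))"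
    and "wf_edges (nverts \<Gamma>) (edges \<Gamma>)" and "wf_locs g (nverts \<Gamma>) (flat 0 (decs \<Gamma>))"
  using assms wf_locs_flat[of "decs \<Gamma>" g 0] by (auto simp: located_flat dgraphs_def wf_edges_def)


subsection \<open>Sorting\<close>

lemma sum_wdeg_bins:
  assumes "finite U"
  shows "(\<Sum>u\<in>U. wdeg m (map fst (filter (\<lambda>z. snd z = u) lw))) = sum_list (map (lpar m) (filter (\<lambda>z. snd z \<in> U) lw))"
proof (induction lw)
  case Nil then show ?case by (simp add: wdeg_def)
next
  case (Cons z lw)
  have "wdeg m (map fst (filter (\<lambda>y. snd y = u) (z # lw)))
      = (if snd z = u then lpar m z else 0) + wdeg m (map fst (filter (\<lambda>y. snd y = u) lw))" for u
    by (cases z) (simp add: wdeg_def)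
  then have "(\<Sum>u\<in>U. wdeg m (map fst (filter (\<lambda>y. snd y = u) (z # lw))))
     = (\<Sum>u\<in>U. if snd z = u then lpar m z else 0) + sum_list (map (lpar m) (filter (\<lambda>z. snd z \<in> U) lw))"
    by (simp add: sum.distrib Cons.IH)
  then show ?case using assms by simp
qed

lemma wdeg_bins: "(\<Sum>u<v. wdeg m (map fst (filter (\<lambda>z. snd z = u) lw))) = below m v lw"
  by (simp add: sum_wdeg_bins below_def)

lemma wdeg_bins': "v \<le> n \<Longrightarrow> (\<Sum>u<v. wdeg m (bins n lw ! u)) = below m v lw"
  by (subst wdeg_bins[symmetric]) (auto simp: bins_nth intro!: sum.cong)

lemma bins_Cons: "v < n \<Longrightarrow> bins n ((x, v) # lw) = (bins n lw)[v := x # bins n lw ! v]"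
  by (rule nth_equalityI) (auto simp: bins_nth nth_list_update)

lemma left_mult_located:
  assumes "v < n"
  shows "lin_ext (left_mult m x v) (located m n es lw) = located m n es ((x, v) # lw)"
  using assms by (simp add: located_def left_mult_def bins_Cons wdeg_bins' mult.commute)

lemma sum_flat: "sum_list (map (lpar m) (flat k ds)) = sum_list (map (wdeg m) ds)"
  by (induction ds arbitrary: k) (simp_all add: wdeg_def o_def)

text \<open>
  So \<open>sortsign\<close> is the Koszul sign of sorting the letters by their vertex.
\<close>

lemma word_sort:
  assumes "\<forall>z\<in>set lw. snd z < n"
  shows "bas lw \<approx>[srel (lpar m)] scl (sortsign m lw) (bas (flat 0 (bins n lw)))"
  using assms
proof (induction lw)
  case Nil
  have "flat k (map (\<lambda>_. []) vs) = []" for k and vs :: "nat list" by (induction vs arbitrary: k) auto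
  then show ?case by (simp add: bins_def)
next
  case (Cons z lw)
  obtain x v where z: "z = (x, v)" by (cases z)
  let ?ds = "bins n lw"
  let ?P = "flat 0 (take v ?ds)" and ?S = "flat v (drop v ?ds)"
  have v: "v < n" using Cons.prems z by simp
  have "take v ?ds @ drop v ?ds = ?ds" by simp
  then have split: "flat 0 ?ds = ?P @ ?S"
    using flat_append[of 0 "take v ?ds" "drop v ?ds"] v by simp
  have drop: "drop v ?ds = ?ds ! v # drop (Suc v) ?ds"
    using v by (simp add: Cons_nth_drop_Suc)
  have "bins n (z # lw) = take v ?ds @ (x # ?ds ! v) # drop (Suc v) ?ds"
    using v z by (simp add: bins_Cons upd_conv_take_nth_drop)
  then have "flat 0 (bins n (z # lw)) = ?P @ (x, v) # ?S"
    using v drop by (simp add: flat_append)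
  moreover have "sum_list (map (lpar m) ?P) = below m v lw"
  proof -
    have "sum_list (map (wdeg m) (take v ?ds)) = (\<Sum>u<v. wdeg m (?ds ! u))"
      using v by (simp add: sum_list_sum_nth atLeast0LessThan)
    then show ?thesis using v by (simp add: sum_flat wdeg_bins')
  qed
  ultimately have "mul z (bas (flat 0 ?ds)) \<approx>[srel (lpar m)]
      scl ((-1) ^ (lpar m z * below m v lw)) (bas (flat 0 (bins n (z # lw))))"
    using word_move[of "[z]" ?P ?S "lpar m"] by (simp add: split z)
  from cm_scl[OF this, of "sortsign m lw"]
  have "mul z (scl (sortsign m lw) (bas (flat 0 ?ds))) \<approx>[srel (lpar m)]
      scl (sortsign m (z # lw)) (bas (flat 0 (bins n (z # lw))))"
    using z by (simp add: mult.commute)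
  moreover have "mul z (bas lw) \<approx>[srel (lpar m)] mul z (scl (sortsign m lw) (bas (flat 0 ?ds)))"
    using Cons by (intro mul_cong) simp
  ultimately show ?case using cm_trans by fastforce
qed


subsection \<open>The relations\<close>

lemma below_swap: "below m v (u @ [a, b] @ w) = below m v (u @ [b, a] @ w)"
  by (simp add: below_def)

lemma sortsign_swap:
  "sortsign m (u @ [a, b] @ w)
     = (if snd a = snd b then 1 else swap_sign (lpar m) a b) * sortsign m (u @ [b, a] @ w)"
proof (induction u)
  case Nil
  define A B where "A = (-1 :: rat) ^ (lpar m a * below m (snd a) w)"
    and "B = (-1 :: rat) ^ (lpar m b * below m (snd b) w)"
  have below: "below m (snd y) (z # w) = (if snd z < snd y then lpar m z else 0) + below m (snd y) w" for y z
    by (simp add: below_def)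
  have ab: "sortsign m (a # b # w) = (if snd b < snd a then swap_sign (lpar m) a b else 1) * (A * B) * sortsign m w"
    by (simp add: below swap_sign_def A_def B_def distrib_left power_add)
  have ba: "sortsign m (b # a # w) = (if snd a < snd b then swap_sign (lpar m) a b else 1) * (A * B) * sortsign m w"
    by (simp add: below swap_sign_sym[of _ a b] swap_sign_def[of _ b a] A_def B_def distrib_left power_add)
  show ?case
    by (cases "snd a < snd b"; cases "snd b < snd a") (simp_all add: ab ba del: sortsign.simps flip: mult.assoc)
next
  case (Cons z u)
  then show ?case using below_swap[of m "snd z" u a b w] by simp
qed

text \<open>
  Letters at the same vertex are exchanged by a relation of the symmetric algebra. For letters at different
  vertices the graph stays the same and only the sorting sign changes.
\<close>

lemma located_swap:
  assumes "wf_edges n es" "wf_locs g n (u @ [a, b] @ w)"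
  shows "located m n es (u @ [a, b] @ w) \<approx>[RR m g]
    scl (swap_sign (lpar m) a b) (located m n es (u @ [b, a] @ w))"
proof (cases "snd a = snd b")
  case False
  then have "bins n (u @ [a, b] @ w) = bins n (u @ [b, a] @ w)"
    by (intro nth_equalityI) (auto simp: bins_nth)
  then show ?thesis
    using False sortsign_swap[of m u a b w] by (simp add: located_def)
next
  case True
  obtain x y v where ab: "a = (x, v)" "b = (y, v)" using True by (cases a; cases b) auto
  have v: "v < n" using assms(2) ab by (simp add: wf_locs_def)
  let ?ds = "bins n (u @ [a, b] @ w)"
  define U W where "U = map fst (filter (\<lambda>z. snd z = v) u)" and "W = map fst (filter (\<lambda>z. snd z = v) w)"
  have nth: "?ds ! v = U @ [x, y] @ W" using v ab by (simp add: bins_nth U_def W_def)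
  have ds: "?ds = take v ?ds @ (U @ [x, y] @ W) # drop (Suc v) ?ds"
    using id_take_nth_drop[of v ?ds] v nth by simp
  have "bins n (u @ [b, a] @ w) = ?ds[v := U @ [y, x] @ W]"
    using v ab by (intro nth_equalityI) (auto simp: bins_nth nth_list_update U_def W_def)
  then have ds': "bins n (u @ [b, a] @ w) = take v ?ds @ (U @ [y, x] @ W) # drop (Suc v) ?ds"
    using v by (simp add: upd_conv_take_nth_drop)
  have "DGraph es ?ds \<in> dgraphs g" by (rule dgraphs_bins[OF assms])
  then have "bas (DGraph es ?ds) - Poly_Mapping.single (DGraph es (bins n (u @ [b, a] @ w))) ((-1) ^ (ldeg m x * ldeg m y))
      \<in> symmetric_relations m g"
    unfolding symmetric_relations_def ds' using ds by (smt (verit) mem_Collect_eq)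
  then have "bas (DGraph es ?ds) \<approx>[RR m g]
      Poly_Mapping.single (DGraph es (bins n (u @ [b, a] @ w))) ((-1) ^ (ldeg m x * ldeg m y))"
    unfolding cong_mod_def by (intro rat_free.span_base) blast
  from cm_scl[OF this, of "sortsign m (u @ [a, b] @ w)"] show ?thesis
    using True ab sortsign_swap[of m u a b w] by (simp add: located_def swap_sign_def mult.commute)
qed

lemma wf_locs_swap: "wf_locs g n (u @ [a, b] @ w) = wf_locs g n (u @ [b, a] @ w)"
  by (auto simp: wf_locs_def)

text \<open>
  Words are compared before the renaming \<open>h\<close>: for a contraction \<open>h\<close> the letters of the renamed word are
  sorted differently.
\<close>

lemma located_cong:
  assumes "bas lw \<approx>[srel (lpar m)] scl c (bas lw')" "wf_edges n es"
    and "wf_locs g n (map (apsnd h) lw)" "wf_locs g n (map (apsnd h) lw')"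
  shows "located m n es (map (apsnd h) lw) \<approx>[RR m g] scl c (located m n es (map (apsnd h) lw'))"
proof -
  define f where "f lw = (if wf_locs g n (map (apsnd h) lw) then located m n es (map (apsnd h) lw) else 0)" for lw
  have "lin_ext f (bas lw) \<approx>[RR m g] lin_ext f (scl c (bas lw'))"
  proof (rule cm_lin_ext_span[OF _ assms(1)])
    fix r assume "r \<in> srel_gen (lpar m)"
    then obtain u a b v where r: "r = bas (u @ [a, b] @ v) - scl (swap_sign (lpar m) a b) (bas (u @ [b, a] @ v))"
      unfolding srel_gen_def by blast
    have par: "lpar m (apsnd h z) = lpar m z" for z by (cases z) simp
    show "lin_ext f r \<in> RR m g"
      using located_swap[OF assms(2), of g "map (apsnd h) u" "apsnd h a" "apsnd h b" "map (apsnd h) v" m]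
        wf_locs_swap[of g n "map (apsnd h) u" "apsnd h a" "apsnd h b" "map (apsnd h) v"]
      by (auto simp: r lin_ext_diff f_def cong_mod_def swap_sign_def par rat_free.span_zero)
  qed
  then show ?thesis using assms(3,4) by (simp add: f_def)
qed

lemma act_id: "act id \<pi> {} (DGraph es ds) = DGraph (permute_list \<pi> es) ds"
proof -
  have "map ((!) es) [0..<length es] = es" by (rule map_nth)
  then show ?thesis by (simp add: act_def map_prod.id permute_list_map[symmetric] inv_id[unfolded id_def] id_def)
qed

lemma koszul_id: "koszul id ns = 1"
proof -
  have "{(i, j). i < j \<and> j < length ns \<and> id j < id i} = {}" by auto
  then show ?thesis unfolding koszul_def by (simp only: sum.empty power_0)
qed

lemma group_rel:
  assumes "\<Gamma> \<in> dgraphs g" "\<sigma> permutes {..<nverts \<Gamma>}" "\<pi> permutes {..<nedges \<Gamma>}" "F \<subseteq> {..<nedges \<Gamma>}"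
  shows "bas \<Gamma> \<approx>[RR m g] Poly_Mapping.single (act \<sigma> \<pi> F \<Gamma>) (of_int (act_sign m \<sigma> F \<Gamma>))"
proof -
  have "bas \<Gamma> - Poly_Mapping.single (act \<sigma> \<pi> F \<Gamma>) (of_int (act_sign m \<sigma> F \<Gamma>)) \<in> group_relations m g"
    unfolding group_relations_def using assms by blast
  then show ?thesis unfolding cong_mod_def by (intro rat_free.span_base) blast
qed

lemma located_edges:
  assumes "wf_edges n es" "wf_locs g n lw" "mset es' = mset es"
  shows "located m n es lw \<approx>[RR m g] located m n es' lw"
proof -
  obtain \<pi> where p: "\<pi> permutes {..<length es}" "permute_list \<pi> es = es'"
    by (rule mset_eq_permutation[OF assms(3)])
  have act: "act id \<pi> {} (DGraph es (bins n lw)) = DGraph es' (bins n lw)"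
    by (simp only: act_id p(2))
  have sg: "act_sign m id {} (DGraph es (bins n lw)) = 1"
    unfolding act_sign_def koszul_id by simp
  have "bas (DGraph es (bins n lw)) \<approx>[RR m g] bas (DGraph es' (bins n lw))"
    using group_rel[OF dgraphs_bins[OF assms(1,2)] permutes_id, of \<pi> "{}" m] p(1)
    unfolding act sg by simp
  from cm_scl[OF this, of "sortsign m lw"] show ?thesis by (simp add: located_def)
qed

lemma located_flip:
  assumes "wf_edges n ((i, j) # es)" "wf_locs g n lw"
  shows "located m n ((i, j) # es) lw \<approx>[RR m g] - located m n ((j, i) # es) lw"
proof -
  have flip: "map (\<lambda>l. if l = 0 then prod.swap (((i, j) # es) ! l) else ((i, j) # es) ! l) [0..<Suc (length es)]
     = (j, i) # es"
    by (simp add: map_upt_Suc map_nth del: upt_Suc)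
  have "act id id {0} (DGraph ((i, j) # es) (bins n lw)) = DGraph ((j, i) # es) (bins n lw)"
    unfolding act_def dgraph.sel singleton_iff list.size add_Suc_right add_0_right flip by (simp add: map_prod.id)
  then have "bas (DGraph ((i, j) # es) (bins n lw)) \<approx>[RR m g]
      Poly_Mapping.single (DGraph ((j, i) # es) (bins n lw)) (- 1)"
    using group_rel[OF dgraphs_bins[OF assms] permutes_id permutes_id, of "{0}" m]
    by (simp add: act_sign_def koszul_id)
  from cm_scl[OF this, of "sortsign m lw"] show ?thesis by (simp add: located_def single_uminus)
qed

text \<open>
  The Koszul sign of a renumbering of the vertices is exactly the change of the sorting sign, one
  letter at a time: the vertices that \<open>v\<close> passes are those lying on different sides of \<open>v\<close> before
  and after the renumbering, that is, those forming an inversion with \<open>v\<close>.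
\<close>

lemma koszul_sortsign:
  assumes \<sigma>: "\<sigma> permutes {..<n}" and lw: "\<forall>z\<in>set lw. snd z < n"
  shows "of_int (koszul \<sigma> (map (wdeg m) (bins n lw))) * sortsign m (map (apsnd \<sigma>) lw) = sortsign m lw"
  using lw
proof (induction lw)
  case Nil
  have "(\<Sum>(i, j) \<in> {(i, j). i < j \<and> j < n \<and> \<sigma> j < \<sigma> i}. map (wdeg m) (bins n []) ! i * map (wdeg m) (bins n []) ! j) = 0"
    by (intro sum.neutral) (auto simp: bins_nth wdeg_def)
  then show ?case by (simp add: koszul_def)
next
  case (Cons z lw)
  obtain x v where z: "z = (x, v)" by (cases z)
  have v: "v < n" using Cons.prems z by simp
  define N where "N u = wdeg m (map fst (filter (\<lambda>y. snd y = u) lw))" for u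
  define d where "d = ldeg m x"
  define I where "I i j = (if i < j \<and> \<sigma> j < \<sigma> i then 1 else 0 :: nat)" for i j
  have kos: "koszul \<sigma> (map (wdeg m) (bins n w)) =
      (-1) ^ (\<Sum>i<n. \<Sum>j<n. I i j * (wdeg m (map fst (filter (\<lambda>y. snd y = i) w)) * wdeg m (map fst (filter (\<lambda>y. snd y = j) w))))"
    for w
  proof -
    let ?h = "\<lambda>i. wdeg m (map fst (filter (\<lambda>y. snd y = i) w))"
    have "(\<Sum>i<n. \<Sum>j<n. I i j * (?h i * ?h j)) = (\<Sum>(i, j)\<in>{..<n}\<times>{..<n}. I i j * (?h i * ?h j))"
      by (simp add: sum.cartesian_product)
    also have "\<dots> = (\<Sum>(i, j) \<in> {(i, j). i < j \<and> j < n \<and> \<sigma> j < \<sigma> i}. I i j * (?h i * ?h j))"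
      by (rule sum.mono_neutral_right) (auto simp: I_def split: if_splits)
    also have "\<dots> = (\<Sum>(i, j) \<in> {(i, j). i < j \<and> j < n \<and> \<sigma> j < \<sigma> i}. map (wdeg m) (bins n w) ! i * map (wdeg m) (bins n w) ! j)"
      by (rule sum.cong) (auto simp: I_def bins_nth)
    finally show ?thesis by (simp add: koszul_def)
  qed
  have N': "wdeg m (map fst (filter (\<lambda>y. snd y = u) (z # lw))) = N u + (if u = v then d else 0)" for u
    by (auto simp: z N_def d_def wdeg_def)
  define A where "A = (\<Sum>j<n. I v j * N j)"
  define B where "B = (\<Sum>i<n. I i v * N i)"
  have pair: "I i j * ((N i + (if i = v then d else 0)) * (N j + (if j = v then d else 0)))
     = I i j * (N i * N j) + ((if i = v then d * (I v j * N j) else 0) + (if j = v then d * (I i v * N i) else 0))" for i j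
    by (auto simp: I_def algebra_simps)
  have "(\<Sum>i<n. \<Sum>j<n. I i j * ((N i + (if i = v then d else 0)) * (N j + (if j = v then d else 0))))
     = (\<Sum>i<n. \<Sum>j<n. I i j * (N i * N j)) + ((\<Sum>i<n. \<Sum>j<n. if i = v then d * (I v j * N j) else 0)
        + (\<Sum>i<n. \<Sum>j<n. if j = v then d * (I i v * N i) else 0))"
    unfolding pair by (simp add: sum.distrib)
  also have "(\<Sum>i<n. \<Sum>j<n. if i = v then d * (I v j * N j) else 0) = d * A"
    using v by (subst sum.swap) (simp add: A_def sum_distrib_left)
  also have "(\<Sum>i<n. \<Sum>j<n. if j = v then d * (I i v * N i) else 0) = d * B"
    using v by (simp add: B_def sum_distrib_left)
  finally have kos': "koszul \<sigma> (map (wdeg m) (bins n (z # lw))) = koszul \<sigma> (map (wdeg m) (bins n lw)) * (-1) ^ (d * (A + B))"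
    unfolding kos N' by (simp add: power_add distrib_left flip: N_def)
  define C where "C = (\<Sum>u<n. (if u < v \<and> \<sigma> u < \<sigma> v then 1 else 0) * N u)"
  have below1: "below m v lw = B + C"
  proof -
    have "below m v lw = (\<Sum>u<v. N u)" by (simp add: N_def wdeg_bins)
    also have "\<dots> = (\<Sum>u<n. (if u < v then 1 else 0) * N u)"
      using v by (intro sum.mono_neutral_cong_left) auto
    also have "\<dots> = (\<Sum>u<n. I u v * N u + (if u < v \<and> \<sigma> u < \<sigma> v then 1 else 0) * N u)"
    proof (intro sum.cong refl)
      fix u
      have "u \<noteq> v \<Longrightarrow> \<sigma> u \<noteq> \<sigma> v" using permutes_inj[OF \<sigma>] by (auto simp: inj_def)
      then show "(if u < v then 1 else 0) * N u = I u v * N u + (if u < v \<and> \<sigma> u < \<sigma> v then 1 else 0) * N u"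
        by (auto simp: I_def)
    qed
    finally show ?thesis by (simp add: sum.distrib B_def C_def)
  qed
  have below2: "below m (\<sigma> v) (map (apsnd \<sigma>) lw) = A + C"
  proof -
    have par: "lpar m \<circ> apsnd \<sigma> = lpar m" by (auto simp: fun_eq_iff)
    have "below m (\<sigma> v) (map (apsnd \<sigma>) lw) = sum_list (map (lpar m) (filter (\<lambda>y. \<sigma> (snd y) < \<sigma> v) lw))"
      unfolding below_def filter_map map_map par by (simp add: o_def)
    also have "filter (\<lambda>y. \<sigma> (snd y) < \<sigma> v) lw = filter (\<lambda>y. snd y \<in> {u. u < n \<and> \<sigma> u < \<sigma> v}) lw"
      using Cons.prems by (intro filter_cong refl) simp
    also have "sum_list (map (lpar m) \<dots>) = (\<Sum>u\<in>{u. u < n \<and> \<sigma> u < \<sigma> v}. N u)"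
      unfolding N_def by (rule sum_wdeg_bins[symmetric]) simp
    also have "\<dots> = (\<Sum>u<n. (if \<sigma> u < \<sigma> v then 1 else 0) * N u)"
      by (intro sum.mono_neutral_cong_left) auto
    also have "\<dots> = (\<Sum>u<n. I v u * N u + (if u < v \<and> \<sigma> u < \<sigma> v then 1 else 0) * N u)"
      by (intro sum.cong refl) (auto simp: I_def not_less_iff_gr_or_eq)
    finally show ?thesis by (simp add: sum.distrib A_def C_def)
  qed
  have "(-1 :: rat) ^ (d * (A + B)) * (-1) ^ (d * (A + C)) = (-1) ^ (d * (B + C)) * (-1) ^ (2 * (d * A))"
    unfolding power_add[symmetric] by (rule arg_cong[of _ _ "\<lambda>e. (-1) ^ e"]) (simp add: algebra_simps)
  then have signs: "(-1 :: rat) ^ (d * (A + B)) * (-1) ^ (d * (A + C)) = (-1) ^ (d * (B + C))"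
    by simp
  let ?k = "of_int (koszul \<sigma> (map (wdeg m) (bins n lw))) :: rat"
  have "of_int (koszul \<sigma> (map (wdeg m) (bins n (z # lw)))) * sortsign m (map (apsnd \<sigma>) (z # lw))
      = (?k * (-1) ^ (d * (A + B))) * ((-1) ^ (d * (A + C)) * sortsign m (map (apsnd \<sigma>) lw))"
    unfolding kos' by (simp add: z below2 d_def[symmetric])
  also have "\<dots> = ((-1) ^ (d * (A + B)) * (-1) ^ (d * (A + C))) * (?k * sortsign m (map (apsnd \<sigma>) lw))"
    by (simp only: mult_ac)
  also have "\<dots> = sortsign m (z # lw)"
    using Cons.IH Cons.prems unfolding signs by (simp add: z below1 d_def[symmetric])
  finally show ?case .
qed

lemma bins_permute:
  assumes "\<sigma> permutes {..<n}"
  shows "permute_list (inv_into UNIV \<sigma>) (bins n lw) = bins n (map (apsnd \<sigma>) lw)"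
proof (rule nth_equalityI)
  fix v assume "v < length (permute_list (inv_into UNIV \<sigma>) (bins n lw))"
  then have v: "v < n" by simp
  have inv: "inv_into UNIV \<sigma> v < n" using permutes_in_image[OF permutes_inv[OF assms], of v] v by simp
  have "snd z = inv_into UNIV \<sigma> v \<longleftrightarrow> \<sigma> (snd z) = v" for z :: "letter \<times> nat"
    using permutes_inverses[OF assms] by metis
  then show "permute_list (inv_into UNIV \<sigma>) (bins n lw) ! v = bins n (map (apsnd \<sigma>) lw) ! v"
    using v inv by (simp add: permute_list_def bins_nth filter_map o_def)
qed simp

lemma located_permute:
  assumes "wf_edges n es" "wf_locs g n lw" "\<sigma> permutes {..<n}"
  shows "located m n es lw \<approx>[RR m g]
    scl (of_int (sign \<sigma>)) (located m n (map (map_prod \<sigma> \<sigma>) es) (map (apsnd \<sigma>) lw))"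
proof -
  let ?k = "of_int (koszul \<sigma> (map (wdeg m) (bins n lw))) :: rat"
  have "map ((!) es) [0..<length es] = es" by (rule map_nth)
  then have act: "act \<sigma> id {} (DGraph es (bins n lw)) = DGraph (map (map_prod \<sigma> \<sigma>) es) (bins n (map (apsnd \<sigma>) lw))"
    using bins_permute[OF assms(3)] by (simp add: act_def)
  have "bas (DGraph es (bins n lw)) \<approx>[RR m g]
     Poly_Mapping.single (DGraph (map (map_prod \<sigma> \<sigma>) es) (bins n (map (apsnd \<sigma>) lw))) (of_int (sign \<sigma>) * ?k)"
    using group_rel[OF dgraphs_bins[OF assms(1,2)] _ permutes_id, of \<sigma> "{}" m] assms(3)
    unfolding act act_sign_def by simp
  from cm_scl[OF this, of "sortsign m lw"]
  have "located m n es lw \<approx>[RR m g]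
     Poly_Mapping.single (DGraph (map (map_prod \<sigma> \<sigma>) es) (bins n (map (apsnd \<sigma>) lw))) (of_int (sign \<sigma>) * (sortsign m lw * ?k))"
    by (simp add: located_def mult_ac)
  moreover have "sortsign m lw * ?k = sortsign m (map (apsnd \<sigma>) lw)"
  proof -
    have "?k * sortsign m (map (apsnd \<sigma>) lw) = sortsign m lw"
      using assms(2,3) by (intro koszul_sortsign) (auto simp: wf_locs_def)
    moreover have "?k * ?k = 1"
      by (simp add: koszul_def flip: power_add mult_2)
    ultimately show ?thesis by (metis mult.assoc mult.commute mult_1)
  qed
  ultimately show ?thesis by (simp add: located_def)
qed


section \<open>Maps that respect the relations\<close>

abbreviation map_edges :: "(nat \<Rightarrow> nat) \<Rightarrow> (nat \<times> nat) list \<Rightarrow> (nat \<times> nat) list" where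
  "map_edges \<sigma> \<equiv> map (map_prod \<sigma> \<sigma>)"

abbreviation map_locs :: "(nat \<Rightarrow> nat) \<Rightarrow> (letter \<times> nat) list \<Rightarrow> (letter \<times> nat) list" where
  "map_locs \<sigma> \<equiv> map (apsnd \<sigma>)"

lemma lpar_apsnd [simp]: "lpar m (apsnd h z) = lpar m z"
  by (cases z) simp

lemma wf_edges_map_edges: "wf_edges n es \<Longrightarrow> (\<And>v. v < n \<Longrightarrow> h v < k) \<Longrightarrow> wf_edges k (map_edges h es)"
  by (fastforce simp: wf_edges_def)

lemma wf_locs_map_locs: "wf_locs g n lw \<Longrightarrow> (\<And>v. v < n \<Longrightarrow> h v < k) \<Longrightarrow> wf_locs g k (map_locs h lw)"
  by (fastforce simp: wf_locs_def)

lemma permutes_less: "\<sigma> permutes {..<n} \<Longrightarrow> v < n \<Longrightarrow> \<sigma> v < (n::nat)"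
  using permutes_in_image[of \<sigma> "{..<n}" v] by simp

lemma wf_edges_mset: "mset es = mset es' \<Longrightarrow> wf_edges n es = wf_edges n es'"
  by (metis wf_edges_def set_mset_mset)

lemma map_locs_ident [simp]: "map_locs (\<lambda>v. v) lw = lw"
  by (auto intro!: map_idI)

lemma wf_edges_alt: "wf_edges n es \<longleftrightarrow> (\<forall>e\<in>set es. fst e < n \<and> snd e < n)"
  by (auto simp: wf_edges_def)

lemma wf_edges_flips:
  "wf_edges n es \<Longrightarrow> wf_edges n (map (\<lambda>l. if l \<in> F then prod.swap (es ! l) else es ! l) [0..<length es])"
  by (auto simp: wf_edges_alt)

text \<open>
  The relations are generated by the exchange of two neighbouring letters, reorderings of the edges,
  the flip of a single edge and the exchange of two neighbouring vertices.
\<close>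

lemma relations_lin_ext:
  fixes f :: "dgraph \<Rightarrow> 'b \<Rightarrow>\<^sub>0 rat"
  assumes swap: "\<And>n es u a b w. wf_edges n es \<Longrightarrow> wf_locs g n (u @ [a, b] @ w) \<Longrightarrow>
      lin_ext f (located m n es (u @ [a, b] @ w)) \<approx>[rat_free.span S] scl (swap_sign (lpar m) a b) (lin_ext f (located m n es (u @ [b, a] @ w)))"
    and edge: "\<And>n es es' lw. wf_edges n es \<Longrightarrow> wf_locs g n lw \<Longrightarrow> mset es = mset es' \<Longrightarrow>
      lin_ext f (located m n es lw) \<approx>[rat_free.span S] lin_ext f (located m n es' lw)"
    and flip: "\<And>n i j es lw. wf_edges n ((i, j) # es) \<Longrightarrow> wf_locs g n lw \<Longrightarrow>
      lin_ext f (located m n ((i, j) # es) lw) \<approx>[rat_free.span S] - lin_ext f (located m n ((j, i) # es) lw)"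
    and vert: "\<And>n k es lw. wf_edges n es \<Longrightarrow> wf_locs g n lw \<Longrightarrow> Suc k < n \<Longrightarrow>
      lin_ext f (located m n es lw) \<approx>[rat_free.span S] - lin_ext f (located m n (map_edges (swp k) es) (map_locs (swp k) lw))"
    and r: "r \<in> rels m g"
  shows "lin_ext f r \<in> rat_free.span S"
proof -
  let ?G = "\<lambda>n es lw. lin_ext f (located m n es lw)"
  have flip1: "?G n es lw \<approx>[rat_free.span S] - ?G n (es[l := prod.swap (es ! l)]) lw"
    if "wf_edges n es" "wf_locs g n lw" "l < length es" for n es lw l
  proof -
    obtain i j where ij: "es ! l = (i, j)" by (cases "es ! l")
    let ?r = "take l es @ drop (Suc l) es"
    have m1: "mset es = mset ((i, j) # ?r)"
      using id_take_nth_drop[OF that(3)] ij by (metis mset_append mset.simps(2) union_mset_add_mset_right)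
    have m2: "mset ((j, i) # ?r) = mset (es[l := prod.swap (es ! l)])"
      using that(3) ij by (simp add: upd_conv_take_nth_drop)
    have w1: "wf_edges n ((i, j) # ?r)" using that(1) wf_edges_mset[OF m1] by simp
    then have w2: "wf_edges n ((j, i) # ?r)" by (auto simp: wf_edges_def)
    have "?G n es lw \<approx>[rat_free.span S] ?G n ((i, j) # ?r) lw"
      by (rule edge[OF that(1,2) m1])
    also have "?G n ((i, j) # ?r) lw \<approx>[rat_free.span S] - ?G n ((j, i) # ?r) lw"
      by (rule flip[OF w1 that(2)])
    also have "- ?G n ((j, i) # ?r) lw \<approx>[rat_free.span S] - ?G n (es[l := prod.swap (es ! l)]) lw"
      by (rule cm_minus, rule edge[OF w2 that(2) m2])
    finally show ?thesis .
  qed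
  have flips: "?G n es lw \<approx>[rat_free.span S] scl ((-1) ^ card F)
      (?G n (map (\<lambda>l. if l \<in> F then prod.swap (es ! l) else es ! l) [0..<length es]) lw)"
    if "wf_edges n es" "wf_locs g n lw" "F \<subseteq> {..<length es}" for n es lw F
  proof -
    have "finite F" using that(3) finite_subset by blast
    then show ?thesis using that(3)
    proof (induction F rule: finite_induct)
      case empty
      then show ?case by (simp add: map_nth)
    next
      case (insert l F)
      let ?h = "\<lambda>F. map (\<lambda>l. if l \<in> F then prod.swap (es ! l) else es ! l) [0..<length es]"
      have "wf_edges n (?h F)" using that(1) by (rule wf_edges_flips)
      moreover have "?h (insert l F) = (?h F)[l := prod.swap (?h F ! l)]"
        using insert by (intro nth_equalityI) (auto simp: nth_list_update)
      ultimately have "?G n (?h F) lw \<approx>[rat_free.span S] - ?G n (?h (insert l F)) lw"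
        using flip1[of n "?h F" lw l] that(2) insert.prems by simp
      from cm_scl[OF this, of "(-1) ^ card F"]
      have "scl ((-1) ^ card F) (?G n (?h F) lw) \<approx>[rat_free.span S] scl ((-1) ^ card (insert l F)) (?G n (?h (insert l F)) lw)"
        using insert.hyps by (simp add: scl_minus scl_minus_left)
      moreover have "?G n es lw \<approx>[rat_free.span S] scl ((-1) ^ card F) (?G n (?h F) lw)"
        using insert by simp
      ultimately show ?case using cm_trans by blast
    qed
  qed
  have verts: "\<forall>es lw. wf_edges n es \<longrightarrow> wf_locs g n lw \<longrightarrow>
      ?G n es lw \<approx>[rat_free.span S] scl (of_int (sign \<sigma>)) (?G n (map_edges \<sigma> es) (map_locs \<sigma> lw))"
    if "\<sigma> permutes {..<n}" for n \<sigma>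
    using that
  proof (induction rule: permutes_adjacent_induct)
    case id
    have "map_edges id es = es" "map_locs id lw = lw" for es lw
      by (auto intro!: map_idI)
    then show ?case by (simp only: sign_id of_int_1 scl_simps cm_refl simp_thms)
  next
    case (swap k \<tau>)
    show ?case
    proof (intro allI impI)
      fix es lw assume w: "wf_edges n es" "wf_locs g n lw"
      have w': "wf_edges n (map_edges \<tau> es)" "wf_locs g n (map_locs \<tau> lw)"
        using w permutes_less[OF swap.hyps(2)] by (auto intro: wf_edges_map_edges wf_locs_map_locs)
      have "permutation \<tau>" using swap.hyps(2) by (rule permutes_imp_permutation[rotated]) simp
      then have sg: "sign (swp k \<circ> \<tau>) = - sign \<tau>"
        using sign_compose[of "swp k" \<tau>] permutation_swap_id[of k "Suc k"] by (simp add: sign_swap_id)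
      have comp: "map_edges (swp k \<circ> \<tau>) es = map_edges (swp k) (map_edges \<tau> es)" "map_locs (swp k \<circ> \<tau>) lw = map_locs (swp k) (map_locs \<tau> lw)"
        by (auto simp: map_prod_def apsnd_def)
      have "?G n es lw \<approx>[rat_free.span S] scl (of_int (sign \<tau>)) (?G n (map_edges \<tau> es) (map_locs \<tau> lw))"
        using swap.IH w by blast
      also have "scl (of_int (sign \<tau>)) (?G n (map_edges \<tau> es) (map_locs \<tau> lw)) \<approx>[rat_free.span S]
          scl (of_int (sign \<tau>)) (- ?G n (map_edges (swp k) (map_edges \<tau> es)) (map_locs (swp k) (map_locs \<tau> lw)))"
        by (rule cm_scl, rule vert[OF w' swap.hyps(1)])
      finally show "?G n es lw \<approx>[rat_free.span S] scl (of_int (sign (swp k \<circ> \<tau>))) (?G n (map_edges (swp k \<circ> \<tau>) es) (map_locs (swp k \<circ> \<tau>) lw))"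
        unfolding sg comp by (simp add: scl_minus scl_minus_left)
    qed
  qed
  from r show ?thesis
  proof
    assume "r \<in> group_relations m g"
    then obtain \<Gamma> \<sigma> \<pi> F where r: "r = bas \<Gamma> - Poly_Mapping.single (act \<sigma> \<pi> F \<Gamma>) (of_int (act_sign m \<sigma> F \<Gamma>))"
      and \<Gamma>: "\<Gamma> \<in> dgraphs g" and \<sigma>: "\<sigma> permutes {..<nverts \<Gamma>}" and \<pi>: "\<pi> permutes {..<nedges \<Gamma>}"
      and F: "F \<subseteq> {..<nedges \<Gamma>}"
      unfolding group_relations_def by blast
    define n es lw where "n = nverts \<Gamma>" and "es = edges \<Gamma>" and "lw = flat 0 (decs \<Gamma>)"
    define es1 where "es1 = map (\<lambda>l. if l \<in> F then prod.swap (es ! l) else es ! l) [0..<length es]"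
    define es2 where "es2 = permute_list \<pi> es1"
    have bas: "bas \<Gamma> = located m n es lw" and w: "wf_edges n es" "wf_locs g n lw"
      using dgraphs_located[OF \<Gamma>] unfolding n_def es_def lw_def by blast+
    have w1: "wf_edges n es1" unfolding es1_def using w(1) by (rule wf_edges_flips)
    have m12: "mset es1 = mset es2" using \<pi> by (simp add: es2_def es1_def es_def)
    have w2: "wf_edges n es2" using w1 wf_edges_mset[OF m12] by simp
    have decs: "decs \<Gamma> = bins n lw" by (simp add: n_def lw_def)
    have act: "act \<sigma> \<pi> F \<Gamma> = DGraph (map_edges \<sigma> es2) (bins n (map_locs \<sigma> lw))"
      using bins_permute[of \<sigma> n lw] \<sigma> unfolding act_def decs es2_def es1_def es_def by (simp add: n_def)
    let ?k = "of_int (koszul \<sigma> (map (wdeg m) (decs \<Gamma>))) :: rat"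
    have "?k * sortsign m (map_locs \<sigma> lw) = sortsign m lw"
      unfolding decs using w(2) \<sigma> by (intro koszul_sortsign) (auto simp: wf_locs_def n_def)
    then have "?k * sortsign m (map_locs \<sigma> lw) = 1" by (simp add: lw_def)
    then have k: "?k = sortsign m (map_locs \<sigma> lw)"
      by (metis sortsign_sq mult.assoc mult_1 mult.right_neutral)
    have "r = located m n es lw - scl ((-1) ^ card F * of_int (sign \<sigma>)) (located m n (map_edges \<sigma> es2) (map_locs \<sigma> lw))"
      unfolding r bas act act_sign_def by (simp add: located_def k[symmetric] mult_ac)
    then have r': "lin_ext f r = ?G n es lw - scl ((-1) ^ card F * of_int (sign \<sigma>)) (?G n (map_edges \<sigma> es2) (map_locs \<sigma> lw))"
      by (simp only: lin_ext_diff lin_ext_scl)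
    have "?G n es lw \<approx>[rat_free.span S] scl ((-1) ^ card F) (?G n es1 lw)"
      using flips[OF w, of F] F unfolding es1_def es_def by blast
    also have "scl ((-1) ^ card F) (?G n es1 lw) \<approx>[rat_free.span S] scl ((-1) ^ card F) (?G n es2 lw)"
      by (rule cm_scl, rule edge[OF w1 w(2) m12])
    also have "scl ((-1) ^ card F) (?G n es2 lw) \<approx>[rat_free.span S]
        scl ((-1) ^ card F) (scl (of_int (sign \<sigma>)) (?G n (map_edges \<sigma> es2) (map_locs \<sigma> lw)))"
      using verts[of \<sigma> n] \<sigma> w2 w(2) by (intro cm_scl) (simp add: n_def)
    finally show ?thesis unfolding r' cong_mod_def by (simp only: scl_simps)
  next
    assume "r \<in> symmetric_relations m g"
    then obtain es as us x y vs bs where r: "r = bas (DGraph es (as @ (us @ [x, y] @ vs) # bs))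
        - Poly_Mapping.single (DGraph es (as @ (us @ [y, x] @ vs) # bs)) ((-1) ^ (ldeg m x * ldeg m y))"
      and \<Gamma>: "DGraph es (as @ (us @ [x, y] @ vs) # bs) \<in> dgraphs g"
      unfolding symmetric_relations_def by blast
    let ?v = "length as" and ?n = "length as + Suc (length bs)"
    let ?U = "flat 0 as @ map (\<lambda>x. (x, ?v)) us" and ?W = "map (\<lambda>x. (x, ?v)) vs @ flat (Suc ?v) bs"
    have fl: "flat 0 (as @ (us @ [p, q] @ vs) # bs) = ?U @ [(p, ?v), (q, ?v)] @ ?W" for p q
      by (simp add: flat_append)
    have b: "bas (DGraph es (as @ (us @ [p, q] @ vs) # bs)) = located m ?n es (?U @ [(p, ?v), (q, ?v)] @ ?W)" for p q
      using located_flat[of m "as @ (us @ [p, q] @ vs) # bs" es] unfolding fl by simp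
    have w: "wf_edges ?n es" "wf_locs g ?n (?U @ [(x, ?v), (y, ?v)] @ ?W)"
      using dgraphs_located(2,3)[OF \<Gamma>] unfolding dgraph.sel fl by simp_all
    have "Poly_Mapping.single (DGraph es (as @ (us @ [y, x] @ vs) # bs)) ((-1) ^ (ldeg m x * ldeg m y))
      = scl (swap_sign (lpar m) (x, ?v) (y, ?v)) (bas (DGraph es (as @ (us @ [y, x] @ vs) # bs)))"
      by (simp add: swap_sign_def)
    then have "lin_ext f r = ?G ?n es (?U @ [(x, ?v), (y, ?v)] @ ?W)
        - scl (swap_sign (lpar m) (x, ?v) (y, ?v)) (?G ?n es (?U @ [(y, ?v), (x, ?v)] @ ?W))"
      unfolding r b by (simp only: lin_ext_diff lin_ext_scl)
    with swap[OF w] show ?thesis by (simp add: cong_mod_def)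
  qed
qed


section \<open>Sums over the edges\<close>

text \<open>
  A summand receives an edge and the list of the remaining edges.
\<close>

definition edge_sum :: "('e \<Rightarrow> 'e list \<Rightarrow> 'v::comm_monoid_add) \<Rightarrow> 'e list \<Rightarrow> 'v" where
  "edge_sum f es = (\<Sum>l<length es. f (es ! l) (drop_nth l es))"

lemma mset_drop_nth: "l < length es \<Longrightarrow> add_mset (es ! l) (mset (drop_nth l es)) = mset es"
proof -
  assume "l < length es"
  then have "mset es = mset (take l es @ es ! l # drop (Suc l) es)" by (simp add: id_take_nth_drop[symmetric])
  then show ?thesis by (simp add: drop_nth_def)
qed

lemma edge_sum_Nil [simp]: "edge_sum f [] = 0"
  by (simp add: edge_sum_def)

lemma edge_sum_Cons: "edge_sum f (e # es) = f e es + edge_sum (\<lambda>e' r. f e' (e # r)) es"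
  by (simp add: edge_sum_def sum.lessThan_Suc_shift drop_nth_def del: sum.lessThan_Suc)

lemma edge_sum_map: "edge_sum f (map h es) = edge_sum (\<lambda>e r. f (h e) (map h r)) es"
  by (induction es arbitrary: f) (simp_all add: edge_sum_Cons)

lemma edge_sum_add: "edge_sum (\<lambda>e r. f e r + h e r) es = edge_sum f es + edge_sum h es"
  by (simp add: edge_sum_def sum.distrib)

lemma edge_sum_sum: "edge_sum (\<lambda>e r. \<Sum>a\<in>A. f a e r) es = (\<Sum>a\<in>A. edge_sum (f a) es)"
  unfolding edge_sum_def by (rule sum.swap)

lemma edge_sum_scl: "edge_sum (\<lambda>e r. scl c (f e r)) es = scl c (edge_sum f es)"
  by (simp add: edge_sum_def scl_sum)

lemma lin_ext_edge_sum: "lin_ext h (edge_sum f es) = edge_sum (\<lambda>e r. lin_ext h (f e r)) es"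
  by (simp add: edge_sum_def lin_ext_sum)

lemma edge_sum_cong:
  assumes "\<And>e r. add_mset e (mset r) = mset es \<Longrightarrow> f e r \<approx>[rat_free.span S] h e r"
  shows "edge_sum f es \<approx>[rat_free.span S] edge_sum h es"
  unfolding edge_sum_def by (intro cm_sum assms mset_drop_nth) simp

lemma edge_sum_mset:
  assumes "mset es' = mset es"
    and "\<And>e r r'. add_mset e (mset r) = mset es \<Longrightarrow> mset r' = mset r \<Longrightarrow> f e r' \<approx>[rat_free.span S] f e r"
  shows "edge_sum f es' \<approx>[rat_free.span S] edge_sum f es"
proof -
  obtain \<pi> where p: "\<pi> permutes {..<length es}" "permute_list \<pi> es = es'"
    by (rule mset_eq_permutation[OF assms(1)])
  have len: "length es' = length es" using assms(1) by (rule mset_eq_length)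
  have "(\<Sum>l<length es. f (es' ! l) (drop_nth l es')) \<approx>[rat_free.span S]
      (\<Sum>l<length es. f (es ! \<pi> l) (drop_nth (\<pi> l) es))"
  proof (rule cm_sum)
    fix l assume "l \<in> {..<length es}"
    then have l: "l < length es" "\<pi> l < length es" using permutes_less[OF p(1)] by auto
    have nth: "es' ! l = es ! \<pi> l" using p l by (simp add: permute_list_nth flip: p(2))
    have "add_mset (es ! \<pi> l) (mset (drop_nth l es')) = mset es"
      using mset_drop_nth[of l es'] l len assms(1) nth by simp
    then have "mset (drop_nth l es') = mset (drop_nth (\<pi> l) es)"
      using mset_drop_nth[OF l(2)] by (metis add_mset_add_mset_same_iff)
    then show "f (es' ! l) (drop_nth l es') \<approx>[rat_free.span S] f (es ! \<pi> l) (drop_nth (\<pi> l) es)"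
      unfolding nth by (rule assms(2)[OF mset_drop_nth[OF l(2)]])
  qed
  also have "(\<Sum>l<length es. f (es ! \<pi> l) (drop_nth (\<pi> l) es)) = (\<Sum>l<length es. f (es ! l) (drop_nth l es))"
    using sum.permute[OF p(1), of "\<lambda>l. f (es ! l) (drop_nth l es)"] by (simp add: o_def)
  finally show ?thesis by (simp add: edge_sum_def len)
qed

text \<open>
  The pattern behind every square-zero statement about edges: a sum over ordered pairs of edges vanishes if
  its terms are antisymmetric in the pair.
\<close>

lemma edge_sum_antisym:
  assumes "\<And>e e' r. set (e # e' # r) \<subseteq> set es \<Longrightarrow> T e e' r \<approx>[rat_free.span S] - T e' e r"
  shows "edge_sum (\<lambda>e r. edge_sum (\<lambda>e' r'. T e e' r') r) es \<approx>[rat_free.span S] 0"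
  using assms
proof (induction es arbitrary: T)
  case Nil then show ?case by simp
next
  case (Cons e es)
  have "edge_sum (\<lambda>e r. edge_sum (\<lambda>e' r'. T e e' r') r) (e # es)
    = (edge_sum (\<lambda>e' r. T e e' r) es + edge_sum (\<lambda>e' r. T e' e r) es)
      + edge_sum (\<lambda>e1 r. edge_sum (\<lambda>e2 r'. T e1 e2 (e # r')) r) es"
    by (simp add: edge_sum_Cons edge_sum_add)
  also have "\<dots> \<approx>[rat_free.span S] (edge_sum (\<lambda>e' r. scl (-1) (T e' e r)) es + edge_sum (\<lambda>e' r. T e' e r) es) + 0"
  proof (intro cm_add cm_refl)
    show "edge_sum (\<lambda>e' r. T e e' r) es \<approx>[rat_free.span S] edge_sum (\<lambda>e' r. scl (-1) (T e' e r)) es"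
    proof (rule edge_sum_cong)
      fix e' r assume "add_mset e' (mset r) = mset es"
      then have "set (e' # r) = set es" by (metis mset.simps(2) set_mset_mset)
      then have "T e e' r \<approx>[rat_free.span S] - T e' e r" by (intro Cons.prems) auto
      then show "T e e' r \<approx>[rat_free.span S] scl (-1) (T e' e r)" by (simp add: scl_minus_left)
    qed
    show "edge_sum (\<lambda>e1 r. edge_sum (\<lambda>e2 r'. T e1 e2 (e # r')) r) es \<approx>[rat_free.span S] 0"
      by (rule Cons.IH, rule Cons.prems) auto
  qed
  also have "(edge_sum (\<lambda>e' r. scl (-1) (T e' e r)) es + edge_sum (\<lambda>e' r. T e' e r) es) + 0 = 0"
    unfolding edge_sum_scl by (simp add: scl_minus_left)
  finally show ?case .
qed


section \<open>The differential in terms of located words\<close>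

abbreviation AB :: "bool \<Rightarrow> nat \<Rightarrow> letter" where
  "AB b p \<equiv> (if b then Alpha p else Beta p)"

text \<open>
  One edge's contribution to \<open>d_cut\<close>: the two factors of \<open>\<Delta>\<close> are put in front of the word, located
  at the ends of the edge. The sum over \<open>b\<close> produces the two terms of \<open>\<Delta>\<close>.
\<close>

definition cut_term :: "nat \<Rightarrow> nat \<Rightarrow> nat \<Rightarrow> nat \<times> nat \<Rightarrow> (nat \<times> nat) list \<Rightarrow> (letter \<times> nat) list \<Rightarrow> dgraph \<Rightarrow>\<^sub>0 rat" where
  "cut_term m g n e r lw = (\<Sum>p<g. \<Sum>b\<in>UNIV. scl ((-1) ^ (n + m) * (if b then 1 else -1))
     (located m n r ((AB b p, fst e) # (AB (\<not> b) p, snd e) # lw)))"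

definition contract_term :: "nat \<Rightarrow> nat \<Rightarrow> nat \<times> nat \<Rightarrow> (nat \<times> nat) list \<Rightarrow> (letter \<times> nat) list \<Rightarrow> dgraph \<Rightarrow>\<^sub>0 rat" where
  "contract_term m n e r lw = (if fst e = snd e then 0 else scl ((-1) ^ Suc (snd e))
     (located m (n - 1) (map_edges (contract_vertex (fst e) (snd e)) r) (map_locs (contract_vertex (fst e) (snd e)) lw)))"

lemma d_cut_located:
  assumes "wf_edges n es"
  shows "lin_ext (d_cut m g) (located m n es lw) = edge_sum (\<lambda>e r. cut_term m g n e r lw) es"
proof -
  have LM: "scl (sortsign m lw) (left_mult2 m x i y j (DGraph r (bins n lw))) = located m n r ((x, i) # (y, j) # lw)"
    if "i < n" "j < n" for x y i j r
  proof -
    have "scl (sortsign m lw) (left_mult2 m x i y j (DGraph r (bins n lw)))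
      = lin_ext (left_mult m x i) (lin_ext (left_mult m y j) (located m n r lw))"
      by (simp only: left_mult2_def located_def lin_ext_single lin_ext_scl)
    then show ?thesis using that by (simp add: left_mult_located)
  qed
  have cut: "scl ((-1) ^ n * sortsign m lw) (cut_edge m g (DGraph es (bins n lw)) l) = cut_term m g n (es ! l) (drop_nth l es) lw"
    if "l < length es" for l
  proof -
    obtain i j where ij: "es ! l = (i, j)" by (cases "es ! l")
    then have less: "i < n" "j < n" using assms that by (auto simp: wf_edges_def dest!: nth_mem)
    have "scl ((-1) ^ n * sortsign m lw) (cut_edge m g (DGraph es (bins n lw)) l)
      = scl ((-1) ^ (n + m)) (\<Sum>p<g. scl (sortsign m lw) (left_mult2 m (Alpha p) i (Beta p) j (DGraph (drop_nth l es) (bins n lw)))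
           - scl (sortsign m lw) (left_mult2 m (Beta p) i (Alpha p) j (DGraph (drop_nth l es) (bins n lw))))"
      by (simp add: cut_edge_def ij Let_def scl_sum scl_diff power_add mult_ac)
    then show ?thesis
      by (simp add: LM[OF less] cut_term_def ij UNIV_bool scl_sum scl_diff scl_minus_left)
  qed
  have "lin_ext (d_cut m g) (located m n es lw) = (\<Sum>l<length es. scl ((-1) ^ n * sortsign m lw) (cut_edge m g (DGraph es (bins n lw)) l))"
    by (simp add: located_def d_cut_def scl_sum mult.commute)
  also have "\<dots> = edge_sum (\<lambda>e r. cut_term m g n e r lw) es"
    unfolding edge_sum_def by (intro sum.cong refl cut) simp
  finally show ?thesis .
qed

lemma contract_less: "v < n \<Longrightarrow> i < n \<Longrightarrow> j < n \<Longrightarrow> i \<noteq> j \<Longrightarrow> contract_vertex i j v < n - 1"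
  by (auto simp: contract_vertex_def Let_def)

lemma map_locs_flat:
  "(\<And>v. k \<le> v \<Longrightarrow> v < k + length ds \<Longrightarrow> c v + k = v + k') \<Longrightarrow> map_locs c (flat k ds) = flat k' ds"
proof (induction ds arbitrary: k k')
  case Nil then show ?case by simp
next
  case (Cons w ds)
  have "c k = k'" using Cons.prems[of k] by simp
  moreover have "map_locs c (flat (Suc k) ds) = flat (Suc k') ds"
    using Cons.prems by (intro Cons.IH) fastforce
  ultimately show ?case by simp
qed

lemma sum_wdeg_block:
  "(\<Sum>v | length A \<le> v \<and> v < length A + length M. wdeg m ((A @ M @ B) ! v)) = sum_list (map (wdeg m) M)"
proof -
  have "(\<Sum>v | length A \<le> v \<and> v < length A + length M. wdeg m ((A @ M @ B) ! v)) = (\<Sum>v<length M. wdeg m (M ! v))"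
    by (rule sum.reindex_bij_witness[of _ "\<lambda>v. v + length A" "\<lambda>v. v - length A"]) (auto simp: nth_append)
  then show ?thesis by (simp add: sum_list_sum_nth atLeast0LessThan)
qed

text \<open>
  Contraction moves one block of letters behind another one. In terms of located words the block
  only changes its location, and sorting produces the Koszul sign of the definition.
\<close>

lemma contract_flat:
  assumes ij: "i < length ds" "j < length ds" "i \<noteq> j"
  shows "bas (map_locs (contract_vertex i j) (flat 0 ds)) \<approx>[srel (lpar m)]
    scl ((-1) ^ (wdeg m (ds ! j) * (\<Sum>v | i < v \<and> v < j \<or> j < v \<and> v \<le> i. wdeg m (ds ! v))))
      (bas (flat 0 (drop_nth j (ds[i := ds ! i @ ds ! j]))))"
proof -
  let ?c = "contract_vertex i j"
  let ?L = "\<lambda>k w. map (\<lambda>x. (x, k)) w :: (letter \<times> nat) list"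
  have par: "sum_list (map (lpar m) (?L k w)) = wdeg m w" for k w
    by (simp add: wdeg_def o_def)
  show ?thesis
  proof (cases "i < j")
    case True
    define A M B where "A = take i ds" and "M = take (j - Suc i) (drop (Suc i) ds)" and "B = drop (Suc j) ds"
    have len: "length A = i" "length M = j - Suc i" using ij True by (auto simp: A_def M_def)
    have "drop (Suc i) ds = M @ drop (j - Suc i) (drop (Suc i) ds)" unfolding M_def by (rule append_take_drop_id[symmetric])
    moreover have "drop (j - Suc i) (drop (Suc i) ds) = ds ! j # B"
      using ij True by (simp add: B_def Cons_nth_drop_Suc)
    ultimately have "drop (Suc i) ds = M @ ds ! j # B" by (simp only:)
    then have ds: "ds = A @ ds ! i # M @ ds ! j # B"
      using id_take_nth_drop[OF ij(1)] by (simp only: A_def)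
    obtain wi wj where w: "wi = ds ! i" "wj = ds ! j" by simp
    have ds: "ds = A @ wi # M @ wj # B" using ds w by simp
    have new: "drop_nth j (ds[i := wi @ wj]) = A @ (wi @ wj) # M @ B"
    proof -
      have "ds[i := wi @ wj] = A @ (wi @ wj) # M @ wj # B"
        using len(1) by (subst ds) (simp add: list_update_append)
      moreover have "j = length (A @ (wi @ wj) # M)" using len ij True by simp
      ultimately show ?thesis by (simp add: drop_nth_def)
    qed
    have cA: "map_locs ?c (flat 0 A) = flat 0 A"
      using len True by (intro map_locs_flat) (auto simp: contract_vertex_def Let_def)
    have cM: "map_locs ?c (flat (Suc i) M) = flat (Suc i) M"
      using len True by (intro map_locs_flat) (auto simp: contract_vertex_def Let_def)
    have cB: "map_locs ?c (flat (Suc j) B) = flat j B"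
      using len True by (intro map_locs_flat) (auto simp: contract_vertex_def Let_def)
    have ci: "?c i = i" "?c j = i" using True by (auto simp: contract_vertex_def Let_def)
    have "flat 0 ds = flat 0 A @ ?L i wi @ flat (Suc i) M @ ?L j wj @ flat (Suc j) B"
      using len ij True by (subst ds) (simp add: flat_append)
    then have L: "map_locs ?c (flat 0 ds) = (flat 0 A @ ?L i wi) @ flat (Suc i) M @ ?L i wj @ flat j B"
      by (simp add: cA cM cB ci o_def)
    have R: "flat 0 (drop_nth j (ds[i := wi @ wj])) = (flat 0 A @ ?L i wi) @ ?L i wj @ flat (Suc i) M @ flat j B"
      using len ij True unfolding new by (simp add: flat_append)
    have "(\<Sum>v | i < v \<and> v < j \<or> j < v \<and> v \<le> i. wdeg m (ds ! v)) = sum_list (map (wdeg m) M)"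
    proof -
      have "{v. i < v \<and> v < j \<or> j < v \<and> v \<le> i} = {v. length (A @ [wi]) \<le> v \<and> v < length (A @ [wi]) + length M}"
        using len True by auto
      then show ?thesis
        using sum_wdeg_block[where A = "A @ [wi]" and M = M and B = "wj # B" and m = m] by (subst ds) simp
    qed
    moreover have "bas (map_locs ?c (flat 0 ds)) \<approx>[srel (lpar m)]
        scl ((-1) ^ (sum_list (map (wdeg m) M) * wdeg m wj)) (bas (flat 0 (drop_nth j (ds[i := wi @ wj]))))"
      unfolding L R using word_move[of "flat (Suc i) M" "?L i wj" "flat j B" "lpar m"]
      unfolding par sum_flat by (rule word_prefix)
    ultimately show ?thesis using w by (simp add: mult.commute)
  next
    case False
    then have ji: "j < i" using ij by simp
    define A M B where "A = take j ds" and "M = take (i - Suc j) (drop (Suc j) ds)" and "B = drop (Suc i) ds"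
    have len: "length A = j" "length M = i - Suc j" using ij ji by (auto simp: A_def M_def)
    have "drop (Suc j) ds = M @ drop (i - Suc j) (drop (Suc j) ds)" unfolding M_def by (rule append_take_drop_id[symmetric])
    moreover have "drop (i - Suc j) (drop (Suc j) ds) = ds ! i # B"
      using ij ji by (simp add: B_def Cons_nth_drop_Suc)
    ultimately have "drop (Suc j) ds = M @ ds ! i # B" by (simp only:)
    then have ds: "ds = A @ ds ! j # M @ ds ! i # B"
      using id_take_nth_drop[OF ij(2)] by (simp only: A_def)
    obtain wi wj where w: "wi = ds ! i" "wj = ds ! j" by simp
    have ds: "ds = A @ wj # M @ wi # B" using ds w by simp
    have new: "drop_nth j (ds[i := wi @ wj]) = A @ M @ (wi @ wj) # B"
    proof -
      have i: "i = length (A @ wj # M)" using len ij ji by simp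
      have "ds[i := wi @ wj] = (A @ wj # M) @ (wi @ wj) # B"
        unfolding i by (subst ds) (simp add: list_update_append)
      then show ?thesis using len by (simp add: drop_nth_def)
    qed
    have cA: "map_locs ?c (flat 0 A) = flat 0 A"
      using len ji by (intro map_locs_flat) (auto simp: contract_vertex_def Let_def)
    have cM: "map_locs ?c (flat (Suc j) M) = flat j M"
      using len ji by (intro map_locs_flat) (auto simp: contract_vertex_def Let_def)
    have cB: "map_locs ?c (flat (Suc i) B) = flat i B"
      using len ji by (intro map_locs_flat) (auto simp: contract_vertex_def Let_def)
    have ci: "?c i = i - 1" "?c j = i - 1" using ji by (auto simp: contract_vertex_def Let_def)
    have "flat 0 ds = flat 0 A @ ?L j wj @ flat (Suc j) M @ ?L i wi @ flat (Suc i) B"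
      using len ij ji by (subst ds) (simp add: flat_append)
    then have L: "map_locs ?c (flat 0 ds) = flat 0 A @ ?L (i - 1) wj @ (flat j M @ ?L (i - 1) wi) @ flat i B"
      by (simp add: cA cM cB ci o_def)
    have "j + length M = i - 1" using len ji by simp
    then have R: "flat 0 (drop_nth j (ds[i := wi @ wj])) = flat 0 A @ (flat j M @ ?L (i - 1) wi) @ ?L (i - 1) wj @ flat i B"
      using len ij ji unfolding new by (simp add: flat_append)
    have "(\<Sum>v | i < v \<and> v < j \<or> j < v \<and> v \<le> i. wdeg m (ds ! v)) = sum_list (map (wdeg m) (M @ [wi]))"
    proof -
      have "{v. i < v \<and> v < j \<or> j < v \<and> v \<le> i} = {v. length (A @ [wj]) \<le> v \<and> v < length (A @ [wj]) + length (M @ [wi])}"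
        using len ji by auto
      then show ?thesis
        using sum_wdeg_block[where A = "A @ [wj]" and M = "M @ [wi]" and B = B and m = m] by (subst ds) simp
    qed
    moreover have "bas (map_locs ?c (flat 0 ds)) \<approx>[srel (lpar m)]
        scl ((-1) ^ (wdeg m wj * sum_list (map (wdeg m) (M @ [wi])))) (bas (flat 0 (drop_nth j (ds[i := wi @ wj]))))"
    proof -
      have "sum_list (map (lpar m) (flat j M @ ?L (i - 1) wi)) = sum_list (map (wdeg m) (M @ [wi]))"
        using par[of "i - 1" wi] sum_flat[of m j M] by simp
      then show ?thesis
        unfolding L R using word_prefix[OF word_move[of "?L (i - 1) wj" "flat j M @ ?L (i - 1) wi" "flat i B" "lpar m"], of "flat 0 A"]
        unfolding par by simp
    qed
    ultimately show ?thesis using w by simp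
  qed
qed

lemma d_c_located:
  assumes w: "wf_edges n es" "wf_locs g n lw"
  shows "lin_ext (d_c m) (located m n es lw) \<approx>[RR m g] edge_sum (\<lambda>e r. contract_term m n e r lw) es"
proof -
  let ?R = "RR m g" and ?ds = "bins n lw"
  have lw_n: "\<forall>z\<in>set lw. snd z < n" using w(2) by (auto simp: wf_locs_def)
  have con: "scl ((-1) ^ Suc (snd (es ! l)) * sortsign m lw) (contract_edge m (DGraph es ?ds) l) \<approx>[?R] contract_term m n (es ! l) (drop_nth l es) lw"
    if "l < length es" for l
  proof -
    obtain i j where e: "es ! l = (i, j)" by (cases "es ! l")
    then have less: "i < n" "j < n" using w(1) that by (auto simp: wf_edges_def dest!: nth_mem)
    show ?thesis
    proof (cases "i = j")
      case True then show ?thesis by (simp add: contract_edge_def contract_term_def e)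
    next
      case False
      let ?c = "contract_vertex i j"
      define r ds' where "r = map_edges ?c (drop_nth l es)" and "ds' = drop_nth j (?ds[i := ?ds ! i @ ?ds ! j])"
      define \<kappa> :: rat where "\<kappa> = (-1) ^ (wdeg m (?ds ! j) * (\<Sum>v | i < v \<and> v < j \<or> j < v \<and> v \<le> i. wdeg m (?ds ! v)))"
      have len': "length ds' = n - 1" using less by (simp add: ds'_def drop_nth_def)
      have con: "contract_edge m (DGraph es ?ds) l = scl \<kappa> (bas (DGraph r ds'))"
        using False by (simp add: contract_edge_def Let_def e r_def ds'_def \<kappa>_def)
      have "set (drop_nth l es) \<subseteq> set es" by (auto simp: drop_nth_def dest: in_set_takeD in_set_dropD)
      then have "wf_edges n (drop_nth l es)" using w(1) by (auto simp: wf_edges_def)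
      then have wr: "wf_edges (n - 1) r"
        unfolding r_def using contract_less less False by (intro wf_edges_map_edges)
      have wl: "wf_locs g (n - 1) (map_locs ?c lw)"
        using w(2) contract_less less False by (intro wf_locs_map_locs)
      have dgr: "DGraph es ?ds \<in> dgraphs g" by (rule dgraphs_bins[OF w])
      then have "wf_locs g n (flat 0 ?ds)" using dgraphs_located(3)[OF dgr] by simp
      then have wf: "wf_locs g (n - 1) (map_locs ?c (flat 0 ?ds))"
        using contract_less less False by (intro wf_locs_map_locs)
      have "\<forall>w\<in>set ds'. \<forall>x\<in>set w. index x < g"
      proof -
        have "set ds' \<subseteq> set (?ds[i := ?ds ! i @ ?ds ! j])"
          unfolding ds'_def drop_nth_def by (auto dest: in_set_takeD in_set_dropD)
        also have "\<dots> \<subseteq> insert (?ds ! i @ ?ds ! j) (set ?ds)" by (rule set_update_subset_insert)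
        finally have "set ds' \<subseteq> insert (?ds ! i @ ?ds ! j) (set ?ds)" .
        moreover have "?ds ! i \<in> set ?ds" "?ds ! j \<in> set ?ds" using less by simp_all
        moreover have "\<forall>w\<in>set ?ds. \<forall>x\<in>set w. index x < g" using dgr by (simp add: dgraphs_def)
        ultimately have "\<forall>w\<in>insert (?ds ! i @ ?ds ! j) (set ?ds). \<forall>x\<in>set w. index x < g"
          and "set ds' \<subseteq> insert (?ds ! i @ ?ds ! j) (set ?ds)" by auto
        then show ?thesis by (meson subsetD)
      qed
      from wf_locs_flat[OF this, of 0] have wd: "wf_locs g (n - 1) (flat 0 ds')" by (simp add: len')
      have c1: "located m (n - 1) r (map_locs ?c lw) \<approx>[?R] scl (sortsign m lw) (located m (n - 1) r (map_locs ?c (flat 0 ?ds)))"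
        by (rule located_cong[OF word_sort[OF lw_n] wr wl wf])
      have c2: "located m (n - 1) r (map_locs ?c (flat 0 ?ds)) \<approx>[?R] scl \<kappa> (located m (n - 1) r (flat 0 ds'))"
      proof -
        have "bas (map_locs ?c (flat 0 ?ds)) \<approx>[srel (lpar m)] scl \<kappa> (bas (flat 0 ds'))"
          using contract_flat[of i ?ds j m] less False by (simp add: \<kappa>_def ds'_def)
        from located_cong[OF this wr, of g "\<lambda>v. v", unfolded map_locs_ident, OF wf wd] show ?thesis .
      qed
      have c3: "located m (n - 1) r (flat 0 ds') = bas (DGraph r ds')"
        using located_flat[of m ds' r] by (simp add: len')
      from cm_trans[OF c1 cm_scl[OF c2]] have "scl (sortsign m lw) (contract_edge m (DGraph es ?ds) l) \<approx>[?R] located m (n - 1) r (map_locs ?c lw)"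
        unfolding con c3 by (rule cm_sym)
      from cm_scl[OF this, of "(-1) ^ Suc j"] show ?thesis
        using False by (simp add: contract_term_def e r_def)
    qed
  qed
  have "lin_ext (d_c m) (located m n es lw) = (\<Sum>l<length es. scl ((-1) ^ Suc (snd (es ! l)) * sortsign m lw) (contract_edge m (DGraph es ?ds) l))"
    by (simp add: located_def d_c_def scl_sum mult.commute)
  also have "\<dots> \<approx>[?R] edge_sum (\<lambda>e r. contract_term m n e r lw) es"
    unfolding edge_sum_def by (intro cm_sum con) simp
  finally show ?thesis .
qed


section \<open>The differential respects the relations and squares to zero\<close>

definition edge_term :: "nat \<Rightarrow> nat \<Rightarrow> nat \<Rightarrow> nat \<times> nat \<Rightarrow> (nat \<times> nat) list \<Rightarrow> (letter \<times> nat) list \<Rightarrow> dgraph \<Rightarrow>\<^sub>0 rat" where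
  "edge_term m g n e r lw = contract_term m n e r lw + cut_term m g n e r lw"

lemma cm_neg_trans: "x \<approx>[rat_free.span S] - y \<Longrightarrow> y \<approx>[rat_free.span S] - z \<Longrightarrow> x \<approx>[rat_free.span S] z"
  using cm_minus[of y S "- z"] cm_trans by fastforce

lemma wf_edges_Cons: "wf_edges n (e # r) \<longleftrightarrow> fst e < n \<and> snd e < n \<and> wf_edges n r"
  by (auto simp: wf_edges_alt)

lemma wf_locs_Cons: "wf_locs g n (z # lw) \<longleftrightarrow> index (fst z) < g \<and> snd z < n \<and> wf_locs g n lw"
  by (auto simp: wf_locs_def)

lemma contract_wf:
  assumes "i < n" "j < n" "i \<noteq> j"
  shows "wf_edges n r \<Longrightarrow> wf_edges (n - 1) (map_edges (contract_vertex i j) r)"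
    and "wf_locs g n lw \<Longrightarrow> wf_locs g (n - 1) (map_locs (contract_vertex i j) lw)"
  using contract_less assms by (auto intro: wf_edges_map_edges wf_locs_map_locs)

lemma permute_wf:
  assumes "\<sigma> permutes {..<n}"
  shows "wf_edges n r \<Longrightarrow> wf_edges n (map_edges \<sigma> r)" and "wf_locs g n lw \<Longrightarrow> wf_locs g n (map_locs \<sigma> lw)"
  using permutes_less[OF assms] by (auto intro: wf_edges_map_edges wf_locs_map_locs)

lemma contract_term_swap:
  assumes "wf_edges n (e # r)" "wf_locs g n (u @ [a, b] @ w)"
  shows "contract_term m n e r (u @ [a, b] @ w) \<approx>[RR m g] scl (swap_sign (lpar m) a b) (contract_term m n e r (u @ [b, a] @ w))"
proof (cases "fst e = snd e")
  case True then show ?thesis by (simp add: contract_term_def)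
next
  case False
  let ?c = "contract_vertex (fst e) (snd e)"
  have "located m (n - 1) (map_edges ?c r) (map_locs ?c u @ [apsnd ?c a, apsnd ?c b] @ map_locs ?c w)
    \<approx>[RR m g] scl (swap_sign (lpar m) (apsnd ?c a) (apsnd ?c b)) (located m (n - 1) (map_edges ?c r) (map_locs ?c u @ [apsnd ?c b, apsnd ?c a] @ map_locs ?c w))"
    using contract_wf[of "fst e" n "snd e"] assms False by (intro located_swap) (auto simp: wf_edges_Cons simp flip: map_append list.map)
  from cm_scl[OF this, of "(-1) ^ Suc (snd e)"] show ?thesis
    using False by (simp add: contract_term_def swap_sign_def mult.commute)
qed

lemma contract_term_edges:
  assumes "wf_edges n (e # r)" "wf_locs g n lw" "mset r' = mset r"
  shows "contract_term m n e r lw \<approx>[RR m g] contract_term m n e r' lw"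
proof (cases "fst e = snd e")
  case True then show ?thesis by (simp add: contract_term_def)
next
  case False
  let ?c = "contract_vertex (fst e) (snd e)"
  have ms: "mset (map_edges ?c r') = mset (map_edges ?c r)" using assms(3) by simp
  have "wf_edges (n - 1) (map_edges ?c r)" "wf_locs g (n - 1) (map_locs ?c lw)"
    using contract_wf[of "fst e" n "snd e"] assms False by (auto simp: wf_edges_Cons)
  from located_edges[OF this ms] show ?thesis
    unfolding contract_term_def if_not_P[OF False] by (rule cm_scl)
qed

lemma contract_term_flip_rest:
  assumes "wf_edges n (e # (k, l) # r)" "wf_locs g n lw"
  shows "contract_term m n e ((k, l) # r) lw \<approx>[RR m g] - contract_term m n e ((l, k) # r) lw"
proof (cases "fst e = snd e")
  case True then show ?thesis by (simp add: contract_term_def)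
next
  case False
  let ?c = "contract_vertex (fst e) (snd e)"
  have w0: "fst e < n" "snd e < n" "wf_edges n ((k, l) # r)" using assms(1) by (simp_all add: wf_edges_Cons)
  have "wf_edges (n - 1) (map_edges ?c ((k, l) # r))" "wf_locs g (n - 1) (map_locs ?c lw)"
    by (rule contract_wf(1)[OF w0(1,2) False w0(3)], rule contract_wf(2)[OF w0(1,2) False assms(2)])
  then have "located m (n - 1) ((?c k, ?c l) # map_edges ?c r) (map_locs ?c lw) \<approx>[RR m g] - located m (n - 1) ((?c l, ?c k) # map_edges ?c r) (map_locs ?c lw)"
    by (intro located_flip) simp_all
  from cm_scl[OF this, of "(-1) ^ Suc (snd e)"] show ?thesis
    using False by (simp add: contract_term_def scl_minus)
qed

text \<open>
  The factor \<open>(-1)^j\<close> of the contraction is what turns the sign of the permutation of the remaining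
  vertices into the sign of \<open>\<sigma>\<close>, by \<open>contract_vertex_permute\<close>.
\<close>

lemma contract_term_permute:
  assumes "wf_edges n (e # r)" "wf_locs g n lw" "\<sigma> permutes {..<n}"
  shows "contract_term m n e r lw \<approx>[RR m g] scl (of_int (sign \<sigma>)) (contract_term m n (map_prod \<sigma> \<sigma> e) (map_edges \<sigma> r) (map_locs \<sigma> lw))"
proof (cases "fst e = snd e")
  case True then show ?thesis by (cases e) (simp add: contract_term_def)
next
  case False
  obtain i j where e: "e = (i, j)" by (cases e)
  have ij: "i < n" "j < n" "i \<noteq> j" using assms(1) False by (auto simp: wf_edges_Cons e)
  let ?c = "contract_vertex i j" and ?c' = "contract_vertex (\<sigma> i) (\<sigma> j)"
  obtain \<rho> where \<rho>: "\<rho> permutes {..<n - 1}" "\<And>v. v < n \<Longrightarrow> ?c' (\<sigma> v) = \<rho> (?c v)"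
    "sign \<rho> * (-1) ^ \<sigma> j = sign \<sigma> * ((-1) ^ j :: int)"
    using contract_vertex_permute[OF assms(3) ij] by blast
  have wr: "wf_edges n r" using assms(1) by (simp add: wf_edges_Cons)
  have maps: "map_edges ?c' (map_edges \<sigma> r) = map_edges \<rho> (map_edges ?c r)" "map_locs ?c' (map_locs \<sigma> lw) = map_locs \<rho> (map_locs ?c lw)"
    using \<rho>(2) wr assms(2) by (auto simp: wf_edges_def wf_locs_def)
  have "\<sigma> i \<noteq> \<sigma> j" using ij(3) permutes_inj[OF assms(3)] by (auto simp: inj_def)
  then have rhs: "scl (of_int (sign \<sigma>)) (contract_term m n (map_prod \<sigma> \<sigma> e) (map_edges \<sigma> r) (map_locs \<sigma> lw))
     = scl (of_int (sign \<sigma> * (-1) ^ Suc (\<sigma> j))) (located m (n - 1) (map_edges \<rho> (map_edges ?c r)) (map_locs \<rho> (map_locs ?c lw)))"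
    by (simp only: contract_term_def e map_prod_simp fst_conv snd_conv if_False maps scl_simps
        of_int_mult of_int_power of_int_minus of_int_1)
  have "sign \<rho> = sign \<rho> * ((-1) ^ \<sigma> j * (-1) ^ \<sigma> j)" by (simp flip: power_add mult_2)
  also have "\<dots> = (sign \<rho> * (-1) ^ \<sigma> j) * (-1) ^ \<sigma> j" by (simp only: mult.assoc)
  also have "\<dots> = sign \<sigma> * (-1) ^ j * (-1) ^ \<sigma> j" by (simp only: \<rho>(3))
  finally have "(-1) ^ Suc j * sign \<rho> = sign \<sigma> * (((-1) ^ j * (-1) ^ j) * (-1) ^ Suc (\<sigma> j))"
    by (simp only: mult_ac power_Suc)
  then have sg: "(-1) ^ Suc j * sign \<rho> = sign \<sigma> * (-1) ^ Suc (\<sigma> j)"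
    by (simp flip: power_add mult_2 del: power_Suc)
  have "located m (n - 1) (map_edges ?c r) (map_locs ?c lw) \<approx>[RR m g] scl (of_int (sign \<rho>)) (located m (n - 1) (map_edges \<rho> (map_edges ?c r)) (map_locs \<rho> (map_locs ?c lw)))"
    using contract_wf[OF ij] wr assms(2) \<rho>(1) by (intro located_permute) auto
  from cm_scl[OF this, of "of_int ((-1) ^ Suc j)"]
  have "scl (of_int ((-1) ^ Suc j)) (located m (n - 1) (map_edges ?c r) (map_locs ?c lw)) \<approx>[RR m g]
      scl (of_int ((-1) ^ Suc j * sign \<rho>)) (located m (n - 1) (map_edges \<rho> (map_edges ?c r)) (map_locs \<rho> (map_locs ?c lw)))"
    by (simp only: scl_simps of_int_mult)
  then show ?thesis unfolding rhs sg using ij(3) by (simp add: contract_term_def e)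
qed

lemma contract_term_flip:
  assumes "wf_edges n ((i, j) # r)" "wf_locs g n lw"
  shows "contract_term m n (i, j) r lw \<approx>[RR m g] - contract_term m n (j, i) r lw"
proof (cases "i = j")
  case True then show ?thesis by (simp add: contract_term_def)
next
  case False
  have ij: "i < n" "j < n" "i \<noteq> j" and wr: "wf_edges n r" using assms(1) False by (auto simp: wf_edges_Cons)
  let ?c = "contract_vertex i j" and ?c' = "contract_vertex j i"
  obtain \<rho> where \<rho>: "\<rho> permutes {..<n - 1}" "\<And>v. v < n \<Longrightarrow> ?c' v = \<rho> (?c v)"
    "sign \<rho> * (-1) ^ i = - ((-1) ^ j :: int)"
    using contract_vertex_flip[OF ij] by blast
  have maps: "map_edges ?c' r = map_edges \<rho> (map_edges ?c r)" "map_locs ?c' lw = map_locs \<rho> (map_locs ?c lw)"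
    using \<rho>(2) wr assms(2) by (auto simp: wf_edges_def wf_locs_def)
  have "sign \<rho> = (sign \<rho> * (-1) ^ i) * (-1) ^ i" by (simp add: mult.assoc flip: power_add mult_2)
  also have "\<dots> = - ((-1) ^ j * (-1) ^ i)" by (simp only: \<rho>(3) mult_minus_left)
  finally have "(-1) ^ Suc j * sign \<rho> = ((-1) ^ j * (-1) ^ j) * (-1) ^ i"
    by (simp only: mult_ac power_Suc mult_minus_left mult_minus_right minus_minus mult_1)
  then have sg: "(-1) ^ Suc j * sign \<rho> = - ((-1) ^ Suc i)"
    by (simp flip: power_add mult_2)
  have "located m (n - 1) (map_edges ?c r) (map_locs ?c lw) \<approx>[RR m g] scl (of_int (sign \<rho>)) (located m (n - 1) (map_edges \<rho> (map_edges ?c r)) (map_locs \<rho> (map_locs ?c lw)))"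
    using contract_wf[OF ij] wr assms(2) \<rho>(1) by (intro located_permute) auto
  from cm_scl[OF this, of "of_int ((-1) ^ Suc j)"]
  have "scl (of_int ((-1) ^ Suc j)) (located m (n - 1) (map_edges ?c r) (map_locs ?c lw)) \<approx>[RR m g]
      scl (of_int ((-1) ^ Suc j * sign \<rho>)) (located m (n - 1) (map_edges ?c' r) (map_locs ?c' lw))"
    by (simp only: scl_simps of_int_mult maps)
  then show ?thesis unfolding sg using ij(3) by (auto simp add: contract_term_def scl_minus_left)
qed

lemma cut_term_swap:
  assumes "wf_edges n (e # r)" "wf_locs g n (u @ [a, b] @ w)"
  shows "cut_term m g n e r (u @ [a, b] @ w) \<approx>[RR m g] scl (swap_sign (lpar m) a b) (cut_term m g n e r (u @ [b, a] @ w))"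
proof -
  have "located m n r ((AB c p, fst e) # (AB (\<not> c) p, snd e) # u @ [a, b] @ w) \<approx>[RR m g]
      scl (swap_sign (lpar m) a b) (located m n r ((AB c p, fst e) # (AB (\<not> c) p, snd e) # u @ [b, a] @ w))" if "p < g" for c p
    using located_swap[of n r g "(AB c p, fst e) # (AB (\<not> c) p, snd e) # u" a b w m] assms that
    by (simp add: wf_edges_Cons wf_locs_Cons)
  then have "cut_term m g n e r (u @ [a, b] @ w) \<approx>[RR m g] (\<Sum>p<g. \<Sum>c\<in>UNIV. scl ((-1) ^ (n + m) * (if c then 1 else -1))
      (scl (swap_sign (lpar m) a b) (located m n r ((AB c p, fst e) # (AB (\<not> c) p, snd e) # u @ [b, a] @ w))))"
    unfolding cut_term_def by (intro cm_sum cm_scl) simp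
  then show ?thesis by (simp add: cut_term_def scl_sum mult_ac)
qed

lemma cut_term_edges:
  assumes "wf_edges n (e # r)" "wf_locs g n lw" "mset r' = mset r"
  shows "cut_term m g n e r lw \<approx>[RR m g] cut_term m g n e r' lw"
  unfolding cut_term_def using assms by (intro cm_sum cm_scl located_edges) (auto simp: wf_edges_Cons wf_locs_Cons)

lemma cut_term_flip_rest:
  assumes "wf_edges n (e # (k, l) # r)" "wf_locs g n lw"
  shows "cut_term m g n e ((k, l) # r) lw \<approx>[RR m g] - cut_term m g n e ((l, k) # r) lw"
proof -
  have "cut_term m g n e ((k, l) # r) lw \<approx>[RR m g] (\<Sum>p<g. \<Sum>c\<in>UNIV. scl ((-1) ^ (n + m) * (if c then 1 else -1))
      (- located m n ((l, k) # r) ((AB c p, fst e) # (AB (\<not> c) p, snd e) # lw)))"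
    unfolding cut_term_def using assms by (intro cm_sum cm_scl located_flip) (auto simp: wf_edges_Cons wf_locs_Cons)
  then show ?thesis by (simp add: cut_term_def scl_minus sum_negf)
qed

lemma cut_term_permute:
  assumes "wf_edges n (e # r)" "wf_locs g n lw" "\<sigma> permutes {..<n}"
  shows "cut_term m g n e r lw \<approx>[RR m g] scl (of_int (sign \<sigma>)) (cut_term m g n (map_prod \<sigma> \<sigma> e) (map_edges \<sigma> r) (map_locs \<sigma> lw))"
proof -
  have "cut_term m g n e r lw \<approx>[RR m g] (\<Sum>p<g. \<Sum>c\<in>UNIV. scl ((-1) ^ (n + m) * (if c then 1 else -1))
      (scl (of_int (sign \<sigma>)) (located m n (map_edges \<sigma> r) (map_locs \<sigma> ((AB c p, fst e) # (AB (\<not> c) p, snd e) # lw)))))"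
    unfolding cut_term_def using assms by (intro cm_sum cm_scl located_permute) (auto simp: wf_edges_Cons wf_locs_Cons)
  then show ?thesis by (simp add: cut_term_def scl_sum mult_ac)
qed

lemma cut_term_flip:
  assumes "wf_edges n ((i, j) # r)" "wf_locs g n lw"
  shows "cut_term m g n (i, j) r lw \<approx>[RR m g] - cut_term m g n (j, i) r lw"
proof -
  have located: "located m n r ((AB c p, i) # (AB (\<not> c) p, j) # lw) \<approx>[RR m g] located m n r ((AB (\<not> c) p, j) # (AB c p, i) # lw)"
    if "p < g" for c p
  proof -
    have "swap_sign (lpar m) (AB c p, i) (AB (\<not> c) p, j) = 1"
      by (simp add: swap_sign_def minus_one_power_iff)
    then show ?thesis
      using located_swap[of n r g "[]" "(AB c p, i)" "(AB (\<not> c) p, j)" lw m] assms that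
      by (simp add: wf_edges_Cons wf_locs_Cons)
  qed
  have "cut_term m g n (i, j) r lw \<approx>[RR m g] (\<Sum>p<g. \<Sum>c\<in>UNIV. scl ((-1) ^ (n + m) * (if c then 1 else -1))
      (located m n r ((AB (\<not> c) p, j) # (AB c p, i) # lw)))"
    unfolding cut_term_def fst_conv snd_conv by (intro cm_sum cm_scl located) simp
  then show ?thesis by (simp add: cut_term_def UNIV_bool scl_minus_left sum_negf[symmetric] add.commute)
qed

lemma edge_term_swap:
  assumes "wf_edges n (e # r)" "wf_locs g n (u @ [a, b] @ w)"
  shows "edge_term m g n e r (u @ [a, b] @ w) \<approx>[RR m g] scl (swap_sign (lpar m) a b) (edge_term m g n e r (u @ [b, a] @ w))"
  unfolding edge_term_def scl_add by (intro cm_add contract_term_swap cut_term_swap assms)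

lemma edge_term_edges:
  assumes "wf_edges n (e # r)" "wf_locs g n lw" "mset r' = mset r"
  shows "edge_term m g n e r lw \<approx>[RR m g] edge_term m g n e r' lw"
  unfolding edge_term_def by (intro cm_add contract_term_edges cut_term_edges assms)

lemma edge_term_flip_rest:
  assumes "wf_edges n (e # (k, l) # r)" "wf_locs g n lw"
  shows "edge_term m g n e ((k, l) # r) lw \<approx>[RR m g] - edge_term m g n e ((l, k) # r) lw"
  unfolding edge_term_def minus_add_distrib add.commute[of "- cut_term _ _ _ _ _ _"]
  using cm_add[OF contract_term_flip_rest[OF assms] cut_term_flip_rest[OF assms]] by simp

lemma edge_term_flip:
  assumes "wf_edges n ((i, j) # r)" "wf_locs g n lw"
  shows "edge_term m g n (i, j) r lw \<approx>[RR m g] - edge_term m g n (j, i) r lw"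
  unfolding edge_term_def using cm_add[OF contract_term_flip[OF assms] cut_term_flip[OF assms]] by simp

lemma edge_term_permute:
  assumes "wf_edges n (e # r)" "wf_locs g n lw" "\<sigma> permutes {..<n}"
  shows "edge_term m g n e r lw \<approx>[RR m g] scl (of_int (sign \<sigma>)) (edge_term m g n (map_prod \<sigma> \<sigma> e) (map_edges \<sigma> r) (map_locs \<sigma> lw))"
  unfolding edge_term_def scl_add by (intro cm_add contract_term_permute cut_term_permute assms)

lemma differential_located:
  assumes "wf_edges n es" "wf_locs g n lw"
  shows "differential m g (located m n es lw) \<approx>[RR m g] edge_sum (\<lambda>e r. edge_term m g n e r lw) es"
proof -
  have "differential m g (located m n es lw) = lin_ext (d_c m) (located m n es lw) + lin_ext (d_cut m g) (located m n es lw)"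
    by (simp only: differential_def lin_ext_plus_fun)
  also have "\<dots> \<approx>[RR m g] edge_sum (\<lambda>e r. contract_term m n e r lw) es + edge_sum (\<lambda>e r. cut_term m g n e r lw) es"
    unfolding d_cut_located[OF assms(1)] by (intro cm_add d_c_located assms cm_refl)
  also have "\<dots> = edge_sum (\<lambda>e r. edge_term m g n e r lw) es"
    by (simp only: edge_term_def edge_sum_add)
  finally show ?thesis .
qed

lemma wf_edges_add_mset: "add_mset e (mset r) = mset es \<Longrightarrow> wf_edges n es \<Longrightarrow> wf_edges n (e # r)"
  using wf_edges_mset[of "e # r" es n] by simp

lemma differential_rels:
  assumes "r \<in> rels m g" shows "differential m g r \<in> RR m g"
proof -
  let ?d = "\<lambda>\<Gamma>. d_c m \<Gamma> + d_cut m g \<Gamma>"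
  let ?G = "\<lambda>n es lw. edge_sum (\<lambda>e r. edge_term m g n e r lw) es"
  have via: "lin_ext ?d (located m n es lw) \<approx>[RR m g] scl c (lin_ext ?d (located m n es' lw'))"
    if w: "wf_edges n es" "wf_locs g n lw" "wf_edges n es'" "wf_locs g n lw'" and G: "?G n es lw \<approx>[RR m g] scl c (?G n es' lw')"
    for n es lw es' lw' c
  proof -
    have "lin_ext ?d (located m n es lw) \<approx>[RR m g] ?G n es lw"
      using differential_located[OF w(1,2)] by (simp add: differential_def)
    also note G
    also have "scl c (?G n es' lw') \<approx>[RR m g] scl c (lin_ext ?d (located m n es' lw'))"
      by (rule cm_scl, rule cm_sym) (use differential_located[OF w(3,4)] in \<open>simp add: differential_def\<close>)
    finally show ?thesis .
  qed
  have "lin_ext ?d r \<in> RR m g"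
  proof (rule relations_lin_ext[OF _ _ _ _ assms])
    fix n es u a b w assume w: "wf_edges n es" "wf_locs g n (u @ [a, b] @ w)"
    have "?G n es (u @ [a, b] @ w) \<approx>[RR m g] edge_sum (\<lambda>e r. scl (swap_sign (lpar m) a b) (edge_term m g n e r (u @ [b, a] @ w))) es"
      by (intro edge_sum_cong edge_term_swap w(2)) (rule wf_edges_add_mset[OF _ w(1)])
    then show "lin_ext ?d (located m n es (u @ [a, b] @ w)) \<approx>[RR m g] scl (swap_sign (lpar m) a b) (lin_ext ?d (located m n es (u @ [b, a] @ w)))"
      using w wf_locs_swap[of g n u a b w] by (intro via) (simp_all only: edge_sum_scl)
  next
    fix n es es' lw assume w: "wf_edges n es" "wf_locs g n lw" and ms: "mset es = mset es'"
    have w': "wf_edges n es'" using w(1) wf_edges_mset[OF ms] by simp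
    have "?G n es lw \<approx>[RR m g] ?G n es' lw"
    proof (rule edge_sum_mset[OF ms])
      fix e r r' assume a: "add_mset e (mset r) = mset es'" and b: "mset r' = mset r"
      show "edge_term m g n e r' lw \<approx>[RR m g] edge_term m g n e r lw"
        by (rule cm_sym, rule edge_term_edges[OF wf_edges_add_mset[OF a w'] w(2) b])
    qed
    then show "lin_ext ?d (located m n es lw) \<approx>[RR m g] lin_ext ?d (located m n es' lw)"
      using via[OF w w' w(2), of 1] by simp
  next
    fix n i j es lw assume w: "wf_edges n ((i, j) # es)" "wf_locs g n lw"
    have "?G n ((i, j) # es) lw \<approx>[RR m g] - edge_term m g n (j, i) es lw + edge_sum (\<lambda>e r. scl (-1) (edge_term m g n e ((j, i) # r) lw)) es"
      unfolding edge_sum_Cons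
    proof (intro cm_add edge_term_flip w edge_sum_cong)
      fix e r assume "add_mset e (mset r) = mset es"
      from wf_edges_add_mset[OF this] w(1) have "wf_edges n (e # (i, j) # r)" by (simp add: wf_edges_Cons)
      from edge_term_flip_rest[OF this w(2), of m]
      show "edge_term m g n e ((i, j) # r) lw \<approx>[RR m g] scl (-1) (edge_term m g n e ((j, i) # r) lw)"
        by (simp add: scl_minus_left)
    qed
    also have "\<dots> = scl (-1) (?G n ((j, i) # es) lw)"
      by (simp only: edge_sum_scl edge_sum_Cons scl_add) (simp add: scl_minus_left)
    finally have "lin_ext ?d (located m n ((i, j) # es) lw) \<approx>[RR m g] scl (-1) (lin_ext ?d (located m n ((j, i) # es) lw))"
      using w by (intro via) (auto simp: wf_edges_Cons)
    then show "lin_ext ?d (located m n ((i, j) # es) lw) \<approx>[RR m g] - lin_ext ?d (located m n ((j, i) # es) lw)"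
      by (simp add: scl_minus_left)
  next
    fix n k es lw assume w: "wf_edges n es" "wf_locs g n lw" and k: "Suc k < n"
    have perm: "swp k permutes {..<n}" using k by (intro permutes_swap_id) auto
    have sg: "of_int (sign (swp k)) = (-1 :: rat)" by (simp add: sign_swap_id)
    have "?G n es lw \<approx>[RR m g] edge_sum (\<lambda>e r. scl (-1) (edge_term m g n (map_prod (swp k) (swp k) e) (map_edges (swp k) r) (map_locs (swp k) lw))) es"
      by (intro edge_sum_cong, unfold sg[symmetric], rule edge_term_permute[OF wf_edges_add_mset[OF _ w(1)] w(2) perm])
    also have "\<dots> = scl (-1) (?G n (map_edges (swp k) es) (map_locs (swp k) lw))"
      by (simp only: edge_sum_scl edge_sum_map)
    finally have "lin_ext ?d (located m n es lw) \<approx>[RR m g] scl (-1) (lin_ext ?d (located m n (map_edges (swp k) es) (map_locs (swp k) lw)))"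
      using w permute_wf[OF perm] by (intro via) auto
    then show "lin_ext ?d (located m n es lw) \<approx>[RR m g] - lin_ext ?d (located m n (map_edges (swp k) es) (map_locs (swp k) lw))"
      by (simp add: scl_minus_left)
  qed
  then show ?thesis by (simp add: differential_def)
qed

lemma differential_cong: "x \<approx>[RR m g] y \<Longrightarrow> differential m g x \<approx>[RR m g] differential m g y"
  unfolding differential_def
  by (rule cm_lin_ext_span) (use differential_rels in \<open>auto simp: differential_def\<close>)

lemma differential_linear:
  "differential m g (x + y) = differential m g x + differential m g y"
  "differential m g (x - y) = differential m g x - differential m g y"
  "differential m g (scl c x) = scl c (differential m g x)"
  "differential m g (sum h A) = (\<Sum>a\<in>A. differential m g (h a))"
  "differential m g 0 = 0"
  by (simp_all add: differential_def lin_ext_add lin_ext_diff lin_ext_scl lin_ext_sum)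


subsection \<open>Two edges\<close>

text \<open>
  The new number of the vertex \<open>w\<close> after the vertex \<open>j\<close> has been removed. Two removals commute, but the
  signs \<open>(-1)^j\<close> that record the numbers of the removed vertices anticommute (lemma \<open>skip_sign\<close>).
\<close>

definition skip :: "nat \<Rightarrow> nat \<Rightarrow> nat" where
  "skip j w = (if j < w then w - 1 else w)"

lemma contract_skip: "contract_vertex i j v = skip j (if v = j then i else v)"
  by (simp add: contract_vertex_def skip_def Let_def)

lemma skip_inj: "x \<noteq> j \<Longrightarrow> y \<noteq> j \<Longrightarrow> skip j x = skip j y \<longleftrightarrow> x = y"
  by (auto simp: skip_def)

lemma skip_skip: "j \<noteq> l \<Longrightarrow> w \<noteq> j \<Longrightarrow> w \<noteq> l \<Longrightarrow> skip (skip j l) (skip j w) = skip (skip l j) (skip l w)"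
  by (auto simp: skip_def)

lemma skip_sign: "j \<noteq> l \<Longrightarrow> (-1 :: rat) ^ Suc j * (-1) ^ Suc (skip j l) = - ((-1) ^ Suc l * (-1) ^ Suc (skip l j))"
proof (induction j l rule: linorder_less_wlog)
  case (less a b)
  then obtain c where "b = Suc c" by (cases b) auto
  then show ?case using less by (simp add: skip_def mult.commute)
next
  case (sym a b) then show ?case by simp
qed simp

lemma contract_contract:
  assumes "i \<noteq> j" "i \<noteq> l" "k \<noteq> j" "k \<noteq> l" "j \<noteq> l"
  shows "contract_vertex (contract_vertex i j k) (contract_vertex i j l) (contract_vertex i j v)
       = contract_vertex (contract_vertex k l i) (contract_vertex k l j) (contract_vertex k l v)"
proof -
  have "contract_vertex (contract_vertex i j k) (contract_vertex i j l) (contract_vertex i j v)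
      = skip (skip j l) (skip j (if v = j then i else if v = l then k else v))"
    using assms by (auto simp: contract_skip skip_inj)
  also have "\<dots> = skip (skip l j) (skip l (if v = j then i else if v = l then k else v))"
    using assms by (intro skip_skip) auto
  also have "\<dots> = contract_vertex (contract_vertex k l i) (contract_vertex k l j) (contract_vertex k l v)"
    using assms by (auto simp: contract_skip skip_inj)
  finally show ?thesis .
qed

text \<open>
  The second step after contracting, respectively cutting, the edge \<open>e\<close>; \<open>K\<close> is the operation
  performed on \<open>e'\<close>.
\<close>

definition after_contract where
  "after_contract K m n e e' r lw = (if fst e = snd e then 0 else
     let c = contract_vertex (fst e) (snd e) in
     scl ((-1) ^ Suc (snd e)) (K (n - 1) (map_prod c c e') (map_edges c r) (map_locs c lw) :: dgraph \<Rightarrow>\<^sub>0 rat))"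

definition after_cut where
  "after_cut K m g n e e' r lw = (\<Sum>p<g. \<Sum>b\<in>UNIV. scl ((-1) ^ (n + m) * (if b then 1 else -1))
     (K n e' r ((AB b p, fst e) # (AB (\<not> b) p, snd e) # lw) :: dgraph \<Rightarrow>\<^sub>0 rat))"

lemma contract_contract_direct:
  assumes "i \<noteq> j" "i \<noteq> l" "k \<noteq> j" "k \<noteq> l" "j \<noteq> l"
  shows "after_contract (contract_term m) m n (i, j) (k, l) r lw = - after_contract (contract_term m) m n (k, l) (i, j) r lw"
proof -
  let ?c = "contract_vertex i j" and ?c' = "contract_vertex k l"
  let ?C = "contract_vertex (?c k) (?c l)" and ?C' = "contract_vertex (?c' i) (?c' j)"
  have ne: "?c k \<noteq> ?c l" "?c' i \<noteq> ?c' j" using assms by (auto simp: contract_skip skip_inj)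
  have maps: "map_edges ?C (map_edges ?c r) = map_edges ?C' (map_edges ?c' r)" "map_locs ?C (map_locs ?c lw) = map_locs ?C' (map_locs ?c' lw)"
    using contract_contract[OF assms] by auto
  have sg: "(-1 :: rat) ^ Suc j * (-1) ^ Suc (?c l) = - ((-1) ^ Suc l * (-1) ^ Suc (?c' j))"
    using skip_sign[OF assms(5)] assms by (simp add: contract_skip)
  have "after_contract (contract_term m) m n (i, j) (k, l) r lw
     = scl ((-1) ^ Suc j * (-1) ^ Suc (?c l)) (located m (n - 1 - 1) (map_edges ?C (map_edges ?c r)) (map_locs ?C (map_locs ?c lw)))"
    using assms ne by (simp add: after_contract_def contract_term_def Let_def del: power_Suc)
  also have "\<dots> = - scl ((-1) ^ Suc l * (-1) ^ Suc (?c' j)) (located m (n - 1 - 1) (map_edges ?C' (map_edges ?c' r)) (map_locs ?C' (map_locs ?c' lw)))"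
    by (simp only: sg maps scl_minus_left)
  also have "\<dots> = - after_contract (contract_term m) m n (k, l) (i, j) r lw"
    using assms ne by (simp add: after_contract_def contract_term_def Let_def del: power_Suc)
  finally show ?thesis .
qed

lemma contract_contract_flip_second:
  assumes "wf_edges n (e # (k, l) # r)" "wf_locs g n lw"
  shows "after_contract (contract_term m) m n e (k, l) r lw \<approx>[RR m g] - after_contract (contract_term m) m n e (l, k) r lw"
proof (cases "fst e = snd e")
  case True then show ?thesis by (simp add: after_contract_def)
next
  case False
  let ?c = "contract_vertex (fst e) (snd e)"
  have w0: "fst e < n" "snd e < n" "wf_edges n ((k, l) # r)" using assms(1) by (simp_all add: wf_edges_Cons)
  have "wf_edges (n - 1) (map_edges ?c ((k, l) # r))" "wf_locs g (n - 1) (map_locs ?c lw)"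
    by (rule contract_wf(1)[OF w0(1,2) False w0(3)], rule contract_wf(2)[OF w0(1,2) False assms(2)])
  then have "contract_term m (n - 1) (?c k, ?c l) (map_edges ?c r) (map_locs ?c lw) \<approx>[RR m g] - contract_term m (n - 1) (?c l, ?c k) (map_edges ?c r) (map_locs ?c lw)"
    by (intro contract_term_flip) simp_all
  from cm_scl[OF this, of "(-1) ^ Suc (snd e)"] show ?thesis
    using False by (simp add: after_contract_def Let_def scl_minus del: power_Suc)
qed

lemma contract_contract_flip_first:
  assumes "wf_edges n ((i, j) # e # r)" "wf_locs g n lw"
  shows "after_contract (contract_term m) m n (i, j) e r lw \<approx>[RR m g] - after_contract (contract_term m) m n (j, i) e r lw"
proof (cases "i = j")
  case True then show ?thesis by (simp add: after_contract_def)
next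
  case False
  have ij: "i < n" "j < n" "i \<noteq> j" and wr: "wf_edges n (e # r)" using assms(1) False by (auto simp: wf_edges_Cons)
  let ?c = "contract_vertex i j" and ?c' = "contract_vertex j i"
  obtain \<rho> where \<rho>: "\<rho> permutes {..<n - 1}" "\<And>v. v < n \<Longrightarrow> ?c' v = \<rho> (?c v)"
    "sign \<rho> * (-1) ^ i = - ((-1) ^ j :: int)"
    using contract_vertex_flip[OF ij] by blast
  have maps: "map_edges ?c' (e # r) = map_edges \<rho> (map_edges ?c (e # r))" "map_locs ?c' lw = map_locs \<rho> (map_locs ?c lw)"
    using \<rho>(2) wr assms(2) by (auto simp: wf_edges_def wf_locs_def)
  then have maps': "map_prod ?c' ?c' e = map_prod \<rho> \<rho> (map_prod ?c ?c e)" "map_edges ?c' r = map_edges \<rho> (map_edges ?c r)"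
    by simp_all
  have "sign \<rho> = (sign \<rho> * (-1) ^ i) * (-1) ^ i" by (simp add: mult.assoc flip: power_add mult_2)
  also have "\<dots> = - ((-1) ^ j * (-1) ^ i)" by (simp only: \<rho>(3) mult_minus_left)
  finally have "(-1) ^ Suc j * sign \<rho> = ((-1) ^ j * (-1) ^ j) * (-1) ^ i"
    by (simp only: mult_ac power_Suc mult_minus_left mult_minus_right minus_minus mult_1)
  then have sg: "(-1) ^ Suc j * sign \<rho> = - ((-1) ^ Suc i)"
    by (simp flip: power_add mult_2)
  have "contract_term m (n - 1) (map_prod ?c ?c e) (map_edges ?c r) (map_locs ?c lw) \<approx>[RR m g]
      scl (of_int (sign \<rho>)) (contract_term m (n - 1) (map_prod ?c' ?c' e) (map_edges ?c' r) (map_locs ?c' lw))"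
    unfolding maps(2) maps'
    using contract_wf(1)[OF ij wr] contract_wf(2)[OF ij assms(2)] \<rho>(1) by (intro contract_term_permute) auto
  from cm_scl[OF this, of "of_int ((-1) ^ Suc j)"]
  have "scl (of_int ((-1) ^ Suc j)) (contract_term m (n - 1) (map_prod ?c ?c e) (map_edges ?c r) (map_locs ?c lw)) \<approx>[RR m g]
      scl (of_int ((-1) ^ Suc j * sign \<rho>)) (contract_term m (n - 1) (map_prod ?c' ?c' e) (map_edges ?c' r) (map_locs ?c' lw))"
    by (simp only: scl_simps of_int_mult)
  then show ?thesis unfolding sg using ij(3) by (auto simp add: after_contract_def Let_def scl_minus_left)
qed

text \<open>
  If one of the two edges is a loop, or if they join the same vertices, then both sides are 0. Otherwise they
  can be oriented so that their heads are distinct and not among the tails, and then the two orders of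
  contraction lead to the same graph.
\<close>

lemma contract_contract_antisym:
  assumes w: "wf_edges n (e # e' # r)" "wf_locs g n lw"
  shows "after_contract (contract_term m) m n e e' r lw \<approx>[RR m g] - after_contract (contract_term m) m n e' e r lw"
proof -
  obtain i j k l where e: "e = (i, j)" "e' = (k, l)" by (cases e, cases e')
  let ?A = "\<lambda>e e'. after_contract (contract_term m) m n e e' r lw"
  have v: "i < n" "j < n" "k < n" "l < n" "wf_edges n r" using w(1) by (auto simp: wf_edges_Cons e)
  have f1: "?A (a, b) (c, d) \<approx>[RR m g] - ?A (b, a) (c, d)"
    and f2: "?A (a, b) (c, d) \<approx>[RR m g] - ?A (a, b) (d, c)"
    if "a < n" "b < n" "c < n" "d < n" for a b c d
    using that v(5) w(2) by (auto intro!: contract_contract_flip_first contract_contract_flip_second simp: wf_edges_Cons)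
  have loop: "?A (a, b) (c, d) = 0" if "a = b \<or> c = d \<or> {a, b} = {c, d}" for a b c d
    using that by (auto simp: after_contract_def contract_term_def Let_def contract_vertex_def doubleton_eq_iff)
  consider "i = j \<or> k = l \<or> {i, j} = {k, l}"
    | "i \<noteq> j" "k \<noteq> l" "{i, j} \<noteq> {k, l}" "j \<noteq> l" "i \<noteq> l" "k \<noteq> j"
    | "i \<noteq> j" "k \<noteq> l" "{i, j} \<noteq> {k, l}" "j = l"
    | "i \<noteq> j" "k \<noteq> l" "{i, j} \<noteq> {k, l}" "i = l"
    | "i \<noteq> j" "k \<noteq> l" "{i, j} \<noteq> {k, l}" "k = j" by blast
  then show ?thesis
  proof cases
    case 1
    then have "?A e e' = 0" "?A e' e = 0" unfolding e by (intro loop; auto)+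
    then show ?thesis by simp
  next
    case 2
    then show ?thesis unfolding e using contract_contract_direct[of i j l k m n r lw] by simp
  next
    case 3
    have d: "?A (j, i) (l, k) = - ?A (l, k) (j, i)" using 3 by (intro contract_contract_direct) auto
    have "?A (i, j) (k, l) \<approx>[RR m g] ?A (j, i) (l, k)"
      by (rule cm_neg_trans[OF f1 f2]) (use v in auto)
    moreover have "?A (k, l) (i, j) \<approx>[RR m g] ?A (l, k) (j, i)"
      by (rule cm_neg_trans[OF f1 f2]) (use v in auto)
    ultimately show ?thesis unfolding e using d cm_trans cm_sym cm_minus by metis
  next
    case 4
    have d: "?A (i, j) (l, k) = - ?A (l, k) (i, j)" using 4 by (intro contract_contract_direct) auto
    have "?A (i, j) (k, l) \<approx>[RR m g] - ?A (i, j) (l, k)"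
      by (rule f2) (use v in auto)
    also have "- ?A (i, j) (l, k) = ?A (l, k) (i, j)" using d by simp
    also have "?A (l, k) (i, j) \<approx>[RR m g] - ?A (k, l) (i, j)"
      by (rule f1) (use v in auto)
    finally show ?thesis unfolding e .
  next
    case 5
    have d: "?A (j, i) (k, l) = - ?A (k, l) (j, i)" using 5 by (intro contract_contract_direct) auto
    have "?A (i, j) (k, l) \<approx>[RR m g] - ?A (j, i) (k, l)"
      by (rule f1) (use v in auto)
    also have "- ?A (j, i) (k, l) = ?A (k, l) (j, i)" using d by simp
    also have "?A (k, l) (j, i) \<approx>[RR m g] - ?A (k, l) (i, j)"
      by (rule f2) (use v in auto)
    finally show ?thesis unfolding e .
  qed
qed

text \<open>
  Contracting and cutting commute as operations on graphs. The sign comes from the factor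
  \<open>(-1)^n\<close> of the cut, which changes when a contraction precedes it.
\<close>

lemma contract_cut_antisym:
  assumes "fst e < n"
  shows "after_contract (cut_term m g) m n e e' r lw = - after_cut (contract_term m) m g n e' e r lw"
proof -
  obtain k where n: "n = Suc k" using assms by (cases n) auto
  show ?thesis
  proof (cases "fst e = snd e")
    case True then show ?thesis by (simp add: after_contract_def after_cut_def contract_term_def)
  next
    case False
    then show ?thesis
      by (simp add: after_contract_def after_cut_def contract_term_def cut_term_def Let_def n scl_sum scl_diff UNIV_bool scl_minus_left mult_ac
          flip: sum_negf)
  qed
qed

text \<open>
  The two pairs of letters put in front of the word have degree \<open>2 m + 1\<close> each and so anticommute.
\<close>

lemma cut_cut_antisym:
  assumes w: "wf_edges n (e # e' # r)" "wf_locs g n lw"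
  shows "after_cut (cut_term m g) m g n e e' r lw \<approx>[RR m g] - after_cut (cut_term m g) m g n e' e r lw"
proof -
  let ?s = "\<lambda>b. (-1) ^ (n + m) * (if b then 1 else -1) :: rat"
  let ?w = "\<lambda>b p e. [(AB b p, fst e), (AB (\<not> b) p, snd e)]"
  have located: "located m n r (?w c q e' @ ?w b p e @ lw) \<approx>[RR m g] scl (-1) (located m n r (?w b p e @ ?w c q e' @ lw))"
    if "p < g" "q < g" for b c p q
  proof -
    have par: "sum_list (map (lpar m) (?w b p e)) = 2 * m + 1" for b p e by simp
    have "bas (?w c q e' @ ?w b p e @ lw) \<approx>[srel (lpar m)] scl (-1) (bas (?w b p e @ ?w c q e' @ lw))"
      using word_move[of "?w c q e'" "?w b p e" lw "lpar m"] unfolding par by simp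
    from located_cong[OF this, of n r g "\<lambda>v. v", unfolded map_locs_ident] show ?thesis
      using w that by (simp add: wf_edges_Cons wf_locs_Cons)
  qed
  let ?S = "\<lambda>H. \<Sum>p<g. \<Sum>b\<in>UNIV. \<Sum>q<g. \<Sum>c\<in>UNIV. scl (?s b * ?s c) (H b p c q) :: dgraph \<Rightarrow>\<^sub>0 rat"
  define H H' where "H b p c q = located m n r (?w c q e' @ ?w b p e @ lw)"
    and "H' b p c q = located m n r (?w b p e @ ?w c q e' @ lw)" for b p c q
  have "?S H \<approx>[RR m g] ?S (\<lambda>b p c q. scl (-1) (H' b p c q))"
    unfolding H_def H'_def by (rule cm_sum, rule cm_sum, rule cm_sum, rule cm_sum, rule cm_scl, rule located) simp_all
  moreover have "after_cut (cut_term m g) m g n e e' r lw = ?S H"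
    by (simp add: after_cut_def cut_term_def scl_sum H_def)
  moreover have "?S (\<lambda>b p c q. scl (-1) (H' b p c q)) = - after_cut (cut_term m g) m g n e' e r lw"
  proof -
    have "?S (\<lambda>b p c q. scl (-1) (H' b p c q)) = - (\<Sum>p<g. \<Sum>b\<in>UNIV. \<Sum>q<g. \<Sum>c\<in>UNIV. scl (?s c * ?s b) (H' b p c q))"
      by (simp add: scl_minus_left sum_negf mult_ac)
    also have "(\<Sum>p<g. \<Sum>b\<in>UNIV. \<Sum>q<g. \<Sum>c\<in>UNIV. scl (?s c * ?s b) (H' b p c q))
        = (\<Sum>p<g. \<Sum>q<g. \<Sum>b\<in>UNIV. \<Sum>c\<in>UNIV. scl (?s c * ?s b) (H' b p c q))"
      by (rule sum.cong[OF refl], rule sum.swap)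
    also have "\<dots> = (\<Sum>q<g. \<Sum>p<g. \<Sum>b\<in>UNIV. \<Sum>c\<in>UNIV. scl (?s c * ?s b) (H' b p c q))"
      by (rule sum.swap)
    also have "\<dots> = (\<Sum>q<g. \<Sum>p<g. \<Sum>c\<in>UNIV. \<Sum>b\<in>UNIV. scl (?s c * ?s b) (H' b p c q))"
      by (rule sum.cong[OF refl], rule sum.cong[OF refl], rule sum.swap)
    also have "\<dots> = (\<Sum>q<g. \<Sum>c\<in>UNIV. \<Sum>p<g. \<Sum>b\<in>UNIV. scl (?s c * ?s b) (H' b p c q))"
      by (rule sum.cong[OF refl], rule sum.swap)
    also have "\<dots> = after_cut (cut_term m g) m g n e' e r lw"
      by (simp add: after_cut_def cut_term_def scl_sum H'_def)
    finally show ?thesis .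
  qed
  ultimately show ?thesis by (simp only:)
qed

lemma differential_edge_term:
  assumes w: "wf_edges n (e # r)" "wf_locs g n lw"
  shows "differential m g (edge_term m g n e r lw) \<approx>[RR m g]
    edge_sum (\<lambda>e' r'. after_contract (edge_term m g) m n e e' r' lw + after_cut (edge_term m g) m g n e e' r' lw) r"
proof -
  have c: "differential m g (contract_term m n e r lw) \<approx>[RR m g] edge_sum (\<lambda>e' r'. after_contract (edge_term m g) m n e e' r' lw) r"
  proof (cases "fst e = snd e")
    case True then show ?thesis by (simp add: contract_term_def after_contract_def edge_sum_def differential_linear)
  next
    case False
    let ?c = "contract_vertex (fst e) (snd e)"
    have "wf_edges (n - 1) (map_edges ?c r)" "wf_locs g (n - 1) (map_locs ?c lw)"
      using contract_wf[of "fst e" n "snd e"] w False by (auto simp: wf_edges_Cons)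
    from cm_scl[OF differential_located[OF this], of "(-1) ^ Suc (snd e)" m]
    show ?thesis using False
      by (simp add: contract_term_def after_contract_def Let_def differential_linear edge_sum_map edge_sum_scl del: power_Suc)
  qed
  have cut: "differential m g (cut_term m g n e r lw) \<approx>[RR m g] edge_sum (\<lambda>e' r'. after_cut (edge_term m g) m g n e e' r' lw) r"
  proof -
    have "(\<Sum>p<g. \<Sum>b\<in>UNIV. scl ((-1) ^ (n + m) * (if b then 1 else -1))
        (differential m g (located m n r ((AB b p, fst e) # (AB (\<not> b) p, snd e) # lw)))) \<approx>[RR m g]
      (\<Sum>p<g. \<Sum>b\<in>UNIV. scl ((-1) ^ (n + m) * (if b then 1 else -1))
        (edge_sum (\<lambda>e' r'. edge_term m g n e' r' ((AB b p, fst e) # (AB (\<not> b) p, snd e) # lw)) r))"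
      using w by (intro cm_sum cm_scl differential_located) (auto simp: wf_edges_Cons wf_locs_Cons)
    then show ?thesis
      by (simp only: cut_term_def after_cut_def differential_linear edge_sum_sum edge_sum_scl)
  qed
  from cm_add[OF c cut] show ?thesis
    by (simp only: edge_term_def[of m g n e] differential_linear edge_sum_add)
qed

lemma differential_sq_located:
  assumes w: "wf_edges n es" "wf_locs g n lw"
  shows "differential m g (differential m g (located m n es lw)) \<approx>[RR m g] 0"
proof -
  let ?T = "\<lambda>e e' r. after_contract (edge_term m g) m n e e' r lw + after_cut (edge_term m g) m g n e e' r lw"
  have "differential m g (differential m g (located m n es lw)) \<approx>[RR m g] differential m g (edge_sum (\<lambda>e r. edge_term m g n e r lw) es)"
    by (rule differential_cong, rule differential_located[OF w])
  also have "differential m g (edge_sum (\<lambda>e r. edge_term m g n e r lw) es) = edge_sum (\<lambda>e r. differential m g (edge_term m g n e r lw)) es"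
    by (simp add: differential_def lin_ext_edge_sum)
  also have "\<dots> \<approx>[RR m g] edge_sum (\<lambda>e r. edge_sum (\<lambda>e' r'. ?T e e' r') r) es"
    by (rule edge_sum_cong, rule differential_edge_term[OF wf_edges_add_mset[OF _ w(1)] w(2)])
  also have "\<dots> \<approx>[RR m g] 0"
  proof (rule edge_sum_antisym)
    fix e e' r assume "set (e # e' # r) \<subseteq> set es"
    then have w1: "wf_edges n (e # e' # r)" and w2: "wf_edges n (e' # e # r)" using w(1) by (auto simp: wf_edges_def)
    have T: "?T e e' r = after_contract (contract_term m) m n e e' r lw + after_contract (cut_term m g) m n e e' r lw
        + (after_cut (contract_term m) m g n e e' r lw + after_cut (cut_term m g) m g n e e' r lw)" for e e'
      by (simp add: after_contract_def after_cut_def Let_def edge_term_def scl_add sum.distrib)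
    have "?T e e' r \<approx>[RR m g] - after_contract (contract_term m) m n e' e r lw + after_contract (cut_term m g) m n e e' r lw
        + (after_cut (contract_term m) m g n e e' r lw + - after_cut (cut_term m g) m g n e' e r lw)"
      unfolding T by (intro cm_add cm_refl contract_contract_antisym cut_cut_antisym w1 w(2))
    also have "\<dots> = - ?T e' e r"
      unfolding T using contract_cut_antisym[of e n m g e' r lw] contract_cut_antisym[of e' n m g e r lw] w1 w2 by (simp add: wf_edges_Cons)
    finally show "?T e e' r \<approx>[RR m g] - ?T e' e r" .
  qed
  finally show ?thesis .
qed

lemma differential_sq:
  assumes "keys x \<subseteq> dgraphs g"
  shows "differential m g (differential m g x) \<approx>[RR m g] 0"
proof -
  have "differential m g (differential m g x) = lin_ext (\<lambda>\<Gamma>. differential m g (differential m g (bas \<Gamma>))) x"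
    by (simp add: differential_def lin_ext_lin_ext)
  also have "\<dots> \<approx>[RR m g] lin_ext (\<lambda>\<Gamma>. 0) x"
  proof (rule cm_lin_ext)
    fix \<Gamma> assume "\<Gamma> \<in> keys x"
    then have "\<Gamma> \<in> dgraphs g" using assms by blast
    then show "differential m g (differential m g (bas \<Gamma>)) \<approx>[RR m g] 0"
      using differential_sq_located dgraphs_located by metis
  qed
  finally show ?thesis by simp
qed


section \<open>Skew and alternating elements\<close>

lemma lin_ext_of_linear:
  assumes "\<And>x y. F (x + y) = F x + F y" "\<And>c x. F (scl c x) = scl c (F x)"
  shows "F x = lin_ext (\<lambda>b. F (bas b)) x"
proof -
  have zero: "F 0 = 0" using assms(2)[of 0 0] by simp
  have "F (sum h A) = (\<Sum>a\<in>A. F (h a))" for h and A :: "'a set"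
    by (induction A rule: infinite_finite_induct) (simp_all add: zero assms(1))
  then have "F (lin_ext bas x) = lin_ext (\<lambda>b. F (bas b)) x"
    unfolding lin_ext_def by (simp add: assms(2) del: scl_simps(5))
  then show ?thesis by simp
qed

text \<open>
  The value on words of the projection onto the elements that are skew in the edges.
\<close>

fun skew_word :: "tok list \<Rightarrow> tok list \<Rightarrow>\<^sub>0 rat" where
  "skew_word [] = bas []"
| "skew_word (Edge i j # w) = scl (1/2) (mul (Edge i j) (skew_word w) - mul (Edge j i) (skew_word w))"
| "skew_word (Decor x v # w) = mul (Decor x v) (skew_word w)"

definition skew_proj :: "(tok list \<Rightarrow>\<^sub>0 rat) \<Rightarrow> tok list \<Rightarrow>\<^sub>0 rat" where
  "skew_proj = lin_ext skew_word"

fun tmap :: "(nat \<Rightarrow> nat) \<Rightarrow> tok \<Rightarrow> tok" where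
  "tmap \<sigma> (Edge i j) = Edge (\<sigma> i) (\<sigma> j)"
| "tmap \<sigma> (Decor x v) = Decor x (\<sigma> v)"

definition renumber :: "(nat \<Rightarrow> nat) \<Rightarrow> (tok list \<Rightarrow>\<^sub>0 rat) \<Rightarrow> tok list \<Rightarrow>\<^sub>0 rat" where
  "renumber \<sigma> = lin_ext (\<lambda>w. bas (map (tmap \<sigma>) w))"

text \<open>
  Projecting onto the elements that are skew in the edges and alternating in the vertices realises
  the coinvariants inside the span of words; the factor \<open>n!\<close> is left in.
\<close>

definition alt_proj :: "nat \<Rightarrow> (tok list \<Rightarrow>\<^sub>0 rat) \<Rightarrow> tok list \<Rightarrow>\<^sub>0 rat" where
  "alt_proj n x = (\<Sum>\<sigma> | \<sigma> permutes {..<n}. scl (of_int (sign \<sigma>)) (renumber \<sigma> (skew_proj x)))"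

lemma skew_proj_linear:
  "skew_proj (x + y) = skew_proj x + skew_proj y" "skew_proj (x - y) = skew_proj x - skew_proj y" "skew_proj 0 = 0" "skew_proj (scl c x) = scl c (skew_proj x)"
  "skew_proj (sum h A) = (\<Sum>a\<in>A. skew_proj (h a))"
  by (simp_all add: skew_proj_def lin_ext_add lin_ext_diff lin_ext_scl lin_ext_sum)

lemma renumber_linear:
  "renumber \<sigma> (x + y) = renumber \<sigma> x + renumber \<sigma> y" "renumber \<sigma> (x - y) = renumber \<sigma> x - renumber \<sigma> y" "renumber \<sigma> 0 = 0"
  "renumber \<sigma> (scl c x) = scl c (renumber \<sigma> x)" "renumber \<sigma> (sum h A) = (\<Sum>a\<in>A. renumber \<sigma> (h a))"
  by (simp_all add: renumber_def lin_ext_add lin_ext_diff lin_ext_scl lin_ext_sum)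

lemma alt_proj_linear:
  "alt_proj n (x + y) = alt_proj n x + alt_proj n y" "alt_proj n (x - y) = alt_proj n x - alt_proj n y" "alt_proj n 0 = 0"
  "alt_proj n (scl c x) = scl c (alt_proj n x)"
  by (simp_all add: alt_proj_def skew_proj_linear renumber_linear scl_add scl_diff sum.distrib sum_subtractf scl_sum mult.commute)

lemma alt_proj_sum: "alt_proj n (sum h A) = (\<Sum>a\<in>A. alt_proj n (h a))"
  by (induction A rule: infinite_finite_induct) (simp_all add: alt_proj_linear)

lemma skew_proj_mul:
  "skew_proj (mul (Edge i j) x) = scl (1/2) (mul (Edge i j) (skew_proj x) - mul (Edge j i) (skew_proj x))"
  "skew_proj (mul (Decor l v) x) = mul (Decor l v) (skew_proj x)"
  by (simp_all add: skew_proj_def mul_def lin_ext_lin_ext lin_ext_scl_fun lin_ext_diff_fun)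

lemma der_skew_word:
  "dE m i j (skew_word w) = scl (1/2) (skew_proj (dword (tpar m) (Edge i j) w) - skew_proj (dword (tpar m) (Edge j i) w))"
  "der (tpar m) (Decor l v) (skew_word w) = skew_proj (dword (tpar m) (Decor l v) w)"
proof -
  show "dE m i j (skew_word w) = scl (1/2) (skew_proj (dword (tpar m) (Edge i j) w) - skew_proj (dword (tpar m) (Edge j i) w))"
  proof (induction w rule: skew_word.induct)
    case 1 then show ?case by (simp add: skew_proj_linear)
  next
    case (2 k l w)
    define \<delta> \<delta>' where "\<delta> = (if i = k \<and> j = l then skew_word w else 0)" and "\<delta>' = (if j = k \<and> i = l then skew_word w else 0)"
    let ?X = "skew_proj (dword (tpar m) (Edge i j) w)" and ?Y = "skew_proj (dword (tpar m) (Edge j i) w)"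
    have Sk0: "skew_proj (if b then bas w else 0) = (if b then skew_word w else 0)" for b by (simp add: skew_proj_def)
    have lhs: "dE m i j (skew_word (Edge k l # w))
       = scl (1/2) ((\<delta> + mul (Edge k l) (dE m i j (skew_word w))) - (\<delta>' + mul (Edge l k) (dE m i j (skew_word w))))"
      unfolding skew_word.simps der_linear der_mul \<delta>_def \<delta>'_def by (simp add: conj_commute)
    have rhs1: "skew_proj (dword (tpar m) (Edge i j) (Edge k l # w)) = \<delta> + scl (1/2) (mul (Edge k l) ?X - mul (Edge l k) ?X)"
      unfolding dword.simps skew_proj_linear Sk0 skew_proj_mul \<delta>_def by simp
    have rhs2: "skew_proj (dword (tpar m) (Edge j i) (Edge k l # w)) = \<delta>' + scl (1/2) (mul (Edge k l) ?Y - mul (Edge l k) ?Y)"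
      unfolding dword.simps skew_proj_linear Sk0 skew_proj_mul \<delta>'_def by simp
    show ?case
      unfolding lhs rhs1 rhs2 2 by (simp add: mul_linear scl_diff scl_add)
  next
    case (3 x u w)
    then show ?case
      by (simp add: der_linear der_mul skew_proj_linear skew_proj_mul mul_linear scl_diff)
  qed
  show "der (tpar m) (Decor l v) (skew_word w) = skew_proj (dword (tpar m) (Decor l v) w)"
  proof (induction w rule: skew_word.induct)
    case 1 then show ?case by (simp add: skew_proj_linear)
  next
    case (2 i j w)
    then show ?case by (simp add: der_linear der_mul skew_proj_linear skew_proj_mul mul_linear)
  next
    case (3 x u w)
    have "skew_proj (bas w) = skew_word w" by (simp add: skew_proj_def)
    with 3 show ?case by (simp add: der_linear der_mul skew_proj_linear skew_proj_mul mul_linear)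
  qed
qed

lemma der_skew_proj:
  "dE m i j (skew_proj x) = scl (1/2) (skew_proj (dE m i j x) - skew_proj (dE m j i x))"
  "der (tpar m) (Decor l v) (skew_proj x) = skew_proj (der (tpar m) (Decor l v) x)"
proof -
  have "dE m i j (skew_proj x) = lin_ext (\<lambda>w. dE m i j (skew_word w)) x" for i j
    by (simp add: der_def skew_proj_def lin_ext_lin_ext)
  then show "dE m i j (skew_proj x) = scl (1/2) (skew_proj (dE m i j x) - skew_proj (dE m j i x))"
    by (simp add: der_skew_word lin_ext_scl_fun lin_ext_diff_fun) (simp add: der_def skew_proj_def lin_ext_lin_ext)
  have "der (tpar m) (Decor l v) (skew_proj x) = lin_ext (\<lambda>w. der (tpar m) (Decor l v) (skew_word w)) x"
    by (simp add: der_def skew_proj_def lin_ext_lin_ext)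
  then show "der (tpar m) (Decor l v) (skew_proj x) = skew_proj (der (tpar m) (Decor l v) x)"
    by (simp add: der_skew_word) (simp add: der_def skew_proj_def lin_ext_lin_ext)
qed

lemma skew_proj_cong:
  assumes "x \<approx>[srel (tpar m)] y" shows "skew_proj x \<approx>[srel (tpar m)] skew_proj y"
  unfolding skew_proj_def
proof (rule cm_lin_ext_span[OF _ assms])
  let ?R = "srel (tpar m)"
  fix r assume "r \<in> srel_gen (tpar m)"
  then obtain u a b v where r: "r = bas (u @ [a, b] @ v) - scl (swap_sign (tpar m) a b) (bas (u @ [b, a] @ v))"
    unfolding srel_gen_def by blast
  have EE: "scl (1/4) (mul (Edge i j) (mul (Edge k l) x)) \<approx>[?R] scl (1/4) (mul (Edge k l) (mul (Edge i j) x))" for i j k l x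
    using cm_scl[OF mul_swap[of "Edge i j" "Edge k l" x "tpar m"], of "1/4"] by simp
  have EL: "scl (1/2) (mul (Edge i j) (mul (Decor l v) x)) \<approx>[?R] scl (1/2) (mul (Decor l v) (mul (Edge i j) x))" for i j l v x
    using cm_scl[OF mul_swap[of "Edge i j" "Decor l v" x "tpar m"], of "1/2"] by simp
  have base: "skew_word (a # b # v) \<approx>[?R] scl (swap_sign (tpar m) a b) (skew_word (b # a # v))"
  proof (cases a)
    case a: (Edge i j)
    show ?thesis
    proof (cases b)
      case b: (Edge k l)
      show ?thesis unfolding a b
        using cm_add[OF cm_diff[OF cm_diff[OF EE EE] EE] EE, of i j k l "skew_word v" i j l k "skew_word v" j i k l "skew_word v" j i l k "skew_word v"]
        by (simp add: mul_linear scl_diff algebra_simps)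
    next
      case b: (Decor x u)
      show ?thesis unfolding a b
        using cm_diff[OF EL EL, of i j x u "skew_word v" j i x u "skew_word v"] by (simp add: mul_linear scl_diff)
    qed
  next
    case a: (Decor x u)
    show ?thesis
    proof (cases b)
      case b: (Edge i j)
      show ?thesis unfolding a b
        using cm_sym[OF cm_diff[OF EL EL, of i j x u "skew_word v" j i x u "skew_word v"]] by (simp add: mul_linear scl_diff)
    next
      case b: (Decor y w)
      show ?thesis unfolding a b using mul_swap[of "Decor x u" "Decor y w" "skew_word v" "tpar m"] by simp
    qed
  qed
  have "skew_word (u @ [a, b] @ v) \<approx>[?R] scl (swap_sign (tpar m) a b) (skew_word (u @ [b, a] @ v))"
  proof (induction u)
    case Nil then show ?case using base by simp
  next
    case (Cons t u)
    show ?case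
    proof (cases t)
      case (Edge i j)
      from cm_scl[OF cm_diff[OF mul_cong[OF Cons.IH, of "Edge i j"] mul_cong[OF Cons.IH, of "Edge j i"]], of "1/2"]
      show ?thesis using Edge by (simp add: mul_linear scl_diff mult.commute)
    next
      case (Decor x v)
      with mul_cong[OF Cons.IH, of t] show ?thesis by (simp add: mul_linear)
    qed
  qed
  then show "lin_ext skew_word r \<in> ?R" by (simp add: r lin_ext_diff cong_mod_def)
qed

lemma tpar_tmap [simp]: "tpar m (tmap \<sigma> t) = tpar m t"
  by (cases t) auto

lemma renumber_mul: "renumber \<sigma> (mul t x) = mul (tmap \<sigma> t) (renumber \<sigma> x)"
  by (simp add: renumber_def mul_def lin_ext_lin_ext)

lemma tmap_inj: "inj \<sigma> \<Longrightarrow> tmap \<sigma> s = tmap \<sigma> t \<longleftrightarrow> s = t"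
  by (cases s; cases t) (auto simp: inj_def)

lemma renumber_der:
  assumes "inj \<sigma>" shows "renumber \<sigma> (der (tpar m) t x) = der (tpar m) (tmap \<sigma> t) (renumber \<sigma> x)"
proof -
  have "renumber \<sigma> (dword (tpar m) t w) = dword (tpar m) (tmap \<sigma> t) (map (tmap \<sigma>) w)" for w
  proof (induction w)
    case Nil then show ?case by (simp add: renumber_linear)
  next
    case (Cons s w)
    have "renumber \<sigma> (bas w) = bas (map (tmap \<sigma>) w)" by (simp add: renumber_def)
    with Cons show ?case
      by (simp add: renumber_linear renumber_mul tmap_inj[OF assms] swap_sign_def)
  qed
  then show ?thesis by (simp add: der_def renumber_def lin_ext_lin_ext)
qed

lemma renumber_cong:
  assumes "x \<approx>[srel (tpar m)] y" shows "renumber \<sigma> x \<approx>[srel (tpar m)] renumber \<sigma> y"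
  unfolding renumber_def
proof (rule cm_lin_ext_span[OF _ assms])
  fix r assume "r \<in> srel_gen (tpar m)"
  then obtain u a b v where r: "r = bas (u @ [a, b] @ v) - scl (swap_sign (tpar m) a b) (bas (u @ [b, a] @ v))"
    unfolding srel_gen_def by blast
  show "lin_ext (\<lambda>w. bas (map (tmap \<sigma>) w)) r \<in> srel (tpar m)"
    using word_swap[of "map (tmap \<sigma>) u" "tmap \<sigma> a" "tmap \<sigma> b" "map (tmap \<sigma>) v" "tpar m"]
    by (simp add: r lin_ext_diff cong_mod_def swap_sign_def)
qed

lemma alt_proj_cong: "x \<approx>[srel (tpar m)] y \<Longrightarrow> alt_proj n x \<approx>[srel (tpar m)] alt_proj n y"
  unfolding alt_proj_def by (intro cm_sum cm_scl renumber_cong skew_proj_cong)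

lemma sum_permuted: "\<sigma> permutes {..<n} \<Longrightarrow> (\<Sum>i<n. f (\<sigma> i)) = (\<Sum>i<(n::nat). f i)"
  using sum.permute[of \<sigma> "{..<n}" f] by (simp add: o_def)

lemma renumber_cut_op:
  assumes "\<sigma> permutes {..<n}" shows "renumber \<sigma> (cut_op m g n x) = cut_op m g n (renumber \<sigma> x)"
proof -
  note inj = permutes_inj[OF assms]
  have "renumber \<sigma> (cut_op m g n x) = (\<Sum>i<n. \<Sum>p<g. mul (tA p (\<sigma> i)) (\<Sum>j<n. mul (tB p (\<sigma> j)) (dE m (\<sigma> i) (\<sigma> j) (renumber \<sigma> x))))"
    by (simp add: cut_op_def half_cut_def renumber_linear renumber_mul renumber_der[OF inj])
  also have "\<dots> = (\<Sum>i<n. \<Sum>p<g. mul (tA p (\<sigma> i)) (half_cut m n p (\<sigma> i) (renumber \<sigma> x)))"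
    unfolding half_cut_def by (subst sum_permuted[OF assms]) (rule refl)
  also have "\<dots> = cut_op m g n (renumber \<sigma> x)"
    unfolding cut_op_def by (rule sum_permuted[OF assms])
  finally show ?thesis .
qed

lemma renumber_contract_pairs: "inj \<sigma> \<Longrightarrow> renumber \<sigma> (contract_pairs m g i j x) = contract_pairs m g (\<sigma> i) (\<sigma> j) (renumber \<sigma> x)"
  by (simp add: contract_pairs_def renumber_linear renumber_der)

lemma renumber_join_op:
  assumes "\<sigma> permutes {..<n}" shows "renumber \<sigma> (join_op m g n x) = join_op m g n (renumber \<sigma> x)"
proof -
  define F where "F i j = mul (Edge i j) (contract_pairs m g i j (renumber \<sigma> x) - contract_pairs m g j i (renumber \<sigma> x))" for i j
  note inj = permutes_inj[OF assms]
  have "renumber \<sigma> (join_op m g n x) = scl (1/2) (\<Sum>i<n. \<Sum>j<n. F (\<sigma> i) (\<sigma> j))"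
    by (simp add: join_op_def F_def renumber_linear renumber_mul renumber_contract_pairs[OF inj])
  also have "(\<Sum>i<n. \<Sum>j<n. F (\<sigma> i) (\<sigma> j)) = (\<Sum>i<n. \<Sum>j<n. F i j)"
    by (subst sum_permuted[OF assms]) (rule sum_permuted[OF assms])
  finally show ?thesis by (simp add: join_op_def F_def)
qed

text \<open>
  What cutting does to the word of a graph before any projection: an edge is cut in both directions, with
  opposite signs.
\<close>

definition word_cut :: "nat \<Rightarrow> nat \<Rightarrow> nat \<Rightarrow> (tok list \<Rightarrow>\<^sub>0 rat) \<Rightarrow> tok list \<Rightarrow>\<^sub>0 rat" where
  "word_cut m g n x = (\<Sum>i<n. \<Sum>p<g. \<Sum>j<n. mul (tA p i) (mul (tB p j) (dE m i j x - dE m j i x)))"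

lemma cut_op_skew_proj: "cut_op m g n (skew_proj x) = scl (1/2) (skew_proj (word_cut m g n x))"
  by (simp add: cut_op_def half_cut_def word_cut_def der_skew_proj skew_proj_linear skew_proj_mul mul_linear scl_sum scl_diff)

lemma contract_pairs_skew_proj: "contract_pairs m g i j (skew_proj x) = skew_proj (contract_pairs m g i j x)"
  by (simp add: contract_pairs_def der_skew_proj skew_proj_linear)

lemma join_op_skew_proj: "join_op m g n (skew_proj x) = skew_proj (join_op m g n x)"
proof -
  define A where "A i j = contract_pairs m g i j (skew_proj x) - contract_pairs m g j i (skew_proj x)" for i j
  have "skew_proj (join_op m g n x) = scl (1/2) (\<Sum>i<n. \<Sum>j<n. scl (1/2) (mul (Edge i j) (A i j) - mul (Edge j i) (A i j)))"
    by (simp add: join_op_def A_def skew_proj_linear skew_proj_mul contract_pairs_skew_proj)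
  also have "(\<Sum>i<n. \<Sum>j<n. scl (1/2) (mul (Edge i j) (A i j) - mul (Edge j i) (A i j)))
     = scl (1/2) ((\<Sum>i<n. \<Sum>j<n. mul (Edge i j) (A i j)) - (\<Sum>i<n. \<Sum>j<n. mul (Edge j i) (A i j)))"
    by (simp add: scl_sum scl_diff sum_subtractf)
  also have "(\<Sum>i<n. \<Sum>j<n. mul (Edge j i) (A i j)) = (\<Sum>i<n. \<Sum>j<n. mul (Edge i j) (A j i))"
    by (rule sum.swap)
  also have "\<dots> = - (\<Sum>i<n. \<Sum>j<n. mul (Edge i j) (A i j))"
    by (simp add: A_def mul_linear sum_subtractf flip: sum_negf)
  also have "scl (1/2) ((\<Sum>i<n. \<Sum>j<n. mul (Edge i j) (A i j)) - - (\<Sum>i<n. \<Sum>j<n. mul (Edge i j) (A i j)))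
     = (\<Sum>i<n. \<Sum>j<n. mul (Edge i j) (A i j))"
    by (simp add: scl_add flip: scl_left_distrib)
  finally show ?thesis by (simp add: join_op_def A_def)
qed

lemma cut_op_alt_proj: "cut_op m g n (alt_proj n x) = scl (1/2) (alt_proj n (word_cut m g n x))"
proof -
  have "cut_op m g n (alt_proj n x) = (\<Sum>\<sigma> | \<sigma> permutes {..<n}. scl (of_int (sign \<sigma>)) (renumber \<sigma> (cut_op m g n (skew_proj x))))"
    by (simp add: alt_proj_def cut_op_linear renumber_cut_op)
  then show ?thesis by (simp add: cut_op_skew_proj renumber_linear alt_proj_def scl_sum mult.commute)
qed

lemma join_op_linear: "join_op m g n (x + y) = join_op m g n x + join_op m g n y" "join_op m g n (scl c x) = scl c (join_op m g n x)"
    "join_op m g n 0 = 0"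
proof -
  have C: "contract_pairs m g i j (x + y) = contract_pairs m g i j x + contract_pairs m g i j y" "contract_pairs m g i j (scl c x) = scl c (contract_pairs m g i j x)"
    "contract_pairs m g i j 0 = 0" for i j
    by (simp_all add: contract_pairs_def der_linear sum.distrib scl_sum)
  show "join_op m g n (x + y) = join_op m g n x + join_op m g n y"
    by (simp add: join_op_def C mul_linear sum.distrib sum_subtractf scl_add scl_diff algebra_simps)
  show "join_op m g n (scl c x) = scl c (join_op m g n x)"
    by (simp add: join_op_def C mul_linear scl_sum scl_diff mult.commute)
  show "join_op m g n 0 = 0"
    by (simp add: join_op_def C mul_linear)
qed

lemma join_op_alt_proj: "join_op m g n (alt_proj n x) = alt_proj n (join_op m g n x)"
proof -
  have sum: "join_op m g n (sum h A) = (\<Sum>a\<in>A. join_op m g n (h a))" for h and A :: "(nat \<Rightarrow> nat) set"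
    by (induction A rule: infinite_finite_induct) (simp_all add: join_op_linear)
  have "join_op m g n (alt_proj n x) = (\<Sum>\<sigma> | \<sigma> permutes {..<n}. scl (of_int (sign \<sigma>)) (renumber \<sigma> (join_op m g n (skew_proj x))))"
    by (simp add: alt_proj_def sum join_op_linear renumber_join_op)
  then show ?thesis by (simp add: join_op_skew_proj alt_proj_def)
qed

lemma alt_proj_skew: "dE m j i (alt_proj n x) = - dE m i j (alt_proj n x)"
proof -
  have "dE m j i (renumber \<sigma> (skew_proj x)) = - dE m i j (renumber \<sigma> (skew_proj x))" if perm: "\<sigma> permutes {..<n}" for \<sigma>
  proof -
    obtain a b where "i = \<sigma> a" "j = \<sigma> b" using permutes_inverses(1)[OF perm] by metis
    moreover have "dE m b a (skew_proj x) = - dE m a b (skew_proj x)"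
      by (simp add: der_skew_proj scl_diff)
    moreover have "renumber \<sigma> (- dE m a b (skew_proj x)) = - renumber \<sigma> (dE m a b (skew_proj x))"
      using renumber_linear(4)[of \<sigma> "-1" "dE m a b (skew_proj x)"] by (simp add: scl_minus_left)
    ultimately show ?thesis
      using renumber_der[OF permutes_inj[OF perm], of m "Edge a b" "skew_proj x"] renumber_der[OF permutes_inj[OF perm], of m "Edge b a" "skew_proj x"]
      by simp
  qed
  then show ?thesis by (simp add: alt_proj_def der_linear scl_minus sum_negf)
qed

lemma skew_alt_proj: "skew m n (alt_proj n x)"
  unfolding skew_def by (intro allI impI, subst alt_proj_skew, rule cm_refl)

lemma skew_proj_renumber: "skew_proj (renumber \<sigma> x) = renumber \<sigma> (skew_proj x)"
proof -
  have "skew_word (map (tmap \<sigma>) w) = renumber \<sigma> (skew_word w)" for w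
    by (induction w rule: skew_word.induct) (simp_all add: renumber_linear renumber_mul, simp add: renumber_def)
  then show ?thesis by (simp add: skew_proj_def renumber_def lin_ext_lin_ext)
qed

lemma renumber_renumber: "renumber \<sigma> (renumber \<tau> x) = renumber (\<sigma> \<circ> \<tau>) x"
proof -
  have "tmap \<sigma> (tmap \<tau> t) = tmap (\<sigma> \<circ> \<tau>) t" for t by (cases t) auto
  then show ?thesis by (simp add: renumber_def lin_ext_lin_ext o_def)
qed

text \<open>
  Renumbering multiplies the projection of a word by the sign by which it multiplies the class of a graph.
\<close>

lemma alt_proj_renumber:
  assumes "\<tau> permutes {..<n}" shows "alt_proj n (renumber \<tau> x) = scl (of_int (sign \<tau>)) (alt_proj n x)"
proof -
  have fin: "finite {..<n}" by simp
  have "alt_proj n (renumber \<tau> x) = (\<Sum>\<sigma> | \<sigma> permutes {..<n}. scl (of_int (sign \<sigma>)) (renumber (\<sigma> \<circ> \<tau>) (skew_proj x)))"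
    by (simp only: alt_proj_def skew_proj_renumber renumber_renumber)
  also have "\<dots> = (\<Sum>\<sigma> | \<sigma> permutes {..<n}. scl (of_int (sign \<tau>)) (scl (of_int (sign (\<sigma> \<circ> \<tau>))) (renumber (\<sigma> \<circ> \<tau>) (skew_proj x))))"
  proof (intro sum.cong refl)
    fix \<sigma> assume "\<sigma> \<in> {\<sigma>. \<sigma> permutes {..<n}}"
    then have "sign (\<sigma> \<circ> \<tau>) = sign \<sigma> * sign \<tau>"
      using assms permutes_imp_permutation[OF fin] by (intro sign_compose) auto
    then have "sign \<tau> * sign (\<sigma> \<circ> \<tau>) = sign \<sigma> * (sign \<tau> * sign \<tau>)" by (simp only: mult_ac)
    then have "sign \<tau> * sign (\<sigma> \<circ> \<tau>) = sign \<sigma>" by (simp only: sign_idempotent mult_1_right)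
    then show "scl (of_int (sign \<sigma>)) (renumber (\<sigma> \<circ> \<tau>) (skew_proj x)) = scl (of_int (sign \<tau>)) (scl (of_int (sign (\<sigma> \<circ> \<tau>))) (renumber (\<sigma> \<circ> \<tau>) (skew_proj x)))"
      by (simp only: scl_simps of_int_mult[symmetric])
  qed
  also have "\<dots> = scl (of_int (sign \<tau>)) (\<Sum>\<sigma> | \<sigma> permutes {..<n}. scl (of_int (sign (\<sigma> \<circ> \<tau>))) (renumber (\<sigma> \<circ> \<tau>) (skew_proj x)))"
    by (simp only: scl_sum)
  also have "(\<Sum>\<sigma> | \<sigma> permutes {..<n}. scl (of_int (sign (\<sigma> \<circ> \<tau>))) (renumber (\<sigma> \<circ> \<tau>) (skew_proj x)))
     = (\<Sum>\<sigma> | \<sigma> permutes {..<n}. scl (of_int (sign \<sigma>)) (renumber \<sigma> (skew_proj x)))"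
    by (rule sum_permutations_compose_right[OF assms, symmetric])
  finally show ?thesis by (simp only: alt_proj_def)
qed


section \<open>Graphs as words\<close>

text \<open>
  The edges come first; being even they can be moved there without signs.
\<close>

definition tokens :: "(nat \<times> nat) list \<Rightarrow> (letter \<times> nat) list \<Rightarrow> tok list" where
  "tokens es lw = map (\<lambda>(i, j). Edge i j) es @ map (\<lambda>(x, v). Decor x v) lw"

fun token_edges :: "tok list \<Rightarrow> (nat \<times> nat) list" where
  "token_edges [] = []" | "token_edges (Edge i j # w) = (i, j) # token_edges w" | "token_edges (Decor x v # w) = token_edges w"

fun token_letters :: "tok list \<Rightarrow> (letter \<times> nat) list" where
  "token_letters [] = []" | "token_letters (Edge i j # w) = token_letters w" | "token_letters (Decor x v # w) = (x, v) # token_letters w"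

lemma tokens_simps [simp]: "tokens ((i, j) # es) lw = Edge i j # tokens es lw" "tokens [] ((x, v) # lw) = Decor x v # tokens [] lw" "tokens [] [] = []"
  by (simp_all add: tokens_def)

lemma token_edges_tokens [simp]: "token_edges (tokens es lw) = es" and token_letters_tokens [simp]: "token_letters (tokens es lw) = lw"
proof -
  have "token_edges (map (\<lambda>(x, v). Decor x v) lw) = []" "token_letters (map (\<lambda>(x, v). Decor x v) lw) = lw" by (induction lw) auto
  then show "token_edges (tokens es lw) = es" "token_letters (tokens es lw) = lw" by (induction es) (auto simp: tokens_def)
qed

lemma token_edges_append [simp]: "token_edges (u @ w) = token_edges u @ token_edges w" by (induction u rule: token_edges.induct) auto
lemma token_letters_append [simp]: "token_letters (u @ w) = token_letters u @ token_letters w" by (induction u rule: token_letters.induct) auto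

lemma mset_tokens: "mset (tokens (token_edges w) (token_letters w)) = mset w"
  by (induction w rule: token_edges.induct) (auto simp: tokens_def)

lemma set_tokens_toks: "set (tokens es lw) \<subseteq> toks g n \<longleftrightarrow> wf_edges n es \<and> wf_locs g n lw"
  by (fastforce simp: tokens_def wf_edges_def wf_locs_def)

lemma wf_tokens: "set w \<subseteq> toks g n \<longleftrightarrow> wf_edges n (token_edges w) \<and> wf_locs g n (token_letters w)"
  by (metis mset_tokens set_mset_mset set_tokens_toks)

lemma tokens_move: "bas (Decor x v # tokens es lw) \<approx>[srel (tpar m)] bas (tokens es ((x, v) # lw))"
proof -
  have par0: "sum_list (map (tpar m \<circ> (\<lambda>(i, j). Edge i j)) es) = 0" by (induction es) auto
  show ?thesis
    using word_move[of "[Decor x v]" "map (\<lambda>(i, j). Edge i j) es" "map (\<lambda>(x, v). Decor x v) lw" "tpar m"]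
    by (simp add: tokens_def par0)
qed

lemma word_tokens: "bas w \<approx>[srel (tpar m)] bas (tokens (token_edges w) (token_letters w))"
proof (induction w rule: token_edges.induct)
  case 1 then show ?case by simp
next
  case (2 i j w)
  from mul_cong[OF this, of "Edge i j"] show ?case by simp
next
  case (3 x v w)
  from mul_cong[OF this, of "Decor x v"]
  have "bas (Decor x v # w) \<approx>[srel (tpar m)] bas (Decor x v # tokens (token_edges w) (token_letters w))" by simp
  from cm_trans[OF this tokens_move] show ?case by simp
qed

lemma tokens_cong:
  assumes "bas lw \<approx>[srel (lpar m)] scl c (bas lw')"
  shows "bas (tokens es lw) \<approx>[srel (tpar m)] scl c (bas (tokens es lw'))"
proof -
  have "lin_ext (\<lambda>lw. bas (tokens es lw)) (bas lw) \<approx>[srel (tpar m)] lin_ext (\<lambda>lw. bas (tokens es lw)) (scl c (bas lw'))"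
  proof (rule cm_lin_ext_span[OF _ assms])
    fix r assume "r \<in> srel_gen (lpar m)"
    then obtain u a b v where r: "r = bas (u @ [a, b] @ v) - scl (swap_sign (lpar m) a b) (bas (u @ [b, a] @ v))"
      unfolding srel_gen_def by blast
    let ?t = "\<lambda>(x, v). Decor x v"
    have "swap_sign (tpar m) (?t a) (?t b) = swap_sign (lpar m) a b" by (cases a; cases b) (simp add: swap_sign_def)
    then show "lin_ext (\<lambda>lw. bas (tokens es lw)) r \<in> srel (tpar m)"
      using word_swap[of "map (\<lambda>(i, j). Edge i j) es @ map ?t u" "?t a" "?t b" "map ?t v" "tpar m"]
      by (simp add: r lin_ext_diff cong_mod_def tokens_def)
  qed
  then show ?thesis by simp
qed

lemma tokens_edges:
  assumes "mset es = mset es'" shows "bas (tokens es lw) \<approx>[srel (tpar m)] bas (tokens es' lw)"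
  using assms
proof (induction es arbitrary: es')
  case Nil then show ?case by simp
next
  case (Cons e es)
  obtain i j where e: "e = (i, j)" by (cases e)
  have "e \<in> set es'" using Cons.prems by (metis list.set_intros(1) set_mset_mset)
  then obtain A B where es': "es' = A @ e # B" by (meson split_list)
  then have "bas (tokens es lw) \<approx>[srel (tpar m)] bas (tokens (A @ B) lw)" using Cons by simp
  from mul_cong[OF this, of "Edge i j"]
  have "bas (tokens (e # es) lw) \<approx>[srel (tpar m)] bas (Edge i j # tokens (A @ B) lw)" by (simp add: e)
  also have "bas (Edge i j # tokens (A @ B) lw) \<approx>[srel (tpar m)] bas (tokens es' lw)"
    using word_move[of "[Edge i j]" "map (\<lambda>(i, j). Edge i j) A" "map (\<lambda>(i, j). Edge i j) B @ map (\<lambda>(x, v). Decor x v) lw" "tpar m"]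
    by (simp add: tokens_def es' e)
  finally show ?case .
qed


subsection \<open>From graphs to alternating words\<close>

text \<open>
  Graphs with another number of vertices are sent to 0, so that all relations between graphs are sent to \<open>srel\<close>.
\<close>

definition graph_to_words :: "nat \<Rightarrow> dgraph \<Rightarrow> tok list \<Rightarrow>\<^sub>0 rat" where
  "graph_to_words n \<Gamma> = (if nverts \<Gamma> = n then alt_proj n (bas (tokens (edges \<Gamma>) (flat 0 (decs \<Gamma>)))) else 0)"

definition to_words :: "nat \<Rightarrow> (dgraph \<Rightarrow>\<^sub>0 rat) \<Rightarrow> tok list \<Rightarrow>\<^sub>0 rat" where
  "to_words n = lin_ext (graph_to_words n)"

lemma to_words_linear:
  "to_words n (x + y) = to_words n x + to_words n y" "to_words n (x - y) = to_words n x - to_words n y" "to_words n (scl c x) = scl c (to_words n x)"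
  "to_words n (sum h A) = (\<Sum>a\<in>A. to_words n (h a))" "to_words n 0 = 0"
  by (simp_all add: to_words_def lin_ext_add lin_ext_diff lin_ext_scl lin_ext_sum)

lemma to_words_other: "n' \<noteq> n \<Longrightarrow> to_words n (located m n' es lw) = 0"
  by (simp add: to_words_def located_def graph_to_words_def)

lemma to_words_located:
  assumes "wf_locs g n lw"
  shows "to_words n (located m n es lw) \<approx>[srel (tpar m)] alt_proj n (bas (tokens es lw))"
proof -
  have "\<forall>z\<in>set lw. snd z < n" using assms by (auto simp: wf_locs_def)
  then have "bas (tokens es lw) \<approx>[srel (tpar m)] scl (sortsign m lw) (bas (tokens es (flat 0 (bins n lw))))"
    by (intro tokens_cong word_sort)
  from alt_proj_cong[OF this, of n]
  have "alt_proj n (bas (tokens es lw)) \<approx>[srel (tpar m)] to_words n (located m n es lw)"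
    by (simp add: to_words_def located_def graph_to_words_def alt_proj_linear(4)[symmetric])
  then show ?thesis by (rule cm_sym)
qed

lemma alt_proj_flip: "alt_proj n (bas (Edge i j # w)) = - alt_proj n (bas (Edge j i # w))"
proof -
  have "skew_proj (bas (Edge i j # w)) = scl (-1) (skew_proj (bas (Edge j i # w)))"
    by (simp add: skew_proj_def scl_minus_left scl_diff)
  then have "alt_proj n (bas (Edge i j # w)) = scl (-1) (alt_proj n (bas (Edge j i # w)))"
    unfolding alt_proj_def by (simp only: renumber_linear scl_sum scl_simps mult.commute)
  then show ?thesis by (simp add: scl_minus_left)
qed

lemma to_words_rels:
  assumes "r \<in> rels m g" shows "to_words n r \<in> srel (tpar m)"
proof -
  let ?R = "srel (tpar m)"
  have "lin_ext (graph_to_words n) r \<in> ?R"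
  proof (rule relations_lin_ext[OF _ _ _ _ assms])
    fix n' es u a b w assume w: "wf_edges n' es" "wf_locs g n' (u @ [a, b] @ w)"
    have "to_words n (located m n' es (u @ [a, b] @ w)) \<approx>[?R] scl (swap_sign (lpar m) a b) (to_words n (located m n' es (u @ [b, a] @ w)))"
    proof (cases "n' = n")
      case True
      have "to_words n (located m n es (u @ [a, b] @ w)) \<approx>[?R] alt_proj n (bas (tokens es (u @ [a, b] @ w)))"
        using w(2) True by (intro to_words_located) simp
      also have "alt_proj n (bas (tokens es (u @ [a, b] @ w))) \<approx>[?R] alt_proj n (scl (swap_sign (lpar m) a b) (bas (tokens es (u @ [b, a] @ w))))"
        by (intro alt_proj_cong tokens_cong word_swap)
      also have "alt_proj n (scl (swap_sign (lpar m) a b) (bas (tokens es (u @ [b, a] @ w)))) \<approx>[?R] scl (swap_sign (lpar m) a b) (to_words n (located m n es (u @ [b, a] @ w)))"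
        unfolding alt_proj_linear using w(2) True wf_locs_swap[of g n u a b w] by (intro cm_scl cm_sym[OF to_words_located]) simp
      finally show ?thesis using True by simp
    qed (simp add: to_words_other)
    then show "lin_ext (graph_to_words n) (located m n' es (u @ [a, b] @ w)) \<approx>[?R] scl (swap_sign (lpar m) a b) (lin_ext (graph_to_words n) (located m n' es (u @ [b, a] @ w)))"
      by (simp only: to_words_def)
  next
    fix n' es es' lw assume w: "wf_edges n' es" "wf_locs g n' lw" "mset es = mset es'"
    have "to_words n (located m n' es lw) \<approx>[?R] to_words n (located m n' es' lw)"
    proof (cases "n' = n")
      case True
      have "to_words n (located m n es lw) \<approx>[?R] alt_proj n (bas (tokens es lw))" using w(2) True by (intro to_words_located) simp
      also have "alt_proj n (bas (tokens es lw)) \<approx>[?R] alt_proj n (bas (tokens es' lw))" by (rule alt_proj_cong[OF tokens_edges[OF w(3)]])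
      also have "alt_proj n (bas (tokens es' lw)) \<approx>[?R] to_words n (located m n es' lw)" using w(2) True by (intro cm_sym[OF to_words_located]) simp
      finally show ?thesis using True by simp
    qed (simp add: to_words_other)
    then show "lin_ext (graph_to_words n) (located m n' es lw) \<approx>[?R] lin_ext (graph_to_words n) (located m n' es' lw)"
      by (simp only: to_words_def)
  next
    fix n' i j es lw assume w: "wf_edges n' ((i, j) # es)" "wf_locs g n' lw"
    have "to_words n (located m n' ((i, j) # es) lw) \<approx>[?R] - to_words n (located m n' ((j, i) # es) lw)"
    proof (cases "n' = n")
      case True
      have "to_words n (located m n ((i, j) # es) lw) \<approx>[?R] alt_proj n (bas (tokens ((i, j) # es) lw))" using w(2) True by (intro to_words_located) simp
      also have "alt_proj n (bas (tokens ((i, j) # es) lw)) = - alt_proj n (bas (tokens ((j, i) # es) lw))" unfolding tokens_simps by (rule alt_proj_flip)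
      also have "- alt_proj n (bas (tokens ((j, i) # es) lw)) \<approx>[?R] - to_words n (located m n ((j, i) # es) lw)"
        using w(2) True by (intro cm_minus cm_sym[OF to_words_located]) simp
      finally show ?thesis using True by simp
    qed (simp add: to_words_other)
    then show "lin_ext (graph_to_words n) (located m n' ((i, j) # es) lw) \<approx>[?R] - lin_ext (graph_to_words n) (located m n' ((j, i) # es) lw)"
      by (simp only: to_words_def)
  next
    fix n' k es lw assume w: "wf_edges n' es" "wf_locs g n' lw" "Suc k < n'"
    have "to_words n (located m n' es lw) \<approx>[?R] - to_words n (located m n' (map_edges (swp k) es) (map_locs (swp k) lw))"
    proof (cases "n' = n")
      case True
      have perm: "swp k permutes {..<n}" using w(3) True by (intro permutes_swap_id) auto
      have "bas (tokens (map_edges (swp k) es) (map_locs (swp k) lw)) = renumber (swp k) (bas (tokens es lw))"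
        by (simp add: renumber_def tokens_def o_def case_prod_unfold)
      then have neg: "alt_proj n (bas (tokens es lw)) = - alt_proj n (bas (tokens (map_edges (swp k) es) (map_locs (swp k) lw)))"
        using alt_proj_renumber[OF perm, of "bas (tokens es lw)"] by (simp add: sign_swap_id scl_minus_left)
      have "to_words n (located m n es lw) \<approx>[?R] alt_proj n (bas (tokens es lw))" using w(2) True by (intro to_words_located) simp
      also note neg
      also have "- alt_proj n (bas (tokens (map_edges (swp k) es) (map_locs (swp k) lw))) \<approx>[?R] - to_words n (located m n (map_edges (swp k) es) (map_locs (swp k) lw))"
        using permute_wf(2)[OF perm] w(2) True by (intro cm_minus cm_sym[OF to_words_located]) simp
      finally show ?thesis using True by simp
    qed (simp add: to_words_other)
    then show "lin_ext (graph_to_words n) (located m n' es lw) \<approx>[?R] - lin_ext (graph_to_words n) (located m n' (map_edges (swp k) es) (map_locs (swp k) lw))"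
      by (simp only: to_words_def)
  qed
  then show ?thesis by (simp add: to_words_def)
qed

lemma to_words_cong: "x \<approx>[RR m g] y \<Longrightarrow> to_words n x \<approx>[srel (tpar m)] to_words n y"
  unfolding to_words_def by (rule cm_lin_ext_span) (use to_words_rels in \<open>auto simp: to_words_def\<close>)


subsection \<open>Cutting\<close>

lemma sum_delta2:
  fixes F :: "nat \<Rightarrow> nat \<Rightarrow> 'v::comm_monoid_add"
  assumes "k < n" "l < n"
  shows "(\<Sum>i<n. \<Sum>j<n. if i = k \<and> j = l then F i j else 0) = F k l"
proof -
  have "(\<Sum>j<n. if i = k \<and> j = l then F i j else 0) = (if i = k then F k l else 0)" for i
    using assms(2) by (cases "i = k") simp_all
  then show ?thesis using assms(1) by simp
qed

lemma mul_if: "mul t (if c then x else 0) = (if c then mul t x else 0)"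
  by (simp add: mul_linear)

lemma dE_tokens: "dE m i j (bas (tokens es lw)) = edge_sum (\<lambda>e r. if e = (i, j) then bas (tokens r lw) else 0) es"
proof (induction es)
  case Nil
  have "dword (tpar m) (Edge i j) (map (\<lambda>(x, v). Decor x v) lw) = 0" by (induction lw) (auto simp: mul_linear)
  then show ?case by (simp add: tokens_def)
next
  case (Cons e es)
  obtain k l where e: "e = (k, l)" by (cases e)
  have "mul (Edge k l) (edge_sum (\<lambda>e r. if e = (i, j) then bas (tokens r lw) else 0) es)
      = edge_sum (\<lambda>e r. if e = (i, j) then bas (tokens ((k, l) # r) lw) else 0) es"
    by (simp add: edge_sum_def mul_linear mul_if cong: if_cong)
  with Cons show ?case by (auto simp: e edge_sum_Cons)
qed

text \<open>
  Both directions of an edge together produce the two terms of \<open>\<Delta>\<close>; in the second one the letters change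
  places, which needs no sign as one of their degrees \<open>m\<close>, \<open>m + 1\<close> is even.
\<close>

lemma word_cut_tokens:
  assumes "wf_edges n es"
  shows "word_cut m g n (bas (tokens es lw)) \<approx>[srel (tpar m)] edge_sum (\<lambda>e r. \<Sum>p<g. \<Sum>b\<in>UNIV. scl (if b then 1 else -1)
     (mul (Decor (AB b p) (fst e)) (mul (Decor (AB (\<not> b) p) (snd e)) (bas (tokens r lw))))) es"
proof -
  let ?R = "srel (tpar m)"
  have "word_cut m g n (bas (tokens es lw)) = edge_sum (\<lambda>e r. \<Sum>p<g. \<Sum>i<n. \<Sum>j<n. mul (tA p i) (mul (tB p j)
      ((if e = (i, j) then bas (tokens r lw) else 0) - (if e = (j, i) then bas (tokens r lw) else 0)))) es"
  proof -
    have "word_cut m g n (bas (tokens es lw)) = (\<Sum>p<g. \<Sum>i<n. \<Sum>j<n. mul (tA p i) (mul (tB p j)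
        (dE m i j (bas (tokens es lw)) - dE m j i (bas (tokens es lw)))))"
      unfolding word_cut_def by (rule sum.swap)
    then show ?thesis
      unfolding dE_tokens by (simp add: edge_sum_def mul_linear sum_subtractf[symmetric] sum.swap[of _ "{..<length es}"])
  qed
  also have "\<dots> \<approx>[?R] edge_sum (\<lambda>e r. \<Sum>p<g. \<Sum>b\<in>UNIV. scl (if b then 1 else -1)
     (mul (Decor (AB b p) (fst e)) (mul (Decor (AB (\<not> b) p) (snd e)) (bas (tokens r lw))))) es"
  proof (rule edge_sum_cong, rule cm_sum)
    fix e r p assume "add_mset e (mset r) = mset es"
    from wf_edges_add_mset[OF this assms] have wf: "wf_edges n (e # r)" .
    obtain k l where e0: "e = (k, l)" by (cases e)
    have e: "e = (k, l)" "k < n" "l < n" using wf by (simp_all add: e0 wf_edges_Cons)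
    let ?z = "bas (tokens r lw)"
    have c: "e = (i, j) \<longleftrightarrow> i = k \<and> j = l" "e = (j, i) \<longleftrightarrow> i = l \<and> j = k" for i j
      unfolding e(1) by blast+
    have "mul (tA p i) (mul (tB p j) ((if e = (i, j) then ?z else 0) - (if e = (j, i) then ?z else 0)))
      = (if i = k \<and> j = l then mul (tA p i) (mul (tB p j) ?z) else 0)
        - (if i = l \<and> j = k then mul (tA p i) (mul (tB p j) ?z) else 0)" for i j
      unfolding c mul_linear mul_if conj_commute[of "j = k"] ..
    then have "(\<Sum>i<n. \<Sum>j<n. mul (tA p i) (mul (tB p j) ((if e = (i, j) then ?z else 0) - (if e = (j, i) then ?z else 0))))
       = (\<Sum>i<n. \<Sum>j<n. if i = k \<and> j = l then mul (tA p i) (mul (tB p j) ?z) else 0)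
         - (\<Sum>i<n. \<Sum>j<n. if i = l \<and> j = k then mul (tA p i) (mul (tB p j) ?z) else 0)"
      by (simp only: sum_subtractf)
    also have "\<dots> = mul (tA p k) (mul (tB p l) ?z) - mul (tA p l) (mul (tB p k) ?z)"
      using e by (simp only: sum_delta2)
    also have "\<dots> \<approx>[?R] mul (tA p k) (mul (tB p l) ?z) - mul (tB p k) (mul (tA p l) ?z)"
      using mul_swap[of "tA p l" "tB p k" ?z "tpar m"] by (intro cm_diff cm_refl) simp
    also have "mul (tA p k) (mul (tB p l) ?z) - mul (tB p k) (mul (tA p l) ?z)
      = (\<Sum>b\<in>UNIV. scl (if b then 1 else -1) (mul (Decor (AB b p) (fst e)) (mul (Decor (AB (\<not> b) p) (snd e)) ?z)))"
      by (simp add: UNIV_bool e scl_minus_left single_uminus)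
    finally show "(\<Sum>i<n. \<Sum>j<n. mul (tA p i) (mul (tB p j) ((if e = (i, j) then ?z else 0) - (if e = (j, i) then ?z else 0))))
      \<approx>[?R] (\<Sum>b\<in>UNIV. scl (if b then 1 else -1) (mul (Decor (AB b p) (fst e)) (mul (Decor (AB (\<not> b) p) (snd e)) ?z)))" .
  qed
  finally show ?thesis .
qed

lemma to_words_d_cut_located:
  assumes w: "wf_edges n es" "wf_locs g n lw"
  shows "to_words n (lin_ext (d_cut m g) (located m n es lw)) \<approx>[srel (tpar m)] scl ((-1) ^ (n + m)) (alt_proj n (word_cut m g n (bas (tokens es lw))))"
proof -
  let ?R = "srel (tpar m)"
  define X where "X e r = (\<Sum>p<g. \<Sum>b\<in>UNIV. scl (if b then 1 else -1)
     (mul (Decor (AB b p) (fst e)) (mul (Decor (AB (\<not> b) p) (snd e)) (bas (tokens r lw)))))" for e r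
  have one: "to_words n (cut_term m g n e r lw) \<approx>[?R] scl ((-1) ^ (n + m)) (alt_proj n (X e r))"
    if "add_mset e (mset r) = mset es" for e r
  proof -
    have we: "fst e < n" "snd e < n" using wf_edges_add_mset[OF that w(1)] by (auto simp: wf_edges_Cons)
    have "to_words n (located m n r ((AB b p, fst e) # (AB (\<not> b) p, snd e) # lw)) \<approx>[?R]
        alt_proj n (mul (Decor (AB b p) (fst e)) (mul (Decor (AB (\<not> b) p) (snd e)) (bas (tokens r lw))))" if "p < g" for b p
    proof -
      have "wf_locs g n ((AB b p, fst e) # (AB (\<not> b) p, snd e) # lw)" using w(2) we that by (simp add: wf_locs_Cons)
      from to_words_located[OF this, of m r]
      have "to_words n (located m n r ((AB b p, fst e) # (AB (\<not> b) p, snd e) # lw)) \<approx>[?R]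
        alt_proj n (bas (tokens r ((AB b p, fst e) # (AB (\<not> b) p, snd e) # lw)))" .
      moreover have "mul (Decor (AB b p) (fst e)) (mul (Decor (AB (\<not> b) p) (snd e)) (bas (tokens r lw)))
          \<approx>[?R] bas (tokens r ((AB b p, fst e) # (AB (\<not> b) p, snd e) # lw))"
        using cm_trans[OF mul_cong[OF tokens_move[of "AB (\<not> b) p" "snd e" r lw m], of "Decor (AB b p) (fst e)"]] tokens_move by simp
      ultimately show ?thesis using cm_trans cm_sym alt_proj_cong by blast
    qed
    then have "(\<Sum>p<g. \<Sum>b\<in>UNIV. scl ((-1) ^ (n + m) * (if b then 1 else -1)) (to_words n (located m n r ((AB b p, fst e) # (AB (\<not> b) p, snd e) # lw))))
      \<approx>[?R] (\<Sum>p<g. \<Sum>b\<in>UNIV. scl ((-1) ^ (n + m) * (if b then 1 else -1))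
        (alt_proj n (mul (Decor (AB b p) (fst e)) (mul (Decor (AB (\<not> b) p) (snd e)) (bas (tokens r lw))))))"
      by (intro cm_sum cm_scl) simp
    then show ?thesis
      by (simp only: cut_term_def X_def to_words_linear alt_proj_linear alt_proj_sum scl_sum scl_simps)
  qed
  have "to_words n (lin_ext (d_cut m g) (located m n es lw)) = edge_sum (\<lambda>e r. to_words n (cut_term m g n e r lw)) es"
    unfolding d_cut_located[OF w(1)] to_words_def lin_ext_edge_sum ..
  also have "\<dots> \<approx>[?R] edge_sum (\<lambda>e r. scl ((-1) ^ (n + m)) (alt_proj n (X e r))) es"
    by (rule edge_sum_cong, rule one)
  also have "\<dots> = scl ((-1) ^ (n + m)) (alt_proj n (edge_sum X es))"
    by (simp add: edge_sum_scl) (simp add: edge_sum_def alt_proj_sum)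
  also have "\<dots> \<approx>[?R] scl ((-1) ^ (n + m)) (alt_proj n (word_cut m g n (bas (tokens es lw))))"
    unfolding X_def by (intro cm_scl alt_proj_cong cm_sym[OF word_cut_tokens] w(1))
  finally show ?thesis .
qed


subsection \<open>Back to graphs\<close>

text \<open>
  Words with letters outside \<open>toks g n\<close> do not come from graphs with \<open>n\<close> vertices; they are sent to 0, which is
  compatible with \<open>srel\<close>.
\<close>

definition word_to_graph :: "nat \<Rightarrow> nat \<Rightarrow> nat \<Rightarrow> tok list \<Rightarrow> dgraph \<Rightarrow>\<^sub>0 rat" where
  "word_to_graph m g n w = (if set w \<subseteq> toks g n then located m n (token_edges w) (token_letters w) else 0)"

lemma word_to_graph_srel:
  assumes "x \<approx>[srel (tpar m)] y"
  shows "lin_ext (word_to_graph m g n) x \<approx>[RR m g] lin_ext (word_to_graph m g n) y"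
proof (rule cm_lin_ext_span[OF _ assms])
  fix r assume "r \<in> srel_gen (tpar m)"
  then obtain u a b v where r: "r = bas (u @ [a, b] @ v) - scl (swap_sign (tpar m) a b) (bas (u @ [b, a] @ v))"
    unfolding srel_gen_def by blast
  have lin: "lin_ext (word_to_graph m g n) r = word_to_graph m g n (u @ [a, b] @ v) - scl (swap_sign (tpar m) a b) (word_to_graph m g n (u @ [b, a] @ v))"
    unfolding r by (simp only: lin_ext_diff lin_ext_scl lin_ext_single scl_simps mult_1_right)
  show "lin_ext (word_to_graph m g n) r \<in> RR m g"
  proof (cases "set (u @ [a, b] @ v) \<subseteq> toks g n")
    case False
    then have "\<not> set (u @ [b, a] @ v) \<subseteq> toks g n" by auto
    with False show ?thesis
      unfolding lin by (simp only: word_to_graph_def if_False scl_simps diff_self rat_free.span_zero)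
  next
    case True
    then have T': "set (u @ [b, a] @ v) \<subseteq> toks g n" by auto
    have wf: "wf_edges n (token_edges (u @ [a, b] @ v))" "wf_locs g n (token_letters (u @ [a, b] @ v))" using True wf_tokens by blast+
    have "located m n (token_edges (u @ [a, b] @ v)) (token_letters (u @ [a, b] @ v)) \<approx>[RR m g]
        scl (swap_sign (tpar m) a b) (located m n (token_edges (u @ [b, a] @ v)) (token_letters (u @ [b, a] @ v)))"
    proof (cases a)
      case a: (Edge i j)
      show ?thesis
      proof (cases b)
        case b: (Edge k l)
        then show ?thesis using located_edges[OF wf, of "token_edges (u @ [b, a] @ v)" m] a by simp
      qed (simp add: a)
    next
      case a: (Decor x i)
      show ?thesis
      proof (cases b)
        case (Edge k l)
        then show ?thesis by (simp add: a)
      next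
        case b: (Decor y j)
        then show ?thesis
          using located_swap[of n "token_edges u @ token_edges v" g "token_letters u" "(x, i)" "(y, j)" "token_letters v" m] wf a by (simp add: swap_sign_def)
      qed
    qed
    then show ?thesis using True T' unfolding lin by (simp only: word_to_graph_def if_True cong_mod_def)
  qed
qed

lemma word_to_graph_skew_word: "lin_ext (\<lambda>w. word_to_graph m g n (u @ w)) (skew_word w) \<approx>[RR m g] word_to_graph m g n (u @ w)"
proof (induction w arbitrary: u rule: skew_word.induct)
  case 1 then show ?case by simp
next
  case (2 i j w)
  have shift: "lin_ext (\<lambda>w. word_to_graph m g n (u @ w)) (mul t x) = lin_ext (\<lambda>w. word_to_graph m g n ((u @ [t]) @ w)) x" for t x
    by (simp add: mul_def lin_ext_lin_ext)
  have flip: "word_to_graph m g n (u @ Edge j i # w) \<approx>[RR m g] - word_to_graph m g n (u @ Edge i j # w)"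
  proof (cases "set (u @ Edge j i # w) \<subseteq> toks g n")
    case False
    then have "\<not> set (u @ Edge i j # w) \<subseteq> toks g n" by auto
    with False show ?thesis by (simp only: word_to_graph_def if_False minus_zero cm_refl)
  next
    case True
    then have T': "set (u @ Edge i j # w) \<subseteq> toks g n" by auto
    let ?L = "token_letters u @ token_letters w" and ?r = "token_edges u @ token_edges w"
    have wf: "wf_edges n (token_edges u @ (j, i) # token_edges w)" "wf_edges n (token_edges u @ (i, j) # token_edges w)" "wf_locs g n ?L"
      using True T' wf_tokens[of "u @ Edge j i # w" g n] wf_tokens[of "u @ Edge i j # w" g n] by simp_all
    then have wf': "wf_edges n ((j, i) # ?r)" "wf_edges n ((i, j) # ?r)" by (auto simp: wf_edges_alt)
    have "located m n (token_edges u @ (j, i) # token_edges w) ?L \<approx>[RR m g] located m n ((j, i) # ?r) ?L"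
      by (rule located_edges[OF wf(1,3)]) simp
    also have "located m n ((j, i) # ?r) ?L \<approx>[RR m g] - located m n ((i, j) # ?r) ?L"
      by (rule located_flip[OF wf'(1) wf(3)])
    also have "- located m n ((i, j) # ?r) ?L \<approx>[RR m g] - located m n (token_edges u @ (i, j) # token_edges w) ?L"
      by (rule cm_minus, rule located_edges[OF wf'(2) wf(3)]) simp
    finally show ?thesis
      using True T' by (simp only: word_to_graph_def if_True token_edges_append token_edges.simps token_letters_append token_letters.simps)
  qed
  have "lin_ext (\<lambda>w. word_to_graph m g n (u @ w)) (skew_word (Edge i j # w))
    = scl (1/2) (lin_ext (\<lambda>w. word_to_graph m g n ((u @ [Edge i j]) @ w)) (skew_word w) - lin_ext (\<lambda>w. word_to_graph m g n ((u @ [Edge j i]) @ w)) (skew_word w))"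
    by (simp only: skew_word.simps lin_ext_scl lin_ext_diff shift)
  also have "\<dots> \<approx>[RR m g] scl (1/2) (word_to_graph m g n ((u @ [Edge i j]) @ w) - word_to_graph m g n ((u @ [Edge j i]) @ w))"
    by (intro cm_scl cm_diff 2)
  also have "\<dots> \<approx>[RR m g] scl (1/2) (word_to_graph m g n (u @ Edge i j # w) - - word_to_graph m g n (u @ Edge i j # w))"
    using flip by (intro cm_scl cm_diff) simp_all
  also have "\<dots> = word_to_graph m g n (u @ Edge i j # w)"
    by (simp add: scl_add flip: scl_left_distrib)
  finally show ?case .
next
  case (3 x v w)
  from 3[of "u @ [Decor x v]"] show ?case by (simp add: mul_def lin_ext_lin_ext)
qed

lemma word_to_graph_renumber:
  assumes "\<sigma> permutes {..<n}"
  shows "lin_ext (word_to_graph m g n) (renumber \<sigma> x) \<approx>[RR m g] scl (of_int (sign \<sigma>)) (lin_ext (word_to_graph m g n) x)"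
proof -
  have tm: "token_edges (map (tmap \<sigma>) w) = map_edges \<sigma> (token_edges w)" "token_letters (map (tmap \<sigma>) w) = map_locs \<sigma> (token_letters w)" for w
    by (induction w rule: token_edges.induct) auto
  have word: "word_to_graph m g n (map (tmap \<sigma>) w) \<approx>[RR m g] scl (of_int (sign \<sigma>)) (word_to_graph m g n w)" for w
  proof -
    have iff: "\<sigma> v < n \<longleftrightarrow> v < n" for v using permutes_in_image[OF assms, of v] by simp
    have "tmap \<sigma> t \<in> toks g n \<longleftrightarrow> t \<in> toks g n" for t by (cases t) (simp_all add: iff)
    then have T: "set (map (tmap \<sigma>) w) \<subseteq> toks g n \<longleftrightarrow> set w \<subseteq> toks g n" by auto
    show ?thesis
    proof (cases "set w \<subseteq> toks g n")
      case True
      have "located m n (token_edges w) (token_letters w) \<approx>[RR m g] scl (of_int (sign \<sigma>)) (located m n (map_edges \<sigma> (token_edges w)) (map_locs \<sigma> (token_letters w)))"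
        using True wf_tokens assms by (intro located_permute) blast+
      from cm_sym[OF cm_scl[OF this, of "of_int (sign \<sigma>)"]]
      have "located m n (map_edges \<sigma> (token_edges w)) (map_locs \<sigma> (token_letters w)) \<approx>[RR m g] scl (of_int (sign \<sigma>)) (located m n (token_edges w) (token_letters w))"
        by (simp flip: of_int_mult)
      then show ?thesis using True T by (simp only: word_to_graph_def tm if_True)
    next
      case False then show ?thesis using T by (simp only: word_to_graph_def if_False scl_simps cm_refl)
    qed
  qed
  have "lin_ext (word_to_graph m g n) (renumber \<sigma> x) = lin_ext (\<lambda>w. word_to_graph m g n (map (tmap \<sigma>) w)) x"
    by (simp add: renumber_def lin_ext_lin_ext)
  also have "\<dots> \<approx>[RR m g] lin_ext (\<lambda>w. scl (of_int (sign \<sigma>)) (word_to_graph m g n w)) x"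
    by (intro cm_lin_ext word)
  finally show ?thesis by (simp add: lin_ext_scl_fun)
qed

text \<open>
  Every term of the projection represents the same class of graphs, so a word is recovered \<open>n!\<close> times.
\<close>

lemma word_to_graph_alt_proj: "lin_ext (word_to_graph m g n) (alt_proj n x) \<approx>[RR m g] scl (of_nat (fact n)) (lin_ext (word_to_graph m g n) x)"
proof -
  have skew_proj: "lin_ext (word_to_graph m g n) (skew_proj x) \<approx>[RR m g] lin_ext (word_to_graph m g n) x"
    unfolding skew_proj_def lin_ext_lin_ext by (intro cm_lin_ext) (use word_to_graph_skew_word[where u = "[]"] in simp)
  have "lin_ext (word_to_graph m g n) (alt_proj n x) = (\<Sum>\<sigma> | \<sigma> permutes {..<n}. scl (of_int (sign \<sigma>)) (lin_ext (word_to_graph m g n) (renumber \<sigma> (skew_proj x))))"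
    by (simp add: alt_proj_def lin_ext_sum lin_ext_scl)
  also have "\<dots> \<approx>[RR m g] (\<Sum>\<sigma> | \<sigma> permutes {..<n}. lin_ext (word_to_graph m g n) x)"
  proof (rule cm_sum)
    fix \<sigma> assume "\<sigma> \<in> {\<sigma>. \<sigma> permutes {..<n}}"
    then have p: "\<sigma> permutes {..<n}" by simp
    have "scl (of_int (sign \<sigma>)) (lin_ext (word_to_graph m g n) (renumber \<sigma> (skew_proj x))) \<approx>[RR m g]
        scl (of_int (sign \<sigma>)) (scl (of_int (sign \<sigma>)) (lin_ext (word_to_graph m g n) x))"
      by (intro cm_scl cm_trans[OF word_to_graph_renumber[OF p]] skew_proj)
    then show "scl (of_int (sign \<sigma>)) (lin_ext (word_to_graph m g n) (renumber \<sigma> (skew_proj x))) \<approx>[RR m g] lin_ext (word_to_graph m g n) x"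
      by (simp flip: of_int_mult)
  qed
  also have "(\<Sum>\<sigma> | \<sigma> permutes {..<n}. lin_ext (word_to_graph m g n) x) = scl (of_nat (fact n)) (lin_ext (word_to_graph m g n) x)"
  proof -
    have "(\<Sum>a\<in>A. y) = scl (of_nat (card A)) y" for A :: "(nat \<Rightarrow> nat) set" and y :: "dgraph \<Rightarrow>\<^sub>0 rat"
      by (induction A rule: infinite_finite_induct) (simp_all add: scl_left_distrib)
    moreover have "card {\<sigma>. \<sigma> permutes {..<n}} = fact n" by (rule card_permutations) simp_all
    ultimately show ?thesis by simp
  qed
  finally show ?thesis .
qed

text \<open>
  By \<open>word_to_graph_alt_proj\<close> the way back recovers \<open>n!\<close> times the class of a graph.
\<close>

lemma to_words_injective:
  assumes x: "keys x \<subseteq> {\<Gamma> \<in> dgraphs g. nverts \<Gamma> = n}" and "to_words n x \<approx>[srel (tpar m)] 0"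
  shows "x \<in> RR m g"
proof -
  have "lin_ext (word_to_graph m g n) (to_words n x) \<approx>[RR m g] 0"
    using word_to_graph_srel[OF assms(2), of g n] by simp
  moreover have "lin_ext (word_to_graph m g n) (to_words n x) \<approx>[RR m g] scl (of_nat (fact n)) x"
  proof -
    have "lin_ext (word_to_graph m g n) (to_words n x) = lin_ext (\<lambda>\<Gamma>. lin_ext (word_to_graph m g n) (graph_to_words n \<Gamma>)) x"
      by (simp add: to_words_def lin_ext_lin_ext)
    also have "\<dots> \<approx>[RR m g] lin_ext (\<lambda>\<Gamma>. scl (of_nat (fact n)) (bas \<Gamma>)) x"
    proof (rule cm_lin_ext)
      fix \<Gamma> assume "\<Gamma> \<in> keys x"
      then have \<Gamma>: "\<Gamma> \<in> dgraphs g" "nverts \<Gamma> = n" using x by auto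
      have "set (tokens (edges \<Gamma>) (flat 0 (decs \<Gamma>))) \<subseteq> toks g n"
        using dgraphs_located(2,3)[OF \<Gamma>(1)] \<Gamma>(2) by (simp add: set_tokens_toks)
      then have "lin_ext (word_to_graph m g n) (bas (tokens (edges \<Gamma>) (flat 0 (decs \<Gamma>)))) = bas \<Gamma>"
        using dgraphs_located(1)[OF \<Gamma>(1), of m] \<Gamma>(2) by (simp add: word_to_graph_def)
      then show "lin_ext (word_to_graph m g n) (graph_to_words n \<Gamma>) \<approx>[RR m g] scl (of_nat (fact n)) (bas \<Gamma>)"
        using word_to_graph_alt_proj[of m g n "bas (tokens (edges \<Gamma>) (flat 0 (decs \<Gamma>)))"] \<Gamma>(2) unfolding graph_to_words_def by simp
    qed
    finally show ?thesis using lin_ext_scl_fun[of "of_nat (fact n)" bas x] by simp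
  qed
  ultimately have "scl (of_nat (fact n)) x \<approx>[RR m g] 0" using cm_trans cm_sym by blast
  from cm_scl[OF this, of "1 / of_nat (fact n)"] show ?thesis by (simp add: cong_mod_zero)
qed


section \<open>Valences and numbers of decorations\<close>

fun isE :: "tok \<Rightarrow> bool" where "isE (Edge i j) = True" | "isE (Decor x v) = False"
fun isA :: "tok \<Rightarrow> bool" where "isA (Edge i j) = False" | "isA (Decor x v) = is_Alpha x"
fun isB :: "tok \<Rightarrow> bool" where "isB (Edge i j) = False" | "isB (Decor x v) = (\<not> is_Alpha x)"

fun tok_valence :: "nat \<Rightarrow> tok \<Rightarrow> nat" where
  "tok_valence v (Edge i j) = (if i = v then 1 else 0) + (if j = v then 1 else 0)"
| "tok_valence v (Decor x u) = (if u = v then 1 else 0)"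

abbreviation cnt :: "(tok \<Rightarrow> bool) \<Rightarrow> tok list \<Rightarrow> nat" where "cnt P w \<equiv> length (filter P w)"
abbreviation word_valence :: "nat \<Rightarrow> tok list \<Rightarrow> nat" where "word_valence v w \<equiv> sum_list (map (tok_valence v) w)"

definition words :: "nat \<Rightarrow> nat \<Rightarrow> nat \<Rightarrow> nat \<Rightarrow> nat \<Rightarrow> tok list set" where
  "words g n e a b = {w. set w \<subseteq> toks g n \<and> cnt isE w = e \<and> cnt isA w = a \<and> cnt isB w = b}"

definition val3 :: "nat \<Rightarrow> tok list \<Rightarrow> bool" where
  "val3 n w \<longleftrightarrow> (\<forall>v<n. 3 \<le> word_valence v w)"

text \<open>
  Graphs with all numerical data fixed: such graphs span the summands on which \<open>d_cut\<close> is studied.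
\<close>

definition graphs_with :: "nat \<Rightarrow> nat \<Rightarrow> nat \<Rightarrow> nat \<Rightarrow> nat \<Rightarrow> dgraph set" where
  "graphs_with g n e a b = {\<Gamma> \<in> dgraphs g. nverts \<Gamma> = n \<and> nedges \<Gamma> = e \<and> num_alpha \<Gamma> = a \<and> num_beta \<Gamma> = b
     \<and> (\<forall>v<n. valence \<Gamma> v \<ge> 3)}"

lemma mset_profile:
  assumes "mset v = add_mset t (mset w)"
  shows "set v = insert t (set w)" "cnt P v = (if P t then 1 else 0) + cnt P w" "word_valence u v = tok_valence u t + word_valence u w"
proof -
  show "set v = insert t (set w)" using assms by (metis set_mset_mset set_mset_add_mset_insert)
  have "mset (filter P v) = mset (filter P (t # w))" using assms by simp
  then have "cnt P v = cnt P (t # w)" by (metis size_mset)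
  then show "cnt P v = (if P t then 1 else 0) + cnt P w" by simp
  have "mset (map (tok_valence u) v) = mset (map (tok_valence u) (t # w))" using assms by simp
  then have "sum_list (map (tok_valence u) v) = sum_list (map (tok_valence u) (t # w))" by (metis sum_mset_sum_list)
  then show "word_valence u v = tok_valence u t + word_valence u w" by simp
qed

lemma tok_kinds:
  assumes "t \<in> toks g n"
  shows "t \<in> edge_toks n \<longleftrightarrow> isE t" "t \<in> alpha_toks g n \<longleftrightarrow> isA t" "t \<in> beta_toks g n \<longleftrightarrow> isB t"
proof -
  have "(t \<in> edge_toks n \<longleftrightarrow> isE t) \<and> (t \<in> alpha_toks g n \<longleftrightarrow> isA t) \<and> (t \<in> beta_toks g n \<longleftrightarrow> isB t)"
  proof (cases t)
    case (Decor x v) then show ?thesis using assms by (cases x) auto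
  qed (use assms in auto)
  then show "t \<in> edge_toks n \<longleftrightarrow> isE t" "t \<in> alpha_toks g n \<longleftrightarrow> isA t" "t \<in> beta_toks g n \<longleftrightarrow> isB t" by auto
qed

lemma words_length: "length w = cnt isE w + cnt isA w + cnt isB w"
proof (induction w)
  case (Cons t w) then show ?case by (cases t) auto
qed simp

lemma sum_word_valence: "set w \<subseteq> toks g n \<Longrightarrow> (\<Sum>v<n. word_valence v w) = 2 * cnt isE w + cnt isA w + cnt isB w"
proof (induction w)
  case Nil then show ?case by simp
next
  case (Cons t w)
  have "(\<Sum>v<n. tok_valence v t) = (if isE t then 2 else 1)"
    using Cons.prems by (cases t) (auto simp: sum.distrib)
  then show ?case using Cons by (cases t) (auto simp: sum.distrib)
qed

lemma mset_concat_bins: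
  "\<forall>z\<in>set lw. snd z < n \<Longrightarrow> mset (concat (bins n lw)) = mset (map fst lw)"
proof (induction lw)
  case Nil
  have "concat (map (\<lambda>_. []) vs) = []" for vs :: "nat list" by (induction vs) auto
  then show ?case by (simp add: bins_def)
next
  case (Cons z lw)
  obtain x v where z: "z = (x, v)" by (cases z)
  have v: "v < n" using Cons.prems z by simp
  let ?ds = "bins n lw"
  have "bins n (z # lw) = take v ?ds @ (x # ?ds ! v) # drop (Suc v) ?ds"
    using v z by (simp add: bins_Cons upd_conv_take_nth_drop)
  moreover have "?ds = take v ?ds @ ?ds ! v # drop (Suc v) ?ds" using v by (simp add: id_take_nth_drop)
  then have "mset (concat ?ds) = mset (concat (take v ?ds @ ?ds ! v # drop (Suc v) ?ds))" by simp
  ultimately show ?case using Cons z by simp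
qed

lemma graph_words:
  assumes w: "wf_edges n es" "wf_locs g n lw"
  shows "DGraph es (bins n lw) \<in> graphs_with g n e a b \<longleftrightarrow> tokens es lw \<in> words g n e a b \<and> val3 n (tokens es lw)"
proof -
  have lab: "\<forall>z\<in>set lw. snd z < n" using w(2) by (auto simp: wf_locs_def)
  have E: "cnt isE (map (\<lambda>(i, j). Edge i j) es) = length es" "cnt isA (map (\<lambda>(i, j). Edge i j) es) = 0"
    "cnt isB (map (\<lambda>(i, j). Edge i j) es) = 0" by (simp_all add: filter_map o_def case_prod_unfold)
  have L: "cnt isE (map (\<lambda>(x, v). Decor x v) lw) = 0"
    "cnt isA (map (\<lambda>(x, v). Decor x v) lw) = length (filter is_Alpha (map fst lw))"
    "cnt isB (map (\<lambda>(x, v). Decor x v) lw) = length (filter (\<lambda>x. \<not> is_Alpha x) (map fst lw))"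
    by (simp_all add: filter_map o_def case_prod_unfold)
  have "length (filter P (concat (bins n lw))) = length (filter P (map fst lw))" for P
  proof -
    have "mset (filter P (concat (bins n lw))) = mset (filter P (map fst lw))"
      by (simp only: mset_filter mset_concat_bins[OF lab])
    then show ?thesis by (rule mset_eq_length)
  qed
  then have cnts: "nedges (DGraph es (bins n lw)) = cnt isE (tokens es lw)" "num_alpha (DGraph es (bins n lw)) = cnt isA (tokens es lw)"
    "num_beta (DGraph es (bins n lw)) = cnt isB (tokens es lw)"
    unfolding tokens_def filter_append length_append E L num_alpha_def num_beta_def by simp_all
  have val: "valence (DGraph es (bins n lw)) v = word_valence v (tokens es lw)" if "v < n" for v
  proof -
    have "length (filter (\<lambda>e. fst e = v) es) + length (filter (\<lambda>e. snd e = v) es) = word_valence v (map (\<lambda>(i, j). Edge i j) es)"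
      by (induction es) auto
    moreover have "length (filter (\<lambda>z. snd z = v) lw) = word_valence v (map (\<lambda>(x, v). Decor x v) lw)"
      by (induction lw) auto
    ultimately show ?thesis using that by (simp add: valence_def tokens_def bins_nth)
  qed
  show ?thesis
    using dgraphs_bins[OF w] w set_tokens_toks[of es lw g n] by (auto simp: graphs_with_def words_def val3_def cnts[unfolded dgraph.sel] val)
qed

lemma graphs_with_located:
  assumes "\<Gamma> \<in> graphs_with g n e a b"
  shows "bas \<Gamma> = located m n (edges \<Gamma>) (flat 0 (decs \<Gamma>))" "wf_edges n (edges \<Gamma>)" "wf_locs g n (flat 0 (decs \<Gamma>))"
    "tokens (edges \<Gamma>) (flat 0 (decs \<Gamma>)) \<in> words g n e a b" "val3 n (tokens (edges \<Gamma>) (flat 0 (decs \<Gamma>)))"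
proof -
  have d: "\<Gamma> \<in> dgraphs g" "nverts \<Gamma> = n" using assms by (auto simp: graphs_with_def)
  show w: "bas \<Gamma> = located m n (edges \<Gamma>) (flat 0 (decs \<Gamma>))" "wf_edges n (edges \<Gamma>)" "wf_locs g n (flat 0 (decs \<Gamma>))"
    using dgraphs_located(1)[OF d(1), of m] dgraphs_located(2,3)[OF d(1)] d(2) by simp_all
  have "DGraph (edges \<Gamma>) (bins n (flat 0 (decs \<Gamma>))) = \<Gamma>" using d(2) by (cases \<Gamma>) auto
  then show "tokens (edges \<Gamma>) (flat 0 (decs \<Gamma>)) \<in> words g n e a b" "val3 n (tokens (edges \<Gamma>) (flat 0 (decs \<Gamma>)))"
    using graph_words[OF w(2,3), of e a b] assms by simp_all
qed

lemma keys_located: "DGraph es (bins n lw) \<in> B \<Longrightarrow> keys (located m n es lw) \<subseteq> B"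
  by (simp add: located_def)

lemma words_token_edges_token_letters: "w \<in> words g n e a b \<Longrightarrow> tokens (token_edges w) (token_letters w) \<in> words g n e a b"
  and val3_token_edges_token_letters: "val3 n w \<Longrightarrow> val3 n (tokens (token_edges w) (token_letters w))"
proof -
  have ms: "mset (tokens (token_edges w) (token_letters w)) = mset w" by (rule mset_tokens)
  have "set (tokens (token_edges w) (token_letters w)) = set w" using ms by (metis set_mset_mset)
  moreover have "cnt P (tokens (token_edges w) (token_letters w)) = cnt P w" for P using ms by (metis mset_filter size_mset)
  moreover have "word_valence v (tokens (token_edges w) (token_letters w)) = word_valence v w" for v using ms by (metis mset_map sum_mset_sum_list)
  ultimately show "w \<in> words g n e a b \<Longrightarrow> tokens (token_edges w) (token_letters w) \<in> words g n e a b" "val3 n w \<Longrightarrow> val3 n (tokens (token_edges w) (token_letters w))"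
    by (simp_all add: words_def val3_def)
qed

lemma keys_mul_in: "(\<And>w. w \<in> keys y \<Longrightarrow> t # w \<in> B) \<Longrightarrow> keys (mul t y) \<subseteq> B"
  using keys_mul[of y "keys y" t] by auto

lemma keys_der_in: "(\<And>v w. v \<in> keys x \<Longrightarrow> mset v = add_mset t (mset w) \<Longrightarrow> w \<in> B) \<Longrightarrow> keys (der par t x) \<subseteq> B"
  by (metis keys_der subsetI)

definition words3 :: "nat \<Rightarrow> nat \<Rightarrow> nat \<Rightarrow> nat \<Rightarrow> nat \<Rightarrow> tok list set" where
  "words3 g n e a b = {w \<in> words g n e a b. val3 n w}"

lemma keys_word_cut:
  assumes "keys z \<subseteq> words3 g n (Suc e) a b"
  shows "keys (word_cut m g n z) \<subseteq> words3 g n e (Suc a) (Suc b)"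
proof -
  have step: "keys (dE m k l z) \<subseteq> {w. tA p i # tB p j # w \<in> words3 g n e (Suc a) (Suc b)}"
    if "i < n" "j < n" "p < g" "(k, l) = (i, j) \<or> (k, l) = (j, i)" for i j k l p
  proof (rule keys_der_in)
    fix v w assume "v \<in> keys z" and ms: "mset v = add_mset (Edge k l) (mset w)"
    then have "v \<in> words3 g n (Suc e) a b" using assms by blast
    then show "w \<in> {w. tA p i # tB p j # w \<in> words3 g n e (Suc a) (Suc b)}"
      using that mset_profile[OF ms] by (auto simp: words3_def words_def val3_def)
  qed
  show ?thesis
    unfolding word_cut_def
  proof (intro keys_sum_subset)
    fix i p j assume "i \<in> {..<n}" "p \<in> {..<g}" "j \<in> {..<n}"
    then have "keys (dE m i j z - dE m j i z) \<subseteq> {w. tA p i # tB p j # w \<in> words3 g n e (Suc a) (Suc b)}"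
      by (intro keys_diff_subset step) auto
    then show "keys (mul (tA p i) (mul (tB p j) (dE m i j z - dE m j i z))) \<subseteq> words3 g n e (Suc a) (Suc b)"
      using keys_mul_in[of "dE m i j z - dE m j i z" "tB p j" "{w. tA p i # w \<in> words3 g n e (Suc a) (Suc b)}"]
      by (intro keys_mul_in) blast
  qed
qed

text \<open>
  The numbers of letters are written with \<open>Suc\<close> on the left, so that for \<open>a = 0\<close> or \<open>b = 0\<close> the set is
  empty, as it must be.
\<close>

lemma keys_join_op:
  assumes "keys x \<subseteq> words3 g n e a b"
  shows "keys (join_op m g n x) \<subseteq> {w. set w \<subseteq> toks g n \<and> cnt isE w = Suc e \<and> Suc (cnt isA w) = a \<and> Suc (cnt isB w) = b \<and> val3 n w}"
    (is "_ \<subseteq> ?U")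
proof -
  have step: "keys (dB m p l (dA m p k x)) \<subseteq> {w. Edge i j # w \<in> ?U}"
    if "i < n" "j < n" "p < g" "(k, l) = (i, j) \<or> (k, l) = (j, i)" for i j k l p
  proof (rule keys_der_in)
    fix v w assume "v \<in> keys (dA m p k x)" and m1: "mset v = add_mset (tB p l) (mset w)"
    then obtain v' where "v' \<in> keys x" and m2: "mset v' = add_mset (tA p k) (mset v)" by (elim keys_der)
    then have "v' \<in> words3 g n e a b" using assms by blast
    then show "w \<in> {w. Edge i j # w \<in> ?U}"
      using that mset_profile[OF m1] mset_profile[OF m2] by (auto simp: words3_def words_def val3_def)
  qed
  show ?thesis
    unfolding join_op_def
  proof (intro keys_scl keys_sum_subset)
    fix i j assume "i \<in> {..<n}" "j \<in> {..<n}"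
    then have sub: "keys (contract_pairs m g i j x - contract_pairs m g j i x) \<subseteq> {w. Edge i j # w \<in> ?U}"
      unfolding contract_pairs_def by (intro keys_diff_subset keys_sum_subset step) simp_all
    show "keys (mul (Edge i j) (contract_pairs m g i j x - contract_pairs m g j i x)) \<subseteq> ?U"
    proof (rule keys_mul_in)
      fix w assume "w \<in> keys (contract_pairs m g i j x - contract_pairs m g j i x)"
      with sub have "w \<in> {w. Edge i j # w \<in> ?U}" by (rule subsetD)
      then show "Edge i j # w \<in> ?U" by (rule CollectD)
    qed
  qed
qed

lemma keys_alt_proj:
  assumes "keys x \<subseteq> words g n e a b" shows "keys (alt_proj n x) \<subseteq> words g n e a b"
proof -
  have skew_word: "keys (skew_word w) \<subseteq> words g n e a b" if "w \<in> words g n e a b" for w e a b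
    using that
  proof (induction w arbitrary: e a b rule: skew_word.induct)
    case 1 then show ?case by simp
  next
    case (2 i j w)
    then obtain e' where e': "e = Suc e'" "w \<in> words g n e' a b" "i < n" "j < n" by (auto simp: words_def)
    have "keys (mul (Edge k l) (skew_word w)) \<subseteq> words g n e a b" if "k < n" "l < n" for k l
      using 2(1)[OF e'(2)] that e'(1) by (intro keys_mul_in) (auto simp: words_def)
    then show ?case using e'(3,4) unfolding skew_word.simps by (intro keys_scl keys_diff_subset) auto
  next
    case (3 x v w)
    then have w: "w \<in> words g n e (a - (if is_Alpha x then 1 else 0)) (b - (if is_Alpha x then 0 else 1))"
      by (auto simp: words_def)
    show ?case
      using 3(1)[OF w] 3(2) unfolding skew_word.simps by (intro keys_mul_in) (auto simp: words_def split: if_splits)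
  qed
  have skew_proj: "keys (skew_proj x) \<subseteq> words g n e a b"
    unfolding skew_proj_def using assms skew_word by (intro keys_lin_ext) blast
  have renumber: "keys (renumber \<sigma> (skew_proj x)) \<subseteq> words g n e a b" if "\<sigma> permutes {..<n}" for \<sigma>
    unfolding renumber_def
  proof (rule keys_lin_ext)
    fix w assume "w \<in> keys (skew_proj x)"
    then have w: "w \<in> words g n e a b" using skew_proj by blast
    have iff: "\<sigma> v < n \<longleftrightarrow> v < n" for v using permutes_in_image[OF that, of v] by simp
    have "isE (tmap \<sigma> t) = isE t" "isA (tmap \<sigma> t) = isA t" "isB (tmap \<sigma> t) = isB t"
      "tmap \<sigma> t \<in> toks g n \<longleftrightarrow> t \<in> toks g n" for t by (cases t; simp add: iff)+
    then have "map (tmap \<sigma>) w \<in> words g n e a b"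
      using w by (auto simp: words_def filter_map o_def)
    then show "keys (bas (map (tmap \<sigma>) w)) \<subseteq> words g n e a b" by simp
  qed
  show ?thesis
    unfolding alt_proj_def using renumber by (intro keys_sum_subset keys_scl) simp
qed


section \<open>Exactness of the cutting differential\<close>

lemma join_op_adjoint:
  assumes y: "keys y \<subseteq> hwords (toks g n) N 0" and v: "keys v \<subseteq> hwords (toks g n) N (Suc 0)"
    and sk: "\<And>i j. dE m j i v = - dE m i j v"
  shows "form (tpar m) (join_op m g n y) v = form (tpar m) y (cut_op m g n v)"
proof -
  let ?f = "form (tpar m)"
  have fin: "finite (toks g n)" by simp
  have "?f (join_op m g n y) v = 1/2 * (\<Sum>i<n. \<Sum>j<n. ?f (contract_pairs m g i j y) (dE m i j v) - ?f (contract_pairs m g j i y) (dE m i j v))"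
    by (simp add: join_op_def form_scl_left form_sum_left form_mul form_diff_left)
  also have "\<dots> = 1/2 * ((\<Sum>i<n. \<Sum>j<n. ?f (contract_pairs m g i j y) (dE m i j v)) - (\<Sum>i<n. \<Sum>j<n. ?f (contract_pairs m g j i y) (dE m i j v)))"
    by (simp only: sum_subtractf)
  also have "(\<Sum>i<n. \<Sum>j<n. ?f (contract_pairs m g j i y) (dE m i j v)) = (\<Sum>i<n. \<Sum>j<n. ?f (contract_pairs m g i j y) (dE m j i v))"
    by (rule sum.swap)
  also have "\<dots> = - (\<Sum>i<n. \<Sum>j<n. ?f (contract_pairs m g i j y) (dE m i j v))"
    unfolding sum_negf[symmetric] by (subst sk) (simp add: form_minus_right)
  also have "1/2 * ((\<Sum>i<n. \<Sum>j<n. ?f (contract_pairs m g i j y) (dE m i j v)) - - (\<Sum>i<n. \<Sum>j<n. ?f (contract_pairs m g i j y) (dE m i j v)))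
      = (\<Sum>i<n. \<Sum>j<n. ?f (contract_pairs m g i j y) (dE m i j v))" by simp
  also have "\<dots> = (\<Sum>i<n. \<Sum>j<n. \<Sum>p<g. ?f y (mul (tA p i) (mul (tB p j) (dE m i j v))))"
  proof (intro sum.cong refl)
    fix i j assume ij: "i \<in> {..<n}" "j \<in> {..<n}"
    have "?f (dB m p j (dA m p i y)) (dE m i j v) = ?f y (mul (tA p i) (mul (tB p j) (dE m i j v)))" if "p < g" for p
    proof -
      have hz: "keys (dE m i j v) \<subseteq> hwords (toks g n) N (Suc (Suc 0))" by (rule hw_der[OF v])
      have "?f y (mul (tA p i) (mul (tB p j) (dE m i j v))) = ?f (dA m p i y) (mul (tB p j) (dE m i j v))"
        using ij that by (intro hw_adj[OF fin _ y] hw_mul hz) auto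
      also have "\<dots> = ?f (dB m p j (dA m p i y)) (dE m i j v)"
        using ij that by (intro hw_adj[OF fin _ hw_der[OF y] hz]) auto
      finally show ?thesis by simp
    qed
    then show "?f (contract_pairs m g i j y) (dE m i j v) = (\<Sum>p<g. ?f y (mul (tA p i) (mul (tB p j) (dE m i j v))))"
      by (simp add: contract_pairs_def form_sum_left)
  qed
  also have "\<dots> = (\<Sum>i<n. \<Sum>p<g. \<Sum>j<n. ?f y (mul (tA p i) (mul (tB p j) (dE m i j v))))"
    by (rule sum.cong[OF refl], rule sum.swap)
  also have "\<dots> = ?f y (cut_op m g n v)"
    by (simp add: cut_op_def half_cut_def mul_linear form_sum_right)
  finally show ?thesis .
qed

lemma keys_d_cut:
  assumes "\<Gamma> \<in> graphs_with g n (Suc e) a b"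
  shows "keys (d_cut m g \<Gamma>) \<subseteq> graphs_with g n e (Suc a) (Suc b)"
proof -
  let ?es = "edges \<Gamma>" and ?lw = "flat 0 (decs \<Gamma>)"
  note \<Gamma> = graphs_with_located[OF assms]
  have "d_cut m g \<Gamma> = edge_sum (\<lambda>e r. cut_term m g n e r ?lw) ?es"
    using d_cut_located[OF \<Gamma>(2), of m g ?lw] by (simp flip: \<Gamma>(1)[of m])
  also have "keys \<dots> \<subseteq> graphs_with g n e (Suc a) (Suc b)"
    unfolding edge_sum_def cut_term_def
  proof (intro keys_sum_subset keys_scl keys_located)
    fix l p b' assume l: "l \<in> {..<length ?es}" and p: "p \<in> {..<g}"
    define ed r where "ed = ?es ! l" and "r = drop_nth l ?es"
    have ms: "add_mset ed (mset r) = mset ?es" unfolding ed_def r_def using l by (intro mset_drop_nth) simp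
    have wf: "wf_edges n (ed # r)" by (rule wf_edges_add_mset[OF ms \<Gamma>(2)])
    let ?lw' = "(AB b' p, fst ed) # (AB (\<not> b') p, snd ed) # ?lw"
    have wf': "wf_edges n r" "wf_locs g n ?lw'" using wf \<Gamma>(3) p by (auto simp: wf_edges_Cons wf_locs_Cons)
    have m1: "mset (tokens ?es ?lw) = add_mset (Edge (fst ed) (snd ed)) (mset (tokens r ?lw))"
      using arg_cong[OF ms, of "image_mset (\<lambda>(i, j). Edge i j)"] by (simp add: tokens_def case_prod_unfold)
    have m2: "mset (tokens r ?lw') = add_mset (Decor (AB b' p) (fst ed)) (mset (Decor (AB (\<not> b') p) (snd ed) # tokens r ?lw))"
      by (simp add: tokens_def)
    have "tokens r ?lw' \<in> words g n e (Suc a) (Suc b) \<and> val3 n (tokens r ?lw')"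
      using \<Gamma>(4,5) mset_profile[OF m1] mset_profile[OF m2] set_tokens_toks[of r ?lw' g n] wf'
      by (cases b') (auto simp: words_def val3_def)
    then show "DGraph (drop_nth l ?es) (bins n ((AB b' p, fst (?es ! l)) # (AB (\<not> b') p, snd (?es ! l)) # ?lw)) \<in> graphs_with g n e (Suc a) (Suc b)"
      using graph_words[OF wf'] unfolding ed_def r_def by blast
  qed
  finally show ?thesis .
qed

text \<open>
  Hodge theory: after subtracting its orthogonal projection to the boundaries, a cycle is killed by
  \<open>cut_op\<close> and by the adjoint \<open>join_op\<close>, and the estimate forces it to vanish.
\<close>

lemma d_cut_exact:
  assumes x: "keys x \<subseteq> graphs_with g n e a b" and e: "e \<ge> 1" and ab: "a + b < g"
    and cycle: "lin_ext (d_cut m g) x \<in> RR m g"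
  shows "\<exists>y. keys y \<subseteq> {\<Gamma>. \<exists>a' b'. a = Suc a' \<and> b = Suc b' \<and> \<Gamma> \<in> graphs_with g n (Suc e) a' b'}
    \<and> x \<approx>[RR m g] lin_ext (d_cut m g) y"
proof -
  let ?R = "srel (tpar m)" and ?T = "toks g n" and ?f = "form (tpar m)" and ?N = "e + a + b"
  let ?s = "(-1) ^ (n + m) :: rat"
  let ?H = "{w. set w \<subseteq> ?T \<and> length w = ?N}"
  define U where "U = {w. set w \<subseteq> ?T \<and> cnt isE w = Suc e \<and> Suc (cnt isA w) = a \<and> Suc (cnt isB w) = b \<and> val3 n w}"
  have fin: "finite ?T" by simp
  have U_len: "w \<in> U \<Longrightarrow> set w \<subseteq> ?T \<and> length w + 1 = ?N" for w
    using words_length[of w] by (auto simp: U_def)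
  have "U \<subseteq> {w. set w \<subseteq> ?T \<and> length w = ?N - 1}" using U_len by fastforce
  then have finU: "finite U" using finite_lists_length_eq[OF fin] finite_subset by blast
  have U_words: "w \<in> words g n (Suc e) (a - 1) (b - 1)" "a \<ge> 1" "b \<ge> 1" if "w \<in> U" for w
    using that by (auto simp: U_def words_def)
  have words_H: "words g n e a b \<subseteq> ?H"
  proof
    fix w assume "w \<in> words g n e a b"
    then show "w \<in> ?H" using words_length[of w] by (simp add: words_def)
  qed
  have V_words: "words3 g n e a b \<subseteq> words g n e a b" by (auto simp: words3_def)

  define x1 where "x1 = lin_ext (\<lambda>\<Gamma>. bas (tokens (edges \<Gamma>) (flat 0 (decs \<Gamma>)))) x"
  have x1_V: "keys x1 \<subseteq> words3 g n e a b"
    unfolding x1_def using x graphs_with_located(4,5) by (intro keys_lin_ext) (fastforce simp: words3_def)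
  have to_words_x: "to_words n x = alt_proj n x1"
  proof -
    have "to_words n x = lin_ext (\<lambda>\<Gamma>. alt_proj n (bas (tokens (edges \<Gamma>) (flat 0 (decs \<Gamma>))))) x"
      unfolding to_words_def using x by (intro lin_ext_cong) (auto simp: graph_to_words_def graphs_with_def)
    also have "\<dots> = alt_proj n x1"
      unfolding x1_def lin_ext_def by (simp only: alt_proj_sum alt_proj_linear)
    finally show ?thesis .
  qed
  have to_words_dx: "to_words n (lin_ext (d_cut m g) y) \<approx>[?R] scl ?s (alt_proj n (word_cut m g n (lin_ext (\<lambda>\<Gamma>. bas (tokens (edges \<Gamma>) (flat 0 (decs \<Gamma>)))) y)))"
    if "keys y \<subseteq> {\<Gamma> \<in> dgraphs g. nverts \<Gamma> = n}" for y
  proof -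
    have "to_words n (lin_ext (d_cut m g) y) = lin_ext (\<lambda>\<Gamma>. to_words n (d_cut m g \<Gamma>)) y"
      by (simp only: to_words_def lin_ext_lin_ext)
    also have "\<dots> \<approx>[?R] lin_ext (\<lambda>\<Gamma>. scl ?s (alt_proj n (word_cut m g n (bas (tokens (edges \<Gamma>) (flat 0 (decs \<Gamma>))))))) y"
    proof (rule cm_lin_ext)
      fix \<Gamma> assume "\<Gamma> \<in> keys y"
      then have \<Gamma>: "\<Gamma> \<in> dgraphs g" "nverts \<Gamma> = n" using that by auto
      have "lin_ext (d_cut m g) (bas \<Gamma>) = d_cut m g \<Gamma>" by simp
      then show "to_words n (d_cut m g \<Gamma>) \<approx>[?R] scl ?s (alt_proj n (word_cut m g n (bas (tokens (edges \<Gamma>) (flat 0 (decs \<Gamma>))))))"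
        using to_words_d_cut_located[of n "edges \<Gamma>" g "flat 0 (decs \<Gamma>)" m] dgraphs_located(1)[OF \<Gamma>(1), of m] dgraphs_located(2,3)[OF \<Gamma>(1)] \<Gamma>(2) by simp
    qed
    also have "lin_ext (\<lambda>\<Gamma>. scl ?s (alt_proj n (word_cut m g n (bas (tokens (edges \<Gamma>) (flat 0 (decs \<Gamma>))))))) y
        = scl ?s (alt_proj n (word_cut m g n (lin_ext (\<lambda>\<Gamma>. bas (tokens (edges \<Gamma>) (flat 0 (decs \<Gamma>)))) y)))"
    proof -
      define F where "F y = scl ?s (alt_proj n (word_cut m g n y))" for y
      have F: "F (x + y) = F x + F y" "F (scl c x) = scl c (F x)" for x y c
        by (simp_all add: F_def word_cut_def der_linear mul_linear alt_proj_linear alt_proj_sum sum.distrib sum_subtractf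
            scl_add scl_diff scl_sum mult.commute)
      have "F (lin_ext (\<lambda>\<Gamma>. bas (tokens (edges \<Gamma>) (flat 0 (decs \<Gamma>)))) y)
         = lin_ext (\<lambda>w. F (bas w)) (lin_ext (\<lambda>\<Gamma>. bas (tokens (edges \<Gamma>) (flat 0 (decs \<Gamma>)))) y)"
        by (rule lin_ext_of_linear[OF F])
      then show ?thesis by (simp add: lin_ext_lin_ext F_def)
    qed
    finally show ?thesis .
  qed
  have x_n: "keys x \<subseteq> {\<Gamma> \<in> dgraphs g. nverts \<Gamma> = n}" using x by (auto simp: graphs_with_def)
  have cyc: "cut_op m g n (alt_proj n x1) \<approx>[?R] 0"
  proof -
    have "to_words n (lin_ext (d_cut m g) x) \<approx>[?R] 0"
      using to_words_cong[of "lin_ext (d_cut m g) x" m g 0 n] cycle by (simp add: cong_mod_zero to_words_linear)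
    with to_words_dx[OF x_n] have "scl ?s (alt_proj n (word_cut m g n x1)) \<approx>[?R] 0"
      unfolding x1_def using cm_sym cm_trans by blast
    from cm_scl[OF this, of "1/2 * ?s"] show ?thesis
      unfolding cut_op_alt_proj by (simp flip: power_add mult_2)
  qed

  \<comment> \<open>The orthogonal projection to the boundaries. The words in \<open>U\<close> keep all valences at least 3, so the
    preimage found below consists of admissible graphs.\<close>
  have keys_D: "keys (cut_op m g n (alt_proj n (bas s))) \<subseteq> ?H" if "s \<in> U" for s
  proof -
    have "s \<in> words3 g n (Suc e) (a - 1) (b - 1)" using that U_words by (auto simp: words3_def U_def)
    then have "keys (word_cut m g n (bas s)) \<subseteq> words3 g n e (Suc (a - 1)) (Suc (b - 1))" by (intro keys_word_cut) simp
    then have "keys (word_cut m g n (bas s)) \<subseteq> words g n e a b" using U_words[OF that] V_words by simp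
    then have "keys (alt_proj n (word_cut m g n (bas s))) \<subseteq> ?H" using keys_alt_proj words_H by blast
    then show ?thesis unfolding cut_op_alt_proj by (rule keys_scl)
  qed
  have keys_x: "keys (alt_proj n x1) \<subseteq> ?H" using keys_alt_proj[of x1 g n e a b] x1_V V_words words_H by blast
  obtain c where c: "\<forall>t\<in>U. ?f (alt_proj n x1 - (\<Sum>s\<in>U. scl (c s) (cut_op m g n (alt_proj n (bas s))))) (cut_op m g n (alt_proj n (bas t))) = 0"
    using orthogonal_projection[where u = "\<lambda>s. cut_op m g n (alt_proj n (bas s))" and par = "tpar m", OF fin finU keys_D keys_x] by blast
  define z where "z = (\<Sum>s\<in>U. scl (c s) (bas s))"
  have z_U: "keys z \<subseteq> U" unfolding z_def by (intro keys_sum_subset keys_scl) simp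
  define y where "y = alt_proj n x1 - cut_op m g n (alt_proj n z)"
  have Dz: "(\<Sum>s\<in>U. scl (c s) (cut_op m g n (alt_proj n (bas s)))) = cut_op m g n (alt_proj n z)"
    by (simp only: z_def alt_proj_sum alt_proj_linear cut_op_linear)
  have orth: "?f y (cut_op m g n (alt_proj n (bas t))) = 0" if "t \<in> U" for t
    using c that unfolding Dz y_def by blast
  define x2 where "x2 = x1 - scl (1/2) (word_cut m g n z)"
  have y_P: "y = alt_proj n x2" by (simp add: y_def x2_def cut_op_alt_proj alt_proj_linear)
  have "keys (word_cut m g n z) \<subseteq> words3 g n e a b"
  proof (cases "U = {}")
    case True
    then have "z = 0" by (simp add: z_def)
    then show ?thesis by (simp add: word_cut_def der_linear mul_linear)
  next
    case False
    then have ab1: "Suc (a - 1) = a" "Suc (b - 1) = b" using U_words by fastforce+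
    have "U \<subseteq> words3 g n (Suc e) (a - 1) (b - 1)" using U_words(1) by (auto simp: words3_def U_def)
    then show ?thesis using keys_word_cut[of z g n e "a - 1" "b - 1" m] z_U ab1 by simp
  qed
  then have x2_V: "keys x2 \<subseteq> words3 g n e a b"
    unfolding x2_def using x1_V by (intro keys_diff_subset keys_scl)
  have keys_y: "keys y \<subseteq> words g n e a b" unfolding y_P using keys_alt_proj x2_V V_words by blast
  then have hy: "keys y \<subseteq> hwords ?T ?N 0" using words_H by (auto simp: hwords_def)
  have Dy: "cut_op m g n y \<approx>[?R] 0"
    unfolding y_def cut_op_linear using cm_diff[OF cyc cut_op_cut_op[of m g n "alt_proj n z"]] by simp
  have Hy: "?f (join_op m g n y) (join_op m g n y) = 0"
  proof -
    define w0 where "w0 = join_op m g n x2"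
    have w0: "keys w0 \<subseteq> U" unfolding w0_def U_def by (rule keys_join_op[OF x2_V])
    have Hw: "join_op m g n y = alt_proj n w0" by (simp add: y_P join_op_alt_proj w0_def)
    have "w0 = (\<Sum>s\<in>U. scl (lkp w0 s) (bas s))"
      using lin_ext_superset[OF finU w0, of bas] by simp
    then have P0: "alt_proj n w0 = (\<Sum>s\<in>U. scl (lkp w0 s) (alt_proj n (bas s)))"
      by (metis (no_types, lifting) alt_proj_linear(4) alt_proj_sum sum.cong)
    have "keys (alt_proj n w0) \<subseteq> hwords ?T ?N (Suc 0)"
    proof (cases "U = {}")
      case True then show ?thesis using w0 by (simp add: alt_proj_linear)
    next
      case False
      have "keys (alt_proj n w0) \<subseteq> words g n (Suc e) (a - 1) (b - 1)"
        using w0 U_words(1) by (intro keys_alt_proj) blast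
      moreover have "words g n (Suc e) (a - 1) (b - 1) \<subseteq> hwords ?T ?N (Suc 0)"
      proof
        fix w assume w: "w \<in> words g n (Suc e) (a - 1) (b - 1)"
        obtain s where "s \<in> U" using False by blast
        then have "a \<ge> 1" "b \<ge> 1" using U_words(2,3) by blast+
        then show "w \<in> hwords ?T ?N (Suc 0)"
          using words_length[of w] w by (simp add: words_def hwords_def)
      qed
      ultimately show ?thesis by blast
    qed
    then have "?f (join_op m g n y) (alt_proj n w0) = ?f y (cut_op m g n (alt_proj n w0))"
      by (rule join_op_adjoint[OF hy _ alt_proj_skew])
    also have "\<dots> = (\<Sum>s\<in>U. lkp w0 s * ?f y (cut_op m g n (alt_proj n (bas s))))"
      unfolding P0 by (simp only: cut_op_linear form_sum_right form_scl_right)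
    also have "\<dots> = 0" using orth by simp
    finally show ?thesis using Hw by simp
  qed
  have "(of_nat g - of_nat a - of_nat b) * of_nat e * ?f y y
     \<le> ?f (cut_op m g n y) (cut_op m g n y) + ?f (join_op m g n y) (join_op m g n y)"
  proof (rule laplacian_bound)
    fix w assume "w \<in> keys y"
    then have w: "w \<in> words g n e a b" using keys_y by blast
    then have "filter (\<lambda>t. t \<in> edge_toks n) w = filter isE w" "filter (\<lambda>t. t \<in> alpha_toks g n) w = filter isA w"
      "filter (\<lambda>t. t \<in> beta_toks g n) w = filter isB w"
      by (auto intro!: filter_cong simp: words_def tok_kinds)
    then show "set w \<subseteq> ?T \<and> length w = ?N \<and> length (filter (\<lambda>t. t \<in> edge_toks n) w) = e \<and>
        length (filter (\<lambda>t. t \<in> alpha_toks g n) w) = a \<and> length (filter (\<lambda>t. t \<in> beta_toks g n) w) = b"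
      using w words_H by (auto simp: words_def)
  next
    show "skew m n y" unfolding y_P by (rule skew_alt_proj)
  qed
  moreover have "?f (cut_op m g n y) (cut_op m g n y) = 0"
    using form_cong_left[OF Dy] by simp
  ultimately have "(of_nat g - of_nat a - of_nat b) * of_nat e * ?f y y \<le> 0" using Hy by simp
  moreover have "(of_nat g - of_nat a - of_nat b) * of_nat e > (0 :: rat)"
  proof -
    have "(of_nat (a + b) :: rat) < of_nat g" using ab by (simp only: of_nat_less_iff)
    then show ?thesis using e by simp
  qed
  ultimately have "?f y y \<le> 0" by (meson linorder_not_less mult_pos_pos)
  moreover have "?f y y \<ge> 0" by (rule hw_nonneg[OF fin hy])
  ultimately have "y \<in> ?R" using hy by (intro form_definite[OF fin, of y ?N]) (auto simp: hwords_def)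
  then have Thx: "to_words n x \<approx>[?R] cut_op m g n (alt_proj n z)" by (simp add: to_words_x y_def cong_mod_def)

  \<comment> \<open>A representative of the preimage by graphs. The factor \<open>1/2\<close> below comes from \<open>cut_op_alt_proj\<close>, and
    \<open>?s\<close> is the sign \<open>(-1)^n\<close> of \<open>d_cut\<close> times the sign \<open>(-1)^m\<close> of \<open>\<Delta>\<close>.\<close>
  define z' where "z' = lin_ext (\<lambda>w. located m n (token_edges w) (token_letters w)) z"
  let ?B = "{\<Gamma>. \<exists>a' b'. a = Suc a' \<and> b = Suc b' \<and> \<Gamma> \<in> graphs_with g n (Suc e) a' b'}"
  have z'_B: "keys z' \<subseteq> ?B"
    unfolding z'_def
  proof (intro keys_lin_ext keys_located)
    fix w assume "w \<in> keys z"
    then have w: "w \<in> U" using z_U by blast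
    have "tokens (token_edges w) (token_letters w) \<in> words g n (Suc e) (a - 1) (b - 1)" "val3 n (tokens (token_edges w) (token_letters w))"
      using words_token_edges_token_letters[OF U_words(1)[OF w]] val3_token_edges_token_letters[of n w] w by (auto simp: U_def)
    moreover have "wf_edges n (token_edges w)" "wf_locs g n (token_letters w)" using U_len[OF w] wf_tokens by blast+
    ultimately have "DGraph (token_edges w) (bins n (token_letters w)) \<in> graphs_with g n (Suc e) (a - 1) (b - 1)"
      using graph_words by blast
    moreover have "a = Suc (a - 1)" "b = Suc (b - 1)" using U_words(2,3)[OF w] by simp_all
    ultimately show "DGraph (token_edges w) (bins n (token_letters w)) \<in> ?B" by blast
  qed
  have z'_n: "keys z' \<subseteq> {\<Gamma> \<in> dgraphs g. nverts \<Gamma> = n}" using z'_B by (auto simp: graphs_with_def)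
  have "to_words n (lin_ext (d_cut m g) z') \<approx>[?R] scl ?s (alt_proj n (word_cut m g n z))"
  proof -
    have lin: "word_cut m g n (x + y) = word_cut m g n x + word_cut m g n y" "word_cut m g n (scl c x) = scl c (word_cut m g n x)" for x y c
      by (simp_all add: word_cut_def der_linear mul_linear sum.distrib sum_subtractf scl_diff scl_sum)
    have "to_words n (lin_ext (d_cut m g) z') = lin_ext (\<lambda>w. to_words n (lin_ext (d_cut m g) (located m n (token_edges w) (token_letters w)))) z"
      by (simp only: z'_def to_words_def lin_ext_lin_ext)
    also have "\<dots> \<approx>[?R] lin_ext (\<lambda>w. scl ?s (alt_proj n (word_cut m g n (bas w)))) z"
    proof (rule cm_lin_ext)
      fix w assume "w \<in> keys z"
      then have wf: "wf_edges n (token_edges w)" "wf_locs g n (token_letters w)" using z_U U_len wf_tokens by blast+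
      have "word_cut m g n (bas (tokens (token_edges w) (token_letters w))) \<approx>[?R] word_cut m g n (bas w)"
        unfolding word_cut_def by (intro cm_sum mul_cong cm_diff der_cong cm_sym[OF word_tokens])
      from cm_trans[OF to_words_d_cut_located[OF wf] cm_scl[OF alt_proj_cong[OF this]]]
      show "to_words n (lin_ext (d_cut m g) (located m n (token_edges w) (token_letters w))) \<approx>[?R] scl ?s (alt_proj n (word_cut m g n (bas w)))" .
    qed
    also have "lin_ext (\<lambda>w. scl ?s (alt_proj n (word_cut m g n (bas w)))) z = scl ?s (alt_proj n (word_cut m g n z))"
      by (rule lin_ext_of_linear[of "\<lambda>z. scl ?s (alt_proj n (word_cut m g n z))", symmetric])
        (simp_all add: lin alt_proj_linear scl_add mult.commute)
    finally show ?thesis .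
  qed
  from cm_scl[OF this, of "?s * (1/2)"]
  have "to_words n (lin_ext (d_cut m g) (scl (?s * (1/2)) z')) \<approx>[?R] cut_op m g n (alt_proj n z)"
    by (simp add: lin_ext_scl to_words_linear cut_op_alt_proj flip: power_add mult_2)
  from cm_diff[OF Thx this] have Th0: "to_words n (x - lin_ext (d_cut m g) (scl (?s * (1/2)) z')) \<approx>[?R] 0"
    by (simp add: to_words_linear)
  have kB: "keys (scl (?s * (1/2)) z') \<subseteq> ?B" by (rule keys_scl[OF z'_B])
  have keys_n: "keys (x - lin_ext (d_cut m g) (scl (?s * (1/2)) z')) \<subseteq> {\<Gamma> \<in> dgraphs g. nverts \<Gamma> = n}"
  proof (rule keys_diff_subset[OF x_n], rule keys_lin_ext)
    fix \<Gamma> assume "\<Gamma> \<in> keys (scl (?s * (1/2)) z')"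
    from subsetD[OF kB this]
    obtain a' b' where G: "\<Gamma> \<in> graphs_with g n (Suc e) a' b'" by (elim CollectE exE conjE)
    have "graphs_with g n e (Suc a') (Suc b') \<subseteq> {\<Gamma> \<in> dgraphs g. nverts \<Gamma> = n}" by (auto simp: graphs_with_def)
    from subset_trans[OF keys_d_cut[OF G] this]
    show "keys (d_cut m g \<Gamma>) \<subseteq> {\<Gamma> \<in> dgraphs g. nverts \<Gamma> = n}" .
  qed
  from to_words_injective[OF keys_n Th0]
  show ?thesis
    unfolding cong_mod_def by (intro exI[of _ "scl (?s * (1/2)) z'"] conjI kB)
qed


section \<open>Filtration by the number of vertices\<close>

definition WH_graphs :: "nat \<Rightarrow> int \<Rightarrow> int \<Rightarrow> nat \<Rightarrow> dgraph set" where
  "WH_graphs g W H e = {\<Gamma> \<in> dgraphs g. nedges \<Gamma> = e \<and> weight \<Gamma> = W \<and> imbalance \<Gamma> = H \<and> (\<forall>v<nverts \<Gamma>. valence \<Gamma> v \<ge> 3)}"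

lemma WH_graphs_graphs_with:
  "\<Gamma> \<in> WH_graphs g W H e \<longleftrightarrow> \<Gamma> \<in> graphs_with g (nverts \<Gamma>) e (num_alpha \<Gamma>) (num_beta \<Gamma>)
     \<and> 2 * (int e - int (nverts \<Gamma>)) + int (num_alpha \<Gamma>) + int (num_beta \<Gamma>) = W
     \<and> int (num_alpha \<Gamma>) - int (num_beta \<Gamma>) = H"
  by (auto simp: WH_graphs_def graphs_with_def weight_def imbalance_def)

lemma graphs_with_WH_graphs:
  "\<Gamma> \<in> graphs_with g n e a b \<Longrightarrow> 2 * (int e - int n) + int a + int b = W \<Longrightarrow> int a - int b = H \<Longrightarrow> \<Gamma> \<in> WH_graphs g W H e"
  by (auto simp: WH_graphs_def graphs_with_def weight_def imbalance_def)

lemma word_valence_tmap: "c u = v \<Longrightarrow> word_valence u w \<le> word_valence v (map (tmap c) w)"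
proof (induction w)
  case (Cons t w)
  then have "tok_valence u t \<le> tok_valence v (tmap c t)" by (cases t) auto
  with Cons show ?case by fastforce
qed simp

lemma word_valence_tmap2: "c i = v \<Longrightarrow> c j = v \<Longrightarrow> i \<noteq> j \<Longrightarrow> word_valence i w + word_valence j w \<le> word_valence v (map (tmap c) w)"
proof (induction w)
  case (Cons t w)
  then have "tok_valence i t + tok_valence j t \<le> tok_valence v (tmap c t)" by (cases t) auto
  with Cons show ?case by fastforce
qed simp

text \<open>
  The merged vertex has valence at least \<open>3 + 3 - 2\<close>, so contraction stays within the complex.
\<close>

lemma graphs_with_contract:
  assumes \<Gamma>: "\<Gamma> \<in> graphs_with g n (Suc e) a b" and ms: "add_mset (i, j) (mset r) = mset (edges \<Gamma>)" and "i \<noteq> j"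
  shows "DGraph (map_edges (contract_vertex i j) r) (bins (n - 1) (map_locs (contract_vertex i j) (flat 0 (decs \<Gamma>)))) \<in> graphs_with g (n - 1) e a b"
proof -
  let ?c = "contract_vertex i j" and ?lw = "flat 0 (decs \<Gamma>)"
  note G = graphs_with_located[OF \<Gamma>]
  have wf: "wf_edges n ((i, j) # r)" by (rule wf_edges_add_mset[OF ms G(2)])
  then have ij: "i < n" "j < n" and wr: "wf_edges n r" by (auto simp: wf_edges_Cons)
  have wf': "wf_edges (n - 1) (map_edges ?c r)" "wf_locs g (n - 1) (map_locs ?c ?lw)"
    using contract_wf[OF ij assms(3)] wr G(3) by blast+
  have m1: "mset (tokens (edges \<Gamma>) ?lw) = add_mset (Edge i j) (mset (tokens r ?lw))"
    using arg_cong[OF ms, of "image_mset (\<lambda>(i, j). Edge i j)"] by (simp add: tokens_def case_prod_unfold)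
  have tokens: "tokens (map_edges ?c r) (map_locs ?c ?lw) = map (tmap ?c) (tokens r ?lw)"
    by (simp add: tokens_def o_def case_prod_unfold)
  have "isE (tmap ?c t) = isE t" "isA (tmap ?c t) = isA t" "isB (tmap ?c t) = isB t" for t by (cases t; simp)+
  then have cmp: "isE \<circ> tmap ?c = isE" "isA \<circ> tmap ?c = isA" "isB \<circ> tmap ?c = isB" by auto
  have "tokens (map_edges ?c r) (map_locs ?c ?lw) \<in> words g (n - 1) e a b"
    using G(4) mset_profile[OF m1] set_tokens_toks[of "map_edges ?c r" "map_locs ?c ?lw" g "n - 1"] wf'
    by (auto simp: words_def tokens cmp)
  moreover have "val3 (n - 1) (tokens (map_edges ?c r) (map_locs ?c ?lw))"
    unfolding val3_def tokens
  proof (intro allI impI)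
    fix v assume v: "v < n - 1"
    have old: "3 \<le> tok_valence u (Edge i j) + word_valence u (tokens r ?lw)" if "u < n" for u
    proof -
      have "3 \<le> word_valence u (tokens (edges \<Gamma>) ?lw)" using G(5) that by (simp add: val3_def)
      then show ?thesis unfolding mset_profile(3)[OF m1, of u] .
    qed
    show "3 \<le> word_valence v (map (tmap ?c) (tokens r ?lw))"
    proof (cases "v = ?c i")
      case True
      have "?c j = ?c i" by (simp add: contract_vertex_def)
      then have "word_valence i (tokens r ?lw) + word_valence j (tokens r ?lw) \<le> word_valence v (map (tmap ?c) (tokens r ?lw))"
        using True assms(3) by (intro word_valence_tmap2) auto
      moreover have "3 \<le> 1 + word_valence i (tokens r ?lw)" "3 \<le> 1 + word_valence j (tokens r ?lw)"
        using old[OF ij(1)] old[OF ij(2)] assms(3) by auto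
      ultimately show ?thesis by linarith
    next
      case False
      define u where "u = (if v < j then v else Suc v)"
      have u: "u < n" "?c u = v" "u \<noteq> j" using v by (auto simp: u_def contract_vertex_def Let_def)
      then have "u \<noteq> i" using False by auto
      then have "3 \<le> word_valence u (tokens r ?lw)" using old[OF u(1)] u(3) by simp
      then show ?thesis using word_valence_tmap[of ?c u v "tokens r ?lw", OF u(2)] by linarith
    qed
  qed
  ultimately show ?thesis using graph_words[OF wf'] by blast
qed

lemma d_c_representative:
  assumes y: "keys y \<subseteq> graphs_with g n (Suc e) a b"
  shows "\<exists>y'. keys y' \<subseteq> graphs_with g (n - 1) e a b \<and> lin_ext (d_c m) y \<approx>[RR m g] y'"
proof (intro exI conjI)
  let ?y' = "lin_ext (\<lambda>\<Gamma>. edge_sum (\<lambda>e r. contract_term m n e r (flat 0 (decs \<Gamma>))) (edges \<Gamma>)) y"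
  show "keys ?y' \<subseteq> graphs_with g (n - 1) e a b"
    unfolding edge_sum_def
  proof (rule keys_lin_ext, rule keys_sum_subset)
    fix \<Gamma> l assume "\<Gamma> \<in> keys y" and l: "l \<in> {..<nedges \<Gamma>}"
    then have \<Gamma>: "\<Gamma> \<in> graphs_with g n (Suc e) a b" using y by blast
    obtain i j where ij: "edges \<Gamma> ! l = (i, j)" by (cases "edges \<Gamma> ! l")
    have "add_mset (i, j) (mset (drop_nth l (edges \<Gamma>))) = mset (edges \<Gamma>)"
      using mset_drop_nth[of l "edges \<Gamma>"] l ij by simp
    from graphs_with_contract[OF \<Gamma> this]
    show "keys (contract_term m n (edges \<Gamma> ! l) (drop_nth l (edges \<Gamma>)) (flat 0 (decs \<Gamma>))) \<subseteq> graphs_with g (n - 1) e a b"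
      by (auto simp only: contract_term_def ij fst_conv snd_conv keys_zero empty_subsetI if_False if_True
          split: if_splits intro!: keys_scl keys_located)
  qed
  have "lin_ext (d_c m) y = lin_ext (\<lambda>\<Gamma>. lin_ext (d_c m) (bas \<Gamma>)) y" by simp
  also have "\<dots> \<approx>[RR m g] ?y'"
  proof (rule cm_lin_ext)
    fix \<Gamma> assume "\<Gamma> \<in> keys y"
    then have \<Gamma>: "\<Gamma> \<in> graphs_with g n (Suc e) a b" using y by blast
    show "lin_ext (d_c m) (bas \<Gamma>) \<approx>[RR m g] edge_sum (\<lambda>e r. contract_term m n e r (flat 0 (decs \<Gamma>))) (edges \<Gamma>)"
      unfolding graphs_with_located(1)[OF \<Gamma>, of m] by (rule d_c_located[OF graphs_with_located(2,3)[OF \<Gamma>]])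
  qed
  finally show "lin_ext (d_c m) y \<approx>[RR m g] ?y'" .
qed

definition vert_part :: "nat \<Rightarrow> (dgraph \<Rightarrow>\<^sub>0 rat) \<Rightarrow> dgraph \<Rightarrow>\<^sub>0 rat" where
  "vert_part N = lin_ext (\<lambda>\<Gamma>. if nverts \<Gamma> = N then bas \<Gamma> else 0)"

text \<open>
  The relations are homogeneous in the number of vertices.
\<close>

lemma vert_part_RR:
  assumes "x \<in> RR m g" shows "vert_part N x \<in> RR m g"
  unfolding vert_part_def
proof (rule lin_ext_span[OF _ assms])
  fix r assume r: "r \<in> rels m g"
  let ?f = "\<lambda>\<Gamma>. if nverts \<Gamma> = N then bas \<Gamma> else 0"
  have located: "lin_ext ?f (located m n es lw) = (if n = N then located m n es lw else 0)" for n es lw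
    by (simp add: located_def)
  show "lin_ext ?f r \<in> RR m g"
  proof (rule relations_lin_ext[OF _ _ _ _ r])
    fix n es u a b w assume "wf_edges n es" "wf_locs g n (u @ [a, b] @ w)"
    from located_swap[OF this, of m]
    show "lin_ext ?f (located m n es (u @ [a, b] @ w)) \<approx>[RR m g] scl (swap_sign (lpar m) a b) (lin_ext ?f (located m n es (u @ [b, a] @ w)))"
      unfolding located by (cases "n = N") simp_all
  next
    fix n es es' lw assume "wf_edges n es" "wf_locs g n lw" "mset es = mset es'"
    then have "located m n es lw \<approx>[RR m g] located m n es' lw" by (intro located_edges) simp_all
    then show "lin_ext ?f (located m n es lw) \<approx>[RR m g] lin_ext ?f (located m n es' lw)"
      unfolding located by (cases "n = N") simp_all
  next
    fix n i j es lw assume "wf_edges n ((i, j) # es)" "wf_locs g n lw"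
    from located_flip[OF this, of m]
    show "lin_ext ?f (located m n ((i, j) # es) lw) \<approx>[RR m g] - lin_ext ?f (located m n ((j, i) # es) lw)"
      unfolding located by (cases "n = N") simp_all
  next
    fix n k es lw assume w: "wf_edges n es" "wf_locs g n lw" and k: "Suc k < n"
    have "swp k permutes {..<n}" using k by (intro permutes_swap_id) auto
    from located_permute[OF w this, of m]
    have "located m n es lw \<approx>[RR m g] - located m n (map_edges (swp k) es) (map_locs (swp k) lw)"
      by (simp add: sign_swap_id scl_minus_left)
    then show "lin_ext ?f (located m n es lw) \<approx>[RR m g] - lin_ext ?f (located m n (map_edges (swp k) es) (map_locs (swp k) lw))"
      unfolding located by (cases "n = N") simp_all
  qed
qed

lemma vert_part_zero: "(\<And>\<Gamma>. \<Gamma> \<in> keys z \<Longrightarrow> nverts \<Gamma> \<noteq> N) \<Longrightarrow> vert_part N z = 0"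
proof -
  assume "\<And>\<Gamma>. \<Gamma> \<in> keys z \<Longrightarrow> nverts \<Gamma> \<noteq> N"
  then have "vert_part N z = lin_ext (\<lambda>_. 0) z" unfolding vert_part_def by (intro lin_ext_cong) simp
  then show ?thesis by simp
qed

lemma vert_part_id: "(\<And>\<Gamma>. \<Gamma> \<in> keys z \<Longrightarrow> nverts \<Gamma> = N) \<Longrightarrow> vert_part N z = z"
proof -
  assume "\<And>\<Gamma>. \<Gamma> \<in> keys z \<Longrightarrow> nverts \<Gamma> = N"
  then have "vert_part N z = lin_ext bas z" unfolding vert_part_def by (intro lin_ext_cong) simp
  then show ?thesis by simp
qed

lemma lookup_vert_part: "lkp (vert_part N z) \<Gamma> = (if nverts \<Gamma> = N then lkp z \<Gamma> else 0)"
proof -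
  have "lkp (vert_part N z) \<Gamma> = (\<Sum>\<Gamma>'\<in>keys z. lkp z \<Gamma>' * lkp (if nverts \<Gamma>' = N then bas \<Gamma>' else 0) \<Gamma>)"
    by (simp add: vert_part_def lin_ext_def lookup_sum lookup_scl)
  also have "\<dots> = (\<Sum>\<Gamma>'\<in>keys z. if \<Gamma>' = \<Gamma> then (if nverts \<Gamma> = N then lkp z \<Gamma> else 0) else 0)"
    by (intro sum.cong refl) (auto simp: lookup_single)
  also have "\<dots> = (if nverts \<Gamma> = N then lkp z \<Gamma> else 0)" by (auto simp: in_keys_iff)
  finally show ?thesis .
qed

lemma nverts_d_c:
  assumes "\<Gamma> \<in> dgraphs g" shows "keys (d_c m \<Gamma>) \<subseteq> {\<Gamma>'. Suc (nverts \<Gamma>') = nverts \<Gamma>}"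
  unfolding d_c_def
proof (intro keys_sum_subset keys_scl)
  fix l assume l: "l \<in> {..<nedges \<Gamma>}"
  obtain i j where ij: "edges \<Gamma> ! l = (i, j)" by (cases "edges \<Gamma> ! l")
  have "(i, j) \<in> set (edges \<Gamma>)" using l ij by (metis lessThan_iff nth_mem)
  then have "j < nverts \<Gamma>" using assms by (auto simp: dgraphs_def)
  then show "keys (contract_edge m \<Gamma> l) \<subseteq> {\<Gamma>'. Suc (nverts \<Gamma>') = nverts \<Gamma>}"
    by (auto simp: contract_edge_def Let_def ij drop_nth_def)
qed

lemma nverts_d_cut:
  assumes "\<Gamma> \<in> dgraphs g" shows "keys (d_cut m g \<Gamma>) \<subseteq> {\<Gamma>'. nverts \<Gamma>' = nverts \<Gamma>}"
proof -
  have "d_cut m g \<Gamma> = edge_sum (\<lambda>e r. cut_term m g (nverts \<Gamma>) e r (flat 0 (decs \<Gamma>))) (edges \<Gamma>)"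
    using d_cut_located[OF dgraphs_located(2)[OF assms], of m g "flat 0 (decs \<Gamma>)"] by (simp flip: dgraphs_located(1)[OF assms, of m])
  then show ?thesis
    by (auto simp only: edge_sum_def cut_term_def intro!: keys_sum_subset keys_scl keys_located) simp
qed

text \<open>
  Summing the valences gives \<open>3 n \<le> 2 e + a + b = W + 2 n\<close>, hence \<open>n \<le> W\<close> and
  \<open>a + b = W + 2 n - 2 e < 3 W\<close>.
\<close>

lemma decorations_bound:
  assumes "\<Gamma> \<in> graphs_with g n e a b" "2 * (int e - int n) + int a + int b = W" "3 * W \<le> int g" "e \<ge> 1"
  shows "a + b < g"
proof -
  let ?w = "tokens (edges \<Gamma>) (flat 0 (decs \<Gamma>))"
  note G = graphs_with_located[OF assms(1)]
  have "(\<Sum>v<n. 3) \<le> (\<Sum>v<n. word_valence v ?w)" using G(5) by (intro sum_mono) (simp add: val3_def)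
  also have "\<dots> = 2 * e + a + b" using G(4) sum_word_valence[of ?w g n] by (simp add: words_def)
  finally have "3 * n \<le> 2 * e + a + b" by simp
  then have "3 * int n \<le> 2 * int e + int a + int b" by linarith
  moreover have "int e \<ge> 1" using assms(4) by simp
  ultimately have "int a + int b < int g" using assms(2,3) by (simp add: algebra_simps)
  then show ?thesis by simp
qed

lemma differential_split: "differential m g x = lin_ext (d_c m) x + lin_ext (d_cut m g) x"
  by (simp only: differential_def lin_ext_plus_fun)

text \<open>
  The part of a cycle with the most vertices is a cycle for \<open>d_cut\<close>, hence congruent to some \<open>d_cut yN\<close>.
  Subtracting \<open>d yN\<close> removes it at the price of \<open>d_c yN\<close>, which has fewer vertices.
\<close>

lemma exact_filtered:
  assumes e: "e \<ge> 1" and g: "3 * W \<le> int g"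
    and "keys x \<subseteq> {\<Gamma> \<in> WH_graphs g W H e. nverts \<Gamma> \<le> N}" and "differential m g x \<in> RR m g"
  shows "\<exists>y. keys y \<subseteq> WH_graphs g W H (Suc e) \<and> x \<approx>[RR m g] differential m g y"
  using assms(3,4)
proof (induction N arbitrary: x)
  case 0
  have "\<Gamma> \<notin> WH_graphs g W H e" if "nverts \<Gamma> = 0" for \<Gamma>
  proof
    assume "\<Gamma> \<in> WH_graphs g W H e"
    then have "edges \<Gamma> \<noteq> []" "\<Gamma> \<in> dgraphs g" using e by (auto simp: WH_graphs_def)
    moreover obtain i j es where "edges \<Gamma> = (i, j) # es"
      using \<open>edges \<Gamma> \<noteq> []\<close> by (metis list.exhaust surj_pair)
    ultimately have "i < nverts \<Gamma>" unfolding dgraphs_def by auto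
    then show False using that by simp
  qed
  then have "x = 0" using 0(1) by (simp add: subset_iff) (metis all_not_in_conv keys_eq_empty)
  then show ?case by (intro exI[of _ 0]) (simp add: differential_linear)
next
  case (Suc N)
  define xN where "xN = vert_part (Suc N) x"
  have x_d: "\<Gamma> \<in> dgraphs g" "nverts \<Gamma> \<le> Suc N" if "\<Gamma> \<in> keys x" for \<Gamma>
    using that Suc.prems(1) by (auto simp: WH_graphs_def)
  have xN_keys: "keys xN \<subseteq> {\<Gamma> \<in> WH_graphs g W H e. nverts \<Gamma> = Suc N}"
    using Suc.prems(1) by (auto simp: xN_def in_keys_iff lookup_vert_part subset_iff split: if_splits)
  have rest: "keys (x - xN) \<subseteq> {\<Gamma> \<in> WH_graphs g W H e. nverts \<Gamma> \<le> N}"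
    using Suc.prems(1) by (fastforce simp: xN_def in_keys_iff lookup_minus lookup_vert_part subset_iff split: if_splits)
  have "vert_part (Suc N) (differential m g x) = lin_ext (d_cut m g) xN"
  proof -
    have "vert_part (Suc N) (differential m g x) = lin_ext (\<lambda>\<Gamma>. vert_part (Suc N) (d_c m \<Gamma>) + vert_part (Suc N) (d_cut m g \<Gamma>)) x"
      by (simp add: vert_part_def differential_def lin_ext_lin_ext lin_ext_add)
    also have "\<dots> = lin_ext (\<lambda>\<Gamma>. lin_ext (d_cut m g) (if nverts \<Gamma> = Suc N then bas \<Gamma> else 0)) x"
    proof (rule lin_ext_cong)
      fix \<Gamma> assume \<Gamma>: "\<Gamma> \<in> keys x"
      have "vert_part (Suc N) (d_c m \<Gamma>) = 0"
        using nverts_d_c[OF x_d(1)[OF \<Gamma>], of m] x_d(2)[OF \<Gamma>] by (intro vert_part_zero) fastforce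
      moreover have "vert_part (Suc N) (d_cut m g \<Gamma>) = (if nverts \<Gamma> = Suc N then d_cut m g \<Gamma> else 0)"
        using nverts_d_cut[OF x_d(1)[OF \<Gamma>], of m] by (auto intro!: vert_part_id vert_part_zero)
      ultimately show "vert_part (Suc N) (d_c m \<Gamma>) + vert_part (Suc N) (d_cut m g \<Gamma>)
          = lin_ext (d_cut m g) (if nverts \<Gamma> = Suc N then bas \<Gamma> else 0)" by simp
    qed
    also have "\<dots> = lin_ext (d_cut m g) xN" by (simp add: xN_def vert_part_def lin_ext_lin_ext)
    finally show ?thesis .
  qed
  then have cyc: "lin_ext (d_cut m g) xN \<in> RR m g" using vert_part_RR[OF Suc.prems(2)] by metis
  have "\<exists>a b. keys xN \<subseteq> graphs_with g (Suc N) e a b \<and> a + b < g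
      \<and> 2 * (int e - int (Suc N)) + int a + int b = W \<and> int a - int b = H \<or> xN = 0"
  proof (cases "keys xN = {}")
    case True then show ?thesis by simp
  next
    case False
    then obtain \<Gamma>0 where \<Gamma>0: "\<Gamma>0 \<in> WH_graphs g W H e" "nverts \<Gamma>0 = Suc N" using xN_keys by blast
    let ?a = "num_alpha \<Gamma>0" and ?b = "num_beta \<Gamma>0"
    have G0: "\<Gamma>0 \<in> graphs_with g (Suc N) e ?a ?b" "2 * (int e - int (Suc N)) + int ?a + int ?b = W" "int ?a - int ?b = H"
      using \<Gamma>0 WH_graphs_graphs_with[of \<Gamma>0] by simp_all
    have "\<Gamma> \<in> graphs_with g (Suc N) e ?a ?b" if "\<Gamma> \<in> keys xN" for \<Gamma>
    proof -
      have \<Gamma>: "\<Gamma> \<in> WH_graphs g W H e" "nverts \<Gamma> = Suc N" using xN_keys that by auto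
      then have "\<Gamma> \<in> graphs_with g (Suc N) e (num_alpha \<Gamma>) (num_beta \<Gamma>)"
        "2 * (int e - int (Suc N)) + int (num_alpha \<Gamma>) + int (num_beta \<Gamma>) = W"
        "int (num_alpha \<Gamma>) - int (num_beta \<Gamma>) = H"
        using WH_graphs_graphs_with[of \<Gamma>] by simp_all
      moreover from this G0 have "num_alpha \<Gamma> = ?a" "num_beta \<Gamma> = ?b" by linarith+
      ultimately show ?thesis by simp
    qed
    then show ?thesis using G0 decorations_bound[OF G0(1,2) g e] by blast
  qed
  then have "\<exists>yN a' b'. keys yN \<subseteq> graphs_with g (Suc N) (Suc e) a' b' \<and> xN \<approx>[RR m g] lin_ext (d_cut m g) yN
      \<and> (2 * (int (Suc e) - int (Suc N)) + int a' + int b' = W \<and> int a' - int b' = H \<or> yN = 0)"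
  proof (elim exE disjE conjE)
    fix a b
    assume ab: "keys xN \<subseteq> graphs_with g (Suc N) e a b" "a + b < g"
      "2 * (int e - int (Suc N)) + int a + int b = W" "int a - int b = H"
    obtain yN where yN: "keys yN \<subseteq> {\<Gamma>. \<exists>a' b'. a = Suc a' \<and> b = Suc b' \<and> \<Gamma> \<in> graphs_with g (Suc N) (Suc e) a' b'}"
      "xN \<approx>[RR m g] lin_ext (d_cut m g) yN"
      using d_cut_exact[OF ab(1) e ab(2) cyc] by blast
    show ?thesis
    proof (cases "keys yN = {}")
      case True
      then have "yN = 0" by simp
      then show ?thesis using yN(2) by (intro exI[of _ 0]) simp
    next
      case False
      then obtain a' b' where a': "a = Suc a'" "b = Suc b'" using yN(1) by blast
      then have "keys yN \<subseteq> graphs_with g (Suc N) (Suc e) a' b'" using yN(1) by auto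
      then show ?thesis using yN(2) ab(3,4) a' by (intro exI[of _ yN] exI[of _ a'] exI[of _ b']) simp
    qed
  next
    assume "xN = 0"
    then show ?thesis by (intro exI[of _ 0]) simp
  qed
  then obtain yN a' b' where yN: "keys yN \<subseteq> graphs_with g (Suc N) (Suc e) a' b'" "xN \<approx>[RR m g] lin_ext (d_cut m g) yN"
    and num: "2 * (int (Suc e) - int (Suc N)) + int a' + int b' = W \<and> int a' - int b' = H \<or> yN = 0" by blast
  obtain y' where y': "keys y' \<subseteq> graphs_with g N e a' b'" "lin_ext (d_c m) yN \<approx>[RR m g] y'"
    and y'0: "yN = 0 \<Longrightarrow> y' = 0"
  proof (cases "yN = 0")
    case True
    show ?thesis by (rule that[of 0]) (simp_all add: True)
  next
    case False
    then show ?thesis using d_c_representative[OF yN(1), of m] that by auto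
  qed
  have yN_WH_graphs: "keys yN \<subseteq> WH_graphs g W H (Suc e)"
    using num yN(1) graphs_with_WH_graphs[where n = "Suc N" and e = "Suc e"] by auto
  have y'_WH_graphs: "keys y' \<subseteq> {\<Gamma> \<in> WH_graphs g W H e. nverts \<Gamma> \<le> N}"
    using num
  proof
    assume n: "2 * (int (Suc e) - int (Suc N)) + int a' + int b' = W \<and> int a' - int b' = H"
    show ?thesis
    proof
      fix \<Gamma> assume "\<Gamma> \<in> keys y'"
      then have G: "\<Gamma> \<in> graphs_with g N e a' b'" using y'(1) by blast
      then have "nverts \<Gamma> = N" by (simp add: graphs_with_def)
      moreover have "\<Gamma> \<in> WH_graphs g W H e" using G n by (intro graphs_with_WH_graphs) auto
      ultimately show "\<Gamma> \<in> {\<Gamma> \<in> WH_graphs g W H e. nverts \<Gamma> \<le> N}" by simp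
    qed
  qed (simp add: y'0)
  define x' where "x' = (x - xN) - y'"
  have x'_keys: "keys x' \<subseteq> {\<Gamma> \<in> WH_graphs g W H e. nverts \<Gamma> \<le> N}"
    unfolding x'_def by (intro keys_diff_subset rest y'_WH_graphs)
  have x_x': "x - differential m g yN \<approx>[RR m g] x'"
  proof -
    have "x - differential m g yN = (x - xN) + (xN - lin_ext (d_cut m g) yN) - lin_ext (d_c m) yN"
      by (simp add: differential_split)
    also have "\<dots> \<approx>[RR m g] (x - xN) + 0 - y'"
      using yN(2) by (intro cm_diff cm_add cm_refl y'(2)) (simp add: cong_mod_def)
    finally show ?thesis by (simp add: x'_def)
  qed
  have "keys yN \<subseteq> dgraphs g" using yN_WH_graphs by (auto simp: WH_graphs_def)
  have "differential m g (x - differential m g yN) \<approx>[RR m g] 0"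
  proof -
    have "differential m g x \<approx>[RR m g] 0" using Suc.prems(2) by (simp add: cong_mod_zero)
    from cm_diff[OF this differential_sq[OF \<open>keys yN \<subseteq> dgraphs g\<close>, of m]]
    show ?thesis by (simp add: differential_linear)
  qed
  with differential_cong[OF x_x'] have "differential m g x' \<approx>[RR m g] 0" using cm_sym cm_trans by blast
  then have "differential m g x' \<in> RR m g" by (simp add: cong_mod_zero)
  from Suc.IH[OF x'_keys this] obtain y2 where y2: "keys y2 \<subseteq> WH_graphs g W H (Suc e)" "x' \<approx>[RR m g] differential m g y2" by blast
  have "x = (x - differential m g yN) + differential m g yN" by simp
  also have "\<dots> \<approx>[RR m g] differential m g y2 + differential m g yN"
    by (rule cm_add[OF cm_trans[OF x_x' y2(2)] cm_refl])
  also have "\<dots> = differential m g (y2 + yN)" by (simp add: differential_linear)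
  finally show ?case using keys_add_subset[OF y2(1) yN_WH_graphs] by blast
qed


section \<open>The Chevalley--Eilenberg cohomology\<close>

definition CE_basis :: "nat \<Rightarrow> nat \<Rightarrow> int \<Rightarrow> int \<Rightarrow> int \<Rightarrow> dgraph set" where
  "CE_basis m g W H k = {\<Gamma> \<in> CE_graphs g. weight \<Gamma> = W \<and> imbalance \<Gamma> = H \<and> degr m \<Gamma> = k}"

text \<open>
  So for fixed weight and imbalance the degree determines the number of edges and conversely, with
  \<open>k_crit\<close> belonging to the graphs without edges.
\<close>

lemma degr_edges: "2 * degr m \<Gamma> = (2 * int m + 1) * weight \<Gamma> - imbalance \<Gamma> - 2 * int (nedges \<Gamma>)"
  by (simp add: degr_def weight_def imbalance_def algebra_simps)

lemma k_crit_edges: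
  assumes "of_int k \<noteq> k_crit m W H" "\<Gamma> \<in> CE_basis m g W H k" shows "nedges \<Gamma> \<ge> 1"
proof (rule ccontr)
  assume "\<not> nedges \<Gamma> \<ge> 1"
  then have "nedges \<Gamma> = 0" by linarith
  then have "2 * k = (2 * int m + 1) * W - H" using degr_edges[of m \<Gamma>] assms(2) by (simp add: CE_basis_def)
  then have "of_int (2 * k) = (of_int ((2 * int m + 1) * W - H) :: rat)" by simp
  then show False using assms(1) by (simp add: k_crit_def field_simps)
qed

text \<open>
  All graphs in one degree have the same number of edges, and one edge more lowers the degree by one; so this
  is exactness at a fixed number of edges.
\<close>

lemma CE_basis_exact:
  assumes g: "3 * W \<le> int g" and k: "of_int k \<noteq> k_crit m W H"
    and x: "keys x \<subseteq> CE_basis m g W H k" and cyc: "differential m g x \<in> RR m g"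
  shows "\<exists>y. keys y \<subseteq> CE_basis m g W H (k - 1) \<and> x \<approx>[RR m g] differential m g y"
proof (cases "keys x = {}")
  case True
  then have "x = 0" by simp
  then show ?thesis by (intro exI[of _ 0]) (simp add: differential_linear)
next
  case False
  then obtain \<Gamma>0 where \<Gamma>0: "\<Gamma>0 \<in> CE_basis m g W H k" using x by blast
  define e where "e = nedges \<Gamma>0"
  have e1: "e \<ge> 1" using k_crit_edges[OF k \<Gamma>0] by (simp add: e_def)
  have rel: "2 * k = (2 * int m + 1) * W - H - 2 * int e"
    using degr_edges[of m \<Gamma>0] \<Gamma>0 by (simp add: CE_basis_def e_def)
  have sub: "CE_basis m g W H k \<subseteq> WH_graphs g W H e"
  proof
    fix \<Gamma> assume \<Gamma>: "\<Gamma> \<in> CE_basis m g W H k"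
    then have "nedges \<Gamma> = e" using degr_edges[of m \<Gamma>] rel by (simp add: CE_basis_def)
    then show "\<Gamma> \<in> WH_graphs g W H e" using \<Gamma> by (auto simp: CE_basis_def WH_graphs_def CE_graphs_def fG_graphs_def dgraphs_def)
  qed
  have sub': "WH_graphs g W H (Suc e) \<subseteq> CE_basis m g W H (k - 1)"
  proof
    fix \<Gamma> assume \<Gamma>: "\<Gamma> \<in> WH_graphs g W H (Suc e)"
    then have "edges \<Gamma> \<noteq> []" "\<Gamma> \<in> dgraphs g" by (auto simp: WH_graphs_def)
    then have "hd (edges \<Gamma>) \<in> set (edges \<Gamma>)" "\<forall>(i, j)\<in>set (edges \<Gamma>). i < nverts \<Gamma>" by (auto simp: dgraphs_def)
    then have "nverts \<Gamma> \<ge> 1" by fastforce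
    moreover have "degr m \<Gamma> = k - 1" using degr_edges[of m \<Gamma>] rel \<Gamma> by (simp add: WH_graphs_def)
    ultimately show "\<Gamma> \<in> CE_basis m g W H (k - 1)" using \<Gamma> by (auto simp: CE_basis_def WH_graphs_def CE_graphs_def fG_graphs_def)
  qed
  define N where "N = Max (nverts ` keys x)"
  have "keys x \<subseteq> {\<Gamma> \<in> WH_graphs g W H e. nverts \<Gamma> \<le> N}"
    using x sub by (auto simp: N_def)
  from exact_filtered[OF e1 g this cyc] show ?thesis using sub' by blast
qed

lemma mem_cls: "z \<in> cls m g x \<longleftrightarrow> z \<approx>[RR m g] x"
proof -
  have "cls m g x = (\<lambda>r. r + x) ` RR m g"
    by (auto simp: cls_def r_coset_def additive_group_def relations_def)
  moreover have "z \<in> (\<lambda>r. r + x) ` RR m g \<longleftrightarrow> z - x \<in> RR m g"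
  proof
    assume "z \<in> (\<lambda>r. r + x) ` RR m g"
    then show "z - x \<in> RR m g" by (elim imageE) simp
  next
    assume "z - x \<in> RR m g"
    then show "z \<in> (\<lambda>r. r + x) ` RR m g" by (intro image_eqI[of _ _ "z - x"]) simp_all
  qed
  ultimately show ?thesis by (simp only: cong_mod_def)
qed

lemma cls_eq: "cls m g x = cls m g y \<longleftrightarrow> x \<approx>[RR m g] y"
proof
  assume "cls m g x = cls m g y"
  then have "x \<in> cls m g y" using mem_cls[of x m g x] cm_refl by simp
  then show "x \<approx>[RR m g] y" by (simp only: mem_cls)
next
  assume xy: "x \<approx>[RR m g] y"
  show "cls m g x = cls m g y"
  proof (rule Set.set_eqI)
    show "z \<in> cls m g x \<longleftrightarrow> z \<in> cls m g y" for z
      unfolding mem_cls using cm_trans[OF _ xy, of z] cm_trans[OF _ cm_sym[OF xy], of z] by (rule iffI)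
  qed
qed

lemma cls_zero: "cls m g 0 = relations m g"
proof (rule Set.set_eqI)
  show "z \<in> cls m g 0 \<longleftrightarrow> z \<in> relations m g" for z
    unfolding mem_cls by (simp add: cong_mod_def relations_def)
qed

lemma cls_add: "cls m g x <#>\<^bsub>additive_group V\<^esub> cls m g y = cls m g (x + y)"
proof (rule Set.set_eqI)
  fix z
  have "z \<in> cls m g x <#>\<^bsub>additive_group V\<^esub> cls m g y \<longleftrightarrow> (\<exists>a\<in>cls m g x. \<exists>b\<in>cls m g y. z = a + b)"
    by (auto simp: set_mult_def additive_group_def)
  also have "\<dots> \<longleftrightarrow> z \<in> cls m g (x + y)"
    unfolding mem_cls
  proof
    assume "\<exists>a\<in>cls m g x. \<exists>b\<in>cls m g y. z = a + b"
    then obtain a b where "a \<in> cls m g x" "b \<in> cls m g y" and z: "z = a + b" by (elim bexE)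
    then have "a \<approx>[RR m g] x" "b \<approx>[RR m g] y" by (simp_all only: mem_cls)
    then show "z \<approx>[RR m g] x + y" unfolding z by (rule cm_add)
  next
    assume z: "z \<approx>[RR m g] x + y"
    show "\<exists>a\<in>cls m g x. \<exists>b\<in>cls m g y. z = a + b"
    proof (intro bexI)
      show "z = (z - y) + y" by simp
      show "y \<in> cls m g y" by (simp only: mem_cls cm_refl)
      have "z - y \<approx>[RR m g] (x + y) - y" by (rule cm_diff[OF z cm_refl])
      then show "z - y \<in> cls m g x" by (simp add: mem_cls)
    qed
  qed
  finally show "z \<in> cls m g x <#>\<^bsub>additive_group V\<^esub> cls m g y \<longleftrightarrow> z \<in> cls m g (x + y)" .
qed

lemma differential_cls_cls: "differential_cls m g (cls m g x) = cls m g (differential m g x)"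
  unfolding differential_cls_def
proof (rule SUP_eq_const)
  have "x \<in> cls m g x" by (simp only: mem_cls cm_refl)
  then show "cls m g x \<noteq> {}" by blast
  show "cls m g (differential m g x') = cls m g (differential m g x)" if "x' \<in> cls m g x" for x'
    using that unfolding cls_eq mem_cls by (rule differential_cong)
qed

text \<open>
  Closure and divisibility make \<open>B\<close> invariant under multiplication by each of its elements without a unit being
  named. As \<open>Z\<close> lies in \<open>B\<close>, all its elements have the same coset, namely \<open>B\<close>.
\<close>

lemma trivial_FactGroup:
  assumes Z: "Z \<noteq> {}" "Z \<subseteq> B"
    and closed: "\<And>X Y. X \<in> B \<Longrightarrow> Y \<in> B \<Longrightarrow> X \<otimes>\<^bsub>G\<^esub> Y \<in> B"
    and divisible: "\<And>X Y. X \<in> B \<Longrightarrow> Y \<in> B \<Longrightarrow> \<exists>h\<in>B. h \<otimes>\<^bsub>G\<^esub> X = Y"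
  shows "trivial_group (G\<lparr>carrier := Z\<rparr> Mod B)"
proof -
  let ?F = "G\<lparr>carrier := Z\<rparr> Mod B"
  have "B #>\<^bsub>G\<lparr>carrier := Z\<rparr>\<^esub> X = B" if "X \<in> B" for X
  proof
    show "B #>\<^bsub>G\<lparr>carrier := Z\<rparr>\<^esub> X \<subseteq> B" unfolding r_coset_def using closed that by auto
    show "B \<subseteq> B #>\<^bsub>G\<lparr>carrier := Z\<rparr>\<^esub> X"
    proof
      fix Y assume "Y \<in> B"
      from divisible[OF that this] show "Y \<in> B #>\<^bsub>G\<lparr>carrier := Z\<rparr>\<^esub> X" unfolding r_coset_def by auto
    qed
  qed
  then have carrier: "carrier ?F = {B}" unfolding FactGroup_def RCOSETS_def using Z by auto
  have one: "\<one>\<^bsub>?F\<^esub> = B" by (simp add: FactGroup_def)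
  have mult: "B \<otimes>\<^bsub>?F\<^esub> B = B"
  proof
    show "B \<otimes>\<^bsub>?F\<^esub> B \<subseteq> B" using closed by (auto simp: FactGroup_def set_mult_def)
    show "B \<subseteq> B \<otimes>\<^bsub>?F\<^esub> B"
    proof
      fix Y assume Y: "Y \<in> B"
      obtain h where h: "h \<in> B" "Y = h \<otimes>\<^bsub>G\<^esub> Y" using divisible[OF Y Y] by metis
      then have "\<exists>h\<in>B. \<exists>h'\<in>B. Y = h \<otimes>\<^bsub>G\<^esub> h'" using Y by blast
      then show "Y \<in> B \<otimes>\<^bsub>?F\<^esub> B" by (simp add: FactGroup_def set_mult_def)
    qed
  qed
  have "group ?F"
    by (rule groupI) (simp_all only: carrier one mult singleton_iff refl simp_thms bex_simps)
  then show ?thesis by (simp add: trivial_group_def carrier one)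
qed

theorem theorem2:
  fixes m g :: nat and W H k :: int
  assumes "m \<ge> 1" and "W \<ge> 0" and "int g \<ge> 3 * W" and "of_int k \<noteq> k_crit m W H"
  shows "trivial_group (CE_cohomology m g W H k)"
proof -
  define V where "V = graph_span (dgraphs g)"
  let ?C = "\<lambda>k. CE_cochains m g W H k" and ?B = "CE_coboundaries m g W H k" and ?Z = "CE_cocycles m g W H k"
  have carrier_C: "carrier (?C k) = cls m g ` {x. keys x \<subseteq> CE_basis m g W H k}" for k
    by (simp add: CE_cochains_def graph_span_def span_bas CE_basis_def)
  have mult_C: "mult (?C k) = set_mult (additive_group V)" and one_C: "one (?C k) = relations m g" for k
    by (simp_all add: CE_cochains_def coinvariants_def FactGroup_def V_def)
  have B: "?B = (\<lambda>y. cls m g (differential m g y)) ` {y. keys y \<subseteq> CE_basis m g W H (k - 1)}"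
    unfolding CE_coboundaries_def carrier_C by (simp add: image_image differential_cls_cls)
  have Z_B: "?Z \<subseteq> ?B"
  proof
    fix X assume "X \<in> ?Z"
    then obtain x where x: "keys x \<subseteq> CE_basis m g W H k" "X = cls m g x" and "differential_cls m g X = relations m g"
      by (auto simp: CE_cocycles_def kernel_def carrier_C one_C)
    then have "cls m g (differential m g x) = cls m g 0" by (simp add: differential_cls_cls cls_zero)
    then have "differential m g x \<in> RR m g" by (simp add: cls_eq cong_mod_zero)
    then obtain y where "keys y \<subseteq> CE_basis m g W H (k - 1)" "x \<approx>[RR m g] differential m g y"
      using CE_basis_exact[OF assms(3,4) x(1)] by blast
    then show "X \<in> ?B" unfolding B x(2) by (auto simp: cls_eq)
  qed
  have "cls m g 0 \<in> ?Z"
  proof -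
    have "differential_cls m g (cls m g 0) = relations m g"
      unfolding differential_cls_cls by (simp add: differential_linear cls_zero)
    moreover have "cls m g 0 \<in> carrier (?C k)" unfolding carrier_C by (rule image_eqI[of _ _ 0]) simp_all
    ultimately show ?thesis by (simp add: CE_cocycles_def kernel_def one_C)
  qed
  then have Z_ne: "?Z \<noteq> {}" by blast
  have add: "X <#>\<^bsub>additive_group V\<^esub> Y \<in> ?B" if XY: "X \<in> ?B" "Y \<in> ?B" for X Y
  proof -
    obtain y y' where y: "keys y \<subseteq> CE_basis m g W H (k - 1)" "X = cls m g (differential m g y)"
      "keys y' \<subseteq> CE_basis m g W H (k - 1)" "Y = cls m g (differential m g y')" using XY unfolding B by blast
    then have "X <#>\<^bsub>additive_group V\<^esub> Y = cls m g (differential m g (y + y'))"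
      by (simp add: cls_add differential_linear)
    then show ?thesis unfolding B using keys_add_subset[OF y(1,3)] by blast
  qed
  have divisible: "\<exists>h\<in>?B. h <#>\<^bsub>additive_group V\<^esub> X = Y" if XY: "X \<in> ?B" "Y \<in> ?B" for X Y
  proof -
    obtain y y' where y: "keys y \<subseteq> CE_basis m g W H (k - 1)" "X = cls m g (differential m g y)"
      "keys y' \<subseteq> CE_basis m g W H (k - 1)" "Y = cls m g (differential m g y')" using XY unfolding B by blast
    have "cls m g (differential m g (y' - y)) \<in> ?B" unfolding B using keys_diff_subset[OF y(3,1)] by blast
    moreover have "cls m g (differential m g (y' - y)) <#>\<^bsub>additive_group V\<^esub> X = Y"
      unfolding y by (simp add: cls_add differential_linear)
    ultimately show ?thesis by (rule rev_bexI)
  qed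
  show ?thesis
    unfolding CE_cohomology_def
    by (rule trivial_FactGroup[OF Z_ne Z_B]) (simp_all only: mult_C add divisible)
qed

end
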